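(* There exists a locally $C^2$ connected domain $\Omega\subset\mathbb R^2$ which satisfies the extension property and is strongly unbounded in every direction $e\in\mathbb S^1$, such that if $d_1=d_2$ and $a_1a_2\le1$, then $$w^*(e,z,u_0,v_0)=w^*(e,u_0,v_0)=0$$ for all $e\in\mathbb S^1$, $z\in\mathbb R^2$ and $(u_0,v_0)\in\Theta$.
   Context: Here $N=2$. Fix positive constants $d_1,d_2,r_1,r_2,a_1,a_2$ with $0<a_1<1<a_2$. For a connected open set $\Omega$ with smooth boundary and outward unit normal $\nu$, $\Theta$ is the set of pairs $(u_0,v_0)$ with $u_0,v_0\in C(\overline\Omega,[0,1])$, $u_0\not\equiv 0$, $(u_0,v_0)=(0,1)$ outside a compact subset of $\overline\Omega$; $(u,v)$ is the solution of $u_t=d_1\Delta u+r_1u(1-u-a_1v)$, $v_t=d_2\Delta v+r_2v(1-v-a_2u)$ in $(0,\infty)\times\Omega$, homogeneous Neumann conditions on $\partial\Omega$, $(u,v)(0,\cdot)=(u_0,v_0)$. Extension property: for every $1\le p\le\infty$ there is a bounded linear map $E:W^{1,p}(\Omega)\to W^{1,p}(\mathbb R^N)$ with $E(f)|_\Omega=f$. $\Omega$ is strongly unbounded in direction $e$ if there exist $R_0\ge0$, $s_0$ with $\overline{B(se,R_0)}\cap\overline\Omega\ne\emptyset$ for all $s\ge s_0$; $R(e)=\inf\{R\ge0:\exists s,\ \forall s'\ge s,\ \overline{B(s'e,R)}\cap\overline\Omega\ne\emptyset\}$. $w^*(e,u_0,v_0)=\inf\{c>0:\forall A>R(e),\ \lim_{t\to\infty}\sup_{s\ge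 ct,\,x\in\overline{B(se,A)}\cap\overline\Omega}(|u|+|1-v|)(t,x)=0\}$ ($+\infty$ if empty); $w^*(e,z,u_0,v_0)=\inf\{c>0:\exists A>0,\ \lim_{t\to\infty}\sup_{s\ge ct,\,x\in\overline{B(z+se,A)}\cap\overline\Omega}(|u|+|1-v|)(t,x)=0\}$ ($+\infty$ if empty). *)

theory Defs
  imports "HOL-Analysis.Analysis" "HOL-Probability.Probability"
begin

type_synonym pt = "real^2"

definition local_C2_defining :: "pt set \<Rightarrow> pt \<Rightarrow> real \<Rightarrow> (pt \<Rightarrow> real) \<Rightarrow> (pt \<Rightarrow> pt)
    \<Rightarrow> (pt \<Rightarrow> pt \<Rightarrow> pt) \<Rightarrow> bool" where
  "local_C2_defining \<Omega> p r g G H \<longleftrightarrow> r > 0 \<and>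
     (\<forall>y\<in>ball p r. (g has_derivative (\<lambda>h. G y \<bullet> h)) (at y)
                   \<and> (G has_derivative H y) (at y) \<and> G y \<noteq> 0) \<and>
     (\<forall>i j. continuous_on (ball p r) (\<lambda>y. H y (axis j 1) $ i)) \<and>
     ball p r \<inter> \<Omega> = {y \<in> ball p r. g y < 0}"

definition locally_C2_domain :: "pt set \<Rightarrow> bool" where
  "locally_C2_domain \<Omega> \<longleftrightarrow> open \<Omega> \<and> connected \<Omega> \<and> \<Omega> \<noteq> {} \<and>
     (\<forall>p\<in>frontier \<Omega>. \<exists>r g G H. local_C2_defining \<Omega> p r g G H)"

definition outward_normal :: "pt set \<Rightarrow> pt \<Rightarrow> pt \<Rightarrow> bool" where
  "outward_normal \<Omega> x n \<longleftrightarrow>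
     (\<exists>r g G H. local_C2_defining \<Omega> x r g G H \<and> n = (1 / norm (G x)) *\<^sub>R G x)"

text \<open>Smooth (C^infinity) functions: a family D of all iterated partial derivatives,
  D [] = f, and D l has partial derivative D (i # l) in direction i.\<close>
definition smooth_family :: "(pt \<Rightarrow> real) \<Rightarrow> (2 list \<Rightarrow> pt \<Rightarrow> real) \<Rightarrow> bool" where
  "smooth_family f D \<longleftrightarrow> D [] = f \<and>
     (\<forall>l x. (D l has_derivative (\<lambda>h. \<Sum>i\<in>UNIV. h $ i * D (i # l) x)) (at x))"

definition test_function :: "pt set \<Rightarrow> (pt \<Rightarrow> real) \<Rightarrow> (2 list \<Rightarrow> pt \<Rightarrow> real) \<Rightarrow> bool" where
  "test_function S \<phi> D \<longleftrightarrow> smooth_family \<phi> D \<and>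
     (\<exists>K. compact K \<and> K \<subseteq> S \<and> (\<forall>x. x \<notin> K \<longrightarrow> \<phi> x = 0))"

definition Lp_mem :: "pt set \<Rightarrow> ennreal \<Rightarrow> (pt \<Rightarrow> real) \<Rightarrow> bool" where
  "Lp_mem S p f \<longleftrightarrow> f \<in> borel_measurable (lebesgue_on S) \<and>
     (if p = \<infinity> then esssup (lebesgue_on S) (\<lambda>x. ereal \<bar>f x\<bar>) < \<infinity>
      else integrable (lebesgue_on S) (\<lambda>x. \<bar>f x\<bar> powr enn2real p))"

definition Lp_norm :: "pt set \<Rightarrow> ennreal \<Rightarrow> (pt \<Rightarrow> real) \<Rightarrow> real" where
  "Lp_norm S p f =
     (if p = \<infinity> then real_of_ereal (esssup (lebesgue_on S) (\<lambda>x. ereal \<bar>f x\<bar>))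
      else (\<integral>x. \<bar>f x\<bar> powr enn2real p \<partial>lebesgue_on S) powr (1 / enn2real p))"

definition weak_partial :: "pt set \<Rightarrow> (pt \<Rightarrow> real) \<Rightarrow> 2 \<Rightarrow> (pt \<Rightarrow> real) \<Rightarrow> bool" where
  "weak_partial S f i g \<longleftrightarrow>
     (\<forall>\<phi> D. test_function S \<phi> D \<longrightarrow>
        (\<integral>x. f x * D [i] x \<partial>lebesgue_on S) = - (\<integral>x. g x * \<phi> x \<partial>lebesgue_on S))"

definition W1p_grad :: "pt set \<Rightarrow> ennreal \<Rightarrow> (pt \<Rightarrow> real) \<Rightarrow> (2 \<Rightarrow> pt \<Rightarrow> real) \<Rightarrow> bool" where
  "W1p_grad S p f g \<longleftrightarrow> Lp_mem S p f \<and> (\<forall>i. Lp_mem S p (g i) \<and> weak_partial S f i (g i))"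

definition W1p :: "pt set \<Rightarrow> ennreal \<Rightarrow> (pt \<Rightarrow> real) \<Rightarrow> bool" where
  "W1p S p f \<longleftrightarrow> (\<exists>g. W1p_grad S p f g)"

definition W1p_norm_with :: "pt set \<Rightarrow> ennreal \<Rightarrow> (pt \<Rightarrow> real) \<Rightarrow> (2 \<Rightarrow> pt \<Rightarrow> real) \<Rightarrow> real" where
  "W1p_norm_with S p f g = Lp_norm S p f + (\<Sum>i\<in>UNIV. Lp_norm S p (g i))"

text \<open>Bounded linear extension operator W^{1,p}(Omega) \<rightarrow> W^{1,p}(R^2), acting on
  representatives (linearity and restriction hold almost everywhere).\<close>
definition extension_operator :: "pt set \<Rightarrow> ennreal \<Rightarrow> ((pt \<Rightarrow> real) \<Rightarrow> (pt \<Rightarrow> real)) \<Rightarrow> bool" where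
  "extension_operator \<Omega> p E \<longleftrightarrow>
     (\<forall>f. W1p \<Omega> p f \<longrightarrow> W1p UNIV p (E f)) \<and>
     (\<forall>f h a b. W1p \<Omega> p f \<longrightarrow> W1p \<Omega> p h \<longrightarrow>
        (AE x in lebesgue. E (\<lambda>y. a * f y + b * h y) x = a * E f x + b * E h x)) \<and>
     (\<exists>C. \<forall>f g. W1p_grad \<Omega> p f g \<longrightarrow>
        (\<exists>g'. W1p_grad UNIV p (E f) g' \<and> W1p_norm_with UNIV p (E f) g' \<le> C * W1p_norm_with \<Omega> p f g)) \<and>
     (\<forall>f. W1p \<Omega> p f \<longrightarrow> (AE x in lebesgue_on \<Omega>. E f x = f x))"

definition extension_property :: "pt set \<Rightarrow> bool" where
  "extension_property \<Omega> \<longleftrightarrow> (\<forall>p::ennreal. 1 \<le> p \<longrightarrow> (\<exists>E. extension_operator \<Omega> p E))"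

definition strongly_unbounded :: "pt set \<Rightarrow> pt \<Rightarrow> bool" where
  "strongly_unbounded \<Omega> e \<longleftrightarrow>
     (\<exists>R0\<ge>0. \<exists>s0. \<forall>s\<ge>s0. cball (s *\<^sub>R e) R0 \<inter> closure \<Omega> \<noteq> {})"

definition R_dir :: "pt set \<Rightarrow> pt \<Rightarrow> real" where
  "R_dir \<Omega> e = Inf {R. R \<ge> 0 \<and> (\<exists>s. \<forall>s'\<ge>s. cball (s' *\<^sub>R e) R \<inter> closure \<Omega> \<noteq> {})}"

definition Theta :: "pt set \<Rightarrow> ((pt \<Rightarrow> real) \<times> (pt \<Rightarrow> real)) set" where
  "Theta \<Omega> = {(u0, v0).
     continuous_on (closure \<Omega>) u0 \<and> continuous_on (closure \<Omega>) v0 \<and>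
     (\<forall>x\<in>closure \<Omega>. 0 \<le> u0 x \<and> u0 x \<le> 1 \<and> 0 \<le> v0 x \<and> v0 x \<le> 1) \<and>
     (\<exists>x\<in>closure \<Omega>. u0 x \<noteq> 0) \<and>
     (\<exists>K. compact K \<and> K \<subseteq> closure \<Omega> \<and> (\<forall>x\<in>closure \<Omega> - K. u0 x = 0 \<and> v0 x = 1))}"

definition classical_eq :: "pt set \<Rightarrow> real \<Rightarrow> (real \<Rightarrow> pt \<Rightarrow> real) \<Rightarrow> (pt \<Rightarrow> real)
    \<Rightarrow> (real \<Rightarrow> pt \<Rightarrow> real) \<Rightarrow> bool" where
  "classical_eq \<Omega> d F w0 w \<longleftrightarrow>
     continuous_on ({0..} \<times> closure \<Omega>) (\<lambda>(t, x). w t x) \<and>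
     (\<forall>x\<in>closure \<Omega>. w 0 x = w0 x) \<and>
     (\<exists>wt gw Hw.
        (\<forall>t>0. \<forall>x\<in>closure \<Omega>. ((w t) has_derivative (\<lambda>h. gw t x \<bullet> h)) (at x within closure \<Omega>)) \<and>
        (\<forall>t>0. \<forall>x\<in>\<Omega>. ((\<lambda>s. w s x) has_real_derivative wt t x) (at t)
                      \<and> ((gw t) has_derivative Hw t x) (at x)
                      \<and> wt t x = d * (\<Sum>i\<in>UNIV. Hw t x (axis i 1) $ i) + F t x) \<and>
        (\<forall>t>0. \<forall>x\<in>frontier \<Omega>. \<forall>n. outward_normal \<Omega> x n \<longrightarrow> gw t x \<bullet> n = 0))"

definition LV_solution :: "pt set \<Rightarrow> real \<Rightarrow> real \<Rightarrow> real \<Rightarrow> real \<Rightarrow> real \<Rightarrow> real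
    \<Rightarrow> (pt \<Rightarrow> real) \<Rightarrow> (pt \<Rightarrow> real) \<Rightarrow> (real \<Rightarrow> pt \<Rightarrow> real) \<Rightarrow> (real \<Rightarrow> pt \<Rightarrow> real) \<Rightarrow> bool" where
  "LV_solution \<Omega> d1 d2 r1 r2 a1 a2 u0 v0 u v \<longleftrightarrow>
     classical_eq \<Omega> d1 (\<lambda>t x. r1 * u t x * (1 - u t x - a1 * v t x)) u0 u \<and>
     classical_eq \<Omega> d2 (\<lambda>t x. r2 * v t x * (1 - v t x - a2 * u t x)) v0 v \<and>
     bounded ((\<lambda>(t, x). u t x) ` ({0..} \<times> closure \<Omega>)) \<and>
     bounded ((\<lambda>(t, x). v t x) ` ({0..} \<times> closure \<Omega>))"

text \<open>Supremum of |u|+|1-v| over closure Omega intersected with the balls of radius A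
  centred at z + s e, s \<ge> c t (supremum of the empty set taken as 0).\<close>
definition dev_sup :: "pt set \<Rightarrow> (real \<Rightarrow> pt \<Rightarrow> real) \<Rightarrow> (real \<Rightarrow> pt \<Rightarrow> real)
    \<Rightarrow> pt \<Rightarrow> pt \<Rightarrow> real \<Rightarrow> real \<Rightarrow> real \<Rightarrow> ereal" where
  "dev_sup \<Omega> u v e z A c t =
     Sup ({0} \<union> {ereal (\<bar>u t x\<bar> + \<bar>1 - v t x\<bar>) | s x.
            s \<ge> c * t \<and> x \<in> cball (z + s *\<^sub>R e) A \<inter> closure \<Omega>})"

definition w_star :: "pt set \<Rightarrow> (real \<Rightarrow> pt \<Rightarrow> real) \<Rightarrow> (real \<Rightarrow> pt \<Rightarrow> real) \<Rightarrow> pt \<Rightarrow> ereal" where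
  "w_star \<Omega> u v e = Inf {ereal c | c. c > 0 \<and>
     (\<forall>A > R_dir \<Omega> e. ((\<lambda>t. dev_sup \<Omega> u v e 0 A c t) \<longlongrightarrow> 0) at_top)}"

definition w_star_z :: "pt set \<Rightarrow> (real \<Rightarrow> pt \<Rightarrow> real) \<Rightarrow> (real \<Rightarrow> pt \<Rightarrow> real) \<Rightarrow> pt \<Rightarrow> pt \<Rightarrow> ereal" where
  "w_star_z \<Omega> u v e z = Inf {ereal c | c. c > 0 \<and>
     (\<exists>A > 0. ((\<lambda>t. dev_sup \<Omega> u v e z A c t) \<longlongrightarrow> 0) at_top)}"

end

theory Submission
  imports Defs "HOL-Real_Asymp.Real_Asymp"
begin

text \<open>
  Let \<Omega> be the image of the lower half-plane under the twist w \<mapsto> w exp (i sqrt (1 + |w|^2)). This is a double spiral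
  whose arms have bounded width, hence it stays within bounded distance of every ray; but along an arm, distance r
  from the origin is reached only after an arc length of order r^2.

  Both u and 1 - v solve linear parabolic equations with bounded coefficients. If \<theta> is a continuous branch of the polar
  angle on \<Omega>, then \<theta>^2 has bounded gradient and Laplacian far from the origin, and a bounded function b with normal derivative
  bounded below turns exp (- \<theta>^2 + \<mu> b) into a supersolution with strictly positive normal derivative. Comparison
  bounds |u| + |1 - v| by M exp (\<Lambda> t - \<theta>^2), and \<theta> is of order |x|, so the bound tends to zero where |x| \<ge> c t, for every c > 0.

  For the extension property, reflect across the boundary in coordinates (X, Y) of a collar of uniform width in which
  Y \<mapsto> - Y has bounded derivatives, and multiply by a cutoff function. The weak derivatives of the reflected function are computed by
  transporting test functions to the half-strip Y < 0, where even reflection is elementary. These transported test functions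
  are only of class C^1, which is enough by mollification.
\<close>

section \<open>The spiral domain\<close>

text \<open>If the partial derivatives of all generators are polynomials in the generators, then so are all higher
  derivatives; bounded generators then give bounded derivatives of every order.\<close>
inductive_set fun_alg :: "(pt \<Rightarrow> real) set \<Rightarrow> (pt \<Rightarrow> real) set" for S where
  gen: "f \<in> S \<Longrightarrow> f \<in> fun_alg S"
| const: "(\<lambda>_. c) \<in> fun_alg S"
| add: "f \<in> fun_alg S \<Longrightarrow> g \<in> fun_alg S \<Longrightarrow> (\<lambda>x. f x + g x) \<in> fun_alg S"
| mult: "f \<in> fun_alg S \<Longrightarrow> g \<in> fun_alg S \<Longrightarrow> (\<lambda>x. f x * g x) \<in> fun_alg S"

lemma fun_alg_uminus: "f \<in> fun_alg S \<Longrightarrow> (\<lambda>x. - f x) \<in> fun_alg S"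
  using fun_alg.mult[OF fun_alg.const[of "-1"], of f S] by simp

lemma fun_alg_diff: "f \<in> fun_alg S \<Longrightarrow> g \<in> fun_alg S \<Longrightarrow> (\<lambda>x. f x - g x) \<in> fun_alg S"
  using fun_alg.add[OF _ fun_alg_uminus, of f S g] by simp

definition closed_diff :: "(pt \<Rightarrow> real) set \<Rightarrow> bool" where
  "closed_diff S \<longleftrightarrow> (\<forall>f\<in>S. \<exists>a\<in>fun_alg S. \<exists>b\<in>fun_alg S.
     \<forall>x. (f has_derivative (\<lambda>h. a x * h$1 + b x * h$2)) (at x))"

lemma fun_alg_derivative:
  assumes S: "closed_diff S" and f: "f \<in> fun_alg S"
  shows "\<exists>a\<in>fun_alg S. \<exists>b\<in>fun_alg S. \<forall>x. (f has_derivative (\<lambda>h. a x * h$1 + b x * h$2)) (at x)"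
  using f
proof induction
  case (gen f)
  then show ?case using S by (auto simp: closed_diff_def)
next
  case (const c)
  have "\<forall>x::pt. ((\<lambda>_. c) has_derivative (\<lambda>h::pt. 0 * h$1 + 0 * h$2)) (at x)" by simp
  with fun_alg.const[of 0 S] show ?case by (intro bexI[of _ "\<lambda>_. 0"])
next
  case (add f g)
  from add.IH obtain a b a' b' where ab: "a \<in> fun_alg S" "b \<in> fun_alg S" "a' \<in> fun_alg S" "b' \<in> fun_alg S"
    and d: "\<And>x. (f has_derivative (\<lambda>h. a x * h$1 + b x * h$2)) (at x)"
      "\<And>x. (g has_derivative (\<lambda>h. a' x * h$1 + b' x * h$2)) (at x)"
    by (elim bexE) (rule that; (assumption | erule spec))
  have "\<forall>x. ((\<lambda>x. f x + g x) has_derivative (\<lambda>h. (a x + a' x) * h$1 + (b x + b' x) * h$2)) (at x)"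
    by (intro allI has_derivative_eq_rhs[OF has_derivative_add[OF d]]) (auto simp: algebra_simps)
  moreover have "(\<lambda>x. a x + a' x) \<in> fun_alg S" "(\<lambda>x. b x + b' x) \<in> fun_alg S"
    by (intro fun_alg.add ab)+
  ultimately show ?case by (intro bexI)
next
  case (mult f g)
  from mult.IH obtain a b a' b' where ab: "a \<in> fun_alg S" "b \<in> fun_alg S" "a' \<in> fun_alg S" "b' \<in> fun_alg S"
    and d: "\<And>x. (f has_derivative (\<lambda>h. a x * h$1 + b x * h$2)) (at x)"
      "\<And>x. (g has_derivative (\<lambda>h. a' x * h$1 + b' x * h$2)) (at x)"
    by (elim bexE) (rule that; (assumption | erule spec))
  have "\<forall>x. ((\<lambda>x. f x * g x) has_derivative (\<lambda>h. (f x * a' x + a x * g x) * h$1 + (f x * b' x + b x * g x) * h$2)) (at x)"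
    by (intro allI has_derivative_eq_rhs[OF has_derivative_mult[OF d]]) (auto simp: algebra_simps)
  moreover have "(\<lambda>x. f x * a' x + a x * g x) \<in> fun_alg S" "(\<lambda>x. f x * b' x + b x * g x) \<in> fun_alg S"
    by (intro fun_alg.add fun_alg.mult ab mult.hyps)+
  ultimately show ?case by (intro bexI)
qed

lemma fun_alg_continuous:
  assumes "closed_diff S" "f \<in> fun_alg S" shows "continuous_on A f"
proof -
  obtain a b where "\<And>x. (f has_derivative (\<lambda>h. a x * h$1 + b x * h$2)) (at x)"
    using fun_alg_derivative[OF assms] by (elim bexE) (rule that; erule spec)
  then show ?thesis by (intro continuous_at_imp_continuous_on ballI) (rule has_derivative_continuous)
qed

lemma fun_alg_bounded:
  assumes S: "\<And>f. f \<in> S \<Longrightarrow> \<exists>C. \<forall>x. \<bar>f x\<bar> \<le> C" and f: "f \<in> fun_alg S"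
  shows "\<exists>C. \<forall>x. \<bar>f x\<bar> \<le> C"
  using f
proof induction
  case (add f g)
  then obtain C D where "\<forall>x. \<bar>f x\<bar> \<le> C" "\<forall>x. \<bar>g x\<bar> \<le> D" by blast
  then have "\<forall>x. \<bar>f x + g x\<bar> \<le> C + D" by (meson abs_triangle_ineq add_mono order_trans)
  then show ?case by blast
next
  case (mult f g)
  then obtain C D where "\<forall>x. \<bar>f x\<bar> \<le> C" "\<forall>x. \<bar>g x\<bar> \<le> D" by blast
  then have "\<forall>x. \<bar>f x * g x\<bar> \<le> C * D"
    by (auto simp: abs_mult intro!: mult_mono intro: order_trans[OF abs_ge_zero])
  then show ?case by blast
qed (use S in auto)

lemma inner_pt: "(a::pt) \<bullet> b = a$1 * b$1 + a$2 * b$2"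
  by (simp add: inner_vec_def UNIV_2)

lemma norm_pt: "norm (a::pt) = sqrt ((a$1)\<^sup>2 + (a$2)\<^sup>2)"
  by (simp add: norm_eq_sqrt_inner inner_pt power2_eq_square)

lemma vec_nth_has_derivative: "((\<lambda>z. z$i) has_derivative (\<lambda>h. h$i)) (at z within S)"
  by (rule bounded_linear_imp_has_derivative) (rule bounded_linear_vec_nth)

lemma vector2_eq: "vector [a, b] = a *\<^sub>R axis 1 1 + b *\<^sub>R (axis 2 1 :: pt)"
  by (simp add: vec_eq_iff forall_2 axis_def)

lemma has_derivative_vector2:
  assumes "(f has_derivative f') (at x within S)" "(g has_derivative g') (at x within S)"
  shows "((\<lambda>x. vector [f x, g x] :: pt) has_derivative (\<lambda>h. vector [f' h, g' h])) (at x within S)"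
  unfolding vector2_eq by (intro has_derivative_add has_derivative_scaleR_left assms)

definition phase :: "pt \<Rightarrow> real" where "phase z = sqrt (1 + (z$1)\<^sup>2 + (z$2)\<^sup>2)"

lemma phase_ge1: "phase z \<ge> 1" and phase_pos: "phase z > 0" and phase_nz: "phase z \<noteq> 0"
  and phase_sq: "(phase z)\<^sup>2 = 1 + (z$1)\<^sup>2 + (z$2)\<^sup>2"
proof -
  show 1: "phase z \<ge> 1" by (simp add: phase_def)
  show "phase z > 0" "phase z \<noteq> 0" using 1 by auto
  show "(phase z)\<^sup>2 = 1 + (z$1)\<^sup>2 + (z$2)\<^sup>2" by (simp add: phase_def add_nonneg_nonneg)
qed

lemma phase_norm: "phase z = sqrt (1 + (norm z)\<^sup>2)"
  by (simp add: phase_def norm_pt)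

lemma norm_le_phase: "norm z \<le> phase z" and phase_le_norm: "phase z \<le> 1 + norm z"
proof -
  show "norm z \<le> phase z" by (simp add: phase_norm real_le_rsqrt)
  show "phase z \<le> 1 + norm z" unfolding phase_norm by (rule real_le_lsqrt) (auto simp: power2_eq_square algebra_simps)
qed

lemma abs_comp_le_phase: "\<bar>z$i\<bar> \<le> phase z"
  using component_le_norm_cart[of z i] norm_le_phase[of z] by simp

lemma has_derivative_phase [derivative_intros]:
  "(phase has_derivative (\<lambda>h. (z$1 / phase z) * h$1 + (z$2 / phase z) * h$2)) (at z within S)"
proof -
  have pos: "0 < 1 + (z$1)\<^sup>2 + (z$2)\<^sup>2" by (smt (verit) zero_le_power2)
  show ?thesis unfolding phase_def using pos
    by (auto intro!: derivative_eq_intros vec_nth_has_derivative simp: field_simps)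
qed

definition spiral_gens :: "(pt \<Rightarrow> real) set" where
  "spiral_gens = {\<lambda>z. z$1 / phase z, \<lambda>z. z$2 / phase z, \<lambda>z. 1 / phase z, \<lambda>z. sin (phase z), \<lambda>z. cos (phase z)}"

lemma inv_phase_has_derivative:
  "((\<lambda>z. 1 / phase z) has_derivative (\<lambda>h. - ((1 / phase z) * (1 / phase z) * (z$1 / phase z)) * h$1
      + - ((1 / phase z) * (1 / phase z) * (z$2 / phase z)) * h$2)) (at z within S)"
  using has_derivative_divide[OF has_derivative_const[of 1] has_derivative_phase phase_nz, of z S]
  by (rule has_derivative_eq_rhs) (auto simp: fun_eq_iff field_simps phase_nz)

lemma spiral_gens_mem:
  "(\<lambda>z. z$1 / phase z) \<in> fun_alg spiral_gens" "(\<lambda>z. z$2 / phase z) \<in> fun_alg spiral_gens"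
  "(\<lambda>z. 1 / phase z) \<in> fun_alg spiral_gens" "(\<lambda>z. sin (phase z)) \<in> fun_alg spiral_gens"
  "(\<lambda>z. cos (phase z)) \<in> fun_alg spiral_gens"
  by (auto intro!: fun_alg.gen simp: spiral_gens_def)

lemma comp_over_phase_has_derivative:
  "((\<lambda>z. z$i / phase z) has_derivative (\<lambda>h. h$i * (1 / phase z) +
      (z$i / phase z) * (- ((1 / phase z) * (z$1 / phase z))) * h$1
    + (z$i / phase z) * (- ((1 / phase z) * (z$2 / phase z))) * h$2)) (at z within S)"
proof -
  have "((\<lambda>z. z$i * (1 / phase z)) has_derivative (\<lambda>h. z$i * (- ((1 / phase z) * (1 / phase z) * (z$1 / phase z)) * h$1
      + - ((1 / phase z) * (1 / phase z) * (z$2 / phase z)) * h$2) + h$i * (1 / phase z))) (at z within S)"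
    by (rule has_derivative_mult[OF vec_nth_has_derivative inv_phase_has_derivative])
  then show ?thesis
    by (auto elim!: has_derivative_eq_rhs simp: algebra_simps)
qed

lemma spiral_gens_closed: "closed_diff spiral_gens"
proof -
  let ?A = "fun_alg spiral_gens"
  note m = spiral_gens_mem
  have ex: "\<exists>a\<in>?A. \<exists>b\<in>?A. \<forall>x. (f has_derivative (\<lambda>h. a x * h$1 + b x * h$2)) (at x)"
    if "a \<in> ?A" "b \<in> ?A" "\<And>x. (f has_derivative (\<lambda>h. a x * h$1 + b x * h$2)) (at x)" for f a b
    using that by (intro bexI[of _ a] bexI[of _ b]) auto
  show ?thesis unfolding closed_diff_def
  proof
    fix f assume "f \<in> spiral_gens"
    then consider "f = (\<lambda>z. z$1 / phase z)" | "f = (\<lambda>z. z$2 / phase z)" | "f = (\<lambda>z. 1 / phase z)"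
      | "f = (\<lambda>z. sin (phase z))" | "f = (\<lambda>z. cos (phase z))" unfolding spiral_gens_def by blast
    then show "\<exists>a\<in>?A. \<exists>b\<in>?A. \<forall>x. (f has_derivative (\<lambda>h. a x * h$1 + b x * h$2)) (at x)"
    proof cases
      case 1
      show ?thesis unfolding 1
      proof (rule ex)
        show "(\<lambda>z. 1 / phase z + (z$1 / phase z) * (- ((1 / phase z) * (z$1 / phase z)))) \<in> ?A" "(\<lambda>z. (z$1 / phase z) * (- ((1 / phase z) * (z$2 / phase z)))) \<in> ?A"
          by (intro fun_alg.add fun_alg.mult fun_alg_uminus m)+
      qed (rule has_derivative_eq_rhs[OF comp_over_phase_has_derivative], simp add: algebra_simps)
    next
      case 2
      show ?thesis unfolding 2
      proof (rule ex)
        show "(\<lambda>z. (z$2 / phase z) * (- ((1 / phase z) * (z$1 / phase z)))) \<in> ?A" "(\<lambda>z. 1 / phase z + (z$2 / phase z) * (- ((1 / phase z) * (z$2 / phase z)))) \<in> ?A"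
          by (intro fun_alg.add fun_alg.mult fun_alg_uminus m)+
      qed (rule has_derivative_eq_rhs[OF comp_over_phase_has_derivative], simp add: algebra_simps)
    next
      case 3
      show ?thesis unfolding 3
        by (rule ex[OF _ _ inv_phase_has_derivative]) (intro fun_alg.mult fun_alg_uminus m)+
    next
      case 4
      show ?thesis unfolding 4
      proof (rule ex)
        show "(\<lambda>z. cos (phase z) * (z$1 / phase z)) \<in> ?A" "(\<lambda>z. cos (phase z) * (z$2 / phase z)) \<in> ?A"
          by (intro fun_alg.mult fun_alg_uminus m)+
      qed (rule has_derivative_eq_rhs[OF has_derivative_sin[OF has_derivative_phase]], simp add: algebra_simps)
    next
      case 5
      show ?thesis unfolding 5
      proof (rule ex)
        show "(\<lambda>z. - sin (phase z) * (z$1 / phase z)) \<in> ?A" "(\<lambda>z. - sin (phase z) * (z$2 / phase z)) \<in> ?A"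
          by (intro fun_alg.mult fun_alg_uminus m)+
      qed (rule has_derivative_eq_rhs[OF has_derivative_cos[OF has_derivative_phase]], simp add: algebra_simps)
    qed
  qed
qed

lemma spiral_gens_bounded: "f \<in> spiral_gens \<Longrightarrow> \<exists>C. \<forall>x. \<bar>f x\<bar> \<le> C"
  unfolding spiral_gens_def using abs_comp_le_phase phase_ge1
  by (auto intro!: exI[of _ 1] simp: divide_le_eq_1 phase_pos abs_of_pos)


definition spiral_re :: "pt \<Rightarrow> real" where "spiral_re z = z$1 * cos (phase z) + z$2 * sin (phase z)"
definition spiral_fun :: "pt \<Rightarrow> real" where "spiral_fun z = z$2 * cos (phase z) - z$1 * sin (phase z)"
definition spiral_grad :: "pt \<Rightarrow> pt" where
  "spiral_grad z = vector [- sin (phase z) - spiral_re z * (z$1 / phase z), cos (phase z) - spiral_re z * (z$2 / phase z)]"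
definition spiral :: "pt set" where "spiral = {z. spiral_fun z < 0}"

lemma spiral_re_spiral_fun_sq: "(spiral_re z)\<^sup>2 + (spiral_fun z)\<^sup>2 = (norm z)\<^sup>2"
proof -
  have "(spiral_re z)\<^sup>2 + (spiral_fun z)\<^sup>2 = ((z$1)\<^sup>2 + (z$2)\<^sup>2) * ((sin (phase z))\<^sup>2 + (cos (phase z))\<^sup>2)"
    unfolding spiral_re_def spiral_fun_def by algebra
  then show ?thesis by (simp add: norm_pt)
qed

lemma spiral_re_spiral_fun_rot:
  "spiral_re z * sin (phase z) + spiral_fun z * cos (phase z) = z$2" "spiral_re z * cos (phase z) - spiral_fun z * sin (phase z) = z$1"
proof -
  have "spiral_re z * sin (phase z) + spiral_fun z * cos (phase z) = z$2 * ((sin (phase z))\<^sup>2 + (cos (phase z))\<^sup>2)"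
    unfolding spiral_re_def spiral_fun_def by algebra
  then show "spiral_re z * sin (phase z) + spiral_fun z * cos (phase z) = z$2" by simp
  have "spiral_re z * cos (phase z) - spiral_fun z * sin (phase z) = z$1 * ((sin (phase z))\<^sup>2 + (cos (phase z))\<^sup>2)"
    unfolding spiral_re_def spiral_fun_def by algebra
  then show "spiral_re z * cos (phase z) - spiral_fun z * sin (phase z) = z$1" by simp
qed

lemma spiral_fun_has_derivative: "(spiral_fun has_derivative (\<lambda>h. spiral_grad z \<bullet> h)) (at z within S)"
  unfolding spiral_fun_def[abs_def] inner_pt spiral_grad_def spiral_re_def
  by (auto intro!: derivative_eq_intros vec_nth_has_derivative has_derivative_phase simp: phase_nz field_simps)

lemma spiral_re_has_derivative: "(spiral_re has_derivative (\<lambda>h. (cos (phase z) + spiral_fun z * (z$1 / phase z)) * h$1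
    + (sin (phase z) + spiral_fun z * (z$2 / phase z)) * h$2)) (at z within S)"
  unfolding spiral_re_def[abs_def] spiral_fun_def
  by (auto intro!: derivative_eq_intros vec_nth_has_derivative has_derivative_phase simp: phase_nz field_simps)

lemma continuous_on_spiral_fun: "continuous_on S spiral_fun" and continuous_on_spiral_re: "continuous_on S spiral_re"
  and continuous_on_phase: "continuous_on S phase"
  using has_derivative_continuous_on[OF spiral_fun_has_derivative] has_derivative_continuous_on[OF spiral_re_has_derivative]
    has_derivative_continuous_on[OF has_derivative_phase] by blast+

lemma spiral_grad_nonzero: "spiral_grad z \<noteq> 0"
proof
  assume "spiral_grad z = 0"
  then have 1: "- sin (phase z) - spiral_re z * (z$1 / phase z) = 0" "cos (phase z) - spiral_re z * (z$2 / phase z) = 0"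
    by (simp_all add: spiral_grad_def vec_eq_iff forall_2)
  have A: "spiral_re z = z$1 * (cos (phase z) - spiral_re z * (z$2 / phase z)) - z$2 * (- sin (phase z) - spiral_re z * (z$1 / phase z))"
    by (simp add: algebra_simps spiral_re_def)
  have "spiral_re z = 0" using A 1 by (metis diff_0_right mult_zero_right)
  with 1 have "sin (phase z) = 0" "cos (phase z) = 0" by auto
  then show False using sin_cos_squared_add[of "phase z"] by simp
qed

definition spiral_ratio :: "pt \<Rightarrow> real" where "spiral_ratio z = (z$2 / phase z) * cos (phase z) - (z$1 / phase z) * sin (phase z)"

lemma spiral_ratio_alg: "spiral_ratio \<in> fun_alg spiral_gens"
  unfolding spiral_ratio_def[abs_def] by (intro fun_alg_diff fun_alg.mult spiral_gens_mem)

lemma spiral_fun_eq: "spiral_fun z = phase z * spiral_ratio z"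
  by (simp add: spiral_fun_def spiral_ratio_def phase_nz field_simps)

lemma spiral_ratio_abs_le: "\<bar>spiral_ratio z\<bar> \<le> 1"
proof -
  have "\<bar>spiral_fun z\<bar> \<le> norm z" using spiral_re_spiral_fun_sq[of z] by (metis abs_le_square_iff abs_norm_cancel le_add_same_cancel2 zero_le_power2)
  then have "\<bar>spiral_fun z\<bar> \<le> phase z" using norm_le_phase[of z] by simp
  then show ?thesis using phase_pos[of z] by (simp add: spiral_fun_eq abs_mult)
qed

lemma spiral_ratio_derivatives:
  obtains GB HB C where "\<And>z. (spiral_ratio has_derivative (\<lambda>h. GB z \<bullet> h)) (at z)"
    "\<And>z. (GB has_derivative HB z) (at z)" "\<And>i j. continuous_on UNIV (\<lambda>z. HB z (axis j 1) $ i)"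
    "\<And>z. norm (GB z) \<le> C" "\<And>z. \<bar>\<Sum>i\<in>UNIV. HB z (axis i 1) $ i\<bar> \<le> C"
proof -
  let ?A = "fun_alg spiral_gens"
  obtain a b where ab: "a \<in> ?A" "b \<in> ?A" "\<And>z. (spiral_ratio has_derivative (\<lambda>h. a z * h$1 + b z * h$2)) (at z)"
    using fun_alg_derivative[OF spiral_gens_closed spiral_ratio_alg] by (elim bexE) (rule that; (assumption | erule spec))
  obtain a1 a2 where a: "a1 \<in> ?A" "a2 \<in> ?A" "\<And>z. (a has_derivative (\<lambda>h. a1 z * h$1 + a2 z * h$2)) (at z)"
    using fun_alg_derivative[OF spiral_gens_closed ab(1)] by (elim bexE) (rule that; (assumption | erule spec))
  obtain b1 b2 where b: "b1 \<in> ?A" "b2 \<in> ?A" "\<And>z. (b has_derivative (\<lambda>h. b1 z * h$1 + b2 z * h$2)) (at z)"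
    using fun_alg_derivative[OF spiral_gens_closed ab(2)] by (elim bexE) (rule that; (assumption | erule spec))
  have bd: "\<exists>C. \<forall>x. \<bar>f x\<bar> \<le> C" if "f \<in> ?A" for f
    by (rule fun_alg_bounded[OF spiral_gens_bounded that])
  obtain C1 C2 C3 C4 where C: "\<And>z. \<bar>a z\<bar> \<le> C1" "\<And>z. \<bar>b z\<bar> \<le> C2" "\<And>z. \<bar>a1 z\<bar> \<le> C3" "\<And>z. \<bar>b2 z\<bar> \<le> C4"
    using bd[OF ab(1)] bd[OF ab(2)] bd[OF a(1)] bd[OF b(2)] by metis
  define HB where "HB z h = (vector [a1 z * h$1 + a2 z * h$2, b1 z * h$1 + b2 z * h$2] :: pt)" for z and h :: pt
  show ?thesis
  proof (rule that[of "\<lambda>z. vector [a z, b z]" HB "C1 + C2 + C3 + C4"])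
    show "(spiral_ratio has_derivative (\<lambda>h. vector [a z, b z] \<bullet> h)) (at z)" for z
      using ab(3)[of z] by (simp add: inner_pt)
    show "((\<lambda>z. vector [a z, b z] :: pt) has_derivative HB z) (at z)" for z
      unfolding HB_def by (rule has_derivative_vector2[OF a(3) b(3)])
    have ci: "continuous_on UNIV f" if "f \<in> ?A" for f using fun_alg_continuous[OF spiral_gens_closed that] .
    show "continuous_on UNIV (\<lambda>z. HB z (axis j 1) $ i)" for i j
      using exhaust_2[of i] exhaust_2[of j] a(1,2) b(1,2) by (auto simp: HB_def axis_def intro!: ci)
    have C0: "0 \<le> C1" "0 \<le> C2" "0 \<le> C3" "0 \<le> C4" using C abs_ge_zero order_trans by blast+
    show "norm (vector [a z, b z] :: pt) \<le> C1 + C2 + C3 + C4" for z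
      using norm_le_l1_cart[of "vector [a z, b z] :: pt"] C(1,2)[of z] C0 by (simp add: UNIV_2)
    show "\<bar>\<Sum>i\<in>UNIV. HB z (axis i 1) $ i\<bar> \<le> C1 + C2 + C3 + C4" for z
      using C(3,4)[of z] C0 by (simp add: UNIV_2 HB_def axis_def)
  qed
qed

lemma spiral_grad_second_derivative:
  obtains H where "\<And>z. (spiral_grad has_derivative H z) (at z)" "\<And>i j. continuous_on UNIV (\<lambda>z. H z (axis j 1) $ i)"
proof -
  obtain GB HB C where B: "\<And>z. (spiral_ratio has_derivative (\<lambda>h. GB z \<bullet> h)) (at z)"
    "\<And>z. (GB has_derivative HB z) (at z)" "\<And>i j. continuous_on UNIV (\<lambda>z. HB z (axis j 1) $ i)"
    by (rule spiral_ratio_derivatives, rule that)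
  define N where "N z = ((1 / phase z) *\<^sub>R z :: pt)" for z
  have phd: "(phase has_derivative (\<lambda>h. N z \<bullet> h)) (at z)" for z
    using has_derivative_phase[of z UNIV]
    by (rule has_derivative_eq_rhs) (auto simp: inner_pt N_def fun_eq_iff field_simps)
  define NH where "NH z h = (1 / phase z) *\<^sub>R h + (- (N z \<bullet> h) / (phase z)\<^sup>2) *\<^sub>R z" for z h :: pt
  have Nd: "(N has_derivative NH z) (at z)" for z
    unfolding N_def[abs_def] NH_def
    by (auto intro!: derivative_eq_intros phd simp: phase_nz N_def inner_pt fun_eq_iff power2_eq_square field_simps)
  have GG: "spiral_grad z = phase z *\<^sub>R GB z + spiral_ratio z *\<^sub>R N z" for z
  proof -
    have "(spiral_fun has_derivative (\<lambda>h. phase z * (GB z \<bullet> h) + (N z \<bullet> h) * spiral_ratio z)) (at z)"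
      unfolding spiral_fun_eq[abs_def] by (rule has_derivative_mult[OF phd B(1)])
    from has_derivative_unique[OF this spiral_fun_has_derivative]
    have "spiral_grad z \<bullet> h = (phase z *\<^sub>R GB z + spiral_ratio z *\<^sub>R N z) \<bullet> h" for h
      by (simp add: inner_add_left fun_eq_iff) (metis mult.commute)
    then show ?thesis by (metis vector_eq_rdot)
  qed
  define H where "H z h = phase z *\<^sub>R HB z h + (N z \<bullet> h) *\<^sub>R GB z + (spiral_ratio z *\<^sub>R NH z h + (GB z \<bullet> h) *\<^sub>R N z)" for z h
  have GBi: "(\<lambda>z. GB z $ i) = (\<lambda>z. GB z \<bullet> axis i 1)" for i by (simp add: inner_axis)
  have cont: "continuous_on UNIV GB" "continuous_on UNIV N" "continuous_on UNIV spiral_ratio"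
    using B Nd by (meson continuous_at_imp_continuous_on has_derivative_continuous)+
  show ?thesis
  proof (rule that)
    show "(spiral_grad has_derivative H z) (at z)" for z
      unfolding GG[abs_def] H_def
      by (intro has_derivative_add has_derivative_scaleR phd B Nd)
    show "continuous_on UNIV (\<lambda>z. H z (axis j 1) $ i)" for i j
      unfolding H_def NH_def by (simp, intro continuous_intros B(3) continuous_on_phase cont) (auto simp: phase_nz)
  qed
qed

lemma open_spiral: "open spiral"
  unfolding spiral_def using continuous_on_spiral_fun[of UNIV]
  by (simp add: open_Collect_less continuous_on_const)

lemma closure_spiral_subset: "closure spiral \<subseteq> {z. spiral_fun z \<le> 0}"
  by (rule closure_minimal) (auto simp: spiral_def intro!: closed_Collect_le continuous_on_spiral_fun continuous_on_const)

lemma frontier_spiral_subset: "frontier spiral \<subseteq> {z. spiral_fun z = 0}"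
  using closure_spiral_subset interior_open[OF open_spiral] by (auto simp: frontier_def spiral_def)

lemma spiral_local_C2: 
  obtains H where "local_C2_defining spiral p 1 spiral_fun spiral_grad H"
proof -
  obtain H where "\<And>z. (spiral_grad has_derivative H z) (at z)" "\<And>i j. continuous_on UNIV (\<lambda>z. H z (axis j 1) $ i)"
    by (rule spiral_grad_second_derivative, rule that)
  then have "local_C2_defining spiral p 1 spiral_fun spiral_grad H"
    unfolding local_C2_defining_def using spiral_fun_has_derivative spiral_grad_nonzero
    by (auto simp: spiral_def intro: continuous_on_subset)
  then show ?thesis by (rule that)
qed

definition spiral_normal :: "pt \<Rightarrow> pt" where "spiral_normal z = (1 / norm (spiral_grad z)) *\<^sub>R spiral_grad z"

lemma outward_normal_spiral: "outward_normal spiral x (spiral_normal x)"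
  unfolding outward_normal_def spiral_normal_def using spiral_local_C2 by metis

text \<open>Rotating each circle about the origin by its phase maps the lower half-plane onto the spiral.\<close>
definition twist :: "pt \<Rightarrow> pt" where
  "twist w = vector [w$1 * cos (phase w) - w$2 * sin (phase w), w$1 * sin (phase w) + w$2 * cos (phase w)]"

lemma norm_twist: "norm (twist w) = norm w"
proof -
  have "(twist w $ 1)\<^sup>2 + (twist w $ 2)\<^sup>2 = ((w$1)\<^sup>2 + (w$2)\<^sup>2) * ((sin (phase w))\<^sup>2 + (cos (phase w))\<^sup>2)"
    unfolding twist_def by (simp only: vector_2) algebra
  then show ?thesis by (simp add: norm_pt)
qed

lemma phase_twist: "phase (twist w) = phase w"
  by (simp add: phase_norm norm_twist)

lemma spiral_fun_twist: "spiral_fun (twist w) = w$2"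
proof -
  have "spiral_fun (twist w) = w$2 * ((sin (phase w))\<^sup>2 + (cos (phase w))\<^sup>2)"
    unfolding spiral_fun_def phase_twist unfolding twist_def by (simp only: vector_2) algebra
  then show ?thesis by simp
qed

lemma twist_spiral_re_spiral_fun: "twist (vector [spiral_re z, spiral_fun z]) = z"
proof -
  have "norm (vector [spiral_re z, spiral_fun z] :: pt) = norm z"
    using spiral_re_spiral_fun_sq[of z] by (simp add: norm_pt)
  then have "phase (vector [spiral_re z, spiral_fun z] :: pt) = phase z" by (simp add: phase_norm)
  then show ?thesis using spiral_re_spiral_fun_rot[of z] by (simp add: twist_def vec_eq_iff forall_2 algebra_simps)
qed

lemma spiral_twist: "spiral = twist ` {w. w$2 < 0}"
proof
  show "spiral \<subseteq> twist ` {w. w$2 < 0}"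
  proof
    fix z assume "z \<in> spiral"
    then have "vector [spiral_re z, spiral_fun z] \<in> {w::pt. w$2 < 0}" by (simp add: spiral_def)
    then have "twist (vector [spiral_re z, spiral_fun z]) \<in> twist ` {w. w$2 < 0}" by (rule imageI)
    then show "z \<in> twist ` {w. w$2 < 0}" by (simp only: twist_spiral_re_spiral_fun)
  qed
  show "twist ` {w. w$2 < 0} \<subseteq> spiral" by (auto simp: spiral_def spiral_fun_twist)
qed

lemma continuous_on_vector2:
  "continuous_on S f \<Longrightarrow> continuous_on S g \<Longrightarrow> continuous_on S (\<lambda>x. vector [f x, g x] :: pt)"
  unfolding vector2_eq by (intro continuous_intros)

lemma continuous_on_twist: "continuous_on S twist"
  unfolding twist_def[abs_def]
  by (intro continuous_on_vector2 continuous_intros continuous_on_phase)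

lemma connected_spiral: "connected spiral"
proof -
  have "{w::pt. w$2 < 0} = {w. axis 2 1 \<bullet> w < 0}" by (auto simp: inner_axis')
  then have "convex {w::pt. w$2 < 0}" by (simp only: convex_halfspace_lt)
  then show ?thesis unfolding spiral_twist
    by (intro connected_continuous_image continuous_on_twist convex_connected)
qed

lemma spiral_nonempty: "spiral \<noteq> {}"
proof -
  have "twist (axis 2 (-1)) \<in> spiral" unfolding spiral_twist by (rule imageI) (simp add: axis_def)
  then show ?thesis by blast
qed

lemma spiral_locally_C2: "locally_C2_domain spiral"
  unfolding locally_C2_domain_def using open_spiral connected_spiral spiral_nonempty
  by (meson spiral_local_C2)

lemma spiral_strongly_unbounded:
  assumes e: "norm e = 1" shows "strongly_unbounded spiral e"
proof -
  have e2: "(e$1)\<^sup>2 + (e$2)\<^sup>2 = 1" using e by (simp add: norm_pt)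
  then obtain \<alpha> where \<alpha>: "e$1 = cos \<alpha>" "e$2 = sin \<alpha>" using sincos_total_2pi by metis
  have key: "cball (s *\<^sub>R e) 10 \<inter> closure spiral \<noteq> {}" if s: "s \<ge> 1" for s
  proof -
    have phe: "phase (r *\<^sub>R e) = sqrt (1 + r\<^sup>2)" for r using e by (simp add: phase_norm power_mult_distrib)
    define n where "n = \<lceil>(sqrt (1 + s\<^sup>2) - \<alpha> - pi/2) / (2 * pi)\<rceil>"
    define y where "y = \<alpha> + pi/2 + 2 * pi * of_int n"
    have "sqrt (1 + s\<^sup>2) \<le> y" and yu: "y \<le> sqrt (1 + s\<^sup>2) + 2 * pi"
      using le_of_int_ceiling[of "(sqrt (1 + s\<^sup>2) - \<alpha> - pi/2) / (2 * pi)"]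
        of_int_ceiling_le_add_one[of "(sqrt (1 + s\<^sup>2) - \<alpha> - pi/2) / (2 * pi)"]
      unfolding y_def n_def[symmetric] by (auto simp: field_simps)
    moreover have "y \<le> sqrt (1 + (s + 10)\<^sup>2)"
    proof -
      have "sqrt (1 + s\<^sup>2) \<le> 1 + s" using s by (intro real_le_lsqrt) (auto simp: power2_eq_square algebra_simps)
      moreover have "s + 10 \<le> sqrt (1 + (s + 10)\<^sup>2)" by (intro real_le_rsqrt) auto
      ultimately show ?thesis using yu pi_less_4 by linarith
    qed
    moreover have "continuous_on {s..s+10} (\<lambda>r. sqrt (1 + r\<^sup>2))" by (intro continuous_intros)
    ultimately obtain r where r: "s \<le> r" "r \<le> s + 10" "sqrt (1 + r\<^sup>2) = y"
      using IVT'[of "\<lambda>r. sqrt (1 + r\<^sup>2)" s y "s + 10"] by auto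
      have "r > 0" using r s by linarith
      have "spiral_fun (r *\<^sub>R e) = r * (sin \<alpha> * cos y - cos \<alpha> * sin y)"
        by (simp add: spiral_fun_def phe r \<alpha> algebra_simps)
      also have "\<dots> = r * sin (\<alpha> - y)" by (simp add: sin_diff)
      also have "sin (\<alpha> - y) = - 1"
      proof -
        have "sin (\<alpha> - y) = - sin (pi/2 + 2 * pi * of_int n)"
          by (metis (no_types, opaque_lifting) add.assoc add_diff_cancel_left' minus_diff_eq sin_minus y_def)
        also have "sin (pi/2 + 2 * pi * of_int n) = 1"
          using sin_int_2pin[of n] cos_int_2pin[of n] by (simp add: sin_add)
        finally show ?thesis .
      qed
      finally have "r *\<^sub>R e \<in> spiral" using \<open>r > 0\<close> by (simp add: spiral_def)
      then have "r *\<^sub>R e \<in> closure spiral" using closure_subset by blast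
    moreover have "r *\<^sub>R e \<in> cball (s *\<^sub>R e) 10"
      using r e by (simp add: dist_norm scaleR_left_diff_distrib[symmetric])
    ultimately show ?thesis by blast
  qed
  then show ?thesis unfolding strongly_unbounded_def by (intro exI[of _ 10]) (auto intro!: exI[of _ 1])
qed

section \<open>The comparison principle\<close>

definition barrier :: "pt set \<Rightarrow> (pt \<Rightarrow> pt) \<Rightarrow> real \<Rightarrow> (pt \<Rightarrow> real) \<Rightarrow> bool" where
  "barrier \<Omega> n C P \<longleftrightarrow> (\<exists>G H.
     (\<forall>x\<in>closure \<Omega>. 0 < P x \<and> (P has_derivative (\<lambda>h. G x \<bullet> h)) (at x within closure \<Omega>)) \<and>
     (\<forall>x\<in>\<Omega>. (G has_derivative H x) (at x) \<and> (\<Sum>i\<in>UNIV. H x (axis i 1) $ i) \<le> C * P x) \<and>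
     (\<forall>x\<in>frontier \<Omega>. 0 < G x \<bullet> n x))"

lemma barrier_add_scaled:
  assumes P: "barrier \<Omega> n C P" and Q: "barrier \<Omega> n C Q" and "\<epsilon> > 0"
  shows "barrier \<Omega> n C (\<lambda>x. P x + \<epsilon> * Q x)"
proof -
  obtain G H where P': 
     "\<forall>x\<in>closure \<Omega>. 0 < P x \<and> (P has_derivative (\<lambda>h. G x \<bullet> h)) (at x within closure \<Omega>)"
     "\<forall>x\<in>\<Omega>. (G has_derivative H x) (at x) \<and> (\<Sum>i\<in>UNIV. H x (axis i 1) $ i) \<le> C * P x"
     "\<forall>x\<in>frontier \<Omega>. 0 < G x \<bullet> n x"
    using P unfolding barrier_def by (elim exE conjE) (rule that)
  obtain G' H' where Q': 
     "\<forall>x\<in>closure \<Omega>. 0 < Q x \<and> (Q has_derivative (\<lambda>h. G' x \<bullet> h)) (at x within closure \<Omega>)"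
     "\<forall>x\<in>\<Omega>. (G' has_derivative H' x) (at x) \<and> (\<Sum>i\<in>UNIV. H' x (axis i 1) $ i) \<le> C * Q x"
     "\<forall>x\<in>frontier \<Omega>. 0 < G' x \<bullet> n x"
    using Q unfolding barrier_def by (elim exE conjE) (rule that)
  show ?thesis unfolding barrier_def
  proof (intro exI[of _ "\<lambda>x. G x + \<epsilon> *\<^sub>R G' x"] exI[of _ "\<lambda>x h. H x h + \<epsilon> *\<^sub>R H' x h"] conjI ballI)
    fix x assume x: "x \<in> closure \<Omega>"
    show "0 < P x + \<epsilon> * Q x" using P'(1) Q'(1) x \<open>\<epsilon> > 0\<close> by (simp add: add_pos_pos)
    show "((\<lambda>x. P x + \<epsilon> * Q x) has_derivative (\<lambda>h. (G x + \<epsilon> *\<^sub>R G' x) \<bullet> h)) (at x within closure \<Omega>)"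
      unfolding inner_add_left inner_scaleR_left
      by (intro has_derivative_add has_derivative_mult_right) (use P'(1) Q'(1) x in blast)+
  next
    fix x assume x: "x \<in> \<Omega>"
    show "((\<lambda>x. G x + \<epsilon> *\<^sub>R G' x) has_derivative (\<lambda>h. H x h + \<epsilon> *\<^sub>R H' x h)) (at x)"
      by (intro has_derivative_add has_derivative_scaleR_right) (use P'(2) Q'(2) x in blast)+
    have "(\<Sum>i\<in>UNIV. (H x (axis i 1) + \<epsilon> *\<^sub>R H' x (axis i 1)) $ i)
        = (\<Sum>i\<in>UNIV. H x (axis i 1) $ i) + \<epsilon> * (\<Sum>i\<in>UNIV. H' x (axis i 1) $ i)"
      by (simp add: sum.distrib sum_distrib_left)
    also have "\<dots> \<le> C * P x + \<epsilon> * (C * Q x)"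
      using P'(2) Q'(2) x \<open>\<epsilon> > 0\<close> by (intro add_mono mult_left_mono) auto
    finally show "(\<Sum>i\<in>UNIV. (H x (axis i 1) + \<epsilon> *\<^sub>R H' x (axis i 1)) $ i) \<le> C * (P x + \<epsilon> * Q x)"
      by (simp add: algebra_simps)
  next
    fix x assume x: "x \<in> frontier \<Omega>"
    then show "0 < (G x + \<epsilon> *\<^sub>R G' x) \<bullet> n x"
      using P'(3) Q'(3) \<open>\<epsilon> > 0\<close> by (simp add: inner_add_left add_pos_pos)
  qed
qed

lemma second_derivative_at_max:
  fixes h :: "real \<Rightarrow> real"
  assumes r: "r > 0" and d: "\<And>s. \<bar>s\<bar> < r \<Longrightarrow> DERIV h s :> h1 s" and dd: "DERIV h1 0 :> c"
    and mx: "\<And>s. \<bar>s\<bar> < r \<Longrightarrow> h s \<le> h 0"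
  shows "c \<le> 0"
proof (rule ccontr)
  assume "\<not> c \<le> 0"
  have "h1 0 = 0" by (rule DERIV_local_max[OF d[of 0] r]) (use r mx in auto)
  moreover obtain e where e: "e > 0" "\<And>s. 0 < s \<Longrightarrow> s < e \<Longrightarrow> h1 0 < h1 (0 + s)"
    using DERIV_pos_inc_right[OF dd] \<open>\<not> c \<le> 0\<close> by auto
  ultimately have pos: "0 < h1 s" if "0 < s" "s < e" for s using that by simp
  define s where "s = min e r / 2"
  have s: "0 < s" "s < e" "s < r" using e(1) r by (auto simp: s_def)
  have "h 0 < h s"
  proof (rule DERIV_pos_imp_increasing_open[OF s(1)])
    show "\<exists>y. DERIV h x :> y \<and> 0 < y" if "0 < x" "x < s" for x
      using d[of x] pos[of x] that s by auto
    show "continuous_on {0..s} h"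
      by (rule DERIV_continuous_on[where D = h1], rule has_field_derivative_at_within, rule d) (use s in auto)
  qed
  then show False using mx[of s] s by simp
qed

lemma classical_eqE:
  assumes "classical_eq \<Omega> d F w0 w"
  obtains wt gw Hw where
      "\<And>t x. t > 0 \<Longrightarrow> x \<in> closure \<Omega> \<Longrightarrow> ((w t) has_derivative (\<lambda>h. gw t x \<bullet> h)) (at x within closure \<Omega>)"
      "\<And>t x. t > 0 \<Longrightarrow> x \<in> \<Omega> \<Longrightarrow> ((\<lambda>s. w s x) has_real_derivative wt t x) (at t)"
      "\<And>t x. t > 0 \<Longrightarrow> x \<in> \<Omega> \<Longrightarrow> ((gw t) has_derivative Hw t x) (at x)"
      "\<And>t x. t > 0 \<Longrightarrow> x \<in> \<Omega> \<Longrightarrow> wt t x = d * (\<Sum>i\<in>UNIV. Hw t x (axis i 1) $ i) + F t x"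
      "\<And>t x n. t > 0 \<Longrightarrow> x \<in> frontier \<Omega> \<Longrightarrow> outward_normal \<Omega> x n \<Longrightarrow> gw t x \<bullet> n = 0"
proof -
  from assms obtain wt gw Hw where A:
        "\<forall>t>0. \<forall>x\<in>closure \<Omega>. ((w t) has_derivative (\<lambda>h. gw t x \<bullet> h)) (at x within closure \<Omega>)"
        "\<forall>t>0. \<forall>x\<in>\<Omega>. ((\<lambda>s. w s x) has_real_derivative wt t x) (at t)
                      \<and> ((gw t) has_derivative Hw t x) (at x)
                      \<and> wt t x = d * (\<Sum>i\<in>UNIV. Hw t x (axis i 1) $ i) + F t x"
        "\<forall>t>0. \<forall>x\<in>frontier \<Omega>. \<forall>n. outward_normal \<Omega> x n \<longrightarrow> gw t x \<bullet> n = 0"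
    unfolding classical_eq_def by (elim conjE exE) (rule that)
  show ?thesis using A by (intro that[of gw wt Hw]) blast+
qed

text \<open>At the first time the solution touches the strictly larger barrier P + \<epsilon> Q, the equation is violated if the contact
  point is interior, and the Neumann condition if it lies on the boundary. As Q tends to infinity, contact occurs in a compact set.\<close>
lemma comparison:
  fixes w :: "real \<Rightarrow> pt \<Rightarrow> real"
  assumes op: "open \<Omega>" and w: "classical_eq \<Omega> d F w0 w" and d: "d > 0"
    and P: "barrier \<Omega> n C P" and Q: "barrier \<Omega> n C Q"
    and Q_inf: "\<And>M. \<exists>\<rho>. \<forall>x\<in>closure \<Omega>. \<rho> \<le> norm x \<longrightarrow> M \<le> Q x"
    and bd: "\<And>t x. 0 \<le> t \<Longrightarrow> x \<in> closure \<Omega> \<Longrightarrow> \<bar>w t x\<bar> \<le> K0"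
    and n: "\<And>x. x \<in> frontier \<Omega> \<Longrightarrow> outward_normal \<Omega> x (n x)"
    and inw: "\<And>x. x \<in> frontier \<Omega> \<Longrightarrow> eventually (\<lambda>s. x - s *\<^sub>R n x \<in> \<Omega>) (at_right 0)"
    and K: "K \<ge> 0" and C: "C \<ge> 0" and \<Lambda>: "\<Lambda> > d * C + 2 * K"
    and F: "\<And>t x. 0 < t \<Longrightarrow> x \<in> \<Omega> \<Longrightarrow> F t x \<le> K * (\<bar>w t x\<bar> + exp (\<Lambda> * t) * P x)"
    and init: "\<And>x. x \<in> closure \<Omega> \<Longrightarrow> w0 x \<le> P x"
    and t: "0 \<le> t" and x: "x \<in> closure \<Omega>"
  shows "w t x \<le> exp (\<Lambda> * t) * P x"
proof -
  have cont: "continuous_on ({0..} \<times> closure \<Omega>) (\<lambda>(t, x). w t x)"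
    and w_init: "\<And>x. x \<in> closure \<Omega> \<Longrightarrow> w 0 x = w0 x" using w by (auto simp: classical_eq_def)
  from w obtain wt gw Hw where wd:
      "\<And>t x. t > 0 \<Longrightarrow> x \<in> closure \<Omega> \<Longrightarrow> ((w t) has_derivative (\<lambda>h. gw t x \<bullet> h)) (at x within closure \<Omega>)"
      "\<And>t x. t > 0 \<Longrightarrow> x \<in> \<Omega> \<Longrightarrow> ((\<lambda>s. w s x) has_real_derivative wt t x) (at t)"
      "\<And>t x. t > 0 \<Longrightarrow> x \<in> \<Omega> \<Longrightarrow> ((gw t) has_derivative Hw t x) (at x)"
      "\<And>t x. t > 0 \<Longrightarrow> x \<in> \<Omega> \<Longrightarrow> wt t x = d * (\<Sum>i\<in>UNIV. Hw t x (axis i 1) $ i) + F t x"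
      "\<And>t x n. t > 0 \<Longrightarrow> x \<in> frontier \<Omega> \<Longrightarrow> outward_normal \<Omega> x n \<Longrightarrow> gw t x \<bullet> n = 0"
    by (rule classical_eqE) (rule that)
  have \<Lambda>0: "\<Lambda> > 0" using \<Lambda> d C K by (smt (verit) mult_nonneg_nonneg)
  have strict: "w t1 x1 < exp (\<Lambda> * t1) * (P x1 + \<epsilon> * Q x1)"
    if \<epsilon>: "\<epsilon> > 0" and t1: "0 \<le> t1" and x1: "x1 \<in> closure \<Omega>" for \<epsilon> t1 x1
  proof (rule ccontr)
    assume bad: "\<not> w t1 x1 < exp (\<Lambda> * t1) * (P x1 + \<epsilon> * Q x1)"
    define Z where "Z x = P x + \<epsilon> * Q x" for x
    have PQ: "0 < P x" "0 < Q x" if "x \<in> closure \<Omega>" for x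
      using P Q that by (auto simp: barrier_def)
    have "barrier \<Omega> n C Z" unfolding Z_def by (rule barrier_add_scaled[OF P Q \<epsilon>])
    then obtain G H where Z0:
       "\<forall>x\<in>closure \<Omega>. 0 < Z x \<and> (Z has_derivative (\<lambda>h. G x \<bullet> h)) (at x within closure \<Omega>)"
       "\<forall>x\<in>\<Omega>. (G has_derivative H x) (at x) \<and> (\<Sum>i\<in>UNIV. H x (axis i 1) $ i) \<le> C * Z x"
       "\<forall>x\<in>frontier \<Omega>. 0 < G x \<bullet> n x"
      unfolding barrier_def by (elim conjE exE) (rule that)
    have Z:
       "\<And>x. x\<in>closure \<Omega> \<Longrightarrow> 0 < Z x" "\<And>x. x\<in>closure \<Omega> \<Longrightarrow> (Z has_derivative (\<lambda>h. G x \<bullet> h)) (at x within closure \<Omega>)"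
       "\<And>x. x\<in>\<Omega> \<Longrightarrow> (G has_derivative H x) (at x)"
       "\<And>x. x\<in>\<Omega> \<Longrightarrow> (\<Sum>i\<in>UNIV. H x (axis i 1) $ i) \<le> C * Z x"
       "\<And>x. x\<in>frontier \<Omega> \<Longrightarrow> 0 < G x \<bullet> n x"
      using Z0 by blast+
    obtain \<rho> where \<rho>: "\<And>x. x \<in> closure \<Omega> \<Longrightarrow> \<rho> \<le> norm x \<Longrightarrow> (K0 + 1) / \<epsilon> \<le> Q x"
      using Q_inf[of "(K0 + 1) / \<epsilon>"] by blast
    have far: "w t x < exp (\<Lambda> * t) * Z x" if "0 \<le> t" "x \<in> closure \<Omega>" "\<rho> \<le> norm x" for t x
    proof -
      have "w t x \<le> K0" using bd[OF that(1,2)] by simp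
      also have "K0 < \<epsilon> * Q x" using \<rho>[OF that(2,3)] \<epsilon> by (simp add: field_simps)
      also have "\<dots> \<le> 1 * Z x" using PQ[OF that(2)] by (simp add: Z_def)
      also have "\<dots> \<le> exp (\<Lambda> * t) * Z x"
        using Z(1)[OF that(2)] \<Lambda>0 that(1) by (intro mult_right_mono) auto
      finally show ?thesis .
    qed
    define N where "N = {y \<in> {0..t1} \<times> (closure \<Omega> \<inter> cball 0 \<rho>). 0 \<le> w (fst y) (snd y) - exp (\<Lambda> * fst y) * Z (snd y)}"
    have contZ: "continuous_on (closure \<Omega>) Z" by (rule has_derivative_continuous_on) (rule Z(2))
    have contw: "continuous_on ({0..} \<times> closure \<Omega>) (\<lambda>y. w (fst y) (snd y) - exp (\<Lambda> * fst y) * Z (snd y))"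
      using cont by (intro continuous_intros continuous_on_compose2[OF contZ]) (auto simp: case_prod_beta)
    have cpt: "compact ({0..t1} \<times> (closure \<Omega> \<inter> cball 0 \<rho>))"
      by (intro compact_Times closed_Int_compact) auto
    have "N = ({0..t1} \<times> (closure \<Omega> \<inter> cball 0 \<rho>)) \<inter> (\<lambda>y. w (fst y) (snd y) - exp (\<Lambda> * fst y) * Z (snd y)) -` {0..}"
      by (auto simp: N_def)
    moreover have "closed (({0..t1} \<times> (closure \<Omega> \<inter> cball 0 \<rho>)) \<inter> (\<lambda>y. w (fst y) (snd y) - exp (\<Lambda> * fst y) * Z (snd y)) -` {0..})"
      by (intro continuous_closed_preimage continuous_on_subset[OF contw] compact_imp_closed[OF cpt]) auto
    ultimately have "closed N" by simp
    have cN: "compact N"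
    proof -
      have "N = ({0..t1} \<times> (closure \<Omega> \<inter> cball 0 \<rho>)) \<inter> N" by (auto simp: N_def)
      then show ?thesis using compact_Int_closed[OF cpt \<open>closed N\<close>] by simp
    qed
    have "(t1, x1) \<in> N"
    proof -
      have "norm x1 < \<rho>" using far[OF t1 x1] bad unfolding Z_def by (meson not_le)
      then show ?thesis using bad t1 x1 by (auto simp: N_def Z_def)
    qed
    then obtain y where y: "y \<in> N" "\<And>z. z \<in> N \<Longrightarrow> fst y \<le> fst z"
      using continuous_attains_inf[OF cN _ continuous_on_fst[OF continuous_on_id]] by blast
    obtain ts xs where ys: "y = (ts, xs)" by (cases y)
    have ts: "0 \<le> ts" "ts \<le> t1" and xs: "xs \<in> closure \<Omega>" and ge: "exp (\<Lambda> * ts) * Z xs \<le> w ts xs"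
      using y(1) by (auto simp: N_def ys)
    have before: "w s x < exp (\<Lambda> * s) * Z x" if "0 \<le> s" "s < ts" "x \<in> closure \<Omega>" for s x
    proof (cases "\<rho> \<le> norm x")
      case True then show ?thesis using far that by blast
    next
      case False
      then have "(s, x) \<notin> N" using y(2)[of "(s,x)"] that ys by auto
      then show ?thesis using that ts False by (auto simp: N_def)
    qed
    have ts0: "ts > 0"
    proof (rule ccontr)
      assume "\<not> ts > 0"
      then have "ts = 0" using ts by simp
      then have "Z xs \<le> P xs" using ge w_init[OF xs] init[OF xs] by simp
      then show False using PQ[OF xs] \<epsilon> by (simp add: Z_def mult_le_0_iff)
    qed
    have at_ts: "w ts x \<le> exp (\<Lambda> * ts) * Z x" if "x \<in> closure \<Omega>" for x
    proof -
      have "continuous_on {0..} (\<lambda>s. (\<lambda>y. w (fst y) (snd y) - exp (\<Lambda> * fst y) * Z (snd y)) (s, x))"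
        by (rule continuous_on_compose2[OF contw]) (use that in \<open>auto intro!: continuous_intros\<close>)
      then have c: "continuous_on {0..ts} (\<lambda>s. w s x - exp (\<Lambda> * s) * Z x)" by (auto elim: continuous_on_subset)
      have cl: "closure {0..<ts} = {0..ts}" using ts0 by simp
      have "w ts x - exp (\<Lambda> * ts) * Z x \<le> 0"
        by (rule continuous_le_on_closure[where f = "\<lambda>s. w s x - exp (\<Lambda> * s) * Z x" and S = "{0..<ts}"])
           (use c cl before that ts0 in \<open>auto simp: less_imp_le\<close>)
      then show ?thesis by simp
    qed
    have eq: "w ts xs = exp (\<Lambda> * ts) * Z xs" using at_ts[OF xs] ge by simp
    define E where "E = exp (\<Lambda> * ts)"
    have E: "E > 0" by (simp add: E_def)
    show False
    proof (cases "xs \<in> \<Omega>")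
      case True
      have wt: "\<Lambda> * (E * Z xs) \<le> wt ts xs"
      proof (rule ccontr)
        assume *: "\<not> \<Lambda> * (E * Z xs) \<le> wt ts xs"
        have "DERIV (\<lambda>s. w s xs - exp (\<Lambda> * s) * Z xs) ts :> wt ts xs - \<Lambda> * (E * Z xs)"
          unfolding E_def by (auto intro!: derivative_eq_intros wd(2) ts0 True)
        from DERIV_neg_dec_left[OF this] * obtain e where e: "e > 0"
          "\<And>h. 0 < h \<Longrightarrow> h < e \<Longrightarrow> w ts xs - exp (\<Lambda> * ts) * Z xs < w (ts - h) xs - exp (\<Lambda> * (ts - h)) * Z xs" by auto
        define h where "h = min e ts / 2"
        have "0 < h" "h < e" "h < ts" using e(1) ts0 by (auto simp: h_def)
        then show False using e(2)[of h] before[of "ts - h" xs] xs eq by simp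
      qed
      obtain r where r: "r > 0" "ball xs r \<subseteq> \<Omega>" using op True by (meson open_contains_ball)
      have sec: "Hw ts xs (axis i 1) $ i - E * H xs (axis i 1) $ i \<le> 0" for i
      proof (rule second_derivative_at_max[OF r(1)])
        have inb: "xs + s *\<^sub>R axis i 1 \<in> \<Omega>" if "\<bar>s\<bar> < r" for s
          using r that by (auto simp: subset_iff dist_norm)
        have lin: "((\<lambda>s. xs + s *\<^sub>R axis i 1) has_derivative (\<lambda>s. s *\<^sub>R axis i 1)) (at s)" for s
          by (auto intro!: derivative_eq_intros)
        show "DERIV (\<lambda>s. w ts (xs + s *\<^sub>R axis i 1) - E * Z (xs + s *\<^sub>R axis i 1)) s :>
           (gw ts (xs + s *\<^sub>R axis i 1) - E *\<^sub>R G (xs + s *\<^sub>R axis i 1)) $ i" if "\<bar>s\<bar> < r" for s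
        proof -
          let ?p = "xs + s *\<^sub>R axis i 1"
          have p: "?p \<in> \<Omega>" "?p \<in> closure \<Omega>" using inb[OF that] closure_subset by auto
          have "(w ts has_derivative (\<lambda>h. gw ts ?p \<bullet> h)) (at ?p)" "(Z has_derivative (\<lambda>h. G ?p \<bullet> h)) (at ?p)"
            using has_derivative_subset[OF wd(1)[OF ts0 p(2)] closure_subset]
              has_derivative_subset[OF Z(2)[OF p(2)] closure_subset] by (simp_all add: at_within_open[OF p(1) op])
          from has_derivative_compose[OF lin this(1)] has_derivative_mult_right[OF has_derivative_compose[OF lin this(2)]]
          show ?thesis unfolding has_field_derivative_def
            by (intro has_derivative_eq_rhs[OF has_derivative_diff]) (auto simp: fun_eq_iff inner_axis algebra_simps)
        qed
        have "((\<lambda>x. gw ts x $ i - E * G x $ i) has_derivative (\<lambda>h. Hw ts xs h $ i - E * H xs h $ i)) (at xs)"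
          by (intro has_derivative_diff has_derivative_mult_right bounded_linear.has_derivative[OF bounded_linear_vec_nth] 
                wd(3) ts0 True Z(3))
        then have g0: "((\<lambda>x. gw ts x $ i - E * G x $ i) has_derivative (\<lambda>h. Hw ts xs h $ i - E * H xs h $ i)) (at (xs + 0 *\<^sub>R axis i 1))" by simp
        have hl: "Hw ts xs (s *\<^sub>R axis i 1) = s *\<^sub>R Hw ts xs (axis i 1)" "H xs (s *\<^sub>R axis i 1) = s *\<^sub>R H xs (axis i 1)" for s
          using has_derivative_linear[OF wd(3)[OF ts0 True]] has_derivative_linear[OF Z(3)[OF True]] linear_scale by blast+
        show "DERIV (\<lambda>s. (gw ts (xs + s *\<^sub>R axis i 1) - E *\<^sub>R G (xs + s *\<^sub>R axis i 1)) $ i) 0 :>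
           Hw ts xs (axis i 1) $ i - E * H xs (axis i 1) $ i"
          using has_derivative_compose[OF lin g0] unfolding has_field_derivative_def
          by (auto simp: hl algebra_simps elim!: has_derivative_eq_rhs)
        show "w ts (xs + s *\<^sub>R axis i 1) - E * Z (xs + s *\<^sub>R axis i 1) \<le> w ts (xs + 0 *\<^sub>R axis i 1) - E * Z (xs + 0 *\<^sub>R axis i 1)"
          if "\<bar>s\<bar> < r" for s
          using at_ts[of "xs + s *\<^sub>R axis i 1"] inb[OF that] closure_subset eq by (auto simp: E_def)
      qed
      have "(\<Sum>i\<in>UNIV. Hw ts xs (axis i 1) $ i) \<le> (\<Sum>i\<in>UNIV. E * H xs (axis i 1) $ i)"
        using sec by (intro sum_mono) simp
      also have "\<dots> \<le> E * (C * Z xs)"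
        unfolding sum_distrib_left[symmetric] using Z(4)[OF True] E by (intro mult_left_mono) auto
      finally have lap: "(\<Sum>i\<in>UNIV. Hw ts xs (axis i 1) $ i) \<le> E * (C * Z xs)" .
      have EZ: "0 < E * Z xs" using E Z(1)[OF xs] by simp
      have "\<Lambda> * (E * Z xs) \<le> d * (\<Sum>i\<in>UNIV. Hw ts xs (axis i 1) $ i) + F ts xs"
        using wt wd(4)[OF ts0 True] by simp
      also have "\<dots> \<le> d * (E * (C * Z xs)) + K * (\<bar>w ts xs\<bar> + E * P xs)"
        using lap F[OF ts0 True] d by (intro add_mono mult_left_mono) (auto simp: E_def)
      also have "\<bar>w ts xs\<bar> = E * Z xs" using eq EZ by (simp add: E_def)
      also have "d * (E * (C * Z xs)) + K * (E * Z xs + E * P xs) \<le> d * (E * (C * Z xs)) + K * (E * Z xs + E * Z xs)"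
        using K E PQ[OF xs] \<epsilon> by (intro add_left_mono mult_left_mono) (auto simp: Z_def)
      also have "\<dots> = (d * C + 2 * K) * (E * Z xs)" by (simp add: algebra_simps)
      also have "\<dots> < \<Lambda> * (E * Z xs)" using \<Lambda> EZ by (rule mult_strict_right_mono)
      finally show False by simp
    next
      case False
      then have fr: "xs \<in> frontier \<Omega>" using xs op by (simp add: frontier_def interior_open)
      from inw[OF fr] obtain b where b: "b > 0" "\<And>s. 0 < s \<Longrightarrow> s < b \<Longrightarrow> xs - s *\<^sub>R n xs \<in> \<Omega>"
        unfolding eventually_at_right_field by auto
      have lin: "((\<lambda>s. xs - s *\<^sub>R n xs) has_derivative (\<lambda>s. - (s *\<^sub>R n xs))) (at 0 within {0..<b})"
        by (auto intro!: derivative_eq_intros)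
      have img: "(\<lambda>s. xs - s *\<^sub>R n xs) ` {0..<b} \<subseteq> closure \<Omega>"
      proof
        fix p assume "p \<in> (\<lambda>s. xs - s *\<^sub>R n xs) ` {0..<b}"
        then obtain s where "p = xs - s *\<^sub>R n xs" "0 \<le> s" "s < b" by (elim imageE) auto
        then show "p \<in> closure \<Omega>" using b(2)[of s] xs closure_subset by (cases "s = 0") auto
      qed
      have "((\<lambda>x. w ts x - E * Z x) has_derivative (\<lambda>h. gw ts xs \<bullet> h - E * (G xs \<bullet> h))) (at (xs - 0 *\<^sub>R n xs) within (\<lambda>s. xs - s *\<^sub>R n xs) ` {0..<b})"
        using has_derivative_subset[OF wd(1)[OF ts0 xs] img] has_derivative_subset[OF Z(2)[OF xs] img]
        by (auto intro!: derivative_eq_intros)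
      from has_derivative_in_compose[OF lin this]
      have "((\<lambda>s. w ts (xs - s *\<^sub>R n xs) - E * Z (xs - s *\<^sub>R n xs)) has_real_derivative
          E * (G xs \<bullet> n xs) - gw ts xs \<bullet> n xs) (at 0 within {0..<b})"
        unfolding has_field_derivative_def by (auto simp: fun_eq_iff algebra_simps elim!: has_derivative_eq_rhs)
      moreover have "0 < E * (G xs \<bullet> n xs) - gw ts xs \<bullet> n xs"
        using wd(5)[OF ts0 fr n[OF fr]] Z(5)[OF fr] E by simp
      ultimately obtain e where e: "e > 0" "\<And>h. 0 < h \<Longrightarrow> 0 + h \<in> {0..<b} \<Longrightarrow> h < e \<Longrightarrow>
         w ts (xs - 0 *\<^sub>R n xs) - E * Z (xs - 0 *\<^sub>R n xs) < w ts (xs - (0 + h) *\<^sub>R n xs) - E * Z (xs - (0 + h) *\<^sub>R n xs)"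
        using has_real_derivative_pos_inc_right by blast
      define h where "h = min e b / 2"
      have h: "0 < h" "h < e" "h < b" using e(1) b(1) by (auto simp: h_def)
      then have "xs - h *\<^sub>R n xs \<in> closure \<Omega>" using b(2)[of h] closure_subset by auto
      then show False using e(2)[of h] h at_ts[of "xs - h *\<^sub>R n xs"] eq by (simp add: E_def)
    qed
  qed
  show ?thesis
  proof (rule field_le_epsilon)
    fix e :: real assume "e > 0"
    have "0 < Q x" using Q x by (auto simp: barrier_def)
    define \<epsilon> where "\<epsilon> = e / (exp (\<Lambda> * t) * Q x)"
    have "\<epsilon> > 0" using \<open>e > 0\<close> \<open>0 < Q x\<close> by (simp add: \<epsilon>_def)
    from strict[OF this t x] have "w t x \<le> exp (\<Lambda> * t) * P x + exp (\<Lambda> * t) * (\<epsilon> * Q x)" by (simp add: algebra_simps)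
    also have "exp (\<Lambda> * t) * (\<epsilon> * Q x) = e" using \<open>0 < Q x\<close> by (simp add: \<epsilon>_def)
    finally show "w t x \<le> exp (\<Lambda> * t) * P x + e" .
  qed
qed

lemma classical_eq_const_minus:
  assumes "classical_eq \<Omega> d F w0 w"
  shows "classical_eq \<Omega> d (\<lambda>t x. - F t x) (\<lambda>x. c - w0 x) (\<lambda>t x. c - w t x)"
proof -
  from assms obtain wt gw Hw where wd:
      "\<And>t x. t > 0 \<Longrightarrow> x \<in> closure \<Omega> \<Longrightarrow> ((w t) has_derivative (\<lambda>h. gw t x \<bullet> h)) (at x within closure \<Omega>)"
      "\<And>t x. t > 0 \<Longrightarrow> x \<in> \<Omega> \<Longrightarrow> ((\<lambda>s. w s x) has_real_derivative wt t x) (at t)"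
      "\<And>t x. t > 0 \<Longrightarrow> x \<in> \<Omega> \<Longrightarrow> ((gw t) has_derivative Hw t x) (at x)"
      "\<And>t x. t > 0 \<Longrightarrow> x \<in> \<Omega> \<Longrightarrow> wt t x = d * (\<Sum>i\<in>UNIV. Hw t x (axis i 1) $ i) + F t x"
      "\<And>t x n. t > 0 \<Longrightarrow> x \<in> frontier \<Omega> \<Longrightarrow> outward_normal \<Omega> x n \<Longrightarrow> gw t x \<bullet> n = 0"
    by (rule classical_eqE) (rule that)
  have cw: "continuous_on ({0..} \<times> closure \<Omega>) (\<lambda>(t, x). w t x)" "\<And>x. x\<in>closure \<Omega> \<Longrightarrow> w 0 x = w0 x"
    using assms by (auto simp: classical_eq_def)
  show ?thesis unfolding classical_eq_def
  proof (intro conjI exI[of _ "\<lambda>t x. - wt t x"] exI[of _ "\<lambda>t x. - gw t x"] exI[of _ "\<lambda>t x h. - Hw t x h"] allI impI ballI)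
    show "continuous_on ({0..} \<times> closure \<Omega>) (\<lambda>(t, x). c - w t x)"
      using continuous_on_diff[OF continuous_on_const[of _ c] cw(1)] by (simp add: case_prod_beta)
    show "((\<lambda>x. c - w t x) has_derivative (\<lambda>h. - gw t x \<bullet> h)) (at x within closure \<Omega>)"
      if "0 < t" "x \<in> closure \<Omega>" for t x
      using has_derivative_diff[OF has_derivative_const[of c] wd(1)[OF that]] by simp
    show "((\<lambda>s. c - w s x) has_real_derivative - wt t x) (at t)" if "0 < t" "x \<in> \<Omega>" for t x
      using DERIV_diff[OF DERIV_const[of c] wd(2)[OF that]] by simp
    show "- wt t x = d * (\<Sum>i\<in>UNIV. (- Hw t x (axis i 1)) $ i) + - F t x" if "0 < t" "x \<in> \<Omega>" for t x
      using wd(4)[OF that] by (simp add: sum_negf)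
  qed (use wd(3,5) cw in \<open>auto intro!: has_derivative_minus\<close>)
qed

section \<open>Barriers on the spiral\<close>

lemma exp_barrier:
  fixes \<theta> b :: "pt \<Rightarrow> real"
  assumes op: "open \<Omega>" and \<theta>: "\<And>x. x \<in> closure \<Omega> \<Longrightarrow> (\<theta> has_derivative (\<lambda>h. G x \<bullet> h)) (at x within closure \<Omega>)"
    and "\<And>x. x \<in> \<Omega> \<Longrightarrow> (G has_derivative H x) (at x)"
    and "\<And>x. x \<in> \<Omega> \<Longrightarrow> norm (G x) \<le> C1"
    and "\<And>x. x \<in> \<Omega> \<Longrightarrow> (\<Sum>i\<in>UNIV. H x (axis i 1) $ i) \<le> C2"
    and "\<And>x. x \<in> frontier \<Omega> \<Longrightarrow> 0 < G x \<bullet> n x"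
    and "C1\<^sup>2 + C2 \<le> C"
  shows "barrier \<Omega> n C (\<lambda>x. exp (\<theta> x))"
  unfolding barrier_def
proof (intro exI[of _ "\<lambda>x. exp (\<theta> x) *\<^sub>R G x"] exI[of _ "\<lambda>x h. exp (\<theta> x) *\<^sub>R H x h + (exp (\<theta> x) * (G x \<bullet> h)) *\<^sub>R G x"] conjI ballI)
  fix x assume x: "x \<in> closure \<Omega>"
  show "0 < exp (\<theta> x)" by simp
  show "((\<lambda>x. exp (\<theta> x)) has_derivative (\<lambda>h. (exp (\<theta> x) *\<^sub>R G x) \<bullet> h)) (at x within closure \<Omega>)"
    by (rule has_derivative_eq_rhs[OF has_derivative_exp[OF \<theta>[OF x]]]) auto
next
  fix x assume x: "x \<in> \<Omega>"
  then have xc: "x \<in> closure \<Omega>" using closure_subset by auto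
  have "(\<theta> has_derivative (\<lambda>h. G x \<bullet> h)) (at x)"
    using has_derivative_subset[OF \<theta>[OF xc] closure_subset] by (simp add: at_within_open[OF x op])
  from has_derivative_scaleR[OF has_derivative_exp[OF this] assms(3)[OF x]]
  show "((\<lambda>x. exp (\<theta> x) *\<^sub>R G x) has_derivative (\<lambda>h. exp (\<theta> x) *\<^sub>R H x h + (exp (\<theta> x) * (G x \<bullet> h)) *\<^sub>R G x)) (at x)"
    by (simp add: mult.commute)
  have "(\<Sum>i\<in>UNIV. (exp (\<theta> x) *\<^sub>R H x (axis i 1) + (exp (\<theta> x) * (G x \<bullet> axis i 1)) *\<^sub>R G x) $ i)
     = exp (\<theta> x) * ((\<Sum>i\<in>UNIV. H x (axis i 1) $ i) + (norm (G x))\<^sup>2)"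
    by (simp add: UNIV_2 inner_pt axis_def norm_pt power2_eq_square algebra_simps)
  also have "\<dots> \<le> exp (\<theta> x) * (C2 + C1\<^sup>2)"
    using assms(4,5)[OF x] by (intro mult_left_mono add_mono power_mono) auto
  also have "\<dots> \<le> exp (\<theta> x) * C" using assms(7) by (intro mult_left_mono) auto
  finally show "(\<Sum>i\<in>UNIV. (exp (\<theta> x) *\<^sub>R H x (axis i 1) + (exp (\<theta> x) * (G x \<bullet> axis i 1)) *\<^sub>R G x) $ i) \<le> C * exp (\<theta> x)"
    by (simp add: mult.commute)
next
  fix x assume "x \<in> frontier \<Omega>"
  then show "0 < (exp (\<theta> x) *\<^sub>R G x) \<bullet> n x" using assms(6) by simp
qed

text \<open>For s > 0 one has s^3/(1+s) = s^2 - s + 1 - 1/(1+s), so the function is of class C^2 with bounded second derivative.\<close>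
definition quad_ramp :: "real \<Rightarrow> real" where "quad_ramp s = (if s \<le> 0 then 0 else s^3 / (1 + s))"
definition quad_ramp1 :: "real \<Rightarrow> real" where "quad_ramp1 s = (if s \<le> 0 then 0 else 2 * s - 1 + 1 / (1 + s)^2)"
definition quad_ramp2 :: "real \<Rightarrow> real" where "quad_ramp2 s = (if s \<le> 0 then 0 else 2 - 2 / (1 + s)^3)"

lemma DERIV_zero_at_quadratic:
  fixes f :: "real \<Rightarrow> real"
  assumes "\<And>s. \<bar>f s\<bar> \<le> c * s\<^sup>2"
  shows "DERIV f 0 :> 0"
proof -
  have f0: "f 0 = 0" using assms[of 0] by simp
  have "((\<lambda>h. f h / h) \<longlongrightarrow> 0) (at 0)"
  proof (rule Lim_null_comparison)
    show "\<forall>\<^sub>F h in at 0. norm (f h / h) \<le> \<bar>c\<bar> * \<bar>h\<bar>"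
    proof (rule eventually_at_filter[THEN iffD2], rule always_eventually, intro allI impI)
      fix h :: real assume "h \<noteq> 0"
      have "\<bar>f h\<bar> \<le> \<bar>c\<bar> * \<bar>h\<bar> * \<bar>h\<bar>"
        using assms[of h] mult_right_mono[OF abs_ge_self[of c], of "h\<^sup>2"] by (simp add: power2_eq_square mult.assoc)
      then show "norm (f h / h) \<le> \<bar>c\<bar> * \<bar>h\<bar>" using \<open>h \<noteq> 0\<close> by (simp add: field_simps)
    qed
    show "((\<lambda>h. \<bar>c\<bar> * \<bar>h\<bar>) \<longlongrightarrow> 0) (at 0)" by (auto intro!: tendsto_eq_intros)
  qed
  then show ?thesis by (simp add: DERIV_def f0)
qed

lemma quad_ramp1_eq: "s > 0 \<Longrightarrow> quad_ramp1 s = s\<^sup>2 * (3 + 2 * s) / (1 + s)\<^sup>2"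
proof -
  assume "s > 0"
  then have "1 + s \<noteq> 0" by simp
  then have "2 * s - 1 + 1 / (1 + s)^2 = s\<^sup>2 * (3 + 2 * s) / (1 + s)\<^sup>2"
    by (simp add: divide_simps) algebra
  then show ?thesis using \<open>s > 0\<close> by (simp add: quad_ramp1_def)
qed

lemma quad_ramp_bounds: "0 \<le> quad_ramp s" "quad_ramp s \<le> s\<^sup>2" "0 \<le> quad_ramp1 s" "s > 0 \<Longrightarrow> quad_ramp1 s \<le> 2 * s" "0 \<le> quad_ramp2 s" "quad_ramp2 s \<le> 2"
  "s \<ge> 1 \<Longrightarrow> s\<^sup>2 / 2 \<le> quad_ramp s"
proof -
  show "0 \<le> quad_ramp s" by (simp add: quad_ramp_def)
  show "quad_ramp s \<le> s\<^sup>2"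
    by (auto simp: quad_ramp_def field_simps power2_eq_square power3_eq_cube)
  show "0 \<le> quad_ramp1 s" using quad_ramp1_eq[of s] by (cases "s > 0") (auto simp: quad_ramp1_def)
  show "s > 0 \<Longrightarrow> quad_ramp1 s \<le> 2 * s"
  proof -
    assume "s > 0"
    then have "1 / (1+s)^2 \<le> 1" using one_le_power[of "1+s" 2] by (simp add: divide_le_eq)
    then show ?thesis using \<open>s > 0\<close> by (simp add: quad_ramp1_def)
  qed
  have "2 / (1+s)^3 \<le> 2" if "s > 0"
    using that one_le_power[of "1+s" 3] by (simp add: field_simps)
  then show "0 \<le> quad_ramp2 s" by (auto simp: quad_ramp2_def)
  show "quad_ramp2 s \<le> 2" by (auto simp: quad_ramp2_def)
  show "s\<^sup>2 / 2 \<le> quad_ramp s" if "s \<ge> 1"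
  proof -
    have "s\<^sup>2 * (1 + s) \<le> s\<^sup>2 * (2 * s)" using that by (intro mult_left_mono) auto
    then show ?thesis using that by (simp add: quad_ramp_def field_simps power2_eq_square power3_eq_cube)
  qed
qed

lemma DERIV_piecewise_zero:
  fixes f g :: "real \<Rightarrow> real"
  assumes q: "\<And>s. s > 0 \<Longrightarrow> \<bar>f s\<bar> \<le> c * s\<^sup>2" and d: "\<And>s. s > 0 \<Longrightarrow> DERIV f s :> g s" and c: "c \<ge> 0"
  shows "DERIV (\<lambda>s. if s \<le> 0 then 0 else f s) s :> (if s \<le> 0 then 0 else g s)"
proof -
  consider "s < 0" | "s = 0" | "s > 0" by linarith
  then show ?thesis
  proof cases
    case 1
    have "DERIV (\<lambda>s. 0) s :> 0" by simp
    then have "DERIV (\<lambda>s. if s \<le> 0 then 0 else f s) s :> 0"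
      by (rule DERIV_cong_ev[THEN iffD1, rotated -1]) (use 1 eventually_nhds_in_open[of "{..<0::real}" s] in \<open>auto elim!: eventually_mono\<close>)
    then show ?thesis using 1 by simp
  next
    case 2
    have "DERIV (\<lambda>s. if s \<le> 0 then 0 else f s) 0 :> 0"
      by (rule DERIV_zero_at_quadratic[where c = c]) (use q c in auto)
    then show ?thesis using 2 by simp
  next
    case 3
    have "DERIV (\<lambda>s. if s \<le> 0 then 0 else f s) s :> g s"
      by (rule DERIV_cong_ev[THEN iffD1, OF refl _ refl d]) (use 3 eventually_nhds_in_open[of "{0::real<..}" s] in \<open>auto elim!: eventually_mono\<close>)
    then show ?thesis using 3 by simp
  qed
qed

lemma DERIV_quad_ramp: "DERIV quad_ramp s :> quad_ramp1 s"
  unfolding quad_ramp_def[abs_def] quad_ramp1_def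
proof (rule DERIV_piecewise_zero[where c = 1])
  show "\<bar>s ^ 3 / (1 + s)\<bar> \<le> 1 * s\<^sup>2" if "s > 0" for s :: real
    using quad_ramp_bounds(1,2)[of s] that by (simp add: quad_ramp_def)
  show "DERIV (\<lambda>s. s ^ 3 / (1 + s)) s :> 2 * s - 1 + 1 / (1 + s)\<^sup>2" if "s > 0" for s :: real
  proof -
    have nz: "1 + s \<noteq> 0" using that by simp
    have "(3 * s\<^sup>2 * (1 + s) - s ^ 3 * 1) / ((1 + s) * (1 + s)) = 2 * s - 1 + 1 / (1 + s)\<^sup>2"
      using nz by (simp add: divide_simps) algebra
    then show ?thesis using nz by (auto intro!: derivative_eq_intros)
  qed
qed simp

lemma DERIV_quad_ramp1: "DERIV quad_ramp1 s :> quad_ramp2 s"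
  unfolding quad_ramp1_def[abs_def] quad_ramp2_def
proof (rule DERIV_piecewise_zero[where c = 3])
  show "\<bar>2 * s - 1 + 1 / (1 + s)\<^sup>2\<bar> \<le> 3 * s\<^sup>2" if "s > 0" for s :: real
  proof -
    have "3 + 2 * s \<le> 3 * (1 + s)\<^sup>2" using that by (simp add: power2_eq_square algebra_simps)
    then have "(3 + 2 * s) / (1 + s)\<^sup>2 \<le> 3" using that by (simp add: divide_le_eq)
    then have "s\<^sup>2 * ((3 + 2 * s) / (1 + s)\<^sup>2) \<le> s\<^sup>2 * 3" by (intro mult_left_mono) auto
    then show ?thesis using quad_ramp1_eq[OF that] quad_ramp_bounds(3)[of s] that by (simp add: quad_ramp1_def)
  qed
  show "DERIV (\<lambda>s. 2 * s - 1 + 1 / (1 + s)\<^sup>2) s :> 2 - 2 / (1 + s) ^ 3" if "s > 0" for s :: real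
  proof -
    have nz: "1 + s \<noteq> 0" using that by simp
    have "(- 2 - 2 * s) / ((1 + s) * (1 + s) * ((1 + s) * (1 + s))) = - (2 / (1 + s) ^ 3)"
      using nz by (simp add: divide_simps) algebra
    then show ?thesis using nz by (auto intro!: derivative_eq_intros simp: power2_eq_square)
  qed
qed simp

text \<open>On the closure of the spiral this is a continuous branch of the polar angle.\<close>
definition spiral_angle :: "pt \<Rightarrow> real" where "spiral_angle z = phase z + Im (Ln (Complex (- spiral_fun z) (spiral_re z))) - pi / 2"

definition angle_grad :: "pt \<Rightarrow> pt" where "angle_grad z = vector [- z$2 / (norm z)\<^sup>2, z$1 / (norm z)\<^sup>2]"

lemma Complex_spiral_nz:
  assumes "z \<noteq> 0" "spiral_fun z \<le> 0"
  shows "Complex (- spiral_fun z) (spiral_re z) \<notin> \<real>\<^sub>\<le>\<^sub>0" "Complex (- spiral_fun z) (spiral_re z) \<noteq> 0"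
proof -
  have "(spiral_re z)\<^sup>2 + (spiral_fun z)\<^sup>2 \<noteq> 0" using spiral_re_spiral_fun_sq[of z] assms(1) by simp
  then have "spiral_re z \<noteq> 0 \<or> spiral_fun z \<noteq> 0" by auto
  then show "Complex (- spiral_fun z) (spiral_re z) \<notin> \<real>\<^sub>\<le>\<^sub>0" "Complex (- spiral_fun z) (spiral_re z) \<noteq> 0"
    using assms(2) by (auto simp: complex_nonpos_Reals_iff complex_eq_iff)
qed

lemma spiral_angle_le: "z \<noteq> 0 \<Longrightarrow> spiral_fun z \<le> 0 \<Longrightarrow> spiral_angle z \<le> phase z" and spiral_angle_ge: "z \<noteq> 0 \<Longrightarrow> spiral_fun z \<le> 0 \<Longrightarrow> phase z - pi \<le> spiral_angle z"
  using Re_Ln_pos_le[OF Complex_spiral_nz(2), of z] by (auto simp: spiral_angle_def)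

lemma Im_inverse_times: "Im (inverse (Complex a b) * Complex x y) = (a * y - b * x) / (a\<^sup>2 + b\<^sup>2)"
  by (simp add: diff_divide_distrib)

lemma spiral_angle_has_derivative:
  assumes z: "z \<noteq> 0" "spiral_fun z \<le> 0"
  shows "(spiral_angle has_derivative (\<lambda>h. angle_grad z \<bullet> h)) (at z within S)"
proof -
  let ?u = "\<lambda>z. Complex (- spiral_fun z) (spiral_re z)"
  let ?u' = "\<lambda>h. Complex (- (spiral_grad z \<bullet> h)) ((cos (phase z) + spiral_fun z * (z$1 / phase z)) * h$1
    + (sin (phase z) + spiral_fun z * (z$2 / phase z)) * h$2)"
  have "(?u has_derivative ?u') (at z)"
    unfolding Complex_eq
    by (intro has_derivative_add has_derivative_mult_right has_derivative_of_real has_derivative_minus spiral_fun_has_derivative spiral_re_has_derivative)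
  moreover have "(Ln has_derivative (\<lambda>k. inverse (?u z) * k)) (at (?u z))"
    using has_field_derivative_Ln[OF Complex_spiral_nz(1)[OF z]] by (simp add: has_field_derivative_def)
  ultimately have "((\<lambda>z. Ln (?u z)) has_derivative (\<lambda>h. inverse (?u z) * ?u' h)) (at z)"
    by (rule has_derivative_compose)
  then have "((\<lambda>z. Im (Ln (?u z))) has_derivative (\<lambda>h. Im (inverse (?u z) * ?u' h))) (at z)"
    by (rule bounded_linear.has_derivative[OF bounded_linear_Im])
  then have "(spiral_angle has_derivative (\<lambda>h. (z$1 / phase z) * h$1 + (z$2 / phase z) * h$2 + Im (inverse (?u z) * ?u' h) - 0)) (at z)"
    unfolding spiral_angle_def[abs_def] by (intro has_derivative_diff has_derivative_add has_derivative_phase has_derivative_const)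
  moreover have "(z$1 / phase z) * h$1 + (z$2 / phase z) * h$2 + Im (inverse (?u z) * ?u' h) - 0 = angle_grad z \<bullet> h" for h
  proof -
    define N where "N = (norm z)\<^sup>2"
    define p where "p = z$1 / phase z"
    define q where "q = z$2 / phase z"
    define c where "c = cos (phase z)"
    define s where "s = sin (phase z)"
    define A where "A = spiral_re z"
    define g where "g = spiral_fun z"
    note defs = p_def q_def c_def s_def A_def g_def
    have N0: "N \<noteq> 0" using z by (simp add: N_def)
    have N: "A^2 + g^2 = N" using spiral_re_spiral_fun_sq[of z] by (simp add: N_def defs)
    have r: "A * s + g * c = z$2" "A * c - g * s = z$1" using spiral_re_spiral_fun_rot[of z] by (simp_all add: defs)
    have u: "?u z = Complex (- g) A"
      "?u' h = Complex (- ((- s - A * p) * h$1 + (c - A * q) * h$2)) ((c + g * p) * h$1 + (s + g * q) * h$2)"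
      by (simp_all add: defs inner_pt spiral_grad_def)
    have "Im (inverse (?u z) * ?u' h) = (- g * ((c + g * p) * h$1 + (s + g * q) * h$2)
        + A * ((- s - A * p) * h$1 + (c - A * q) * h$2)) / N"
      unfolding u Im_inverse_times N[symmetric] by (simp add: algebra_simps)
    also have "\<dots> = (- (A * s + g * c) * h$1 + (A * c - g * s) * h$2 - (A^2 + g^2) * (p * h$1 + q * h$2)) / N"
      by (simp add: algebra_simps power2_eq_square)
    also have "\<dots> = (- z$2 * h$1 + z$1 * h$2) / N - (p * h$1 + q * h$2)"
      unfolding r N using N0 by (simp add: field_simps)
    finally show ?thesis
      by (simp add: inner_pt angle_grad_def N_def[symmetric] p_def q_def add_divide_distrib diff_divide_distrib)
  qed
  ultimately have "(spiral_angle has_derivative (\<lambda>h. angle_grad z \<bullet> h)) (at z)" by simp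
  then show ?thesis by (rule has_derivative_at_withinI)
qed

definition spiral_weight :: "pt \<Rightarrow> real" where "spiral_weight z = (if norm z < 1 then 0 else quad_ramp (spiral_angle z - 2))"
definition spiral_weight_grad :: "pt \<Rightarrow> pt" where "spiral_weight_grad z = (if norm z < 1 then 0 else quad_ramp1 (spiral_angle z - 2) *\<^sub>R angle_grad z)"

lemma norm_angle_grad: "z \<noteq> 0 \<Longrightarrow> norm (angle_grad z) = 1 / norm z"
proof -
  assume z: "z \<noteq> 0"
  have "(norm (angle_grad z))\<^sup>2 = (1 / norm z)\<^sup>2"
  proof -
    have "(norm (angle_grad z))\<^sup>2 = ((z$1)\<^sup>2 + (z$2)\<^sup>2) / ((norm z)\<^sup>2)\<^sup>2"
      by (simp add: norm_pt angle_grad_def power_divide add_divide_distrib add.commute)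
    also have "(z$1)\<^sup>2 + (z$2)\<^sup>2 = (norm z)\<^sup>2" by (simp add: norm_pt)
    finally show ?thesis using z by (simp add: power2_eq_square)
  qed
  then show ?thesis by (simp add: power2_eq_iff_nonneg)
qed

lemma spiral_angle_small: "z \<noteq> 0 \<Longrightarrow> spiral_fun z \<le> 0 \<Longrightarrow> norm z < 3/2 \<Longrightarrow> spiral_angle z - 2 \<le> 0"
proof -
  assume a: "z \<noteq> 0" "spiral_fun z \<le> 0" "norm z < 3/2"
  have "(norm z)\<^sup>2 \<le> (3/2)\<^sup>2" using a(3) by (intro power_mono) auto
  then have "phase z \<le> 2" unfolding phase_norm by (intro real_le_lsqrt) (auto simp: power2_eq_square)
  then show ?thesis using spiral_angle_le[OF a(1,2)] by simp
qed

lemma spiral_weight_cases: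
  assumes "spiral_fun z \<le> 0"
  shows "norm z < 3/2 \<Longrightarrow> spiral_weight z = 0" "norm z < 3/2 \<Longrightarrow> spiral_weight_grad z = 0"
    "1 \<le> norm z \<Longrightarrow> spiral_weight z = quad_ramp (spiral_angle z - 2)" "1 \<le> norm z \<Longrightarrow> spiral_weight_grad z = quad_ramp1 (spiral_angle z - 2) *\<^sub>R angle_grad z"
proof -
  assume "norm z < 3/2"
  then show "spiral_weight z = 0" "spiral_weight_grad z = 0"
    using spiral_angle_small[of z] assms by (cases "z = 0"; auto simp: spiral_weight_def spiral_weight_grad_def quad_ramp_def quad_ramp1_def)+
qed (auto simp: spiral_weight_def spiral_weight_grad_def)

lemma spiral_weight_has_derivative:
  assumes z: "z \<in> closure spiral"
  shows "(spiral_weight has_derivative (\<lambda>h. spiral_weight_grad z \<bullet> h)) (at z within closure spiral)"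
proof -
  have g: "spiral_fun y \<le> 0" if "y \<in> closure spiral" for y using that closure_spiral_subset by auto
  show ?thesis
  proof (cases "norm z < 3/2")
    case True
    have "(spiral_weight has_derivative (\<lambda>h. 0)) (at z within closure spiral)"
    proof (rule has_derivative_transform_within)
      show "((\<lambda>_. 0) has_derivative (\<lambda>h. 0)) (at z within closure spiral)" by simp
      show "0 < 3/2 - norm z" using True by simp
      show "0 = spiral_weight y" if "y \<in> closure spiral" "dist y z < 3/2 - norm z" for y
        using spiral_weight_cases(1)[OF g[OF that(1)]] that(2) norm_triangle_ineq2[of y z] by (simp add: dist_norm)
    qed (use z in auto)
    then show ?thesis using spiral_weight_cases(2)[OF g[OF z] True] by simp
  next
    case False
    then have nz: "z \<noteq> 0" by auto
    have "(quad_ramp has_derivative (\<lambda>k. quad_ramp1 (spiral_angle z - 2) * k)) (at (spiral_angle z - 2))"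
      using DERIV_quad_ramp by (simp add: has_field_derivative_def)
    moreover have "((\<lambda>z. spiral_angle z - 2) has_derivative (\<lambda>h. angle_grad z \<bullet> h)) (at z within closure spiral)"
      using has_derivative_diff[OF spiral_angle_has_derivative[OF nz g[OF z]] has_derivative_const[of 2]] by simp
    ultimately have "((\<lambda>z. quad_ramp (spiral_angle z - 2)) has_derivative (\<lambda>h. quad_ramp1 (spiral_angle z - 2) * (angle_grad z \<bullet> h))) (at z within closure spiral)"
      by (rule has_derivative_compose[rotated])
    then have "(spiral_weight has_derivative (\<lambda>h. quad_ramp1 (spiral_angle z - 2) * (angle_grad z \<bullet> h))) (at z within closure spiral)"
    proof (rule has_derivative_transform_within)
      show "(0::real) < 1/2" by simp
      show "quad_ramp (spiral_angle y - 2) = spiral_weight y" if "y \<in> closure spiral" "dist y z < 1/2" for y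
        using spiral_weight_cases(3)[OF g[OF that(1)]] that(2) False norm_triangle_ineq3[of y z] by (simp add: dist_norm)
    qed (use z in auto)
    then show ?thesis using spiral_weight_cases(4)[OF g[OF z]] False by simp
  qed
qed

lemma spiral_weight_grad_norm: assumes "spiral_fun z \<le> 0" shows "norm (spiral_weight_grad z) \<le> 4"
proof (cases "norm z < 1 \<or> spiral_angle z - 2 \<le> 0")
  case True then show ?thesis by (auto simp: spiral_weight_grad_def quad_ramp1_def)
next
  case False
  then have nz: "z \<noteq> 0" "1 \<le> norm z" "0 < spiral_angle z - 2" by auto
  have "quad_ramp1 (spiral_angle z - 2) \<le> 2 * (spiral_angle z - 2)" using quad_ramp_bounds(4) nz by blast
  also have "\<dots> \<le> 2 * phase z" using spiral_angle_le[OF nz(1) assms] by simp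
  also have "\<dots> \<le> 4 * norm z" using phase_le_norm[of z] nz by simp
  finally have "quad_ramp1 (spiral_angle z - 2) / norm z \<le> 4" using nz by (simp add: field_simps)
  then show ?thesis using False quad_ramp_bounds(3)[of "spiral_angle z - 2"] by (simp add: spiral_weight_grad_def norm_angle_grad nz)
qed

lemma spiral_weight_grad_has_derivative:
  obtains H where "\<And>z. z \<in> spiral \<Longrightarrow> (spiral_weight_grad has_derivative H z) (at z)"
    "\<And>z. z \<in> spiral \<Longrightarrow> \<bar>\<Sum>i\<in>UNIV. H z (axis i 1) $ i\<bar> \<le> 2"
proof -
  have g: "spiral_fun y \<le> 0" if "y \<in> spiral" for y using that by (simp add: spiral_def)
  have "\<exists>H. (spiral_weight_grad has_derivative H) (at z) \<and> \<bar>\<Sum>i\<in>UNIV. H (axis i 1) $ i\<bar> \<le> 2" if z: "z \<in> spiral" for z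
  proof -
    obtain r where r: "r > 0" "ball z r \<subseteq> spiral" using open_spiral z by (meson open_contains_ball)
    show ?thesis
    proof (cases "norm z < 3/2")
      case True
      have "(spiral_weight_grad has_derivative (\<lambda>h. 0)) (at z)"
      proof (rule has_derivative_transform_within)
        show "((\<lambda>_. 0) has_derivative (\<lambda>h. 0)) (at z)" by simp
        show "0 < min r (3/2 - norm z)" using True r by simp
        show "0 = spiral_weight_grad y" if "y \<in> UNIV" "dist y z < min r (3/2 - norm z)" for y
        proof -
          have "y \<in> spiral" using r(2) that by (auto simp: dist_commute)
          then show ?thesis using spiral_weight_cases(2)[OF g] that(2) norm_triangle_ineq2[of y z] by (simp add: dist_norm)
        qed
      qed auto
      then show ?thesis by (intro exI[of _ "\<lambda>h. 0"]) simp
    next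
      case False
      then have nz: "z \<noteq> 0" by auto
      define N where "N = (norm z)\<^sup>2"
      have Npos: "N > 0" using nz by (simp add: N_def)
      have Nd: "((\<lambda>z. (norm z)\<^sup>2) has_derivative (\<lambda>h. 2 * (z \<bullet> h))) (at z)"
        unfolding power2_norm_eq_inner by (auto intro!: derivative_eq_intros simp: inner_commute)
      have d1: "((\<lambda>z. - z$2 / (norm z)\<^sup>2) has_derivative (\<lambda>h. - h$2 / N + z$2 * (2 * (z \<bullet> h)) / N^2)) (at z)"
        using has_derivative_minus[OF has_derivative_divide[OF vec_nth_has_derivative[of 2] Nd, simplified, OF nz, folded N_def]]
        unfolding minus_divide_left
        by (rule has_derivative_eq_rhs) (use Npos in \<open>auto simp: fun_eq_iff N_def[symmetric] field_simps power2_eq_square\<close>)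
      have d2: "((\<lambda>z. z$1 / (norm z)\<^sup>2) has_derivative (\<lambda>h. h$1 / N - z$1 * (2 * (z \<bullet> h)) / N^2)) (at z)"
        using has_derivative_divide[OF vec_nth_has_derivative[of 1] Nd, simplified, OF nz, folded N_def]
        by (rule has_derivative_eq_rhs) (use Npos in \<open>auto simp: fun_eq_iff N_def[symmetric] field_simps power2_eq_square\<close>)
      define V where "V h = (vector [- h$2 / N + z$2 * (2 * (z \<bullet> h)) / N^2, h$1 / N - z$1 * (2 * (z \<bullet> h)) / N^2] :: pt)" for h
      have Vd: "(angle_grad has_derivative V) (at z)"
        unfolding angle_grad_def[abs_def] V_def by (rule has_derivative_vector2[OF d1 d2])
      have "(quad_ramp1 has_derivative (\<lambda>k. quad_ramp2 (spiral_angle z - 2) * k)) (at (spiral_angle z - 2))"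
        using DERIV_quad_ramp1 by (simp add: has_field_derivative_def)
      moreover have "((\<lambda>z. spiral_angle z - 2) has_derivative (\<lambda>h. angle_grad z \<bullet> h)) (at z)"
        using has_derivative_diff[OF spiral_angle_has_derivative[OF nz g[OF z]] has_derivative_const[of 2]] by simp
      ultimately have K: "((\<lambda>z. quad_ramp1 (spiral_angle z - 2)) has_derivative (\<lambda>h. quad_ramp2 (spiral_angle z - 2) * (angle_grad z \<bullet> h))) (at z)"
        by (rule has_derivative_compose[rotated])
      define H where "H h = quad_ramp1 (spiral_angle z - 2) *\<^sub>R V h + (quad_ramp2 (spiral_angle z - 2) * (angle_grad z \<bullet> h)) *\<^sub>R angle_grad z" for h
      have "((\<lambda>z. quad_ramp1 (spiral_angle z - 2) *\<^sub>R angle_grad z) has_derivative H) (at z)"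
        unfolding H_def by (rule has_derivative_scaleR[OF K Vd])
      then have "(spiral_weight_grad has_derivative H) (at z)"
      proof (rule has_derivative_transform_within)
        show "(0::real) < min r (1/2)" using r by simp
        show "quad_ramp1 (spiral_angle y - 2) *\<^sub>R angle_grad y = spiral_weight_grad y" if "y \<in> UNIV" "dist y z < min r (1/2)" for y
        proof -
          have "y \<in> spiral" using r(2) that by (auto simp: dist_commute)
          moreover have "1 \<le> norm y" using that(2) False norm_triangle_ineq3[of y z] by (auto simp: dist_norm)
          ultimately show ?thesis using spiral_weight_cases(4)[OF g] by simp
        qed
      qed auto
      moreover have "(\<Sum>i\<in>UNIV. H (axis i 1) $ i) = quad_ramp2 (spiral_angle z - 2) * (1 / norm z)\<^sup>2"
      proof -
        have "(\<Sum>i\<in>UNIV. H (axis i 1) $ i) = quad_ramp2 (spiral_angle z - 2) * (angle_grad z \<bullet> angle_grad z)"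
          by (simp add: H_def V_def UNIV_2 inner_axis axis_def inner_pt algebra_simps)
        then show ?thesis using norm_angle_grad[OF nz] by (simp add: power2_norm_eq_inner[symmetric])
      qed
      moreover have "\<bar>quad_ramp2 (spiral_angle z - 2) * (1 / norm z)\<^sup>2\<bar> \<le> 2 * 1\<^sup>2"
        using quad_ramp_bounds(5,6)[of "spiral_angle z - 2"] False nz unfolding abs_mult abs_power2
        by (intro mult_mono power_mono) (auto simp: field_simps)
      ultimately show ?thesis by (intro exI[of _ H]) simp
    qed
  qed
  then obtain H where "\<forall>z\<in>spiral. (spiral_weight_grad has_derivative H z) (at z) \<and> \<bar>\<Sum>i\<in>UNIV. H z (axis i 1) $ i\<bar> \<le> 2"
    using bchoice[of spiral "\<lambda>z H. (spiral_weight_grad has_derivative H) (at z) \<and> \<bar>\<Sum>i\<in>UNIV. H (axis i 1) $ i\<bar> \<le> 2"] by blast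
  then show ?thesis by (intro that[of H]) auto
qed

lemma spiral_ratio_normal_derivative:
  assumes d: "(spiral_ratio has_derivative (\<lambda>h. GB \<bullet> h)) (at z)" and z: "spiral_fun z = 0"
  shows "1/2 \<le> GB \<bullet> spiral_normal z"
proof -
  have B0: "spiral_ratio z = 0" using z phase_nz[of z] by (simp add: spiral_fun_eq)
  have "(spiral_fun has_derivative (\<lambda>h. phase z * (GB \<bullet> h) + ((z$1 / phase z) * h$1 + (z$2 / phase z) * h$2) * spiral_ratio z)) (at z)"
    unfolding spiral_fun_eq[abs_def] by (rule has_derivative_mult[OF has_derivative_phase d])
  from has_derivative_unique[OF this spiral_fun_has_derivative]
  have "phase z * (GB \<bullet> h) = spiral_grad z \<bullet> h" for h by (simp add: B0 fun_eq_iff)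
  then have GB: "GB \<bullet> h = (spiral_grad z \<bullet> h) / phase z" for h by (simp add: phase_nz field_simps)
  have "GB \<bullet> spiral_normal z = norm (spiral_grad z) / phase z"
    by (simp add: GB spiral_normal_def norm_eq_sqrt_inner real_div_sqrt)
  moreover have "phase z / 2 \<le> norm (spiral_grad z)"
  proof (rule power2_le_imp_le)
    define f where "f = phase z"
    define s where "s = sin (phase z)"
    define c where "c = cos (phase z)"
    define A where "A = spiral_re z"
    define x where "x = z$1"
    define y where "y = z$2"
    note defs = f_def s_def c_def A_def x_def y_def
    have f: "f > 0" "f^2 = 1 + x^2 + y^2" "1 \<le> f" using phase_pos phase_sq phase_ge1 by (auto simp: defs)
    have sc: "s^2 + c^2 = 1" by (simp add: defs)
    have r: "A * s = y" "A * c = x" using spiral_re_spiral_fun_rot[of z] z by (simp_all add: defs)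
    have A2: "A^2 = x^2 + y^2" using spiral_re_spiral_fun_sq[of z] z by (simp add: defs norm_pt)
    have "(norm (spiral_grad z))\<^sup>2 = (- s - A * (x / f))^2 + (c - A * (y / f))^2"
      by (simp add: norm_pt spiral_grad_def defs)
    also have "\<dots> = s^2 + c^2 + 2 * A * (s * (x / f) - c * (y / f)) + A^2 * ((x / f)^2 + (y / f)^2)"
      by algebra
    also have "A * (s * x - c * y) = 0" using r by (simp add: right_diff_distrib mult.assoc[symmetric])
    then have "2 * A * (s * (x / f) - c * (y / f)) = 0" by (auto simp: diff_divide_distrib[symmetric])
    also have "s^2 + c^2 + 0 + A^2 * ((x / f)^2 + (y / f)^2) = 1 + (f^2 - 1)^2 / f^2"
      unfolding A2 sc power_divide add_divide_distrib[symmetric] using f(2) by (simp add: power2_eq_square)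
    finally have N: "(norm (spiral_grad z))\<^sup>2 = 1 + (f^2 - 1)^2 / f^2" .
    have "f^2 * f^2 \<le> 4 * (f^2 + (f^2 - 1)^2)"
    proof -
      have "0 \<le> (3 * f^2 - 2)^2 + 8 + 0 * f^2" by simp
      then show ?thesis by (simp add: power2_eq_square algebra_simps)
    qed
    then have "f^2 / 4 \<le> 1 + (f^2 - 1)^2 / f^2" using f(1) by (simp add: field_simps power2_eq_square)
    then show "(phase z / 2)\<^sup>2 \<le> (norm (spiral_grad z))\<^sup>2" unfolding N by (simp add: defs power_divide)
  qed simp
  ultimately show ?thesis using phase_pos[of z] by (simp add: pos_le_divide_eq)
qed

lemma spiral_barriers:
  obtains \<mu> C where "\<mu> > 0" "C \<ge> 0" "barrier spiral spiral_normal C (\<lambda>x. exp (- spiral_weight x + \<mu> * spiral_ratio x))"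
    "barrier spiral spiral_normal C (\<lambda>x. exp (spiral_weight x + \<mu> * spiral_ratio x))"
proof -
  obtain GB HB CB where B: "\<And>z. (spiral_ratio has_derivative (\<lambda>h. GB z \<bullet> h)) (at z)"
    "\<And>z. (GB has_derivative HB z) (at z)" 
    "\<And>z. norm (GB z) \<le> CB" "\<And>z. \<bar>\<Sum>i\<in>UNIV. HB z (axis i 1) $ i\<bar> \<le> CB"
    by (rule spiral_ratio_derivatives, rule that)
  obtain HT where T: "\<And>z. z \<in> spiral \<Longrightarrow> (spiral_weight_grad has_derivative HT z) (at z)"
    "\<And>z. z \<in> spiral \<Longrightarrow> \<bar>\<Sum>i\<in>UNIV. HT z (axis i 1) $ i\<bar> \<le> 2"
    by (rule spiral_weight_grad_has_derivative, rule that)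
  have g: "spiral_fun y \<le> 0" if "y \<in> closure spiral" for y using that closure_spiral_subset by auto
  have g': "spiral_fun y \<le> 0" if "y \<in> spiral" for y using that by (simp add: spiral_def)
  have CB: "0 \<le> CB" using B(3) norm_ge_zero order_trans by blast
  have main: "barrier spiral spiral_normal ((4 + 9 * CB)\<^sup>2 + (2 + 9 * CB)) (\<lambda>x. exp (\<sigma> * spiral_weight x + 9 * spiral_ratio x))" if "\<bar>\<sigma>\<bar> = 1" for \<sigma>
  proof (rule exp_barrier[where G = "\<lambda>x. \<sigma> *\<^sub>R spiral_weight_grad x + 9 *\<^sub>R GB x" and H = "\<lambda>x h. \<sigma> *\<^sub>R HT x h + 9 *\<^sub>R HB x h"
        and ?C1.0 = "4 + 9 * CB" and ?C2.0 = "2 + 9 * CB", OF open_spiral])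
    show "((\<lambda>x. \<sigma> * spiral_weight x + 9 * spiral_ratio x) has_derivative (\<lambda>h. (\<sigma> *\<^sub>R spiral_weight_grad x + 9 *\<^sub>R GB x) \<bullet> h)) (at x within closure spiral)"
      if "x \<in> closure spiral" for x
      unfolding inner_add_left inner_scaleR_left
      by (intro has_derivative_add has_derivative_mult_right spiral_weight_has_derivative that has_derivative_at_withinI[OF B(1)])
    show "((\<lambda>x. \<sigma> *\<^sub>R spiral_weight_grad x + 9 *\<^sub>R GB x) has_derivative (\<lambda>h. \<sigma> *\<^sub>R HT x h + 9 *\<^sub>R HB x h)) (at x)" if "x \<in> spiral" for x
      by (intro has_derivative_add has_derivative_scaleR_right T(1) that B(2))
    show "norm (\<sigma> *\<^sub>R spiral_weight_grad x + 9 *\<^sub>R GB x) \<le> 4 + 9 * CB" if "x \<in> spiral" for x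
      using norm_triangle_ineq[of "\<sigma> *\<^sub>R spiral_weight_grad x" "9 *\<^sub>R GB x"] spiral_weight_grad_norm[OF g'[OF that]] B(3)[of x] \<open>\<bar>\<sigma>\<bar> = 1\<close> by simp
    show "(\<Sum>i\<in>UNIV. (\<sigma> *\<^sub>R HT x (axis i 1) + 9 *\<^sub>R HB x (axis i 1)) $ i) \<le> 2 + 9 * CB" if "x \<in> spiral" for x
    proof -
      have "(\<Sum>i\<in>UNIV. (\<sigma> *\<^sub>R HT x (axis i 1) + 9 *\<^sub>R HB x (axis i 1)) $ i) =
         \<sigma> * (\<Sum>i\<in>UNIV. HT x (axis i 1) $ i) + 9 * (\<Sum>i\<in>UNIV. HB x (axis i 1) $ i)"
        by (simp add: sum.distrib sum_distrib_left)
      also have "\<dots> \<le> 2 + 9 * CB"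
        using T(2)[OF that] B(4)[of x] \<open>\<bar>\<sigma>\<bar> = 1\<close> by (auto simp: abs_if split: if_splits)
      finally show ?thesis .
    qed
    show "0 < (\<sigma> *\<^sub>R spiral_weight_grad x + 9 *\<^sub>R GB x) \<bullet> spiral_normal x" if "x \<in> frontier spiral" for x
    proof -
      have x: "spiral_fun x = 0" using that frontier_spiral_subset by auto
      have "\<bar>\<sigma> * (spiral_weight_grad x \<bullet> spiral_normal x)\<bar> \<le> norm (spiral_weight_grad x) * norm (spiral_normal x)"
        using Cauchy_Schwarz_ineq2[of "spiral_weight_grad x" "spiral_normal x"] \<open>\<bar>\<sigma>\<bar> = 1\<close> by (simp add: abs_mult)
      also have "norm (spiral_normal x) = 1" by (simp add: spiral_normal_def spiral_grad_nonzero)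
      finally have "\<bar>\<sigma> * (spiral_weight_grad x \<bullet> spiral_normal x)\<bar> \<le> 4" using spiral_weight_grad_norm[of x] x by simp
      then show ?thesis using spiral_ratio_normal_derivative[OF B(1) x] by (simp add: inner_add_left)
    qed
  qed (use that in auto)
  show ?thesis
    by (rule that[of 9 "(4 + 9 * CB)\<^sup>2 + (2 + 9 * CB)"]) (use main[of 1] main[of "-1"] CB in auto)
qed

lemma spiral_inward:
  assumes "x \<in> frontier spiral"
  shows "eventually (\<lambda>s. x - s *\<^sub>R spiral_normal x \<in> spiral) (at_right 0)"
proof -
  have x: "spiral_fun x = 0" using assms frontier_spiral_subset by auto
  have "((\<lambda>s. x - s *\<^sub>R spiral_normal x) has_derivative (\<lambda>s. - (s *\<^sub>R spiral_normal x))) (at 0)"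
    by (auto intro!: derivative_eq_intros)
  moreover have "(spiral_fun has_derivative (\<lambda>h. spiral_grad x \<bullet> h)) (at (x - 0 *\<^sub>R spiral_normal x))" using spiral_fun_has_derivative by simp
  ultimately have "((\<lambda>s. spiral_fun (x - s *\<^sub>R spiral_normal x)) has_derivative (\<lambda>s. spiral_grad x \<bullet> (- (s *\<^sub>R spiral_normal x)))) (at 0)"
    by (rule has_derivative_compose)
  then have d: "DERIV (\<lambda>s. spiral_fun (x - s *\<^sub>R spiral_normal x)) 0 :> - (spiral_grad x \<bullet> spiral_normal x)"
    unfolding has_field_derivative_def by (auto simp: fun_eq_iff elim!: has_derivative_eq_rhs)
  have "spiral_grad x \<bullet> spiral_normal x = norm (spiral_grad x)" by (simp add: spiral_normal_def norm_eq_sqrt_inner real_div_sqrt)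
  then have "- (spiral_grad x \<bullet> spiral_normal x) < 0" using spiral_grad_nonzero[of x] by simp
  from DERIV_neg_dec_right[OF d this] obtain e where "e > 0" "\<forall>h>0. h < e \<longrightarrow> spiral_fun (x - 0 *\<^sub>R spiral_normal x) > spiral_fun (x - (0 + h) *\<^sub>R spiral_normal x)"
    by auto
  then show ?thesis unfolding eventually_at_right_field using x by (auto simp: spiral_def intro!: exI[of _ e])
qed

lemma spiral_weight_ge:
  assumes "spiral_fun z \<le> 0" "pi + 3 \<le> norm z" shows "(norm z - pi - 2)\<^sup>2 / 2 \<le> spiral_weight z"
proof -
  have z: "z \<noteq> 0" "1 \<le> norm z" using assms(2) pi_ge_two norm_zero by (smt (verit))+
  have s: "norm z - pi - 2 \<le> spiral_angle z - 2" using spiral_angle_ge[OF z(1) assms(1)] norm_le_phase[of z] by simp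
  have "(norm z - pi - 2)\<^sup>2 / 2 \<le> (spiral_angle z - 2)\<^sup>2 / 2"
    using s assms(2) by (intro divide_right_mono power_mono) auto
  also have "\<dots> \<le> quad_ramp (spiral_angle z - 2)" using s assms(2) by (intro quad_ramp_bounds(7)) auto
  finally show ?thesis using z(2) by (simp add: spiral_weight_def)
qed

lemma barrier_scale:
  assumes "barrier \<Omega> n C P" "M > 1" shows "barrier \<Omega> n C (\<lambda>x. M * P x)"
proof -
  have "(\<lambda>x. P x + (M - 1) * P x) = (\<lambda>x. M * P x)" by (simp add: algebra_simps)
  then show ?thesis using barrier_add_scaled[OF assms(1,1), of "M - 1"] assms(2) by simp
qed

lemma LV_solution_decay:
  assumes pos: "0 < d1" "0 < d2" "0 < r1" "0 < r2" "0 < a1" "0 < a2"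
    and init: "(u0, v0) \<in> Theta spiral" and sol: "LV_solution spiral d1 d2 r1 r2 a1 a2 u0 v0 u v"
  obtains M \<Lambda> where "\<And>t x. 0 \<le> t \<Longrightarrow> x \<in> closure spiral \<Longrightarrow> \<bar>u t x\<bar> + \<bar>1 - v t x\<bar> \<le> M * exp (\<Lambda> * t - spiral_weight x)"
    "\<Lambda> > 0" "M > 0"
proof -
  have ue: "classical_eq spiral d1 (\<lambda>t x. r1 * u t x * (1 - u t x - a1 * v t x)) u0 u"
    and ve: "classical_eq spiral d2 (\<lambda>t x. r2 * v t x * (1 - v t x - a2 * u t x)) v0 v"
    and bu: "bounded ((\<lambda>(t, x). u t x) ` ({0..} \<times> closure spiral))"
    and bv: "bounded ((\<lambda>(t, x). v t x) ` ({0..} \<times> closure spiral))"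
    using sol by (auto simp: LV_solution_def)
  obtain Ku where Ku: "Ku > 0" "\<And>t x. 0 \<le> t \<Longrightarrow> x \<in> closure spiral \<Longrightarrow> \<bar>u t x\<bar> \<le> Ku"
    using bu unfolding bounded_pos by force
  obtain Kv where Kv: "Kv > 0" "\<And>t x. 0 \<le> t \<Longrightarrow> x \<in> closure spiral \<Longrightarrow> \<bar>v t x\<bar> \<le> Kv"
    using bv unfolding bounded_pos by force
  obtain \<mu> C where B: "\<mu> > 0" "C \<ge> 0" "barrier spiral spiral_normal C (\<lambda>x. exp (- spiral_weight x + \<mu> * spiral_ratio x))"
    "barrier spiral spiral_normal C (\<lambda>x. exp (spiral_weight x + \<mu> * spiral_ratio x))"
    by (rule spiral_barriers, rule that)
  have B\<mu>: "- \<mu> \<le> \<mu> * spiral_ratio x" "\<mu> * spiral_ratio x \<le> \<mu>" for x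
    using mult_left_mono[of "-1" "spiral_ratio x" \<mu>] mult_left_mono[of "spiral_ratio x" 1 \<mu>] spiral_ratio_abs_le[of x] B(1) by auto
  have g: "spiral_fun y \<le> 0" if "y \<in> closure spiral" for y using that closure_spiral_subset by auto
  have Q_inf: "\<exists>\<rho>. \<forall>x\<in>closure spiral. \<rho> \<le> norm x \<longrightarrow> M \<le> exp (spiral_weight x + \<mu> * spiral_ratio x)" for M
  proof (intro exI ballI impI)
    fix x assume x: "x \<in> closure spiral" "pi + 3 + 2 * (\<bar>M\<bar> + \<mu>) \<le> norm x"
    define t where "t = norm x - pi - 2"
    have t: "1 \<le> t" "2 * (\<bar>M\<bar> + \<mu>) \<le> t" using x(2) B(1) by (auto simp: t_def)
    have "\<bar>M\<bar> + \<mu> \<le> t / 2" using t by simp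
    also have "\<dots> \<le> t\<^sup>2 / 2" using t by (simp add: power2_eq_square)
    also have "\<dots> \<le> spiral_weight x" unfolding t_def using spiral_weight_ge[OF g[OF x(1)]] x(2) B(1) by simp
    finally have "M \<le> 1 + (spiral_weight x + \<mu> * spiral_ratio x)" using B\<mu>(1)[of x] by linarith
    then show "M \<le> exp (spiral_weight x + \<mu> * spiral_ratio x)" using exp_ge_add_one_self order_trans by blast
  qed
  have u01: "\<bar>u0 x\<bar> \<le> 1" "\<bar>1 - v0 x\<bar> \<le> 1" if "x \<in> closure spiral" for x using init that by (auto simp: Theta_def)
  obtain S where S: "compact S" "S \<subseteq> closure spiral" "\<And>x. x \<in> closure spiral - S \<Longrightarrow> u0 x = 0 \<and> v0 x = 1"
    using init by (auto simp: Theta_def)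
  have "continuous_on (closure spiral) spiral_weight"
    by (rule has_derivative_continuous_on) (rule spiral_weight_has_derivative)
  then have "bounded (spiral_weight ` S)"
    using compact_continuous_image compact_imp_bounded continuous_on_subset S by metis
  then obtain b where b: "b > 0" "\<And>x. x \<in> S \<Longrightarrow> \<bar>spiral_weight x\<bar> \<le> b" unfolding bounded_pos by auto
  define M0 where "M0 = exp (b + \<mu>)"
  define P where "P x = M0 * exp (- spiral_weight x + \<mu> * spiral_ratio x)" for x
  have "M0 > 1" using b(1) B(1) by (simp add: M0_def)
  have P: "barrier spiral spiral_normal C P" unfolding P_def by (rule barrier_scale[OF B(3) \<open>M0 > 1\<close>])
  have P_pos: "0 < P x" for x using \<open>M0 > 1\<close> by (simp add: P_def)
  have P1: "1 \<le> P x" if "x \<in> S" for x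
  proof -
    have "0 \<le> (b + \<mu>) + (- spiral_weight x + \<mu> * spiral_ratio x)" using b(2)[OF that] B\<mu>(1)[of x] by linarith
    then show ?thesis unfolding P_def M0_def exp_add[symmetric] by simp
  qed
  have init_P: "\<bar>u0 x\<bar> \<le> P x" "\<bar>1 - v0 x\<bar> \<le> P x" if "x \<in> closure spiral" for x
    using u01[OF that] P1[of x] S(3)[of x] P_pos[of x] that by (cases "x \<in> S"; force)+
  define K where "K = r1 * (1 + Ku + a1 * Kv) + r2 * Kv * (1 + a2)"
  define \<Lambda> where "\<Lambda> = (d1 + d2) * C + 2 * K + 1"
  have K12: "r1 * (1 + Ku + a1 * Kv) \<le> K" "r2 * Kv \<le> K" "r2 * Kv * a2 \<le> K" "0 \<le> K"
    using pos Ku(1) Kv(1) by (auto simp: K_def algebra_simps intro!: add_nonneg_nonneg)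
  have \<Lambda>: "\<Lambda> > d1 * C + 2 * K" "\<Lambda> > d2 * C + 2 * K" "\<Lambda> > 0"
    using K12(4) mult_nonneg_nonneg[OF less_imp_le[OF pos(1)] B(2)] mult_nonneg_nonneg[OF less_imp_le[OF pos(2)] B(2)]
    unfolding \<Lambda>_def distrib_right by linarith+
  have cl: "x \<in> closure spiral" if "x \<in> spiral" for x using that closure_subset by auto
  note comp = comparison[OF open_spiral _ _ P B(4) Q_inf _ outward_normal_spiral spiral_inward K12(4) B(2)]
  have Fu: "\<bar>r1 * u t x * (1 - u t x - a1 * v t x)\<bar> \<le> K * (\<bar>u t x\<bar> + exp (\<Lambda> * t) * P x)"
    if "0 < t" "x \<in> spiral" for t x
  proof -
    have bd: "\<bar>u t x\<bar> \<le> Ku" "\<bar>v t x\<bar> \<le> Kv" using Ku(2) Kv(2) cl that by auto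
    have "\<bar>a1 * v t x\<bar> \<le> a1 * Kv" using bd pos by (simp add: abs_mult)
    then have "\<bar>1 - u t x - a1 * v t x\<bar> \<le> 1 + Ku + a1 * Kv" using bd by linarith
    then have "\<bar>r1 * u t x * (1 - u t x - a1 * v t x)\<bar> \<le> r1 * \<bar>u t x\<bar> * (1 + Ku + a1 * Kv)"
      using pos by (simp add: abs_mult mult_left_mono)
    also have "\<dots> = (r1 * (1 + Ku + a1 * Kv)) * \<bar>u t x\<bar>" by simp
    also have "\<dots> \<le> K * \<bar>u t x\<bar>" by (intro mult_right_mono K12) simp
    also have "\<dots> \<le> K * (\<bar>u t x\<bar> + exp (\<Lambda> * t) * P x)"
      using K12(4) P_pos[of x] by (intro mult_left_mono) auto
    finally show ?thesis .
  qed
  have u: "\<bar>u t x\<bar> \<le> exp (\<Lambda> * t) * P x" if "0 \<le> t" "x \<in> closure spiral" for t x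
  proof -
    have "u t x \<le> exp (\<Lambda> * t) * P x"
      by (rule comp[OF ue pos(1) Ku(2) _ \<Lambda>(1) _ _ that]) (use Fu init_P in \<open>auto simp: abs_le_iff\<close>)
    moreover have "0 - u t x \<le> exp (\<Lambda> * t) * P x"
      by (rule comp[OF classical_eq_const_minus[OF ue] pos(1) _ _ \<Lambda>(1) _ _ that, where ?K0.0 = Ku])
         (use Fu init_P Ku in \<open>auto simp: abs_le_iff\<close>)
    ultimately show ?thesis by linarith
  qed
  have Fv: "\<bar>r2 * v t x * (1 - v t x - a2 * u t x)\<bar> \<le> K * (\<bar>1 - v t x\<bar> + exp (\<Lambda> * t) * P x)"
    if "0 < t" "x \<in> spiral" for t x
  proof -
    have bd: "\<bar>v t x\<bar> \<le> Kv" "\<bar>u t x\<bar> \<le> exp (\<Lambda> * t) * P x" using Kv(2) u cl that by auto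
    have "\<bar>r2 * v t x * (1 - v t x - a2 * u t x)\<bar> = r2 * \<bar>v t x\<bar> * \<bar>1 - v t x - a2 * u t x\<bar>"
      using pos by (simp add: abs_mult)
    also have "\<dots> \<le> r2 * Kv * (\<bar>1 - v t x\<bar> + a2 * \<bar>u t x\<bar>)"
    proof (intro mult_mono)
      have "\<bar>a2 * u t x\<bar> = a2 * \<bar>u t x\<bar>" using pos by (simp add: abs_mult)
      then show "\<bar>1 - v t x - a2 * u t x\<bar> \<le> \<bar>1 - v t x\<bar> + a2 * \<bar>u t x\<bar>" by linarith
    qed (use pos bd Kv(1) in auto)
    also have "\<dots> = (r2 * Kv) * \<bar>1 - v t x\<bar> + (r2 * Kv * a2) * \<bar>u t x\<bar>" by (simp add: algebra_simps)
    also have "\<dots> \<le> K * \<bar>1 - v t x\<bar> + K * (exp (\<Lambda> * t) * P x)"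
      using bd(2) pos Kv(1) K12 by (intro add_mono mult_mono) auto
    finally show ?thesis by (simp add: distrib_left)
  qed
  have v: "\<bar>1 - v t x\<bar> \<le> exp (\<Lambda> * t) * P x" if "0 \<le> t" "x \<in> closure spiral" for t x
  proof -
    have e1: "classical_eq spiral d2 (\<lambda>t x. - (r2 * v t x * (1 - v t x - a2 * u t x))) (\<lambda>x. 1 - v0 x) (\<lambda>t x. 1 - v t x)"
      by (rule classical_eq_const_minus[OF ve])
    have bd: "\<bar>1 - v t x\<bar> \<le> 1 + Kv" if "0 \<le> t" "x \<in> closure spiral" for t x using Kv(2)[OF that] by linarith
    have "1 - v t x \<le> exp (\<Lambda> * t) * P x"
      by (rule comp[OF e1 pos(2) bd _ \<Lambda>(2) _ _ that]) (use Fv init_P in \<open>auto simp: abs_le_iff\<close>)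
    moreover have "0 - (1 - v t x) \<le> exp (\<Lambda> * t) * P x"
    proof (rule comp[OF classical_eq_const_minus[OF e1] pos(2) _ _ \<Lambda>(2) _ _ that, where ?K0.0 = "1 + Kv"])
      show "\<bar>0 - (1 - v t x)\<bar> \<le> 1 + Kv" if "0 \<le> t" "x \<in> closure spiral" for t x using bd[OF that] by linarith
      show "- (- (r2 * v t x * (1 - v t x - a2 * u t x))) \<le> K * (\<bar>0 - (1 - v t x)\<bar> + exp (\<Lambda> * t) * P x)" if "0 < t" "x \<in> spiral" for t x
        using Fv[OF that] by (simp add: abs_le_iff abs_minus_commute)
      show "0 - (1 - v0 x) \<le> P x" if "x \<in> closure spiral" for x using init_P(2)[OF that] by linarith
    qed
    ultimately show ?thesis by linarith
  qed
  show ?thesis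
  proof (rule that[of "2 * M0 * exp \<mu>" \<Lambda>])
    fix t x assume tx: "0 \<le> (t::real)" "x \<in> closure spiral"
    have "P x \<le> M0 * exp (- spiral_weight x + \<mu>)" unfolding P_def using B\<mu>(2)[of x] \<open>M0 > 1\<close> by (intro mult_left_mono) auto
    then have "exp (\<Lambda> * t) * P x \<le> exp (\<Lambda> * t) * (M0 * exp (- spiral_weight x + \<mu>))" by (intro mult_left_mono) auto
    also have "\<dots> = M0 * exp \<mu> * exp (\<Lambda> * t - spiral_weight x)" by (simp add: exp_add exp_diff exp_minus field_simps)
    finally show "\<bar>u t x\<bar> + \<bar>1 - v t x\<bar> \<le> 2 * M0 * exp \<mu> * exp (\<Lambda> * t - spiral_weight x)"
      using u[OF tx] v[OF tx] by simp
  qed (use \<Lambda> \<open>M0 > 1\<close> in auto)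
qed

lemma dev_sup_tendsto_zero:
  assumes bd: "\<And>t x. 0 \<le> t \<Longrightarrow> x \<in> closure spiral \<Longrightarrow> \<bar>u t x\<bar> + \<bar>1 - v t x\<bar> \<le> M * exp (\<Lambda> * t - spiral_weight x)"
    and "\<Lambda> > 0" "M > 0" "c > 0" "norm e = 1"
  shows "((\<lambda>t. dev_sup spiral u v e z A c t) \<longlongrightarrow> 0) at_top"
proof -
  define a where "a = \<bar>A\<bar> + norm z"
  define D where "D = a + pi + 3"
  have a: "a \<ge> 0" by (simp add: a_def)
  have D: "D > 0" using pi_ge_two a by (simp add: D_def)
  define t0 where "t0 = max (2 * D / c) (8 * (\<Lambda> + 1) / c\<^sup>2)"
  have up: "dev_sup spiral u v e z A c t \<le> ereal (M * exp (- t))" if t: "t0 \<le> t" for t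
    unfolding dev_sup_def
  proof (rule Sup_least, safe)
    show "0 \<le> ereal (M * exp (- t))" using assms by simp
    fix s x assume s: "c * t \<le> s" and x: "x \<in> cball (z + s *\<^sub>R e) A" "x \<in> closure spiral"
    have g: "spiral_fun x \<le> 0" using x(2) closure_spiral_subset by auto
    have ct: "2 * D \<le> c * t" using t \<open>c > 0\<close> by (simp add: t0_def field_simps)
    then have ct0: "0 < c * t" using D by linarith
    then have t0: "0 < t" using \<open>c > 0\<close> by (simp add: zero_less_mult_iff)
    have s0: "s = norm (s *\<^sub>R e)" using s ct0 assms(5) by simp
    have "norm (s *\<^sub>R e) \<le> norm x + norm (z + s *\<^sub>R e - x) + norm z"
      using norm_triangle_ineq4[of "x + (z + s *\<^sub>R e - x)" z] norm_triangle_ineq[of x "z + s *\<^sub>R e - x"] by simp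
    moreover have "norm (z + s *\<^sub>R e - x) \<le> \<bar>A\<bar>" using x(1) by (simp add: dist_norm)
    ultimately have nx: "c * t - a \<le> norm x" using s s0 unfolding a_def by linarith
    then have nx2: "pi + 3 \<le> norm x" using ct a pi_ge_two unfolding D_def by simp
    have "c * t / 2 \<le> norm x - pi - 2" using nx ct a pi_ge_two unfolding D_def by simp
    then have "(c * t / 2)\<^sup>2 \<le> (norm x - pi - 2)\<^sup>2" using ct0 by (intro power_mono) auto
    moreover have "2 * ((\<Lambda> + 1) * t) \<le> (c * t / 2)\<^sup>2"
    proof -
      have "8 * (\<Lambda> + 1) \<le> t * c\<^sup>2" using t \<open>c > 0\<close> by (simp add: t0_def field_simps)
      then have "8 * (\<Lambda> + 1) * t \<le> t * c\<^sup>2 * t" using t0 by (intro mult_right_mono) auto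
      then show ?thesis by (simp add: power2_eq_square field_simps)
    qed
    ultimately have "(\<Lambda> + 1) * t \<le> spiral_weight x" using spiral_weight_ge[OF g nx2] by linarith
    then have "\<Lambda> * t - spiral_weight x \<le> - t" by (simp add: algebra_simps)
    then have "M * exp (\<Lambda> * t - spiral_weight x) \<le> M * exp (- t)" using \<open>M > 0\<close> by simp
    then show "ereal (\<bar>u t x\<bar> + \<bar>1 - v t x\<bar>) \<le> ereal (M * exp (- t))"
      using bd[of t x] t0 x(2) by simp
  qed
  have "((\<lambda>t. M * exp (- t)) \<longlongrightarrow> M * 0) at_top"
    by (intro tendsto_mult tendsto_const filterlim_compose[OF exp_at_bot] filterlim_uminus_at_bot_at_top)
  then have lim: "((\<lambda>t. ereal (M * exp (- t))) \<longlongrightarrow> 0) at_top" using tendsto_ereal by (fastforce simp: zero_ereal_def)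
  show ?thesis
  proof (rule tendsto_sandwich[OF _ _ tendsto_const lim])
    show "\<forall>\<^sub>F t in at_top. 0 \<le> dev_sup spiral u v e z A c t"
      unfolding dev_sup_def by (intro always_eventually allI Sup_upper) simp
    show "\<forall>\<^sub>F t in at_top. dev_sup spiral u v e z A c t \<le> ereal (M * exp (- t))"
      using eventually_ge_at_top[of t0] by eventually_elim (rule up)
  qed
qed

lemma Inf_ereal_positive: "(\<And>c. c > 0 \<Longrightarrow> Q c) \<Longrightarrow> Inf {ereal c | c. c > 0 \<and> Q c} = 0"
proof (rule antisym)
  assume Q: "\<And>c. c > 0 \<Longrightarrow> Q c"
  show "Inf {ereal c | c. c > 0 \<and> Q c} \<le> 0"
  proof (rule ereal_le_epsilon2[rule_format, where y = 0, simplified] )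
    fix e :: real assume "0 < e"
    then show "Inf {ereal c |c. 0 < c \<and> Q c} \<le> ereal e" using Q by (intro Inf_lower) auto
  qed
  show "0 \<le> Inf {ereal c | c. c > 0 \<and> Q c}" by (rule Inf_greatest) auto
qed

lemma spiral_speeds_zero:
  assumes pos: "0 < d1" "0 < d2" "0 < r1" "0 < r2" "0 < a1" "0 < a2"
    and init: "(u0, v0) \<in> Theta spiral" and sol: "LV_solution spiral d1 d2 r1 r2 a1 a2 u0 v0 u v"
    and e: "norm e = 1"
  shows "w_star_z spiral u v e z = 0" "w_star spiral u v e = 0"
proof -
  obtain M \<Lambda> where M: "\<And>t x. 0 \<le> t \<Longrightarrow> x \<in> closure spiral \<Longrightarrow> \<bar>u t x\<bar> + \<bar>1 - v t x\<bar> \<le> M * exp (\<Lambda> * t - spiral_weight x)"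
    "\<Lambda> > 0" "M > 0" by (rule LV_solution_decay[OF pos init sol], rule that)
  note lim = dev_sup_tendsto_zero[OF M(1) M(2,3) _ e]
  show "w_star_z spiral u v e z = 0" unfolding w_star_z_def
    by (rule Inf_ereal_positive) (use lim in \<open>auto intro!: exI[of _ 1]\<close>)
  show "w_star spiral u v e = 0" unfolding w_star_def
    by (rule Inf_ereal_positive) (use lim in auto)
qed

section \<open>Mollification\<close>

definition bump_s :: "real \<Rightarrow> real" where "bump_s x = 1 / (1 - x\<^sup>2)"

text \<open>The functions q exp(-1/(1-x^2)), with q a polynomial in x and 1/(1-x^2), are closed under differentiation.\<close>
inductive_set bump_coeffs :: "(real \<Rightarrow> real) set" where
  "(\<lambda>_. c) \<in> bump_coeffs"
| "(\<lambda>x. x) \<in> bump_coeffs"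
| "bump_s \<in> bump_coeffs"
| "f \<in> bump_coeffs \<Longrightarrow> g \<in> bump_coeffs \<Longrightarrow> (\<lambda>x. f x + g x) \<in> bump_coeffs"
| "f \<in> bump_coeffs \<Longrightarrow> g \<in> bump_coeffs \<Longrightarrow> (\<lambda>x. f x * g x) \<in> bump_coeffs"

definition bump_of :: "(real \<Rightarrow> real) \<Rightarrow> real \<Rightarrow> real" where
  "bump_of q x = (if \<bar>x\<bar> < 1 then q x * exp (- bump_s x) else 0)"

lemma bump_s_ge1: "\<bar>x\<bar> < 1 \<Longrightarrow> 1 \<le> bump_s x"
proof -
  assume "\<bar>x\<bar> < 1"
  then have "x\<^sup>2 < 1" by (simp add: abs_square_less_1)
  then show ?thesis by (simp add: bump_s_def le_divide_eq)
qed

lemma DERIV_bump_s: "\<bar>x\<bar> < 1 \<Longrightarrow> DERIV bump_s x :> 2 * x * (bump_s x * bump_s x)"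
proof -
  assume "\<bar>x\<bar> < 1"
  then have "x\<^sup>2 < 1" by (simp add: abs_square_less_1)
  then have nz: "1 - x\<^sup>2 \<noteq> 0" by simp
  show ?thesis unfolding bump_s_def[abs_def] using nz by (auto intro!: derivative_eq_intros)
qed

lemma bump_coeffs_derivative:
  assumes "q \<in> bump_coeffs"
  shows "\<exists>r\<in>bump_coeffs. \<forall>x. \<bar>x\<bar> < 1 \<longrightarrow> DERIV q x :> r x"
  using assms
proof induction
  case (1 c)
  show ?case by (rule bexI[of _ "\<lambda>_. 0"]) (auto intro: bump_coeffs.intros)
next
  case 2
  show ?case by (rule bexI[of _ "\<lambda>_. 1"]) (auto intro: bump_coeffs.intros)
next
  case 3
  show ?case by (rule bexI[of _ "\<lambda>x. 2 * x * (bump_s x * bump_s x)"]) (auto intro!: bump_coeffs.intros DERIV_bump_s)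
next
  case (4 f g)
  then obtain r r' where r: "r \<in> bump_coeffs" "r' \<in> bump_coeffs" "\<And>x. \<bar>x\<bar> < 1 \<Longrightarrow> DERIV f x :> r x" "\<And>x. \<bar>x\<bar> < 1 \<Longrightarrow> DERIV g x :> r' x"
    by auto
  show ?case by (rule bexI[of _ "\<lambda>x. r x + r' x"]) (auto intro!: DERIV_add r bump_coeffs.intros)
next
  case (5 f g)
  then obtain r r' where r: "r \<in> bump_coeffs" "r' \<in> bump_coeffs" "\<And>x. \<bar>x\<bar> < 1 \<Longrightarrow> DERIV f x :> r x" "\<And>x. \<bar>x\<bar> < 1 \<Longrightarrow> DERIV g x :> r' x"
    by auto
  show ?case by (rule bexI[of _ "\<lambda>x. r x * g x + r' x * f x"]) (auto intro!: DERIV_mult r bump_coeffs.intros 5)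
qed

lemma bump_coeffs_bound:
  assumes "q \<in> bump_coeffs"
  shows "\<exists>C\<ge>0. \<exists>m. \<forall>x. \<bar>x\<bar> < 1 \<longrightarrow> \<bar>q x\<bar> \<le> C * bump_s x ^ m"
  using assms
proof induction
  case (1 c)
  show ?case by (intro exI[of _ "\<bar>c\<bar>"] exI[of _ 0] conjI) auto
next
  case 2
  show ?case by (intro exI[of _ 1] exI[of _ 0] conjI) auto
next
  case 3
  show ?case using bump_s_ge1 by (intro exI[of _ 1] exI[of _ 1] conjI) force+
next
  case (4 f g)
  then obtain C m C' m' where h: "0 \<le> C" "0 \<le> C'" "\<And>x. \<bar>x\<bar> < 1 \<Longrightarrow> \<bar>f x\<bar> \<le> C * bump_s x ^ m" "\<And>x. \<bar>x\<bar> < 1 \<Longrightarrow> \<bar>g x\<bar> \<le> C' * bump_s x ^ m'"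
    by auto
  have "\<bar>f x + g x\<bar> \<le> (C + C') * bump_s x ^ (m + m')" if x: "\<bar>x\<bar> < 1" for x
  proof -
    have "C * bump_s x ^ m \<le> C * bump_s x ^ (m + m')" "C' * bump_s x ^ m' \<le> C' * bump_s x ^ (m + m')"
      using bump_s_ge1[OF x] h(1,2) by (auto intro!: mult_left_mono power_increasing)
    then show ?thesis using h(3,4)[OF x] abs_triangle_ineq[of "f x" "g x"] by (simp add: distrib_right)
  qed
  then show ?case using h(1,2) by (intro exI[of _ "C + C'"] exI[of _ "m + m'"] conjI) auto
next
  case (5 f g)
  then obtain C m C' m' where h: "0 \<le> C" "0 \<le> C'" "\<And>x. \<bar>x\<bar> < 1 \<Longrightarrow> \<bar>f x\<bar> \<le> C * bump_s x ^ m" "\<And>x. \<bar>x\<bar> < 1 \<Longrightarrow> \<bar>g x\<bar> \<le> C' * bump_s x ^ m'"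
    by auto
  have "\<bar>f x * g x\<bar> \<le> (C * C') * bump_s x ^ (m + m')" if x: "\<bar>x\<bar> < 1" for x
    using mult_mono[OF h(3)[OF x] h(4)[OF x]] h(1) bump_s_ge1[OF x] by (simp add: abs_mult power_add ac_simps)
  then show ?case using h(1,2) by (intro exI[of _ "C * C'"] exI[of _ "m + m'"] conjI) auto
qed

lemma bump_of_quadratic:
  assumes "q \<in> bump_coeffs"
  obtains c where "c \<ge> 0" "\<And>x. \<bar>bump_of q x\<bar> \<le> c * (x - 1)\<^sup>2" "\<And>x. \<bar>bump_of q x\<bar> \<le> c * (x + 1)\<^sup>2"
proof -
  obtain C m where C: "C \<ge> 0" "\<And>x. \<bar>x\<bar> < 1 \<Longrightarrow> \<bar>q x\<bar> \<le> C * bump_s x ^ m"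
    using bump_coeffs_bound[OF assms] by auto
  define k where "k = real (m + 2) ^ (m + 2)"
  have k: "k > 0" by (simp add: k_def)
  have main: "\<bar>bump_of q x\<bar> \<le> C * k * (1 - x\<^sup>2)\<^sup>2" for x
  proof (cases "\<bar>x\<bar> < 1")
    case True
    define s where "s = bump_s x"
    have s: "1 \<le> s" using bump_s_ge1[OF True] by (simp add: s_def)
    have "(s / real (m + 2)) ^ (m + 2) \<le> (1 + s / real (m + 2)) ^ (m + 2)" using s by (intro power_mono) auto
    also have "\<dots> \<le> exp s" using s by (intro exp_ge_one_plus_x_over_n_power_n) auto
    finally have "s ^ (m + 2) / k \<le> exp s" by (simp only: power_divide k_def)
    then have "s ^ m * s\<^sup>2 \<le> k * exp s" using k by (simp only: pos_divide_le_eq power_add mult.commute)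
    then have "s ^ m * exp (- s) \<le> k * (1 / s\<^sup>2)" using s by (simp add: exp_minus field_simps)
    also have "1 / s\<^sup>2 = (1 - x\<^sup>2)\<^sup>2" by (simp add: s_def bump_s_def power_divide)
    finally have 1: "s ^ m * exp (- s) \<le> k * (1 - x\<^sup>2)\<^sup>2" .
    have "\<bar>bump_of q x\<bar> = \<bar>q x\<bar> * exp (- s)" using True by (simp add: bump_of_def abs_mult s_def)
    also have "\<dots> \<le> C * s ^ m * exp (- s)" using C(2)[OF True] by (intro mult_right_mono) (auto simp: s_def)
    also have "\<dots> \<le> C * (k * (1 - x\<^sup>2)\<^sup>2)" using mult_left_mono[OF 1 C(1)] by (simp add: mult.assoc)
    finally show ?thesis by (simp add: mult.assoc)
  qed (use C(1) k in \<open>auto simp: bump_of_def\<close>)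
  have sq: "(1 - x\<^sup>2)\<^sup>2 \<le> 4 * (x - 1)\<^sup>2" "(1 - x\<^sup>2)\<^sup>2 \<le> 4 * (x + 1)\<^sup>2" if "\<bar>x\<bar> < 1" for x :: real
  proof -
    have e: "(1 - x\<^sup>2)\<^sup>2 = (x + 1)\<^sup>2 * (x - 1)\<^sup>2" by algebra
    have "(x + 1)\<^sup>2 \<le> 2\<^sup>2" "(1 - x)\<^sup>2 \<le> 2\<^sup>2" using that by (intro power_mono; simp add: abs_if split: if_splits)+
    then have "(x + 1)\<^sup>2 \<le> 4" "(x - 1)\<^sup>2 \<le> 4" by (simp_all add: power2_commute)
    then show "(1 - x\<^sup>2)\<^sup>2 \<le> 4 * (x - 1)\<^sup>2" "(1 - x\<^sup>2)\<^sup>2 \<le> 4 * (x + 1)\<^sup>2"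
      unfolding e using mult_right_mono[of "(x + 1)\<^sup>2" 4 "(x - 1)\<^sup>2"] mult_right_mono[of "(x - 1)\<^sup>2" 4 "(x + 1)\<^sup>2"]
      by (simp_all add: mult.commute)
  qed
  have "\<bar>bump_of q x\<bar> \<le> C * k * 4 * y" if y: "(1 - x\<^sup>2)\<^sup>2 \<le> 4 * y \<or> \<not> \<bar>x\<bar> < 1" "0 \<le> y" for x y
  proof (cases "\<bar>x\<bar> < 1")
    case True
    then have "C * k * (1 - x\<^sup>2)\<^sup>2 \<le> C * k * (4 * y)" using y C(1) k by (intro mult_left_mono) auto
    then show ?thesis using main[of x] by simp
  qed (use C(1) k y in \<open>auto simp: bump_of_def\<close>)
  then have "\<bar>bump_of q x\<bar> \<le> C * k * 4 * (x - 1)\<^sup>2" "\<bar>bump_of q x\<bar> \<le> C * k * 4 * (x + 1)\<^sup>2" for x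
    using sq[of x] by (metis zero_le_power2)+
  then show ?thesis using C(1) k by (intro that[of "C * k * 4"]) auto
qed

lemma DERIV_zero_at_quadratic':
  fixes f :: "real \<Rightarrow> real"
  assumes "\<And>s. \<bar>f s\<bar> \<le> c * (s - a)\<^sup>2"
  shows "DERIV f a :> 0"
proof -
  have "DERIV (\<lambda>s. f (s + a)) 0 :> 0"
    by (rule DERIV_zero_at_quadratic[where c = c]) (use assms[of "_ + a"] in auto)
  then show ?thesis using DERIV_shift[of f 0 0 a] by simp
qed

lemma bump_of_derivative:
  assumes "q \<in> bump_coeffs"
  shows "\<exists>r\<in>bump_coeffs. \<forall>x. DERIV (bump_of q) x :> bump_of r x"
proof -
  obtain q' where q': "q' \<in> bump_coeffs" "\<And>x. \<bar>x\<bar> < 1 \<Longrightarrow> DERIV q x :> q' x"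
    using bump_coeffs_derivative[OF assms] by auto
  obtain c where c: "c \<ge> 0" "\<And>x. \<bar>bump_of q x\<bar> \<le> c * (x - 1)\<^sup>2" "\<And>x. \<bar>bump_of q x\<bar> \<le> c * (x + 1)\<^sup>2"
    by (rule bump_of_quadratic[OF assms], rule that)
  define r where "r x = q' x + q x * ((-1) * (2 * x * (bump_s x * bump_s x)))" for x
  have r: "r \<in> bump_coeffs" unfolding r_def[abs_def] by (intro bump_coeffs.intros q' assms)
  have "DERIV (bump_of q) x :> bump_of r x" for x
  proof -
    consider "\<bar>x\<bar> < 1" | "x = 1" | "x = -1" | "\<bar>x\<bar> > 1" by linarith
    then show ?thesis
    proof cases
      case 1
      have "DERIV (\<lambda>x. q x * exp (- bump_s x)) x :> bump_of r x"
        using 1 by (auto intro!: derivative_eq_intros q' DERIV_bump_s simp: bump_of_def r_def algebra_simps)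
      then show ?thesis
        by (rule DERIV_cong_ev[THEN iffD1, OF refl _ refl, rotated])
           (use 1 eventually_nhds_in_open[of "{-1<..<1::real}" x] in \<open>auto elim!: eventually_mono simp: bump_of_def abs_less_iff\<close>)
    next
      case 2
      have "DERIV (bump_of q) 1 :> 0" by (rule DERIV_zero_at_quadratic'[OF c(2)])
      then show ?thesis using 2 by (simp add: bump_of_def)
    next
      case 3
      have "DERIV (bump_of q) (-1) :> 0" by (rule DERIV_zero_at_quadratic'[where c = c]) (use c(3) in simp)
      then show ?thesis using 3 by (simp add: bump_of_def)
    next
      case 4
      have op: "open {x::real. 1 < \<bar>x\<bar>}" by (intro open_Collect_less continuous_intros)
      have "DERIV (\<lambda>x. 0::real) x :> 0" by simp
      then have "DERIV (bump_of q) x :> 0"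
        by (rule DERIV_cong_ev[THEN iffD1, OF refl _ refl, rotated])
           (use 4 eventually_nhds_in_open[OF op, of x] in \<open>auto elim!: eventually_mono simp: bump_of_def\<close>)
      then show ?thesis using 4 by (simp add: bump_of_def)
    qed
  qed
  then show ?thesis using r by blast
qed

lemma bump_sequence:
  obtains B :: "nat \<Rightarrow> real \<Rightarrow> real" where "\<And>n x. DERIV (B n) x :> B (Suc n) x"
    "\<And>n x. 1 \<le> \<bar>x\<bar> \<Longrightarrow> B n x = 0" "\<And>x. 0 \<le> B 0 x" "0 < B 0 0"
proof -
  have "\<exists>f. \<forall>n. (f n \<in> bump_coeffs \<and> (n = 0 \<longrightarrow> f n = (\<lambda>_. 1))) \<and> (\<forall>x. DERIV (bump_of (f n)) x :> bump_of (f (Suc n)) x)"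
  proof (rule dependent_nat_choice)
    show "\<exists>x. x \<in> bump_coeffs \<and> (0 = (0::nat) \<longrightarrow> x = (\<lambda>_. 1))" by (auto intro: bump_coeffs.intros)
    show "\<exists>y. (y \<in> bump_coeffs \<and> (Suc n = 0 \<longrightarrow> y = (\<lambda>_. 1))) \<and> (\<forall>xa. DERIV (bump_of x) xa :> bump_of y xa)"
      if "x \<in> bump_coeffs \<and> (n = 0 \<longrightarrow> x = (\<lambda>_. 1))" for x n
      using bump_of_derivative[of x] that by auto
  qed
  then obtain f where f: "\<And>n. f n \<in> bump_coeffs" "f 0 = (\<lambda>_. 1)" "\<And>n x. DERIV (bump_of (f n)) x :> bump_of (f (Suc n)) x"
    by blast
  show ?thesis by (rule that[of "\<lambda>n. bump_of (f n)", OF f(3)]) (auto simp: f(2) bump_of_def)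
qed

lemma smooth_kernel:
  obtains k :: "pt \<Rightarrow> real" and D where "smooth_family k D" "\<And>x. 2 \<le> norm x \<Longrightarrow> k x = 0" "\<And>x. 0 \<le> k x" "0 < k 0"
proof -
  obtain B :: "nat \<Rightarrow> real \<Rightarrow> real" where B: "\<And>n x. DERIV (B n) x :> B (Suc n) x"
    "\<And>n x. 1 \<le> \<bar>x\<bar> \<Longrightarrow> B n x = 0" "\<And>x. 0 \<le> B 0 x" "0 < B 0 0"
    by (rule bump_sequence, rule that)
  define D :: "2 list \<Rightarrow> pt \<Rightarrow> real" where "D l x = B (count_list l 1) (x$1) * B (count_list l 2) (x$2)" for l x
  have Bd: "((\<lambda>x::pt. B n (x$i)) has_derivative (\<lambda>h. h$i * B (Suc n) (x$i))) (at x)" for n i x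
    using has_derivative_compose[OF vec_nth_has_derivative[of i x UNIV] B(1)[unfolded has_field_derivative_def]]
    by (simp add: mult.commute)
  have d: "(D l has_derivative (\<lambda>h. \<Sum>i\<in>UNIV. h $ i * D (i # l) x)) (at x)" for l x
    unfolding D_def[abs_def]
    by (rule has_derivative_eq_rhs[OF has_derivative_mult[OF Bd Bd]]) (auto simp: UNIV_2 algebra_simps)
  show ?thesis
  proof (rule that[of "D []" D])
    show "smooth_family (D []) D" using d by (simp add: smooth_family_def)
    show "D [] x = 0" if "2 \<le> norm x" for x
    proof -
      have "1 \<le> \<bar>x$1\<bar> \<or> 1 \<le> \<bar>x$2\<bar>" using that norm_le_l1_cart[of x] by (auto simp: UNIV_2)
      then show ?thesis using B(2) by (auto simp: D_def)
    qed
  qed (use B in \<open>auto simp: D_def\<close>)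
qed

lemma smooth_family_scale:
  assumes "smooth_family k D"
  shows "smooth_family (\<lambda>x. k (a *\<^sub>R x)) (\<lambda>l x. a ^ length l * D l (a *\<^sub>R x))"
proof -
  have "((\<lambda>x. a ^ length l * D l (a *\<^sub>R x)) has_derivative (\<lambda>h. \<Sum>i\<in>UNIV. h $ i * (a ^ length (i # l) * D (i # l) (a *\<^sub>R x)))) (at x)" for l x
  proof -
    have "((\<lambda>x. a *\<^sub>R x) has_derivative (\<lambda>h. a *\<^sub>R h)) (at x)" by (auto intro!: derivative_eq_intros)
    moreover have "(D l has_derivative (\<lambda>h. \<Sum>i\<in>UNIV. h $ i * D (i # l) (a *\<^sub>R x))) (at (a *\<^sub>R x))"
      using assms by (simp add: smooth_family_def)
    ultimately have "((\<lambda>x. D l (a *\<^sub>R x)) has_derivative (\<lambda>h. \<Sum>i\<in>UNIV. (a *\<^sub>R h) $ i * D (i # l) (a *\<^sub>R x))) (at x)"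
      by (rule has_derivative_compose)
    from has_derivative_mult_right[OF this, of "a ^ length l"] show ?thesis
      by (rule has_derivative_eq_rhs) (simp add: sum_distrib_left ac_simps)
  qed
  then show ?thesis using assms by (simp add: smooth_family_def)
qed

lemma smooth_family_continuous: "smooth_family k D \<Longrightarrow> continuous_on A (D l)"
  unfolding smooth_family_def by (meson continuous_at_imp_continuous_on has_derivative_continuous)

lemma convolution_has_derivative:
  fixes \<psi> \<kappa> :: "pt \<Rightarrow> real"
  assumes \<psi>: "continuous_on UNIV \<psi>" and \<kappa>: "\<And>x. (\<kappa> has_derivative (\<lambda>h. \<Sum>i\<in>UNIV. h $ i * \<kappa>' i x)) (at x)"
    and c: "\<And>i. continuous_on UNIV (\<kappa>' i)"
  shows "((\<lambda>x. integral (cbox a b) (\<lambda>y. \<psi> y * \<kappa> (x - y))) has_derivative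
     (\<lambda>h. \<Sum>i\<in>UNIV. h $ i * integral (cbox a b) (\<lambda>y. \<psi> y * \<kappa>' i (x - y)))) (at x)"
proof -
  define P where "P i = Blinfun (\<lambda>h::pt. h $ i)" for i
  have P: "blinfun_apply (P i) h = h $ i" for i h
    unfolding P_def by (simp add: bounded_linear_Blinfun_apply bounded_linear_vec_nth)
  define fx where "fx x t = (\<Sum>i\<in>UNIV. (\<psi> t * \<kappa>' i (x - t)) *\<^sub>R P i)" for x t
  have fx: "blinfun_apply (fx x t) h = (\<Sum>i\<in>UNIV. \<psi> t * \<kappa>' i (x - t) * h $ i)" for x t h
    by (simp add: fx_def blinfun.sum_left blinfun.scaleR_left P)
  have c\<kappa>: "continuous_on UNIV \<kappa>"
    using \<kappa> by (meson continuous_at_imp_continuous_on has_derivative_continuous)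
  have "((\<lambda>x. integral (cbox a b) (\<lambda>y. \<psi> y * \<kappa> (x - y))) has_derivative blinfun_apply (integral (cbox a b) (fx x))) (at x within UNIV)"
  proof (rule leibniz_rule[where fx = fx])
    show "((\<lambda>x. \<psi> t * \<kappa> (x - t)) has_derivative blinfun_apply (fx x t)) (at x within UNIV)" for x t
    proof -
      have "((\<lambda>x. x - t) has_derivative (\<lambda>h. h)) (at x)" by (auto intro!: derivative_eq_intros)
      from has_derivative_mult_right[OF has_derivative_compose[OF this \<kappa>], of "\<psi> t"] show ?thesis
        by (rule has_derivative_eq_rhs) (auto simp: fx fun_eq_iff sum_distrib_left ac_simps)
    qed
    show "(\<lambda>t. \<psi> t * \<kappa> (x - t)) integrable_on cbox a b" for x
      by (intro integrable_continuous continuous_intros continuous_on_subset[OF \<psi>] continuous_on_compose2[OF c\<kappa>]) auto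
    show "continuous_on (UNIV \<times> cbox a b) (\<lambda>(x, t). fx x t)"
      unfolding fx_def case_prod_beta
      by (intro continuous_intros continuous_on_compose2[OF \<psi>] continuous_on_compose2[OF c]) auto
  qed auto
  then show ?thesis
  proof (rule has_derivative_eq_rhs)
    have int: "fx x integrable_on cbox a b" unfolding fx_def
      by (intro integrable_continuous continuous_intros continuous_on_subset[OF \<psi>] continuous_on_compose2[OF c]) auto
    show "blinfun_apply (integral (cbox a b) (fx x)) = (\<lambda>h. \<Sum>i\<in>UNIV. h $ i * integral (cbox a b) (\<lambda>y. \<psi> y * \<kappa>' i (x - y)))"
    proof
      fix h
      have "blinfun_apply (integral (cbox a b) (fx x)) h = integral (cbox a b) (\<lambda>t. \<Sum>i\<in>UNIV. \<psi> t * \<kappa>' i (x - t) * h $ i)"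
        unfolding blinfun_apply_integral[OF int] fx ..
      also have "\<dots> = (\<Sum>i\<in>UNIV. integral (cbox a b) (\<lambda>t. \<psi> t * \<kappa>' i (x - t) * h $ i))"
        by (intro integral_sum integrable_continuous continuous_intros continuous_on_subset[OF \<psi>] continuous_on_compose2[OF c]) auto
      finally show "blinfun_apply (integral (cbox a b) (fx x)) h = (\<Sum>i\<in>UNIV. h $ i * integral (cbox a b) (\<lambda>y. \<psi> y * \<kappa>' i (x - y)))"
        by (simp add: mult.commute)
    qed
  qed
qed

lemma convolution_commute:
  fixes \<psi> \<kappa> :: "pt \<Rightarrow> real"
  assumes c: "continuous_on UNIV \<psi>" "continuous_on UNIV \<kappa>"
    and \<psi>: "\<And>y. y \<notin> cbox a b \<Longrightarrow> \<psi> y = 0" and \<kappa>: "\<And>y. y \<notin> cbox a' b' \<Longrightarrow> \<kappa> y = 0"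
  shows "integral (cbox a b) (\<lambda>y. \<psi> y * \<kappa> (x - y)) = integral (cbox a' b') (\<lambda>y. \<kappa> y * \<psi> (x - y))"
proof -
  have i1: "((\<lambda>y. \<psi> y * \<kappa> (x - y)) has_integral integral (cbox a b) (\<lambda>y. \<psi> y * \<kappa> (x - y))) (cbox a b)"
    by (intro integrable_integral integrable_continuous continuous_intros continuous_on_subset[OF c(1)] continuous_on_compose2[OF c(2)]) auto
  from has_integral_affinity[OF i1, of "-1" x]
  have "((\<lambda>y. \<psi> (x - y) * \<kappa> y) has_integral integral (cbox a b) (\<lambda>y. \<psi> y * \<kappa> (x - y))) ((\<lambda>y. x - y) ` cbox a b)"
    by (simp add: algebra_simps)
  then have "((\<lambda>y. \<psi> (x - y) * \<kappa> y) has_integral integral (cbox a b) (\<lambda>y. \<psi> y * \<kappa> (x - y))) UNIV"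
  proof (rule has_integral_on_superset)
    fix y assume "y \<notin> (\<lambda>y. x - y) ` cbox a b"
    then have "x - y \<notin> cbox a b" by (metis diff_diff_eq2 add_diff_cancel_left' image_eqI)
    then show "\<psi> (x - y) * \<kappa> y = 0" using \<psi> by simp
  qed auto
  moreover have "((\<lambda>y. \<kappa> y * \<psi> (x - y)) has_integral integral (cbox a' b') (\<lambda>y. \<kappa> y * \<psi> (x - y))) UNIV"
  proof (rule has_integral_on_superset)
    show "((\<lambda>y. \<kappa> y * \<psi> (x - y)) has_integral integral (cbox a' b') (\<lambda>y. \<kappa> y * \<psi> (x - y))) (cbox a' b')"
      by (intro integrable_integral integrable_continuous continuous_intros continuous_on_subset[OF c(2)] continuous_on_compose2[OF c(1)]) auto
  qed (use \<kappa> in auto)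
  ultimately show ?thesis by (simp add: mult.commute has_integral_unique)
qed

definition C1c :: "pt set \<Rightarrow> (pt \<Rightarrow> real) \<Rightarrow> (pt \<Rightarrow> pt) \<Rightarrow> bool" where
  "C1c S \<phi> G \<longleftrightarrow> (\<forall>x. (\<phi> has_derivative (\<lambda>h. G x \<bullet> h)) (at x)) \<and> continuous_on UNIV G \<and>
     (\<exists>K. compact K \<and> K \<subseteq> S \<and> (\<forall>x. x \<notin> K \<longrightarrow> \<phi> x = 0))"

lemma gradient_zero_off_closed_support:
  assumes "closed K" "\<And>x. x \<notin> K \<Longrightarrow> \<phi> x = 0" "(\<phi> has_derivative (\<lambda>h. G \<bullet> h)) (at x)" "x \<notin> K"
  shows "G = (0::pt)"
proof -
  have "((\<lambda>_. 0) has_derivative (\<lambda>h. G \<bullet> h)) (at x)"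
    by (rule has_derivative_transform_within_open[OF assms(3), of "- K"]) (use assms in auto)
  from has_derivative_unique[OF this has_derivative_const] have "G \<bullet> G = 0" by (metis)
  then show ?thesis by simp
qed

lemma C1c_support:
  assumes "C1c S \<phi> G"
  obtains K where "compact K" "K \<subseteq> S" "\<And>x. x \<notin> K \<Longrightarrow> \<phi> x = 0" "\<And>x. x \<notin> K \<Longrightarrow> G x = 0"
proof -
  obtain K where K: "compact K" "K \<subseteq> S" "\<And>x. x \<notin> K \<Longrightarrow> \<phi> x = 0" using assms by (auto simp: C1c_def)
  have "G x = 0" if "x \<notin> K" for x
    by (rule gradient_zero_off_closed_support[of K \<phi> _ x]) (use K assms that compact_imp_closed in \<open>auto simp: C1c_def\<close>)
  with K show ?thesis by (rule that)
qed

lemma C1c_continuous: "C1c S \<phi> G \<Longrightarrow> continuous_on A \<phi>" "C1c S \<phi> G \<Longrightarrow> continuous_on A G"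
  unfolding C1c_def by (meson continuous_at_imp_continuous_on has_derivative_continuous,
    meson continuous_on_subset subset_UNIV)

lemma compact_support_bounded:
  fixes f :: "pt \<Rightarrow> real"
  assumes "continuous_on UNIV f" "compact K" "\<And>x. x \<notin> K \<Longrightarrow> f x = 0"
  obtains C where "C \<ge> 0" "\<And>x. \<bar>f x\<bar> \<le> C"
proof -
  have "bounded (f ` K)" using assms compact_continuous_image compact_imp_bounded continuous_on_subset subset_UNIV by metis
  then obtain C where "C > 0" "\<And>x. x \<in> K \<Longrightarrow> \<bar>f x\<bar> \<le> C" unfolding bounded_pos by auto
  then show ?thesis using assms(3) by (intro that[of C]) (auto, metis abs_zero less_imp_le)
qed

lemma mollify:
  assumes \<phi>: "C1c S \<phi> G" and S: "open S"
  obtains \<phi>n Dn K C where "\<And>n. smooth_family (\<phi>n n) (Dn n)" "compact K" "K \<subseteq> S"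
    "\<And>n x. x \<notin> K \<Longrightarrow> \<phi>n n x = 0" "\<And>n i x. x \<notin> K \<Longrightarrow> Dn n [i] x = 0"
    "\<And>n x. \<bar>\<phi>n n x\<bar> \<le> C" "\<And>n i x. \<bar>Dn n [i] x\<bar> \<le> C"
    "\<And>x. (\<lambda>n. \<phi>n n x) \<longlonglongrightarrow> \<phi> x" "\<And>i x. (\<lambda>n. Dn n [i] x) \<longlonglongrightarrow> G x $ i"
proof -
  obtain K0 where K0: "compact K0" "K0 \<subseteq> S" "\<And>x. x \<notin> K0 \<Longrightarrow> \<phi> x = 0" "\<And>x. x \<notin> K0 \<Longrightarrow> G x = 0"
    by (rule C1c_support[OF \<phi>], rule that)
  obtain \<epsilon> where \<epsilon>: "\<epsilon> > 0" "(\<Union>x\<in>K0. cball x \<epsilon>) \<subseteq> S"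
    using compact_subset_open_imp_cball_epsilon_subset[OF K0(1) S K0(2)] .
  define K where "K = (\<Union>x\<in>K0. \<Union>y\<in>cball 0 \<epsilon>. {x + y})"
  have K: "compact K" unfolding K_def by (intro compact_sums' K0(1) compact_cball)
  have KS: "K \<subseteq> S"
  proof
    fix z assume "z \<in> K"
    then obtain x y where "x \<in> K0" "norm y \<le> \<epsilon>" "z = x + y" by (auto simp: K_def)
    then have "z \<in> cball x \<epsilon>" by (simp add: dist_norm)
    then show "z \<in> S" using \<epsilon>(2) \<open>x \<in> K0\<close> by blast
  qed
  obtain k :: "pt \<Rightarrow> real" and D where k: "smooth_family k D" "\<And>x. 2 \<le> norm x \<Longrightarrow> k x = 0" "\<And>x. 0 \<le> k x" "0 < k 0"
    by (rule smooth_kernel, rule that)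
  define a where "a n = 2 * (real n + 1) / min \<epsilon> 1" for n
  have a0: "a n > 0" for n using \<epsilon>(1) by (simp add: a_def)
  have a1: "2 / a n \<le> \<epsilon>" "2 / a n \<le> 1" "2 / a n \<le> 1 / (real n + 1)" for n
  proof -
    have "min \<epsilon> 1 > 0" using \<epsilon>(1) by simp
    then have e: "2 / a n = min \<epsilon> 1 / (real n + 1)" unfolding a_def by (simp add: field_simps)
    have "min \<epsilon> 1 / (real n + 1) \<le> min \<epsilon> 1 / 1" using \<epsilon>(1) by (intro divide_left_mono) auto
    then show "2 / a n \<le> \<epsilon>" "2 / a n \<le> 1" unfolding e by auto
    show "2 / a n \<le> 1 / (real n + 1)" unfolding e by (intro divide_right_mono) auto
  qed
  define kn where "kn n x = k (a n *\<^sub>R x)" for n x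
  define Dk where "Dk n l x = a n ^ length l * D l (a n *\<^sub>R x)" for n l x
  have kn: "smooth_family (kn n) (Dk n)" for n
    using smooth_family_scale[OF k(1), of "a n"] by (simp add: kn_def[abs_def] Dk_def[abs_def])
  have kn0: "kn n x = 0" if "2 / a n \<le> norm x" for n x
    using that a0[of n] by (simp add: kn_def k(2) field_simps)
  have kc: "continuous_on A (kn n)" for A n
    using smooth_family_continuous[OF kn, of A n "[]"] kn[of n] by (simp add: smooth_family_def)
  have kpos: "0 \<le> kn n x" for n x by (simp add: kn_def k(3))
  obtain c1 :: pt where c1: "cball 0 1 \<subseteq> cbox (- c1) c1" using bounded_subset_cbox_symmetric[OF bounded_cball] .
  obtain c2 :: pt where c2: "K0 \<subseteq> cbox (- c2) c2" using bounded_subset_cbox_symmetric[OF compact_imp_bounded[OF K0(1)]] .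
  have k_out: "kn n y = 0" if "y \<notin> cbox (- c1) c1" for n y
  proof -
    have "1 < norm y" using that c1 by (auto simp: subset_iff) (meson not_le)
    then show ?thesis using kn0[of n y] a1(2)[of n] by linarith
  qed
  have k_int: "kn n integrable_on cbox (- c1) c1" for n by (intro integrable_continuous kc)
  define I where "I n = integral (cbox (- c1) c1) (kn n)" for n
  have I: "I n > 0" for n
  proof -
    have "I n \<ge> 0" unfolding I_def by (intro integral_nonneg k_int kpos)
    moreover have "I n \<noteq> 0"
    proof
      assume "I n = 0"
      moreover have "0 \<in> box (- c1) c1"
      proof -
        have "ball 0 1 \<subseteq> interior (cbox (- c1) c1)" by (rule interior_maximal) (use c1 in auto)
        then show ?thesis by (auto simp: interior_cbox)
      qed
      ultimately have "kn n 0 = 0"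
        using integral_cbox_eq_0_iff[OF kc, of "- c1" c1 n] kpos subsetD[OF box_subset_cbox, of 0 "- c1" c1]
        unfolding I_def by blast
      then show False using k(4) by (simp add: kn_def)
    qed
    ultimately show ?thesis by linarith
  qed
  define avg where "avg n \<psi> x = integral (cbox (- c1) c1) (\<lambda>y. kn n y * \<psi> (x - y)) / I n" for n \<psi> and x :: pt
  have ai: "(\<lambda>y. kn n y * \<psi> (x - y)) integrable_on cbox (- c1) c1" if "continuous_on UNIV \<psi>" for n \<psi> x
    by (intro integrable_continuous continuous_intros kc continuous_on_compose2[OF that]) auto
  have avg_const: "integral (cbox (- c1) c1) (\<lambda>y. kn n y * c) = I n * c" for n c by (simp add: I_def)
  have avg_dist: "\<bar>avg n \<psi> x - c\<bar> \<le> e" if \<psi>: "continuous_on UNIV \<psi>" and e: "\<And>y. norm y < 2 / a n \<Longrightarrow> \<bar>\<psi> (x - y) - c\<bar> \<le> e" for n \<psi> x c e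
  proof -
    have i2: "(\<lambda>y. kn n y * c) integrable_on cbox (- c1) c1" for c by (intro integrable_continuous continuous_intros kc)
    have "\<bar>integral (cbox (- c1) c1) (\<lambda>y. kn n y * \<psi> (x - y)) - integral (cbox (- c1) c1) (\<lambda>y. kn n y * c)\<bar>
       = norm (integral (cbox (- c1) c1) (\<lambda>y. kn n y * \<psi> (x - y) - kn n y * c))"
      by (subst integral_diff[OF ai[OF \<psi>] i2]) simp
    also have "\<dots> \<le> integral (cbox (- c1) c1) (\<lambda>y. kn n y * e)"
    proof (rule integral_norm_bound_integral[OF integrable_diff[OF ai[OF \<psi>] i2] i2])
      fix y
      show "norm (kn n y * \<psi> (x - y) - kn n y * c) \<le> kn n y * e"
      proof (cases "norm y < 2 / a n")
        case True
        then show ?thesis using mult_left_mono[OF e[OF True] kpos[of n y]] kpos[of n y]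
          by (simp add: right_diff_distrib[symmetric] abs_mult)
      next
        case False then show ?thesis using kn0[of n y] by simp
      qed
    qed
    finally have "\<bar>integral (cbox (- c1) c1) (\<lambda>y. kn n y * \<psi> (x - y)) - I n * c\<bar> \<le> I n * e" by (simp only: avg_const)
    then have "\<bar>I n * (avg n \<psi> x - c)\<bar> \<le> I n * e" using I[of n] by (simp add: avg_def right_diff_distrib)
    then show ?thesis using I[of n] by (simp add: abs_mult)
  qed
  have avg_lim: "(\<lambda>n. avg n \<psi> x) \<longlonglongrightarrow> \<psi> x" if \<psi>: "continuous_on UNIV \<psi>" for \<psi> x
  proof (rule LIMSEQ_I)
    fix r :: real assume "r > 0"
    then obtain d where d: "d > 0" "\<And>y. dist y x < d \<Longrightarrow> dist (\<psi> y) (\<psi> x) < r / 2"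
      using \<psi> unfolding continuous_on_iff by (metis half_gt_zero UNIV_I)
    obtain N :: nat where N: "1 / (real N + 1) < d"
      using reals_Archimedean[OF d(1)] by (auto simp: inverse_eq_divide add.commute)
    have "norm (avg n \<psi> x - \<psi> x) < r" if "n \<ge> N" for n
    proof -
      have "1 / (real n + 1) \<le> 1 / (real N + 1)" using that by (intro divide_left_mono) auto
      then have "2 / a n < d" using a1(3)[of n] N by linarith
      then have "\<bar>avg n \<psi> x - \<psi> x\<bar> \<le> r / 2"
        using d(2) by (intro avg_dist[OF \<psi>]) (force simp: dist_norm less_imp_le)
      then show ?thesis using \<open>r > 0\<close> by simp
    qed
    then show "\<exists>N. \<forall>n\<ge>N. norm (avg n \<psi> x - \<psi> x) < r" by blast
  qed
  have avg_supp: "avg n \<psi> x = 0" if "continuous_on UNIV \<psi>" "\<And>y. y \<notin> K0 \<Longrightarrow> \<psi> y = 0" "x \<notin> K" for n \<psi> x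
  proof -
    have "\<bar>avg n \<psi> x - 0\<bar> \<le> 0"
    proof (rule avg_dist[OF that(1)])
      fix y :: pt assume y: "norm y < 2 / a n"
      have "x - y \<notin> K0"
      proof
        assume "x - y \<in> K0"
        moreover have "y \<in> cball 0 \<epsilon>" using y a1(1)[of n] by simp
        ultimately have "(x - y) + y \<in> K" unfolding K_def by blast
        then show False using that(3) by simp
      qed
      then show "\<bar>\<psi> (x - y) - 0\<bar> \<le> 0" using that(2) by simp
    qed
    then show ?thesis by simp
  qed
  have \<phi>c: "continuous_on UNIV \<phi>" and Gc: "continuous_on UNIV G" using C1c_continuous[OF \<phi>] .
  have Gic: "continuous_on UNIV (\<lambda>x. G x $ i)" for i by (intro continuous_intros Gc)
  define Dn where "Dn n l x = integral (cbox (- c2) c2) (\<lambda>y. \<phi> y * Dk n l (x - y)) / I n" for n l x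
  have Dn_der: "(Dn n l has_derivative (\<lambda>h. \<Sum>i\<in>UNIV. h $ i * Dn n (i # l) x)) (at x)" for n l x
  proof -
    have "((\<lambda>x. integral (cbox (- c2) c2) (\<lambda>y. \<phi> y * Dk n l (x - y))) has_derivative
     (\<lambda>h. \<Sum>i\<in>UNIV. h $ i * integral (cbox (- c2) c2) (\<lambda>y. \<phi> y * Dk n (i # l) (x - y)))) (at x)"
      by (rule convolution_has_derivative[OF \<phi>c])
         (use kn[of n] smooth_family_continuous[OF kn] in \<open>auto simp: smooth_family_def\<close>)
    from has_derivative_mult_right[OF this, of "1 / I n"]
    have "((\<lambda>x. 1 / I n * integral (cbox (- c2) c2) (\<lambda>y. \<phi> y * Dk n l (x - y))) has_derivative
       (\<lambda>h. \<Sum>i\<in>UNIV. h $ i * Dn n (i # l) x)) (at x)"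
      by (rule has_derivative_eq_rhs) (auto simp: Dn_def sum_divide_distrib)
    then show ?thesis by (simp add: Dn_def[abs_def])
  qed
  have Dn0: "Dn n [] = avg n \<phi>" for n
  proof
    fix x
    have "integral (cbox (- c2) c2) (\<lambda>y. \<phi> y * kn n (x - y)) = integral (cbox (- c1) c1) (\<lambda>y. kn n y * \<phi> (x - y))"
      by (rule convolution_commute[OF \<phi>c kc]) (use K0(3) c2 k_out in auto)
    moreover have "Dk n [] = kn n" using kn[of n] by (simp add: smooth_family_def)
    ultimately show "Dn n [] x = avg n \<phi> x" by (simp add: Dn_def avg_def)
  qed
  have Dn1: "Dn n [i] x = avg n (\<lambda>x. G x $ i) x" for n i x
  proof -
    have "((\<lambda>x. integral (cbox (- c1) c1) (\<lambda>y. kn n y * \<phi> (x - y))) has_derivative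
     (\<lambda>h. \<Sum>i\<in>UNIV. h $ i * integral (cbox (- c1) c1) (\<lambda>y. kn n y * G (x - y) $ i))) (at x)"
    proof (rule convolution_has_derivative[OF kc _ Gic])
      show "(\<phi> has_derivative (\<lambda>h. \<Sum>i\<in>UNIV. h $ i * G x $ i)) (at x)" for x
        using \<phi> by (auto simp: C1c_def inner_vec_def mult.commute)
    qed
    from has_derivative_mult_right[OF this, of "1 / I n"]
    have "(avg n \<phi> has_derivative (\<lambda>h. \<Sum>i\<in>UNIV. h $ i * avg n (\<lambda>x. G x $ i) x)) (at x)"
      by (auto simp: avg_def[abs_def] sum_divide_distrib elim!: has_derivative_eq_rhs)
    from has_derivative_unique[OF this Dn_der[of n "[]" x, unfolded Dn0]]
    have "(\<Sum>j\<in>UNIV. axis i 1 $ j * avg n (\<lambda>x. G x $ j) x) = (\<Sum>j\<in>UNIV. (axis i 1 :: pt) $ j * Dn n [j] x)"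
      by (rule fun_cong)
    then show ?thesis by (simp add: axis_def if_distrib[of "\<lambda>z. z * _"] cong: if_cong)
  qed
  obtain C where C: "C \<ge> 0" "\<And>x. \<bar>\<phi> x\<bar> \<le> C" using compact_support_bounded[OF \<phi>c K0(1,3)] by blast
  obtain C' where C': "C' \<ge> 0" "\<And>x. \<bar>G x $ 1\<bar> \<le> C'" using compact_support_bounded[OF Gic[of 1] K0(1)] K0(4) by (metis zero_index)
  obtain C'' where C'': "C'' \<ge> 0" "\<And>x. \<bar>G x $ 2\<bar> \<le> C''" using compact_support_bounded[OF Gic[of 2] K0(1)] K0(4) by (metis zero_index)
  have CG: "\<bar>G x $ i\<bar> \<le> C + C' + C''" for x i using exhaust_2[of i] C(1) C'(1) C'(2)[of x] C''(1) C''(2)[of x] by auto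
  show ?thesis
  proof (rule that[of "\<lambda>n. Dn n []" Dn K "C + C' + C''"])
    show "smooth_family (Dn n []) (Dn n)" for n using Dn_der by (simp add: smooth_family_def)
    show "Dn n [] x = 0" if "x \<notin> K" for n x unfolding Dn0 by (rule avg_supp[OF \<phi>c K0(3) that])
    show "Dn n [i] x = 0" if "x \<notin> K" for n i x unfolding Dn1 by (rule avg_supp[OF Gic _ that]) (simp add: K0(4))
    show "\<bar>Dn n [] x\<bar> \<le> C + C' + C''" for n x
      using avg_dist[OF \<phi>c, of n x 0 C] C C'(1) C''(1) by (simp add: Dn0)
    show "\<bar>Dn n [i] x\<bar> \<le> C + C' + C''" for n i x
      using avg_dist[OF Gic, of n x i 0 "C + C' + C''"] CG by (simp add: Dn1)
    show "(\<lambda>n. Dn n [] x) \<longlonglongrightarrow> \<phi> x" for x unfolding Dn0 by (rule avg_lim[OF \<phi>c])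
    show "(\<lambda>n. Dn n [i] x) \<longlonglongrightarrow> G x $ i" for i x unfolding Dn1 by (rule avg_lim[OF Gic])
  qed (use K KS in auto)
qed

section \<open>Weak gradients against continuously differentiable test functions\<close>

definition loc_int :: "pt set \<Rightarrow> (pt \<Rightarrow> real) \<Rightarrow> bool" where
  "loc_int S f \<longleftrightarrow> (\<forall>r. f absolutely_integrable_on (S \<inter> cball 0 r))"

lemma absolutely_integrable_mult_bounded:
  fixes f \<psi> :: "pt \<Rightarrow> real"
  assumes "f absolutely_integrable_on A" "A \<in> sets lebesgue" "continuous_on A \<psi>" "bounded (\<psi> ` A)"
  shows "(\<lambda>x. f x * \<psi> x) absolutely_integrable_on A"
proof -
  have "(\<lambda>x. \<psi> x * f x) absolutely_integrable_on A"
    by (rule absolutely_integrable_bounded_measurable_product[OF bilinear_times])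
       (use assms continuous_imp_measurable_on_sets_lebesgue in auto)
  then show ?thesis by (simp add: mult.commute)
qed

lemma absolutely_integrable_extend_zero:
  fixes f :: "pt \<Rightarrow> real"
  assumes "f absolutely_integrable_on A" "A \<subseteq> S" "\<And>x. x \<in> S \<Longrightarrow> x \<notin> A \<Longrightarrow> f x = 0"
  shows "f absolutely_integrable_on S"
proof -
  have "(\<lambda>x. if x \<in> A then f x else 0) = (\<lambda>x. if x \<in> S then f x else 0)" using assms(2,3) by (auto simp: fun_eq_iff)
  then show ?thesis
    using assms(1) absolutely_integrable_restrict_UNIV[of A f] absolutely_integrable_restrict_UNIV[of S f] by simp
qed

lemma sets_lebesgue_Int_cball: "S \<in> sets lebesgue \<Longrightarrow> S \<inter> cball (0::pt) r \<in> sets lebesgue"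
  by (intro sets.Int) auto

lemma loc_int_mult_test:
  assumes f: "loc_int S f" and S: "S \<in> sets lebesgue" and c: "continuous_on S \<psi>" and b: "bounded (\<psi> ` S)"
    and K: "bounded K" "\<And>x. x \<in> S \<Longrightarrow> x \<notin> K \<Longrightarrow> \<psi> x = 0"
  shows "(\<lambda>x. f x * \<psi> x) absolutely_integrable_on S"
proof -
  obtain r where r: "\<And>x. x \<in> K \<Longrightarrow> norm x \<le> r" using K(1) by (auto simp: bounded_iff)
  have "(\<lambda>x. f x * \<psi> x) absolutely_integrable_on (S \<inter> cball 0 r)"
    by (intro absolutely_integrable_mult_bounded sets_lebesgue_Int_cball S continuous_on_subset[OF c] bounded_subset[OF b])
       (use f in \<open>auto simp: loc_int_def\<close>)
  then show ?thesis by (rule absolutely_integrable_extend_zero) (use K(2) r in auto)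
qed

lemma loc_int_mult:
  assumes f: "loc_int S f" and S: "S \<in> sets lebesgue" and c: "continuous_on S \<psi>"
    and b: "\<And>r. bounded (\<psi> ` (S \<inter> cball 0 r))"
  shows "loc_int S (\<lambda>x. f x * \<psi> x)"
  unfolding loc_int_def
  by (intro allI absolutely_integrable_mult_bounded sets_lebesgue_Int_cball S continuous_on_subset[OF c] b)
     (use f in \<open>auto simp: loc_int_def\<close>)

lemma loc_int_add: "loc_int S f \<Longrightarrow> loc_int S g \<Longrightarrow> loc_int S (\<lambda>x. f x + g x)"
  by (simp add: loc_int_def set_integral_add(1))

lemma loc_int_subset:
  assumes "loc_int S f" "T \<subseteq> S" "T \<in> sets lebesgue" shows "loc_int T f"
  unfolding loc_int_def
proof
  fix r
  have "f absolutely_integrable_on (S \<inter> cball 0 r)" using assms(1) by (simp add: loc_int_def)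
  then show "f absolutely_integrable_on (T \<inter> cball 0 r)"
    by (rule set_integrable_subset) (use assms sets_lebesgue_Int_cball in auto)
qed

lemma loc_int_cong: "(\<And>x. x \<in> S \<Longrightarrow> f x = g x) \<Longrightarrow> loc_int S f \<longleftrightarrow> loc_int S g"
  unfolding loc_int_def by (intro all_cong1 set_integrable_cong) auto

lemma change_of_variables_real:
  fixes f :: "pt \<Rightarrow> real" and g :: "pt \<Rightarrow> pt"
  assumes "S \<in> sets lebesgue" "\<And>x. x \<in> S \<Longrightarrow> (g has_derivative g' x) (at x within S)" "inj_on g S"
  shows "(\<lambda>x. \<bar>det (matrix (g' x))\<bar> * f (g x)) absolutely_integrable_on S \<and>
           integral S (\<lambda>x. \<bar>det (matrix (g' x))\<bar> * f (g x)) = b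
     \<longleftrightarrow> f absolutely_integrable_on (g ` S) \<and> integral (g ` S) f = b"
proof -
  have eq: "(h absolutely_integrable_on A \<and> integral A h = b) \<longleftrightarrow>
     ((\<lambda>x. h x *\<^sub>R axis 1 1 :: real^1) absolutely_integrable_on A \<and> integral A (\<lambda>x. h x *\<^sub>R axis 1 1 :: real^1) = b *\<^sub>R axis 1 1)"
    for h and A :: "pt set"
  proof -
    have bl: "bounded_linear (\<lambda>r. r *\<^sub>R axis 1 1 :: real^1)" by (rule bounded_linear_scaleR_left)
    have bl': "bounded_linear (\<lambda>v::real^1. v $ 1)" by (rule bounded_linear_vec_nth)
    have 1: "h absolutely_integrable_on A \<longleftrightarrow> (\<lambda>x. h x *\<^sub>R axis 1 1 :: real^1) absolutely_integrable_on A"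
    proof
      show "(\<lambda>x. h x *\<^sub>R axis 1 1 :: real^1) absolutely_integrable_on A" if "h absolutely_integrable_on A"
        using absolutely_integrable_linear[OF that bl] by (simp add: o_def)
      show "h absolutely_integrable_on A" if "(\<lambda>x. h x *\<^sub>R axis 1 1 :: real^1) absolutely_integrable_on A"
        using absolutely_integrable_linear[OF that bl'] by (simp add: o_def axis_def)
    qed
    have 2: "integral A (\<lambda>x. h x *\<^sub>R axis 1 1 :: real^1) = integral A h *\<^sub>R axis 1 1" if "h absolutely_integrable_on A"
      using integral_linear[OF set_lebesgue_integral_eq_integral(1)[OF that] bl] by (simp add: o_def)
    show ?thesis using 1 2 by (auto simp: axis_eq_0_iff)
  qed
  show ?thesis
    unfolding eq[where h = "\<lambda>x. \<bar>det (matrix (g' x))\<bar> * f (g x)"] eq[where h = f]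
    using has_absolute_integral_change_of_variables[OF assms, of "\<lambda>x. f x *\<^sub>R axis 1 1 :: real^1" "b *\<^sub>R axis 1 1"]
    by simp
qed

lemma Lp_mem_loc_int:
  assumes p: "1 \<le> p" and S: "S \<in> sets lebesgue" and f: "Lp_mem S p f"
  shows "loc_int S f"
  unfolding loc_int_def
proof
  fix r
  define A where "A = S \<inter> cball (0::pt) r"
  have A: "A \<in> sets lebesgue" unfolding A_def by (rule sets_lebesgue_Int_cball[OF S])
  have lm: "A \<in> lmeasurable" by (rule bounded_set_imp_lmeasurable[OF _ A]) (auto simp: A_def)
  have AS: "A \<subseteq> S" by (auto simp: A_def)
  have mS: "f \<in> borel_measurable (lebesgue_on S)" using f by (simp add: Lp_mem_def)
  have mA: "f \<in> borel_measurable (lebesgue_on A)" by (rule measurable_restrict_mono[OF mS AS])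
  have "integrable (lebesgue_on A) f"
  proof (cases "p = \<infinity>")
    case True
    then have e: "esssup (lebesgue_on S) (\<lambda>x. ereal \<bar>f x\<bar>) < \<infinity>" using f by (simp add: Lp_mem_def)
    interpret finite_measure "lebesgue_on A" by (rule finite_measure_lebesgue_on[OF lm])
    have "AE x in lebesgue_on S. ereal \<bar>f x\<bar> \<le> esssup (lebesgue_on S) (\<lambda>x. ereal \<bar>f x\<bar>)" by (rule esssup_AE)
    moreover obtain B where "esssup (lebesgue_on S) (\<lambda>x. ereal \<bar>f x\<bar>) \<le> ereal B"
      using e less_PInf_Ex_of_nat[of "esssup (lebesgue_on S) (\<lambda>x. ereal \<bar>f x\<bar>)"] by (auto intro: less_imp_le)
    ultimately have "AE x in lebesgue_on S. \<bar>f x\<bar> \<le> B" by (auto elim!: eventually_mono dest: order_trans)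
    then have "AE x in lebesgue. x \<in> S \<longrightarrow> \<bar>f x\<bar> \<le> B" using S by (subst (asm) AE_restrict_space_iff) auto
    then have "AE x in lebesgue. x \<in> A \<longrightarrow> \<bar>f x\<bar> \<le> B" by eventually_elim (use AS in auto)
    then have "AE x in lebesgue_on A. norm (f x) \<le> B" using A by (subst AE_restrict_space_iff) auto
    then show ?thesis by (rule integrable_const_bound[OF _ mA])
  next
    case False
    define q where "q = enn2real p"
    have q: "1 \<le> q" using p False unfolding q_def
      by (metis enn2real_1 enn2real_mono infinity_ennreal_def top.not_eq_extremum)
    have "integrable (lebesgue_on S) (\<lambda>x. \<bar>f x\<bar> powr q)" using f False by (simp add: Lp_mem_def q_def)
    then have "set_integrable lebesgue S (\<lambda>x. \<bar>f x\<bar> powr q)"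
      unfolding set_integrable_def using S by (simp add: integrable_restrict_space)
    then have "set_integrable lebesgue A (\<lambda>x. \<bar>f x\<bar> powr q)" by (rule set_integrable_subset[OF _ A AS])
    then have "integrable (lebesgue_on A) (\<lambda>x. \<bar>f x\<bar> powr q)"
      unfolding set_integrable_def using A by (simp add: integrable_restrict_space)
    moreover have "integrable (lebesgue_on A) (\<lambda>x. 1::real)"
      by (rule finite_measure.integrable_const[OF finite_measure_lebesgue_on[OF lm]])
    ultimately have "integrable (lebesgue_on A) (\<lambda>x. 1 + \<bar>f x\<bar> powr q)" by (intro Bochner_Integration.integrable_add)
    then show ?thesis
    proof (rule Bochner_Integration.integrable_bound[OF _ mA])
      have "\<bar>f x\<bar> \<le> 1 + \<bar>f x\<bar> powr q" for x
      proof (cases "\<bar>f x\<bar> \<le> 1")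
        case False
        then have "\<bar>f x\<bar> powr 1 \<le> \<bar>f x\<bar> powr q" using q by (intro powr_mono) auto
        then show ?thesis using False by simp
      qed (smt (verit) powr_ge_zero)
      then show "AE x in lebesgue_on A. norm (f x) \<le> norm (1 + \<bar>f x\<bar> powr q)"
        by (intro AE_I2) (smt (verit) real_norm_def powr_ge_zero)
    qed
  qed
  then show "f absolutely_integrable_on (S \<inter> cball 0 r)"
    unfolding A_def[symmetric] set_integrable_def using A by (simp add: integrable_restrict_space)
qed

definition weak_grad :: "pt set \<Rightarrow> (pt \<Rightarrow> real) \<Rightarrow> (2 \<Rightarrow> pt \<Rightarrow> real) \<Rightarrow> bool" where
  "weak_grad S f g \<longleftrightarrow> (\<forall>\<phi> G i. C1c S \<phi> G \<longrightarrow>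
     integral S (\<lambda>x. f x * G x $ i) = - integral S (\<lambda>x. g i x * \<phi> x))"

lemma C1c_bounded:
  assumes "C1c S \<phi> G" shows "bounded (\<phi> ` A)" "bounded ((\<lambda>x. G x $ i) ` A)"
proof -
  obtain K where K: "compact K" "\<And>x. x \<notin> K \<Longrightarrow> \<phi> x = 0" "\<And>x. x \<notin> K \<Longrightarrow> G x = 0"
    by (rule C1c_support[OF assms], rule that)
  obtain C where "\<And>x. \<bar>\<phi> x\<bar> \<le> C" using compact_support_bounded[OF C1c_continuous(1)[OF assms] K(1,2)] by blast
  then show "bounded (\<phi> ` A)" unfolding bounded_iff by auto
  have "continuous_on UNIV (\<lambda>x. G x $ i)" by (intro continuous_intros C1c_continuous(2)[OF assms])
  moreover have "G x $ i = 0" if "x \<notin> K" for x using K(3)[OF that] by simp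
  ultimately obtain C where "\<And>x. \<bar>G x $ i\<bar> \<le> C" using compact_support_bounded[OF _ K(1), of "\<lambda>x. G x $ i"] by blast
  then show "bounded ((\<lambda>x. G x $ i) ` A)" unfolding bounded_iff by auto
qed

lemma C1c_integrable:
  assumes "C1c T \<phi> G" "loc_int S f" "S \<in> sets lebesgue"
  shows "(\<lambda>x. f x * \<phi> x) absolutely_integrable_on S" "(\<lambda>x. f x * G x $ i) absolutely_integrable_on S"
proof -
  obtain K where K: "compact K" "\<And>x. x \<notin> K \<Longrightarrow> \<phi> x = 0" "\<And>x. x \<notin> K \<Longrightarrow> G x = 0"
    by (rule C1c_support[OF assms(1)], rule that)
  have "bounded K" using K(1) compact_imp_bounded by auto
  note K' = this K(2,3)
  show "(\<lambda>x. f x * \<phi> x) absolutely_integrable_on S"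
    by (rule loc_int_mult_test[OF assms(2,3) C1c_continuous(1)[OF assms(1)] C1c_bounded(1)[OF assms(1)] K'(1)]) (use K' in auto)
  show "(\<lambda>x. f x * G x $ i) absolutely_integrable_on S"
    by (rule loc_int_mult_test[OF assms(2,3) continuous_on_component[OF C1c_continuous(2)[OF assms(1)]] C1c_bounded(2)[OF assms(1)] K'(1)]) (use K' in auto)
qed

lemma dominated_test_limit:
  fixes f :: "pt \<Rightarrow> real"
  assumes f: "loc_int S f" and S: "S \<in> sets lebesgue"
    and c: "\<And>n. continuous_on S (\<psi> n)" and b: "\<And>n x. x \<in> S \<Longrightarrow> \<bar>\<psi> n x\<bar> \<le> C"
    and K: "bounded K" "\<And>n x. x \<in> S \<Longrightarrow> x \<notin> K \<Longrightarrow> \<psi> n x = 0"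
    and lim: "\<And>x. x \<in> S \<Longrightarrow> (\<lambda>n. \<psi> n x) \<longlonglongrightarrow> \<psi>' x"
  shows "(\<lambda>n. integral S (\<lambda>x. f x * \<psi> n x)) \<longlonglongrightarrow> integral S (\<lambda>x. f x * \<psi>' x)"
proof -
  obtain r where r: "\<And>x. x \<in> K \<Longrightarrow> norm x \<le> r" using K(1) by (auto simp: bounded_iff)
  define h where "h x = (if x \<in> cball 0 r then \<bar>f x\<bar> * C else 0)" for x
  have "(\<lambda>x. \<bar>f x\<bar> * C) absolutely_integrable_on (S \<inter> cball 0 r)"
    using f by (intro set_integrable_mult_left set_integrable_abs) (simp add: loc_int_def)
  then have "h absolutely_integrable_on (S \<inter> cball 0 r)"
    by (rule set_integrable_cong[THEN iffD1, rotated -1]) (auto simp: h_def)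
  then have "h absolutely_integrable_on S" by (rule absolutely_integrable_extend_zero) (auto simp: h_def)
  then have h: "h integrable_on S" by (rule set_lebesgue_integral_eq_integral(1))
  show ?thesis
  proof (rule dominated_convergence(2)[OF _ h])
    show "(\<lambda>x. f x * \<psi> n x) integrable_on S" for n
      by (rule set_lebesgue_integral_eq_integral(1)[OF loc_int_mult_test[OF f S c _ K(1)]])
         (use b K(2) in \<open>auto simp: bounded_iff intro!: exI[of _ C]\<close>)
    show "norm (f x * \<psi> n x) \<le> h x" if "x \<in> S" for n x
      using b[OF that, of n] K(2)[OF that, of n] r[of x]
      by (cases "x \<in> K") (auto simp: h_def abs_mult intro!: mult_left_mono)
    show "(\<lambda>n. f x * \<psi> n x) \<longlonglongrightarrow> f x * \<psi>' x" if "x \<in> S" for x by (intro tendsto_intros lim that)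
  qed
qed

lemma weak_partial_imp_weak_grad:
  assumes S: "open S" and f: "loc_int S f" and g: "\<And>i. loc_int S (g i)" and w: "\<And>i. weak_partial S f i (g i)"
  shows "weak_grad S f g"
  unfolding weak_grad_def
proof (intro allI impI)
  fix \<phi> G i assume \<phi>: "C1c S \<phi> G"
  have Sm: "S \<in> sets lebesgue" using S by auto
  obtain \<phi>n Dn K C where m: "\<And>n. smooth_family (\<phi>n n) (Dn n)" "compact K" "K \<subseteq> S"
    "\<And>n x. x \<notin> K \<Longrightarrow> \<phi>n n x = 0" "\<And>n i x. x \<notin> K \<Longrightarrow> Dn n [i] x = 0"
    "\<And>n x. \<bar>\<phi>n n x\<bar> \<le> C" "\<And>n i x. \<bar>Dn n [i] x\<bar> \<le> C"
    "\<And>x. (\<lambda>n. \<phi>n n x) \<longlonglongrightarrow> \<phi> x" "\<And>i x. (\<lambda>n. Dn n [i] x) \<longlonglongrightarrow> G x $ i"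
    by (rule mollify[OF \<phi> S], rule that)
  have c: "continuous_on S (Dn n [i])" "continuous_on S (\<phi>n n)" for n
    using smooth_family_continuous[OF m(1)[of n], of S] m(1)[of n] unfolding smooth_family_def by metis+
  have bK: "bounded K" using m(2) compact_imp_bounded by auto
  have i1: "(\<lambda>x. f x * Dn n [i] x) absolutely_integrable_on S" for n
    by (rule loc_int_mult_test[OF f Sm c(1) _ bK]) (use m in \<open>auto simp: bounded_iff intro!: exI[of _ C]\<close>)
  have i2: "(\<lambda>x. g i x * \<phi>n n x) absolutely_integrable_on S" for n
    by (rule loc_int_mult_test[OF g Sm c(2) _ bK]) (use m in \<open>auto simp: bounded_iff intro!: exI[of _ C]\<close>)
  have toL: "(\<integral>x. h x \<partial>lebesgue_on S) = integral S h" if "h absolutely_integrable_on S" for h :: "pt \<Rightarrow> real"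
    by (rule lebesgue_integral_eq_integral[OF absolutely_integrable_imp_integrable[OF that Sm] Sm])
  have eq: "integral S (\<lambda>x. f x * Dn n [i] x) = - integral S (\<lambda>x. g i x * \<phi>n n x)" for n
  proof -
    have "test_function S (\<phi>n n) (Dn n)" unfolding test_function_def using m by auto
    then have "(\<integral>x. f x * Dn n [i] x \<partial>lebesgue_on S) = - (\<integral>x. g i x * \<phi>n n x \<partial>lebesgue_on S)"
      using w[of i] unfolding weak_partial_def by blast
    then show ?thesis unfolding toL[OF i1] toL[OF i2] .
  qed
  have l1: "(\<lambda>n. integral S (\<lambda>x. f x * Dn n [i] x)) \<longlonglongrightarrow> integral S (\<lambda>x. f x * G x $ i)"
    by (rule dominated_test_limit[OF f Sm c(1) _ bK]) (use m in auto)
  have "(\<lambda>n. integral S (\<lambda>x. g i x * \<phi>n n x)) \<longlonglongrightarrow> integral S (\<lambda>x. g i x * \<phi> x)"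
    by (rule dominated_test_limit[OF g Sm c(2) _ bK]) (use m in auto)
  then have "(\<lambda>n. - integral S (\<lambda>x. g i x * \<phi>n n x)) \<longlonglongrightarrow> - integral S (\<lambda>x. g i x * \<phi> x)" by (rule tendsto_minus)
  with l1 show "integral S (\<lambda>x. f x * G x $ i) = - integral S (\<lambda>x. g i x * \<phi> x)"
    unfolding eq by (rule LIMSEQ_unique)
qed

lemma weak_grad_imp_weak_partial_UNIV:
  assumes w: "weak_grad UNIV f g" and f: "loc_int UNIV f" "\<And>i. loc_int UNIV (g i)"
  shows "weak_partial UNIV f i (g i)"
  unfolding weak_partial_def
proof (intro allI impI)
  fix \<phi> D assume t: "test_function UNIV \<phi> D"
  define G where "G x = (\<chi> i. D [i] x)" for x :: pt
  have sm: "smooth_family \<phi> D" and K: "\<exists>K. compact K \<and> (\<forall>x. x \<notin> K \<longrightarrow> \<phi> x = 0)" using t by (auto simp: test_function_def)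
  have C: "C1c UNIV \<phi> G"
    unfolding C1c_def
  proof (intro conjI allI)
    show "(\<phi> has_derivative (\<lambda>h. G x \<bullet> h)) (at x)" for x
      using sm unfolding smooth_family_def by (auto simp: G_def inner_vec_def mult.commute)
    show "continuous_on UNIV G" unfolding G_def by (intro continuous_on_vec_lambda smooth_family_continuous[OF sm])
    show "\<exists>K. compact K \<and> K \<subseteq> UNIV \<and> (\<forall>x. x \<notin> K \<longrightarrow> \<phi> x = 0)" using K by auto
  qed
  have toL: "(\<integral>x. h x \<partial>lebesgue_on UNIV) = integral UNIV h" if "h absolutely_integrable_on UNIV" for h :: "pt \<Rightarrow> real"
    by (rule lebesgue_integral_eq_integral[OF absolutely_integrable_imp_integrable[OF that]]) auto
  have "integral UNIV (\<lambda>x. f x * G x $ i) = - integral UNIV (\<lambda>x. g i x * \<phi> x)"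
    using w C unfolding weak_grad_def by blast
  then show "(\<integral>x. f x * D [i] x \<partial>lebesgue_on UNIV) = - (\<integral>x. g i x * \<phi> x \<partial>lebesgue_on UNIV)"
    using toL[OF C1c_integrable(2)[OF C f(1), of i]] toL[OF C1c_integrable(1)[OF C f(2), of i]] by (simp add: G_def)
qed

section \<open>The collar of the boundary\<close>

text \<open>In complex notation, col_map (X, Y) = (X + (i - 1) Y) exp (i col_phase X), and Y = 0 is the boundary of the spiral.
  The phase does not depend on Y; this is why the reflection in Y has bounded derivatives although col_map does not.\<close>
definition col_phase :: "real \<Rightarrow> real" where "col_phase X = sqrt (1 + X\<^sup>2)"
definition col_map :: "pt \<Rightarrow> pt" where
  "col_map w = vector [(w$1 - w$2) * cos (col_phase (w$1)) - w$2 * sin (col_phase (w$1)), (w$1 - w$2) * sin (col_phase (w$1)) + w$2 * cos (col_phase (w$1))]"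
definition col_phase1 :: "real \<Rightarrow> real" where "col_phase1 X = X / col_phase X"
text \<open>The partial derivatives of col_map in X and Y are (TX1, TX2) and (TY1, TY2); col_jac is the Jacobian determinant.\<close>
definition TX1 where "TX1 w = (1 - col_phase1 (w$1) * w$2) * cos (col_phase (w$1)) - col_phase1 (w$1) * (w$1 - w$2) * sin (col_phase (w$1))" for w :: pt
definition TX2 where "TX2 w = (1 - col_phase1 (w$1) * w$2) * sin (col_phase (w$1)) + col_phase1 (w$1) * (w$1 - w$2) * cos (col_phase (w$1))" for w :: pt
definition TY1 where "TY1 w = - cos (col_phase (w$1)) - sin (col_phase (w$1))" for w :: pt
definition TY2 where "TY2 w = cos (col_phase (w$1)) - sin (col_phase (w$1))" for w :: pt
definition col_jac where "col_jac w = 1 + col_phase1 (w$1) * (w$1 - 2 * w$2)" for w :: pt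

lemma col_phase_ge1: "1 \<le> col_phase X" and col_phase_pos: "0 < col_phase X" and col_phase_nz: "col_phase X \<noteq> 0" and col_phase_sq: "(col_phase X)\<^sup>2 = 1 + X\<^sup>2" and abs_le_col_phase: "\<bar>X\<bar> \<le> col_phase X"
proof -
  show 1: "1 \<le> col_phase X" by (simp add: col_phase_def)
  show "0 < col_phase X" "col_phase X \<noteq> 0" using 1 by auto
  show "(col_phase X)\<^sup>2 = 1 + X\<^sup>2" by (simp add: col_phase_def)
  show "\<bar>X\<bar> \<le> col_phase X" unfolding col_phase_def by (rule real_le_rsqrt) simp
qed

lemma col_phase1_abs: "\<bar>col_phase1 X\<bar> \<le> 1"
  using abs_le_col_phase[of X] col_phase_pos[of X] by (simp add: col_phase1_def)

lemma col_phase1_mult: "col_phase1 X * X = col_phase X - 1 / col_phase X"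
  using col_phase_sq[of X] col_phase_nz[of X] by (simp add: col_phase1_def field_simps power2_eq_square)

lemma col_phase_has_derivative: "((\<lambda>w::pt. col_phase (w$1)) has_derivative (\<lambda>h. col_phase1 (w$1) * h$1)) (at w within S)"
proof -
  have pos: "0 < 1 + (w$1)\<^sup>2" by (simp add: add_pos_nonneg)
  show ?thesis unfolding col_phase_def col_phase1_def using pos
    by (auto intro!: derivative_eq_intros vec_nth_has_derivative simp: field_simps)
qed

lemma col_phase1_has_derivative: "((\<lambda>w::pt. col_phase1 (w$1)) has_derivative (\<lambda>h. (1 / col_phase (w$1) - (col_phase1 (w$1))\<^sup>2 / col_phase (w$1)) * h$1)) (at w within S)"
proof -
  have "((\<lambda>w::pt. w$1 / col_phase (w$1)) has_derivative (\<lambda>h. - w$1 * (inverse (col_phase (w$1)) * (col_phase1 (w$1) * h$1) * inverse (col_phase (w$1))) + h$1 / col_phase (w$1))) (at w within S)"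
    by (rule has_derivative_divide[OF vec_nth_has_derivative col_phase_has_derivative col_phase_nz])
  then show ?thesis unfolding col_phase1_def
    by (rule has_derivative_eq_rhs) (auto simp: fun_eq_iff col_phase_nz field_simps power2_eq_square)
qed

lemma col_map_has_derivative:
  "(col_map has_derivative (\<lambda>h. vector [TX1 w * h$1 + TY1 w * h$2, TX2 w * h$1 + TY2 w * h$2])) (at w within S)"
proof -
  have 1: "((\<lambda>w::pt. (w$1 - w$2) * cos (col_phase (w$1)) - w$2 * sin (col_phase (w$1))) has_derivative (\<lambda>h. TX1 w * h$1 + TY1 w * h$2)) (at w within S)"
    unfolding TX1_def TY1_def
    by (auto intro!: derivative_eq_intros vec_nth_has_derivative col_phase_has_derivative simp: algebra_simps)
  have 2: "((\<lambda>w::pt. (w$1 - w$2) * sin (col_phase (w$1)) + w$2 * cos (col_phase (w$1))) has_derivative (\<lambda>h. TX2 w * h$1 + TY2 w * h$2)) (at w within S)"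
    unfolding TX2_def TY2_def
    by (auto intro!: derivative_eq_intros vec_nth_has_derivative col_phase_has_derivative simp: algebra_simps)
  show ?thesis unfolding col_map_def[abs_def] by (rule has_derivative_vector2[OF 1 2])
qed

lemma col_jac_eq: "TX1 w * TY2 w - TX2 w * TY1 w = col_jac w"
proof -
  have "TX1 w * TY2 w - TX2 w * TY1 w = (1 + col_phase1 (w$1) * (w$1 - 2 * w$2)) * ((sin (col_phase (w$1)))\<^sup>2 + (cos (col_phase (w$1)))\<^sup>2)"
    unfolding TX1_def TX2_def TY1_def TY2_def by algebra
  then show ?thesis by (simp add: col_jac_def)
qed

lemma col_jac_bounds:
  assumes "\<bar>w$2\<bar> \<le> 1/10"
  shows "col_phase (w$1) / 2 \<le> col_jac w" "col_jac w \<le> 3 * col_phase (w$1)" "0 < col_jac w"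
proof -
  have b: "\<bar>col_phase1 (w$1) * (2 * w$2)\<bar> \<le> 1/5" using col_phase1_abs[of "w$1"] assms mult_mono[of "\<bar>col_phase1 (w$1)\<bar>" 1 "\<bar>2 * w$2\<bar>" "1/5"] by (simp add: abs_mult)
  have e: "col_jac w = 1 + (col_phase (w$1) - 1 / col_phase (w$1)) - col_phase1 (w$1) * (2 * w$2)"
    unfolding col_phase1_mult[symmetric] col_jac_def by (simp add: algebra_simps)
  have i: "0 < 1 / col_phase (w$1)" "1 / col_phase (w$1) \<le> 1" using col_phase_ge1[of "w$1"] by auto
  show "col_phase (w$1) / 2 \<le> col_jac w" "col_jac w \<le> 3 * col_phase (w$1)" using b i col_phase_ge1[of "w$1"] unfolding e by linarith+
  then show "0 < col_jac w" using col_phase_pos[of "w$1"] by linarith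
qed

lemma TX_bounds:
  assumes "\<bar>w$2\<bar> \<le> 1/10"
  shows "\<bar>TX1 w\<bar> \<le> 4 * col_phase (w$1)" "\<bar>TX2 w\<bar> \<le> 4 * col_phase (w$1)" "\<bar>TY1 w\<bar> \<le> 2" "\<bar>TY2 w\<bar> \<le> 2"
proof -
  have m: "\<bar>a * b\<bar> \<le> A" if "\<bar>a\<bar> \<le> A" "\<bar>b\<bar> \<le> 1" for a b A :: real
    using mult_mono[OF that] by (simp add: abs_mult) (meson abs_ge_zero order_trans that)
  have c: "\<bar>cos (col_phase (w$1))\<bar> \<le> 1" "\<bar>sin (col_phase (w$1))\<bar> \<le> 1" by simp_all
  have "\<bar>w$2 * col_phase1 (w$1)\<bar> \<le> 1/10" by (rule m[OF assms col_phase1_abs])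
  then have a1: "\<bar>1 - col_phase1 (w$1) * w$2\<bar> \<le> 2 * col_phase (w$1)" using col_phase_ge1[of "w$1"] by (simp add: mult.commute abs_le_iff)
  have "\<bar>w$1 - w$2\<bar> \<le> 2 * col_phase (w$1)" using abs_le_col_phase[of "w$1"] col_phase_ge1[of "w$1"] assms by linarith
  from m[OF this col_phase1_abs] have a2: "\<bar>col_phase1 (w$1) * (w$1 - w$2)\<bar> \<le> 2 * col_phase (w$1)" by (simp add: mult.commute)
  show "\<bar>TX1 w\<bar> \<le> 4 * col_phase (w$1)" unfolding TX1_def using m[OF a1 c(1)] m[OF a2 c(2)] by linarith
  show "\<bar>TX2 w\<bar> \<le> 4 * col_phase (w$1)" unfolding TX2_def using m[OF a1 c(2)] m[OF a2 c(1)] by linarith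
  show "\<bar>TY1 w\<bar> \<le> 2" "\<bar>TY2 w\<bar> \<le> 2" unfolding TY1_def TY2_def using c by linarith+
qed

lemma col_map_norm: "(norm (col_map w))\<^sup>2 = (w$1 - w$2)\<^sup>2 + (w$2)\<^sup>2"
proof -
  have "(col_map w $ 1)\<^sup>2 + (col_map w $ 2)\<^sup>2 = ((w$1 - w$2)\<^sup>2 + (w$2)\<^sup>2) * ((sin (col_phase (w$1)))\<^sup>2 + (cos (col_phase (w$1)))\<^sup>2)"
    unfolding col_map_def by (simp only: vector_2) algebra
  then show ?thesis by (simp add: norm_pt)
qed

lemma col_map_norm_bounds: "\<bar>w$1\<bar> - \<bar>w$2\<bar> \<le> norm (col_map w)" "norm (col_map w) \<le> \<bar>w$1\<bar> + 2 * \<bar>w$2\<bar>"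
proof -
  have "\<bar>w$1 - w$2\<bar> \<le> norm (col_map w)" by (rule power2_le_imp_le) (auto simp: col_map_norm)
  then show "\<bar>w$1\<bar> - \<bar>w$2\<bar> \<le> norm (col_map w)" by linarith
  have "norm (col_map w) \<le> \<bar>w$1 - w$2\<bar> + \<bar>w$2\<bar>"
    by (rule power2_le_imp_le) (auto simp: col_map_norm power2_sum)
  then show "norm (col_map w) \<le> \<bar>w$1\<bar> + 2 * \<bar>w$2\<bar>" by linarith
qed

lemma sqrt_one_plus_lipschitz: "\<bar>sqrt (1 + a\<^sup>2) - sqrt (1 + b\<^sup>2)\<bar> \<le> \<bar>\<bar>a\<bar> - \<bar>b\<bar>\<bar>" for a b :: real
proof -
  have pos: "0 < col_phase a + col_phase b" using col_phase_pos[of a] col_phase_pos[of b] by simp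
  have "(col_phase a - col_phase b) * (col_phase a + col_phase b) = (\<bar>a\<bar> - \<bar>b\<bar>) * (\<bar>a\<bar> + \<bar>b\<bar>)"
    using col_phase_sq[of a] col_phase_sq[of b] by (simp add: algebra_simps power2_eq_square abs_mult[symmetric])
  then have "\<bar>col_phase a - col_phase b\<bar> * (col_phase a + col_phase b) = \<bar>\<bar>a\<bar> - \<bar>b\<bar>\<bar> * (\<bar>a\<bar> + \<bar>b\<bar>)"
    using pos by (metis abs_mult abs_of_nonneg abs_of_pos add_nonneg_nonneg abs_ge_zero)
  also have "\<dots> \<le> \<bar>\<bar>a\<bar> - \<bar>b\<bar>\<bar> * (col_phase a + col_phase b)" using abs_le_col_phase[of a] abs_le_col_phase[of b] by (intro mult_left_mono) auto
  finally show ?thesis using pos by (simp add: col_phase_def)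
qed

lemma sin_cos_small:
  fixes D :: real assumes "\<bar>D\<bar> \<le> 1"
  shows "0 \<le> D * sin D" "D * sin D \<le> D\<^sup>2" "\<bar>D * (1 - cos D)\<bar> \<le> D * sin D" "D \<noteq> 0 \<Longrightarrow> 0 < cos D"
proof -
  have D2: "\<bar>D\<bar> < pi/2" using assms pi_ge_two pi_gt3 by linarith
  show cpos: "0 < cos D" using D2 by (intro cos_gt_zero_pi) auto
  have s: "\<bar>sin D\<bar> \<le> \<bar>D\<bar>" by (rule abs_sin_x_le_abs_x)
  have sgn: "0 \<le> D * sin D"
  proof (cases "0 \<le> D")
    case True then have "0 \<le> sin D" using D2 by (intro sin_ge_zero) auto
    then show ?thesis using True by simp
  next
    case False then have "0 \<le> sin (- D)" using D2 by (intro sin_ge_zero) auto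
    then show ?thesis using False by (simp add: mult_nonpos_nonpos)
  qed
  then show "0 \<le> D * sin D" .
  then have e: "D * sin D = \<bar>D\<bar> * \<bar>sin D\<bar>" by (metis abs_mult abs_of_nonneg)
  show "D * sin D \<le> D\<^sup>2" using e s mult_left_mono[OF s, of "\<bar>D\<bar>"] by (simp add: power2_eq_square)
  have "1 - cos D \<le> \<bar>sin D\<bar>"
  proof (rule power2_le_imp_le)
    have "(1 - cos D)\<^sup>2 \<le> (1 - cos D) * (1 + cos D)" using cpos cos_le_one[of D] unfolding power2_eq_square by (intro mult_left_mono) auto
    also have "\<dots> = (sin D)\<^sup>2" by (simp add: sin_squared_eq algebra_simps power2_eq_square)
    finally show "(1 - cos D)\<^sup>2 \<le> \<bar>sin D\<bar>\<^sup>2" by simp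
  qed simp
  then show "\<bar>D * (1 - cos D)\<bar> \<le> D * sin D" unfolding e using cos_le_one[of D] by (simp add: abs_mult mult_left_mono)
qed

lemma col_map_inj: "inj_on col_map {w. \<bar>w$2\<bar> \<le> 1/10}"
proof (rule inj_onI)
  fix w w' assume w: "w \<in> {w. \<bar>w$2\<bar> \<le> 1/10}" "w' \<in> {w. \<bar>w$2\<bar> \<le> 1/10}" and eq: "col_map w = col_map w'"
  define X Y X' Y' where xy: "X = w$1" "Y = w$2" "X' = w'$1" "Y' = w'$2"
  have Y: "\<bar>Y\<bar> \<le> 1/10" "\<bar>Y'\<bar> \<le> 1/10" using w by (auto simp: xy)
  define D where "D = col_phase X' - col_phase X"
  have c: "(X - Y) * cos (col_phase X) - Y * sin (col_phase X) = (X' - Y') * cos (col_phase X') - Y' * sin (col_phase X')"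
    "(X - Y) * sin (col_phase X) + Y * cos (col_phase X) = (X' - Y') * sin (col_phase X') + Y' * cos (col_phase X')"
    using eq by (auto simp: col_map_def vec_eq_iff forall_2 xy)
  have re: "X - Y = (X' - Y') * cos D - Y' * sin D" and im: "Y = (X' - Y') * sin D + Y' * cos D"
  proof -
    have "X - Y = ((X - Y) * cos (col_phase X) - Y * sin (col_phase X)) * cos (col_phase X) + ((X - Y) * sin (col_phase X) + Y * cos (col_phase X)) * sin (col_phase X)"
      using sin_cos_squared_add[of "col_phase X"] by algebra
    also have "\<dots> = (X' - Y') * cos D - Y' * sin D" unfolding c D_def cos_diff sin_diff by algebra
    finally show "X - Y = (X' - Y') * cos D - Y' * sin D" .
    have "Y = ((X - Y) * sin (col_phase X) + Y * cos (col_phase X)) * cos (col_phase X) - ((X - Y) * cos (col_phase X) - Y * sin (col_phase X)) * sin (col_phase X)"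
      using sin_cos_squared_add[of "col_phase X"] by algebra
    also have "\<dots> = (X' - Y') * sin D + Y' * cos D" unfolding c D_def cos_diff sin_diff by algebra
    finally show "Y = (X' - Y') * sin D + Y' * cos D" .
  qed
  have sum: "X - X' = (X' - 2 * Y') * sin D - X' * (1 - cos D)" using re im by (simp add: algebra_simps)
  have near: "\<bar>\<bar>X\<bar> - \<bar>X'\<bar>\<bar> \<le> 3/10"
    using col_map_norm_bounds[of w] col_map_norm_bounds[of w'] eq Y unfolding xy by (simp only:) linarith
  have D1: "\<bar>D\<bar> \<le> 1" using sqrt_one_plus_lipschitz[of X' X] near unfolding D_def col_phase_def by linarith
  define P where "P = col_phase X + col_phase X'"
  have P: "0 < P" "\<bar>X'\<bar> \<le> P" "\<bar>X + X'\<bar> \<le> P" using col_phase_pos[of X] col_phase_pos[of X'] abs_le_col_phase[of X'] abs_le_col_phase[of X] by (auto simp: P_def)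
  have DP: "D * P = - (X - X') * (X + X')" using col_phase_sq[of X] col_phase_sq[of X'] unfolding D_def P_def by algebra
  have "D = 0"
  proof (rule ccontr)
    assume "D \<noteq> 0"
    then have D2: "0 < D\<^sup>2" by simp
    define q where "q = D * sin D - D * (1 - cos D)"
    have q: "0 \<le> q" "q \<le> 2 * D\<^sup>2" using sin_cos_small(2,3)[OF D1] by (auto simp: q_def abs_le_iff)
    have "- (D\<^sup>2 * P) = (X - X') * (X + X') * D" using DP by algebra
    also have "\<dots> = ((X' - 2 * Y') * sin D - X' * (1 - cos D)) * (X + X') * D" by (simp only: sum)
    also have "\<dots> = X' * (X + X') * q - 2 * Y' * (X + X') * (D * sin D)" by (simp add: q_def algebra_simps)
    finally have main: "- (D\<^sup>2 * P) = X' * (X + X') * q - 2 * Y' * (X + X') * (D * sin D)" .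
    have l1: "- (3/10 * P) \<le> X' * (X + X')"
    proof (cases "0 \<le> X * X'")
      case True
      then have "0 \<le> X' * (X + X')" by (simp add: distrib_left mult.commute)
      then show ?thesis using P(1) by linarith
    next
      case False
      then have "\<bar>X + X'\<bar> = \<bar>\<bar>X\<bar> - \<bar>X'\<bar>\<bar>" by (auto simp: zero_le_mult_iff not_le abs_if)
      then have "\<bar>X + X'\<bar> \<le> 3/10" using near by simp
      then have "\<bar>X'\<bar> * \<bar>X + X'\<bar> \<le> P * (3/10)" using P by (intro mult_mono) auto
      then show ?thesis by (simp add: abs_mult[symmetric] abs_le_iff)
    qed
    have l2: "- (3/10 * P) * (2 * D\<^sup>2) \<le> X' * (X + X') * q"
    proof -
      have "- (3/10 * P) * (2 * D\<^sup>2) \<le> - (3/10 * P) * q" using q P(1) by (intro mult_left_mono_neg) auto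
      also have "\<dots> \<le> X' * (X + X') * q" using l1 q(1) by (rule mult_right_mono)
      finally show ?thesis .
    qed
    have "\<bar>2 * Y' * (X + X')\<bar> \<le> (2/10) * P" unfolding abs_mult using Y(2) P by (intro mult_mono) auto
    then have "\<bar>2 * Y' * (X + X')\<bar> * (D * sin D) \<le> (2/10) * P * D\<^sup>2"
      using sin_cos_small(1,2)[OF D1] P(1) by (intro mult_mono) auto
    then have "2 * Y' * (X + X') * (D * sin D) \<le> (2/10) * P * D\<^sup>2"
      using mult_right_mono[OF abs_ge_self[of "2 * Y' * (X + X')"] sin_cos_small(1)[OF D1]] by linarith
    then have "D\<^sup>2 * P * (2/10) \<le> 0" using main l2 by (simp add: algebra_simps)
    then show False using D2 P(1) by (simp add: mult_le_0_iff)
  qed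
  then have "X = X'" "Y = Y'" using sum im by auto
  then show "w = w'" by (simp add: vec_eq_iff forall_2 xy)
qed

lemma spiral_fun_col_map_sign:
  assumes "\<bar>w$2\<bar> \<le> 1/10" "w$2 \<noteq> 0"
  shows "0 < w$2 * spiral_fun (col_map w)"
proof -
  define X Y where xy: "X = w$1" "Y = w$2"
  have Y: "\<bar>Y\<bar> \<le> 1/10" "Y \<noteq> 0" using assms by (auto simp: xy)
  define \<psi> where "\<psi> = phase (col_map w)"
  define E where "E = col_phase X - \<psi>"
  have \<psi>2: "\<psi>\<^sup>2 = 1 + ((X - Y)\<^sup>2 + Y\<^sup>2)" using col_map_norm[of w] unfolding \<psi>_def phase_norm by (simp add: xy)
  have \<psi>: "0 < \<psi>" by (simp add: \<psi>_def phase_pos)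
  have EP: "E * (col_phase X + \<psi>) = 2 * Y * (X - Y)" using col_phase_sq[of X] \<psi>2 unfolding E_def by algebra
  have pos: "0 < col_phase X + \<psi>" using \<psi> col_phase_pos[of X] by simp
  have "\<bar>E\<bar> \<le> \<bar>\<bar>X\<bar> - \<bar>norm (col_map w)\<bar>\<bar>" unfolding E_def \<psi>_def phase_norm col_phase_def by (rule sqrt_one_plus_lipschitz)
  then have E1: "\<bar>E\<bar> \<le> 1" using col_map_norm_bounds[of w] Y unfolding xy by linarith
  have g: "spiral_fun (col_map w) = (X - Y) * sin E + Y * cos E"
    unfolding spiral_fun_def \<psi>_def[symmetric] E_def sin_diff cos_diff unfolding col_map_def xy by (simp add: algebra_simps)
  have "0 \<le> Y * (X - Y) * sin E"
  proof -
    have "2 * (Y * (X - Y) * sin E) = (E * sin E) * (col_phase X + \<psi>)" using EP by algebra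
    also have "\<dots> \<ge> 0" using sin_cos_small(1)[OF E1] pos by simp
    finally show ?thesis by linarith
  qed
  moreover have "0 < Y\<^sup>2 * cos E" using Y(2) sin_cos_small(4)[OF E1] by (cases "E = 0") auto
  ultimately show ?thesis unfolding g xy(2)[symmetric] by (simp add: algebra_simps power2_eq_square)
qed

lemma spiral_fun_col_map_zero: "w$2 = 0 \<Longrightarrow> spiral_fun (col_map w) = 0"
proof -
  assume w: "w$2 = 0"
  then have "(norm (col_map w))\<^sup>2 = (w$1)\<^sup>2" using col_map_norm[of w] by simp
  then have "phase (col_map w) = col_phase (w$1)" by (simp add: phase_norm col_phase_def)
  then show ?thesis using w by (simp add: spiral_fun_def) (simp add: col_map_def)
qed

lemma boundary_col_map: "spiral_fun z = 0 \<Longrightarrow> z = col_map (vector [spiral_re z, 0])"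
proof -
  assume z: "spiral_fun z = 0"
  have "phase (vector [spiral_re z, 0] :: pt) = col_phase (spiral_re z)" by (simp add: phase_norm col_phase_def norm_pt)
  then have "twist (vector [spiral_re z, 0]) = col_map (vector [spiral_re z, 0])" by (simp add: twist_def col_map_def)
  then show ?thesis using twist_spiral_re_spiral_fun[of z] z by simp
qed

definition strip :: "real \<Rightarrow> real \<Rightarrow> pt set" where "strip a b = {w. a < w$2 \<and> w$2 < b}"
abbreviation "collar \<equiv> strip (- (1/10)) (1/10)"
abbreviation "col_nbhd \<equiv> col_map ` collar"
definition col_inv :: "pt \<Rightarrow> pt" where "col_inv = inv_into collar col_map"

lemma open_strip: "open (strip a b)"
proof -
  have "strip a b = {w. a < w$2} \<inter> {w. w$2 < b}" by (auto simp: strip_def)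
  then show ?thesis by (simp add: open_Int open_Collect_less continuous_intros)
qed

lemma collar_abs: "w \<in> collar \<Longrightarrow> \<bar>w$2\<bar> \<le> 1/10" by (auto simp: strip_def)

lemma col_map_inj_collar: "inj_on col_map collar"
  using inj_on_subset[OF col_map_inj] collar_abs by blast

lemma continuous_on_col_map: "continuous_on S col_map"
  by (rule has_derivative_continuous_on) (rule col_map_has_derivative)

lemma col_inv_col_map: "w \<in> collar \<Longrightarrow> col_inv (col_map w) = w"
  unfolding col_inv_def by (rule inv_into_f_f[OF col_map_inj_collar])

lemma col_map_col_inv: "z \<in> col_nbhd \<Longrightarrow> col_map (col_inv z) = z" and col_inv_mem: "z \<in> col_nbhd \<Longrightarrow> col_inv z \<in> collar"
  unfolding col_inv_def by (auto intro: f_inv_into_f inv_into_into)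

lemma open_col_map_image: "open S \<Longrightarrow> S \<subseteq> collar \<Longrightarrow> open (col_map ` S)"
  by (rule invariance_of_domain[OF continuous_on_col_map _ inj_on_subset[OF col_map_inj_collar]])

lemma open_col_nbhd: "open col_nbhd" by (rule open_col_map_image[OF open_strip]) auto

lemma continuous_on_col_inv: "continuous_on col_nbhd col_inv"
proof -
  obtain g where "homeomorphism collar col_nbhd col_map g"
    by (rule invariance_of_domain_homeomorphism[OF open_strip continuous_on_col_map _ col_map_inj_collar]) auto
  then have "continuous_on col_nbhd g" "\<And>w. w \<in> collar \<Longrightarrow> g (col_map w) = w" by (auto simp: homeomorphism_def)
  then show ?thesis using col_inv_col_map by (auto elim!: continuous_on_cong[THEN iffD1, rotated -1])
qed

lemma col_inv_has_derivative:
  assumes w: "w \<in> collar"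
  shows "(col_inv has_derivative (\<lambda>v. vector [(TY2 w * v$1 - TY1 w * v$2) / col_jac w, (TX1 w * v$2 - TX2 w * v$1) / col_jac w])) (at (col_map w))"
proof (rule has_derivative_inverse_dieudonne[OF open_strip open_col_nbhd continuous_on_col_map continuous_on_col_inv col_inv_col_map w col_map_has_derivative])
  let ?g = "\<lambda>v::pt. vector [(TY2 w * v$1 - TY1 w * v$2) / col_jac w, (TX1 w * v$2 - TX2 w * v$1) / col_jac w] :: pt"
  have J: "col_jac w \<noteq> 0" using col_jac_bounds(3)[OF collar_abs[OF w]] by simp
  have "((\<lambda>v::pt. vector [(TY2 w * v$1 - TY1 w * v$2) / col_jac w, (TX1 w * v$2 - TX2 w * v$1) / col_jac w] :: pt) has_derivative ?g) (at 0)"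
    by (rule has_derivative_vector2; use J in \<open>auto intro!: derivative_eq_intros vec_nth_has_derivative\<close>)
  then show "bounded_linear ?g" by (rule has_derivative_bounded_linear)
  show "?g \<circ> (\<lambda>h. vector [TX1 w * h$1 + TY1 w * h$2, TX2 w * h$1 + TY2 w * h$2]) = id"
  proof
    fix h :: pt
    have "TY2 w * (TX1 w * h$1 + TY1 w * h$2) - TY1 w * (TX2 w * h$1 + TY2 w * h$2) = col_jac w * h$1"
      "TX1 w * (TX2 w * h$1 + TY2 w * h$2) - TX2 w * (TX1 w * h$1 + TY1 w * h$2) = col_jac w * h$2"
      unfolding col_jac_eq[symmetric] by algebra+
    then show "(?g \<circ> (\<lambda>h. vector [TX1 w * h$1 + TY1 w * h$2, TX2 w * h$1 + TY2 w * h$2])) h = id h"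
      using J by (simp add: vec_eq_iff forall_2)
  qed
qed

lemma closed_col_map_strip:
  assumes "a \<le> 1/10" shows "closed (col_map ` {w. \<bar>w$2\<bar> \<le> a})"
  unfolding closed_sequential_limits
proof (intro allI impI, elim conjE)
  fix z l assume z: "\<forall>n::nat. z n \<in> col_map ` {w. \<bar>w$2\<bar> \<le> a}" and l: "z \<longlonglongrightarrow> l"
  obtain r where r: "\<And>n. norm (z n) \<le> r" using convergent_imp_bounded[OF l] by (auto simp: bounded_iff)
  let ?C = "{w::pt. \<bar>w$2\<bar> \<le> a} \<inter> cball 0 (r + 1)"
  have "z n \<in> col_map ` ?C" for n
  proof -
    obtain w where w: "\<bar>w$2\<bar> \<le> a" "z n = col_map w" using z by auto
    have "norm w \<le> \<bar>w$1\<bar> + \<bar>w$2\<bar>" using norm_le_l1_cart[of w] by (simp add: UNIV_2)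
    also have "\<dots> \<le> r + 1" using col_map_norm_bounds(1)[of w] r[of n] w assms by simp
    finally show ?thesis using w by auto
  qed
  moreover have "closed (col_map ` ?C)"
    by (intro compact_imp_closed compact_continuous_image continuous_on_col_map closed_Int_compact closed_Collect_le continuous_intros) auto
  ultimately have "l \<in> col_map ` ?C" using l closed_sequentially by metis
  then show "l \<in> col_map ` {w. \<bar>w$2\<bar> \<le> a}" by auto
qed

section \<open>Chain rules\<close>

lemma C1cD: "C1c S \<phi> G \<Longrightarrow> (\<phi> has_derivative (\<lambda>h. G x \<bullet> h)) (at x)"
  by (simp add: C1c_def)

lemma C1c_extend:
  assumes S: "open S" and K: "compact K" "K \<subseteq> S"
    and d: "\<And>x. x \<in> S \<Longrightarrow> (h has_derivative (\<lambda>v. G x \<bullet> v)) (at x)" and c: "continuous_on S G"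
    and z: "\<And>x. x \<in> S \<Longrightarrow> x \<notin> K \<Longrightarrow> h x = 0"
  shows "C1c S (\<lambda>x. if x \<in> S then h x else 0) (\<lambda>x. if x \<in> S then G x else 0)"
proof -
  let ?h = "\<lambda>x. if x \<in> S then h x else 0" and ?G = "\<lambda>x. if x \<in> S then G x else 0"
  have clK: "closed K" using K(1) compact_imp_closed by auto
  have h0: "?h x = 0" if "x \<notin> K" for x using z that by auto
  have dS: "(?h has_derivative (\<lambda>v. ?G x \<bullet> v)) (at x)" if "x \<in> S" for x
    using that by (auto intro!: has_derivative_transform_within_open[OF d[OF that] S that])
  have d0: "(?h has_derivative (\<lambda>v. 0)) (at x)" if "x \<notin> K" for x
    by (rule has_derivative_transform_within_open[OF has_derivative_const[of 0], of "- K"]) (use clK that h0 in auto)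
  have G0: "?G x = 0" if "x \<notin> K" for x
  proof (cases "x \<in> S")
    case True
    then show ?thesis using gradient_zero_off_closed_support[OF clK h0 dS[OF True] that] by simp
  qed simp
  have "(?h has_derivative (\<lambda>v. ?G x \<bullet> v)) (at x)" for x
    using dS[of x] d0[of x] G0[of x] K(2) by (cases "x \<in> S") auto
  moreover have "continuous_on (S \<union> - K) ?G"
  proof (rule continuous_on_open_Un[OF S])
    show "open (- K)" using clK by auto
    show "continuous_on S ?G" by (rule continuous_on_eq[OF c]) simp
    have "continuous_on (- K) (\<lambda>x. 0 :: pt)" by (rule continuous_on_const)
    then show "continuous_on (- K) ?G" by (rule continuous_on_eq) (use G0 in auto)
  qed
  moreover have "S \<union> - K = UNIV" using K(2) by auto
  ultimately show ?thesis unfolding C1c_def using K h0 by (intro conjI allI exI[of _ K]) auto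
qed

lemma C1c_mult:
  assumes S: "open S" and p: "C1c S p G"
    and d: "\<And>x. x \<in> S \<Longrightarrow> (q has_derivative (\<lambda>v. Q x \<bullet> v)) (at x)" and c: "continuous_on S Q"
  shows "C1c S (\<lambda>x. p x * q x) (\<lambda>x. if x \<in> S then p x *\<^sub>R Q x + q x *\<^sub>R G x else 0)"
proof -
  obtain K where K: "compact K" "K \<subseteq> S" "\<And>x. x \<notin> K \<Longrightarrow> p x = 0" "\<And>x. x \<notin> K \<Longrightarrow> G x = 0"
    by (rule C1c_support[OF p], rule that)
  have cq: "continuous_on S q" using d by (meson continuous_at_imp_continuous_on has_derivative_continuous)
  have "C1c S (\<lambda>x. if x \<in> S then p x * q x else 0) (\<lambda>x. if x \<in> S then p x *\<^sub>R Q x + q x *\<^sub>R G x else 0)"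
  proof (rule C1c_extend[OF S K(1,2)])
    show "((\<lambda>x. p x * q x) has_derivative (\<lambda>v. (p x *\<^sub>R Q x + q x *\<^sub>R G x) \<bullet> v)) (at x)" if "x \<in> S" for x
      by (rule has_derivative_eq_rhs[OF has_derivative_mult[OF C1cD[OF p] d[OF that]]]) (auto simp: inner_add_left algebra_simps)
    show "continuous_on S (\<lambda>x. p x *\<^sub>R Q x + q x *\<^sub>R G x)"
      by (intro continuous_intros C1c_continuous[OF p] c cq)
  qed (use K in auto)
  moreover have "(\<lambda>x. if x \<in> S then p x * q x else 0) = (\<lambda>x. p x * q x)" using K by (auto simp: fun_eq_iff)
  ultimately show ?thesis by simp
qed

definition col_phase2 :: "real \<Rightarrow> real" where "col_phase2 X = 1 / col_phase X - (col_phase1 X)\<^sup>2 / col_phase X"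

lemma continuous_on_col_phase [continuous_intros]: "continuous_on S f \<Longrightarrow> continuous_on S (\<lambda>x. col_phase (f x))"
  unfolding col_phase_def by (intro continuous_intros)
lemma continuous_on_col_phase1 [continuous_intros]: "continuous_on S f \<Longrightarrow> continuous_on S (\<lambda>x. col_phase1 (f x))"
  unfolding col_phase1_def by (intro continuous_intros) (auto simp: col_phase_nz)
lemma continuous_on_col_phase2 [continuous_intros]: "continuous_on S f \<Longrightarrow> continuous_on S (\<lambda>x. col_phase2 (f x))"
  unfolding col_phase2_def by (intro continuous_intros) (auto simp: col_phase_nz)

lemma continuous_on_T [continuous_intros]:
  "continuous_on S TX1" "continuous_on S TX2" "continuous_on S TY1" "continuous_on S TY2" "continuous_on S col_jac"
  unfolding TX1_def[abs_def] TX2_def[abs_def] TY1_def[abs_def] TY2_def[abs_def] col_jac_def[abs_def]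
  by (intro continuous_intros)+

definition GTX1 :: "pt \<Rightarrow> pt" where "GTX1 w = vector [
  - col_phase2 (w$1) * w$2 * cos (col_phase (w$1)) - (1 - col_phase1 (w$1) * w$2) * (col_phase1 (w$1) * sin (col_phase (w$1)))
  - col_phase2 (w$1) * (w$1 - w$2) * sin (col_phase (w$1)) - col_phase1 (w$1) * sin (col_phase (w$1)) - col_phase1 (w$1) * (w$1 - w$2) * (col_phase1 (w$1) * cos (col_phase (w$1))),
  col_phase1 (w$1) * (sin (col_phase (w$1)) - cos (col_phase (w$1)))]"
definition GTX2 :: "pt \<Rightarrow> pt" where "GTX2 w = vector [
  - col_phase2 (w$1) * w$2 * sin (col_phase (w$1)) + (1 - col_phase1 (w$1) * w$2) * (col_phase1 (w$1) * cos (col_phase (w$1)))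
  + col_phase2 (w$1) * (w$1 - w$2) * cos (col_phase (w$1)) + col_phase1 (w$1) * cos (col_phase (w$1)) - col_phase1 (w$1) * (w$1 - w$2) * (col_phase1 (w$1) * sin (col_phase (w$1))),
  - col_phase1 (w$1) * (sin (col_phase (w$1)) + cos (col_phase (w$1)))]"
definition GTY1 :: "pt \<Rightarrow> pt" where "GTY1 w = vector [col_phase1 (w$1) * (sin (col_phase (w$1)) - cos (col_phase (w$1))), 0]"
definition GTY2 :: "pt \<Rightarrow> pt" where "GTY2 w = vector [- col_phase1 (w$1) * (sin (col_phase (w$1)) + cos (col_phase (w$1))), 0]"
definition GJ :: "pt \<Rightarrow> pt" where
  "GJ w = TX1 w *\<^sub>R GTY2 w + TY2 w *\<^sub>R GTX1 w - (TX2 w *\<^sub>R GTY1 w + TY1 w *\<^sub>R GTX2 w)"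

lemma T_derivs:
  "(TX1 has_derivative (\<lambda>h. GTX1 w \<bullet> h)) (at w)" "(TX2 has_derivative (\<lambda>h. GTX2 w \<bullet> h)) (at w)"
  "(TY1 has_derivative (\<lambda>h. GTY1 w \<bullet> h)) (at w)" "(TY2 has_derivative (\<lambda>h. GTY2 w \<bullet> h)) (at w)"
  unfolding TX1_def[abs_def] TX2_def[abs_def] TY1_def[abs_def] TY2_def[abs_def] GTX1_def GTX2_def GTY1_def GTY2_def inner_pt
  by (auto intro!: derivative_eq_intros vec_nth_has_derivative col_phase_has_derivative col_phase1_has_derivative[folded col_phase2_def] simp: algebra_simps)

lemma J_deriv: "(col_jac has_derivative (\<lambda>h. GJ w \<bullet> h)) (at w)"
  unfolding col_jac_eq[symmetric, abs_def] GJ_def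
  by (rule has_derivative_eq_rhs[OF has_derivative_diff[OF has_derivative_mult[OF T_derivs(1,4)] has_derivative_mult[OF T_derivs(2,3)]]])
     (auto simp: inner_add_left inner_diff_left algebra_simps)

lemma continuous_on_GT:
  "continuous_on S GTX1" "continuous_on S GTX2" "continuous_on S GTY1" "continuous_on S GTY2"
  unfolding GTX1_def[abs_def] GTX2_def[abs_def] GTY1_def[abs_def] GTY2_def[abs_def]
  by (intro continuous_on_vector2 continuous_intros)+

lemma continuous_on_GJ: "continuous_on S GJ"
  unfolding GJ_def[abs_def] by (intro continuous_intros continuous_on_GT)

lemma mixed_partials: "GTX1 w $ 2 = GTY1 w $ 1" "GTX2 w $ 2 = GTY2 w $ 1"
  by (simp_all add: GTX1_def GTX2_def GTY1_def GTY2_def)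

lemma col_jac_pos: "w \<in> collar \<Longrightarrow> 0 < col_jac w" using col_jac_bounds(3)[OF collar_abs] .

text \<open>Test functions are transported in both directions, so that weak derivatives can be computed in collar coordinates.\<close>
lemma push_C1c:
  assumes S: "open S" "S \<subseteq> collar" and p: "C1c S p G"
  shows "C1c (col_map ` S) (\<lambda>z. if z \<in> col_map ` S then p (col_inv z) else 0)
    (\<lambda>z. if z \<in> col_map ` S then (let w = col_inv z in vector [(G w $ 1 * TY2 w - G w $ 2 * TX2 w) / col_jac w, (G w $ 2 * TX1 w - G w $ 1 * TY1 w) / col_jac w]) else 0)"
proof -
  obtain K where K: "compact K" "K \<subseteq> S" "\<And>x. x \<notin> K \<Longrightarrow> p x = 0" "\<And>x. x \<notin> K \<Longrightarrow> G x = 0"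
    by (rule C1c_support[OF p], rule that)
  have sub: "col_map ` S \<subseteq> col_nbhd" using S(2) by auto
  have cI: "continuous_on (col_map ` S) col_inv" by (rule continuous_on_subset[OF continuous_on_col_inv sub])
  have Iim: "col_inv ` col_map ` S \<subseteq> S" using col_inv_col_map S(2) by auto
  show ?thesis
  proof (rule C1c_extend)
    show "open (col_map ` S)" by (rule open_col_map_image[OF S])
    show "compact (col_map ` K)" by (rule compact_continuous_image[OF continuous_on_col_map K(1)])
    show "col_map ` K \<subseteq> col_map ` S" using K(2) by auto
    fix z assume "z \<in> col_map ` S"
    then obtain w where w: "w \<in> S" "z = col_map w" by auto
    then have wc: "w \<in> collar" using S by auto
    have Iz: "col_inv z = w" using w col_inv_col_map[OF wc] by simp
    have "(p has_derivative (\<lambda>h. G w \<bullet> h)) (at (col_inv (col_map w)))" using C1cD[OF p] col_inv_col_map[OF wc] by simp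
    from has_derivative_compose[OF col_inv_has_derivative[OF wc] this]
    show "((\<lambda>z. p (col_inv z)) has_derivative (\<lambda>v. (let w = col_inv z in vector [(G w $ 1 * TY2 w - G w $ 2 * TX2 w) / col_jac w, (G w $ 2 * TX1 w - G w $ 1 * TY1 w) / col_jac w]) \<bullet> v)) (at z)"
      unfolding w(2)[symmetric] by (rule has_derivative_eq_rhs) (use col_jac_pos[OF wc] in \<open>auto simp: Iz inner_pt field_simps\<close>)
    show "p (col_inv z) = 0" if "z \<notin> col_map ` K" using that w Iz K(3) by auto
  next
    have nz: "col_jac (col_inv z) \<noteq> 0" if "z \<in> col_map ` S" for z using col_jac_pos[OF col_inv_mem[OF subsetD[OF sub that]]] by simp
    have c: "continuous_on (col_map ` S) (\<lambda>z. f (col_inv z))" if "continuous_on UNIV f" for f :: "pt \<Rightarrow> real"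
      by (rule continuous_on_compose2[OF that cI]) auto
    have cG: "continuous_on UNIV (\<lambda>w. G w $ i)" for i by (intro continuous_intros C1c_continuous[OF p])
    show "continuous_on (col_map ` S) (\<lambda>z. let w = col_inv z in vector [(G w $ 1 * TY2 w - G w $ 2 * TX2 w) / col_jac w, (G w $ 2 * TX1 w - G w $ 1 * TY1 w) / col_jac w] :: pt)"
      unfolding Let_def
      by (rule continuous_on_vector2; intro continuous_on_divide continuous_on_diff continuous_on_mult ballI nz
            c[OF cG] c[OF continuous_on_T(1)] c[OF continuous_on_T(2)] c[OF continuous_on_T(3)] c[OF continuous_on_T(4)] c[OF continuous_on_T(5)];
          assumption)
  qed
qed

lemma pull_C1c:
  assumes S: "open S" "S \<subseteq> collar" and p: "C1c (col_map ` S) \<phi> G"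
  shows "C1c S (\<lambda>w. if w \<in> S then \<phi> (col_map w) else 0)
    (\<lambda>w. if w \<in> S then (vector [G (col_map w) $ 1 * TX1 w + G (col_map w) $ 2 * TX2 w, G (col_map w) $ 1 * TY1 w + G (col_map w) $ 2 * TY2 w]) else 0)"
proof -
  obtain K where K: "compact K" "K \<subseteq> col_map ` S" "\<And>x. x \<notin> K \<Longrightarrow> \<phi> x = 0" "\<And>x. x \<notin> K \<Longrightarrow> G x = 0"
    by (rule C1c_support[OF p], rule that)
  have sub: "col_map ` S \<subseteq> col_nbhd" using S(2) by auto
  have cI: "continuous_on K col_inv" by (rule continuous_on_subset[OF continuous_on_col_inv order_trans[OF K(2) sub]])
  show ?thesis
  proof (rule C1c_extend[OF S(1)])
    show "compact (col_inv ` K)" by (rule compact_continuous_image[OF cI K(1)])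
    show "col_inv ` K \<subseteq> S" using col_inv_col_map S(2) K(2) by fastforce
    fix w assume w: "w \<in> S"
    from has_derivative_compose[OF col_map_has_derivative[of w UNIV] C1cD[OF p]]
    show "((\<lambda>w. \<phi> (col_map w)) has_derivative (\<lambda>v. vector [G (col_map w) $ 1 * TX1 w + G (col_map w) $ 2 * TX2 w, G (col_map w) $ 1 * TY1 w + G (col_map w) $ 2 * TY2 w] \<bullet> v)) (at w)"
      by (rule has_derivative_eq_rhs) (auto simp: inner_pt algebra_simps)
    show "\<phi> (col_map w) = 0" if "w \<notin> col_inv ` K"
    proof (rule K(3))
      show "col_map w \<notin> K" using that col_inv_col_map[of w] w S(2) by force
    qed
  next
    have cG: "continuous_on S (\<lambda>w. G (col_map w) $ i)" for i
      by (intro continuous_intros continuous_on_compose2[OF C1c_continuous(2)[OF p, of UNIV] continuous_on_col_map]) auto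
    show "continuous_on S (\<lambda>w. vector [G (col_map w) $ 1 * TX1 w + G (col_map w) $ 2 * TX2 w, G (col_map w) $ 1 * TY1 w + G (col_map w) $ 2 * TY2 w] :: pt)"
      by (intro continuous_on_vector2 continuous_on_add continuous_on_mult cG continuous_on_T)
  qed
qed

lemma col_map_integral:
  assumes S: "S \<in> sets lebesgue" "S \<subseteq> collar"
  shows "(\<lambda>w. col_jac w * f (col_map w)) absolutely_integrable_on S \<longleftrightarrow> f absolutely_integrable_on (col_map ` S)"
    and "f absolutely_integrable_on (col_map ` S) \<Longrightarrow> integral (col_map ` S) f = integral S (\<lambda>w. col_jac w * f (col_map w))"
proof -
  let ?g' = "\<lambda>w h. vector [TX1 w * h$1 + TY1 w * h$2, TX2 w * h$1 + TY2 w * h$2] :: pt"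
  have det: "\<bar>det (matrix (?g' w))\<bar> = col_jac w" if "w \<in> S" for w
  proof -
    have "det (matrix (?g' w)) = col_jac w" unfolding col_jac_eq[symmetric] det_2 by (simp add: matrix_def axis_def)
    then show ?thesis using col_jac_pos[OF subsetD[OF S(2) that]] by simp
  qed
  have e: "(\<lambda>w. \<bar>det (matrix (?g' w))\<bar> * f (col_map w)) absolutely_integrable_on S \<longleftrightarrow> (\<lambda>w. col_jac w * f (col_map w)) absolutely_integrable_on S"
    "integral S (\<lambda>w. \<bar>det (matrix (?g' w))\<bar> * f (col_map w)) = integral S (\<lambda>w. col_jac w * f (col_map w))"
    by (intro set_integrable_cong refl; simp add: det) (intro integral_cong; simp add: det)
  note cv = change_of_variables_real[OF S(1) col_map_has_derivative inj_on_subset[OF col_map_inj_collar S(2)], of f, unfolded e]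
  show "(\<lambda>w. col_jac w * f (col_map w)) absolutely_integrable_on S \<longleftrightarrow> f absolutely_integrable_on (col_map ` S)" using cv by blast
  show "f absolutely_integrable_on (col_map ` S) \<Longrightarrow> integral (col_map ` S) f = integral S (\<lambda>w. col_jac w * f (col_map w))" using cv by blast
qed

lemma loc_int_col_map:
  assumes S: "open S" "S \<subseteq> collar" and f: "loc_int (col_map ` S) f"
  shows "loc_int S (\<lambda>w. f (col_map w))"
  unfolding loc_int_def
proof
  fix r
  let ?A = "S \<inter> cball 0 r"
  have A: "?A \<in> sets lebesgue" using S by (intro sets.Int) auto
  have AS: "?A \<subseteq> collar" using S by auto
  have "bounded (col_map ` cball 0 r)"
    by (intro compact_imp_bounded compact_continuous_image continuous_on_col_map) auto
  then obtain R where R: "\<And>z. z \<in> col_map ` cball 0 r \<Longrightarrow> norm z \<le> R" by (auto simp: bounded_iff)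
  have Am: "col_map ` ?A \<in> sets lebesgue"
  proof -
    have "col_map differentiable_on ?A" unfolding differentiable_on_def differentiable_def using col_map_has_derivative by blast
    then show ?thesis by (rule differentiable_image_in_sets_lebesgue[OF A order_refl])
  qed
  have "f absolutely_integrable_on (col_map ` S \<inter> cball 0 R)" using f by (simp add: loc_int_def)
  then have "f absolutely_integrable_on (col_map ` ?A)"
    by (rule set_integrable_subset) (use R Am in auto)
  then have i: "(\<lambda>w. col_jac w * f (col_map w)) absolutely_integrable_on ?A" using col_map_integral(1)[OF A AS] by blast
  have Jb: "1/2 \<le> col_jac w" if "w \<in> ?A" for w using col_jac_bounds(1)[OF collar_abs, of w] col_phase_ge1[of "w$1"] that S by auto
  have "(\<lambda>w. (col_jac w * f (col_map w)) * (1 / col_jac w)) absolutely_integrable_on ?A"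
  proof (rule absolutely_integrable_mult_bounded[OF i A])
    show "continuous_on ?A (\<lambda>w. 1 / col_jac w)" by (intro continuous_intros) (use Jb in force)
    have "\<bar>1 / col_jac w\<bar> \<le> 2" if "w \<in> ?A" for w using Jb[OF that] by (simp add: field_simps)
    then show "bounded ((\<lambda>w. 1 / col_jac w) ` ?A)" by (auto simp: bounded_iff intro!: exI[of _ 2])
  qed
  then show "(\<lambda>w. f (col_map w)) absolutely_integrable_on ?A"
    by (rule set_integrable_cong[THEN iffD1, rotated -1]) (use Jb in \<open>force+\<close>)
qed

lemma chain_rule_down:
  assumes S: "open S" "S \<subseteq> collar" and w: "weak_grad (col_map ` S) f g"
    and f: "loc_int (col_map ` S) f" and g: "\<And>i. loc_int (col_map ` S) (g i)"
  shows "weak_grad S (\<lambda>w. f (col_map w)) (\<lambda>m w. if m = 1 then g 1 (col_map w) * TX1 w + g 2 (col_map w) * TX2 w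
      else g 1 (col_map w) * TY1 w + g 2 (col_map w) * TY2 w)"
  unfolding weak_grad_def
proof (intro allI impI)
  fix h Gh and m :: 2 assume h: "C1c S h Gh"
  have Sm: "S \<in> sets lebesgue" using S by auto
  have Wm: "col_map ` S \<in> sets lebesgue" using open_col_map_image[OF S] by auto
  define a1 a2 Ga1 Ga2 where a: "a1 = (if m = 1 then TX1 else TY1)" "a2 = (if m = 1 then TX2 else TY2)"
    "Ga1 = (if m = 1 then GTX1 else GTY1)" "Ga2 = (if m = 1 then GTX2 else GTY2)"
  have ad: "(a1 has_derivative (\<lambda>v. Ga1 x \<bullet> v)) (at x)" "(a2 has_derivative (\<lambda>v. Ga2 x \<bullet> v)) (at x)" for x
    using T_derivs[of x] by (auto simp: a)
  have ac: "continuous_on A Ga1" "continuous_on A Ga2" for A using continuous_on_GT by (auto simp: a)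
  have Jn: "col_jac x \<noteq> 0" if "x \<in> S" for x using col_jac_pos[of x] S(2) that by auto
  define s where "s x = h x * (1 / col_jac x)" for x
  define Gs where "Gs x = (if x \<in> S then h x *\<^sub>R ((- 1 / (col_jac x)\<^sup>2) *\<^sub>R GJ x) + (1 / col_jac x) *\<^sub>R Gh x else 0)" for x
  have s: "C1c S s Gs" unfolding s_def[abs_def] Gs_def[abs_def]
  proof (rule C1c_mult[OF S(1) h])
    show "((\<lambda>x. 1 / col_jac x) has_derivative (\<lambda>v. ((- 1 / (col_jac x)\<^sup>2) *\<^sub>R GJ x) \<bullet> v)) (at x)" if "x \<in> S" for x
      by (rule has_derivative_eq_rhs[OF has_derivative_divide[OF has_derivative_const J_deriv Jn[OF that]]])
         (auto simp: fun_eq_iff divide_inverse power2_eq_square)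
    show "continuous_on S (\<lambda>x. (- 1 / (col_jac x)\<^sup>2) *\<^sub>R GJ x)"
      by (intro continuous_intros continuous_on_GJ) (use Jn in auto)
  qed
  have sJ: "col_jac x * (Gs x $ i) + s x * (GJ x $ i) = Gh x $ i" if "x \<in> S" for x i
    using Jn[OF that] that by (simp add: Gs_def s_def field_simps power2_eq_square)
  have p: "C1c S (\<lambda>x. s x * a1 x) (\<lambda>x. if x \<in> S then s x *\<^sub>R Ga1 x + a1 x *\<^sub>R Gs x else 0)"
     "C1c S (\<lambda>x. s x * a2 x) (\<lambda>x. if x \<in> S then s x *\<^sub>R Ga2 x + a2 x *\<^sub>R Gs x else 0)"
    by (rule C1c_mult[OF S(1) s ad(1) ac(1)], rule C1c_mult[OF S(1) s ad(2) ac(2)])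
  note P = push_C1c[OF S p(1)] push_C1c[OF S p(2)]
  have tr: "integral (col_map ` S) F = integral S (\<lambda>w. col_jac w * F (col_map w))" if "F absolutely_integrable_on (col_map ` S)" for F :: "pt \<Rightarrow> real"
    by (rule col_map_integral(2)[OF Sm S(2) that])
  have tri: "(\<lambda>w. col_jac w * F (col_map w)) absolutely_integrable_on S" if "F absolutely_integrable_on (col_map ` S)" for F :: "pt \<Rightarrow> real"
    using col_map_integral(1)[OF Sm S(2)] that by blast
  let ?P1 = "\<lambda>z. if z \<in> col_map ` S then s (col_inv z) * a1 (col_inv z) else 0"
  let ?P2 = "\<lambda>z. if z \<in> col_map ` S then s (col_inv z) * a2 (col_inv z) else 0"
  define G1 where "G1 x = (if x \<in> S then s x *\<^sub>R Ga1 x + a1 x *\<^sub>R Gs x else 0)" for x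
  define G2 where "G2 x = (if x \<in> S then s x *\<^sub>R Ga2 x + a2 x *\<^sub>R Gs x else 0)" for x
  define D1 where "D1 z = (if z \<in> col_map ` S then (let w = col_inv z in vector [(G1 w $ 1 * TY2 w - G1 w $ 2 * TX2 w) / col_jac w, (G1 w $ 2 * TX1 w - G1 w $ 1 * TY1 w) / col_jac w]) else 0 :: pt)" for z
  define D2 where "D2 z = (if z \<in> col_map ` S then (let w = col_inv z in vector [(G2 w $ 1 * TY2 w - G2 w $ 2 * TX2 w) / col_jac w, (G2 w $ 2 * TX1 w - G2 w $ 1 * TY1 w) / col_jac w]) else 0 :: pt)" for z
  have P1: "C1c (col_map ` S) ?P1 D1" and P2: "C1c (col_map ` S) ?P2 D2"
    using P unfolding D1_def[abs_def] D2_def[abs_def] G1_def[abs_def] G2_def[abs_def] by auto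
  have e1: "integral (col_map ` S) (\<lambda>x. f x * D1 x $ 1) = - integral (col_map ` S) (\<lambda>x. g 1 x * ?P1 x)"
    and e2: "integral (col_map ` S) (\<lambda>x. f x * D2 x $ 2) = - integral (col_map ` S) (\<lambda>x. g 2 x * ?P2 x)"
    using w P1 P2 unfolding weak_grad_def by blast+
  note ints = C1c_integrable(2)[OF P1 f Wm, of 1] C1c_integrable(2)[OF P2 f Wm, of 2]
    C1c_integrable(1)[OF P1 g Wm, of 1] C1c_integrable(1)[OF P2 g Wm, of 2]
  have hk: "F integrable_on S" if "F absolutely_integrable_on S" for F :: "pt \<Rightarrow> real" using set_lebesgue_integral_eq_integral(1)[OF that] .
  have L: "integral S (\<lambda>w. f (col_map w) * Gh w $ m) = integral (col_map ` S) (\<lambda>x. f x * D1 x $ 1) + integral (col_map ` S) (\<lambda>x. f x * D2 x $ 2)"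
    unfolding tr[OF ints(1)] tr[OF ints(2)] integral_add[OF hk[OF tri[OF ints(1)]] hk[OF tri[OF ints(2)]], symmetric]
  proof (rule integral_cong)
    fix x assume x: "x \<in> S"
    then have Ix: "col_inv (col_map x) = x" using col_inv_col_map S by auto
    have xT: "col_map x \<in> col_map ` S" using x by simp
    have d1: "col_jac x * D1 (col_map x) $ 1 = G1 x $ 1 * TY2 x - G1 x $ 2 * TX2 x" using xT Jn[OF x] by (simp add: D1_def Ix Let_def)
    have d2: "col_jac x * D2 (col_map x) $ 2 = G2 x $ 2 * TX1 x - G2 x $ 1 * TY1 x" using xT Jn[OF x] by (simp add: D2_def Ix Let_def)
    have "col_jac x * D1 (col_map x) $ 1 + col_jac x * D2 (col_map x) $ 2 = Gh x $ m"
    proof (cases "m = 1")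
      case True
      have "Gh x $ 1 = (TX1 x * TY2 x - TX2 x * TY1 x) * Gs x $ 1 + s x * GJ x $ 1" using sJ[OF x, of 1] col_jac_eq[of x] by simp
      then show ?thesis using True x mixed_partials[of x] unfolding d1 d2 
        by (simp add: G1_def G2_def a GJ_def algebra_simps)
    next
      case False
      then have m2: "m = 2" using exhaust_2[of m] by auto
      have "Gh x $ 2 = (TX1 x * TY2 x - TX2 x * TY1 x) * Gs x $ 2 + s x * GJ x $ 2" using sJ[OF x, of 2] col_jac_eq[of x] by simp
      then show ?thesis using m2 x mixed_partials[of x] unfolding d1 d2 
        by (simp add: G1_def G2_def a GJ_def algebra_simps)
    qed
    then have "f (col_map x) * Gh x $ m = f (col_map x) * (col_jac x * D1 (col_map x) $ 1 + col_jac x * D2 (col_map x) $ 2)" by simp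
    then show "f (col_map x) * Gh x $ m = col_jac x * (f (col_map x) * D1 (col_map x) $ 1) + col_jac x * (f (col_map x) * D2 (col_map x) $ 2)"
      by (simp add: algebra_simps)
  qed
  have R: "integral S (\<lambda>w. (if m = 1 then g 1 (col_map w) * TX1 w + g 2 (col_map w) * TX2 w else g 1 (col_map w) * TY1 w + g 2 (col_map w) * TY2 w) * h w)
    = integral (col_map ` S) (\<lambda>x. g 1 x * ?P1 x) + integral (col_map ` S) (\<lambda>x. g 2 x * ?P2 x)"
    unfolding tr[OF ints(3)] tr[OF ints(4)] integral_add[OF hk[OF tri[OF ints(3)]] hk[OF tri[OF ints(4)]], symmetric]
  proof (rule integral_cong)
    fix x assume x: "x \<in> S"
    then have Ix: "col_inv (col_map x) = x" using col_inv_col_map S by auto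
    have hs: "h x = col_jac x * s x" using Jn[OF x] by (simp add: s_def)
    show "(if m = 1 then g 1 (col_map x) * TX1 x + g 2 (col_map x) * TX2 x else g 1 (col_map x) * TY1 x + g 2 (col_map x) * TY2 x) * h x
      = col_jac x * (g 1 (col_map x) * ?P1 (col_map x)) + col_jac x * (g 2 (col_map x) * ?P2 (col_map x))"
      using x by (simp add: Ix hs a algebra_simps)
  qed
  show "integral S (\<lambda>x. f (col_map x) * Gh x $ m) = - integral S (\<lambda>x. (if m = 1 then g 1 (col_map x) * TX1 x + g 2 (col_map x) * TX2 x
      else g 1 (col_map x) * TY1 x + g 2 (col_map x) * TY2 x) * h x)"
    unfolding L R e1 e2 by simp
qed

lemma negligible_axis: "negligible {w::pt. w$2 = 0}"
proof -
  have "{w::pt. w$2 = 0} = {w. w \<bullet> axis 2 1 = 0}" by (auto simp: inner_axis)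
  then show ?thesis using negligible_standard_hyperplane[of "axis 2 1 :: pt" 0] by (simp add: axis_in_Basis_iff)
qed

lemma chain_rule_up:
  assumes w: "weak_grad collar (\<lambda>w. f (col_map w)) G"
    and f: "loc_int col_nbhd f" "\<And>i. loc_int col_nbhd (g i)"
    and F: "loc_int collar (\<lambda>w. f (col_map w))" "\<And>i. loc_int collar (G i)"
    and G: "\<And>w. w \<in> collar \<Longrightarrow> w$2 \<noteq> 0 \<Longrightarrow> G 1 w = g 1 (col_map w) * TX1 w + g 2 (col_map w) * TX2 w"
      "\<And>w. w \<in> collar \<Longrightarrow> w$2 \<noteq> 0 \<Longrightarrow> G 2 w = g 1 (col_map w) * TY1 w + g 2 (col_map w) * TY2 w"
  shows "weak_grad col_nbhd f g"
  unfolding weak_grad_def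
proof (intro allI impI)
  fix \<phi> H and i :: 2 assume \<phi>: "C1c col_nbhd \<phi> H"
  let ?S = "collar"
  have S: "open ?S" "?S \<subseteq> collar" using open_strip by auto
  have Sm: "?S \<in> sets lebesgue" using S by auto
  have Wm: "col_nbhd \<in> sets lebesgue" using open_col_nbhd by auto
  define \<Phi> where "\<Phi> w = (if w \<in> ?S then \<phi> (col_map w) else 0)" for w
  define G\<Phi> where "G\<Phi> w = (if w \<in> ?S then (vector [H (col_map w) $ 1 * TX1 w + H (col_map w) $ 2 * TX2 w, H (col_map w) $ 1 * TY1 w + H (col_map w) $ 2 * TY2 w]) else 0 :: pt)" for w
  have \<Phi>: "C1c ?S \<Phi> G\<Phi>" unfolding \<Phi>_def[abs_def] G\<Phi>_def[abs_def] by (rule pull_C1c[OF S \<phi>])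
  define b1 b2 Gb1 Gb2 where b: "b1 = (if i = 1 then TY2 else (\<lambda>w. - TY1 w))" "b2 = (if i = 1 then (\<lambda>w. - TX2 w) else TX1)"
    "Gb1 = (if i = 1 then GTY2 else (\<lambda>w. - GTY1 w))" "Gb2 = (if i = 1 then (\<lambda>w. - GTX2 w) else GTX1)"
  have bd: "(b1 has_derivative (\<lambda>v. Gb1 x \<bullet> v)) (at x)" "(b2 has_derivative (\<lambda>v. Gb2 x \<bullet> v)) (at x)" for x
    using T_derivs[of x] by (auto simp: b intro!: has_derivative_minus)
  have bc: "continuous_on A Gb1" "continuous_on A Gb2" for A using continuous_on_GT by (auto simp: b intro!: continuous_on_minus)
  define D1 where "D1 x = (if x \<in> ?S then \<Phi> x *\<^sub>R Gb1 x + b1 x *\<^sub>R G\<Phi> x else 0)" for x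
  define D2 where "D2 x = (if x \<in> ?S then \<Phi> x *\<^sub>R Gb2 x + b2 x *\<^sub>R G\<Phi> x else 0)" for x
  have P1: "C1c ?S (\<lambda>x. \<Phi> x * b1 x) D1" unfolding D1_def[abs_def] by (rule C1c_mult[OF S(1) \<Phi> bd(1) bc(1)])
  have P2: "C1c ?S (\<lambda>x. \<Phi> x * b2 x) D2" unfolding D2_def[abs_def] by (rule C1c_mult[OF S(1) \<Phi> bd(2) bc(2)])
  have e1: "integral ?S (\<lambda>x. f (col_map x) * D1 x $ 1) = - integral ?S (\<lambda>x. G 1 x * (\<Phi> x * b1 x))"
    and e2: "integral ?S (\<lambda>x. f (col_map x) * D2 x $ 2) = - integral ?S (\<lambda>x. G 2 x * (\<Phi> x * b2 x))"
    using w P1 P2 unfolding weak_grad_def by blast+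
  have tr: "integral col_nbhd F = integral ?S (\<lambda>w. col_jac w * F (col_map w))" if "F absolutely_integrable_on col_nbhd" for F :: "pt \<Rightarrow> real"
    by (rule col_map_integral(2)[OF Sm S(2) that])
  have hk: "F integrable_on ?S" if "F absolutely_integrable_on ?S" for F :: "pt \<Rightarrow> real" using set_lebesgue_integral_eq_integral(1)[OF that] .
  have L: "integral col_nbhd (\<lambda>x. f x * H x $ i) = integral ?S (\<lambda>x. f (col_map x) * D1 x $ 1) + integral ?S (\<lambda>x. f (col_map x) * D2 x $ 2)"
    unfolding tr[OF C1c_integrable(2)[OF \<phi> f(1) Wm]]
      integral_add[OF hk[OF C1c_integrable(2)[OF P1 F(1) Sm]] hk[OF C1c_integrable(2)[OF P2 F(1) Sm]], symmetric]
  proof (rule integral_cong)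
    fix x assume x: "x \<in> ?S"
    have "D1 x $ 1 + D2 x $ 2 = col_jac x * H (col_map x) $ i"
      unfolding col_jac_eq[symmetric] using x mixed_partials[of x] exhaust_2[of i]
      by (auto simp: D1_def D2_def b G\<Phi>_def algebra_simps)
    then have "f (col_map x) * (col_jac x * H (col_map x) $ i) = f (col_map x) * (D1 x $ 1 + D2 x $ 2)" by simp
    then show "col_jac x * (f (col_map x) * H (col_map x) $ i) = f (col_map x) * D1 x $ 1 + f (col_map x) * D2 x $ 2" by (simp add: algebra_simps)
  qed
  have R: "integral col_nbhd (\<lambda>x. g i x * \<phi> x) = integral ?S (\<lambda>x. G 1 x * (\<Phi> x * b1 x)) + integral ?S (\<lambda>x. G 2 x * (\<Phi> x * b2 x))"
    unfolding tr[OF C1c_integrable(1)[OF \<phi> f(2) Wm]]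
      integral_add[OF hk[OF C1c_integrable(1)[OF P1 F(2) Sm]] hk[OF C1c_integrable(1)[OF P2 F(2) Sm]], symmetric]
  proof (rule integral_spike[OF negligible_axis])
    fix x assume x: "x \<in> ?S - {w. w$2 = 0}"
    then have "G 1 x * b1 x + G 2 x * b2 x = col_jac x * g i (col_map x)"
      unfolding col_jac_eq[symmetric] using G[of x] exhaust_2[of i] by (auto simp: b algebra_simps)
    then have "(G 1 x * b1 x + G 2 x * b2 x) * \<phi> (col_map x) = col_jac x * g i (col_map x) * \<phi> (col_map x)" by simp
    then show "G 1 x * (\<Phi> x * b1 x) + G 2 x * (\<Phi> x * b2 x) = col_jac x * (g i (col_map x) * \<phi> (col_map x))"
      using x by (simp add: \<Phi>_def algebra_simps)
  qed
  show "integral col_nbhd (\<lambda>x. f x * H x $ i) = - integral col_nbhd (\<lambda>x. g i x * \<phi> x)" unfolding L R e1 e2 by simp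
qed

section \<open>Even reflection\<close>

definition refl2 :: "pt \<Rightarrow> pt" where "refl2 w = vector [w$1, - w$2]"
abbreviation "lower \<equiv> strip (- (1/10)) 0"
abbreviation "upper \<equiv> strip 0 (1/10)"

lemma refl2_nth [simp]: "refl2 w $ 1 = w$1" "refl2 w $ 2 = - w$2" by (simp_all add: refl2_def)
lemma refl2_refl2 [simp]: "refl2 (refl2 w) = w" by (simp add: vec_eq_iff forall_2)
lemma norm_refl2 [simp]: "norm (refl2 w) = norm w" by (simp add: norm_pt)
lemma refl2_has_derivative: "(refl2 has_derivative refl2) (at w within S)"
  unfolding refl2_def[abs_def]
  by (rule has_derivative_vector2) (auto intro!: derivative_eq_intros vec_nth_has_derivative)
lemma continuous_on_refl2 [continuous_intros]: "continuous_on S refl2"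
  by (rule has_derivative_continuous_on) (rule refl2_has_derivative)
lemma inj_refl2: "inj_on refl2 S" by (metis inj_onI refl2_refl2)
lemma refl2_image_lower: "refl2 ` lower = upper" "refl2 ` upper = lower"
proof -
  have "refl2 ` lower \<subseteq> upper" "refl2 ` upper \<subseteq> lower" by (auto simp: strip_def)
  then show "refl2 ` lower = upper" "refl2 ` upper = lower"
    by (auto simp: subset_iff image_iff) (metis refl2_refl2)+
qed

lemma strip_sets: "strip a b \<in> sets lebesgue" using open_strip by auto

lemma refl2_integral:
  fixes f :: "pt \<Rightarrow> real"
  assumes S: "S \<in> sets lebesgue"
  shows "(\<lambda>w. f (refl2 w)) absolutely_integrable_on S \<longleftrightarrow> f absolutely_integrable_on (refl2 ` S)"
    and "f absolutely_integrable_on (refl2 ` S) \<Longrightarrow> integral (refl2 ` S) f = integral S (\<lambda>w. f (refl2 w))"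
proof -
  have d: "\<bar>det (matrix refl2)\<bar> = 1" by (simp add: det_2 matrix_def refl2_def axis_def)
  note cv = change_of_variables_real[OF S refl2_has_derivative inj_refl2, of f, unfolded d, simplified]
  show "(\<lambda>w. f (refl2 w)) absolutely_integrable_on S \<longleftrightarrow> f absolutely_integrable_on (refl2 ` S)" using cv by blast
  show "f absolutely_integrable_on (refl2 ` S) \<Longrightarrow> integral (refl2 ` S) f = integral S (\<lambda>w. f (refl2 w))" using cv by blast
qed

lemma collar_integral_split:
  fixes h :: "pt \<Rightarrow> real"
  assumes l: "h absolutely_integrable_on (lower \<inter> B)" and u: "h absolutely_integrable_on (upper \<inter> B)" and B: "B \<in> sets lebesgue"
  shows "h absolutely_integrable_on (collar \<inter> B)"
    "integral (collar \<inter> B) h = integral (lower \<inter> B) h + integral (upper \<inter> B) h"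
proof -
  let ?V = "(lower \<inter> B) \<union> (upper \<inter> B)"
  have n: "negligible ((collar \<inter> B - ?V) \<union> (?V - collar \<inter> B))"
    by (rule negligible_subset[OF negligible_axis]) (auto simp: strip_def)
  have V: "h absolutely_integrable_on ?V"
    by (rule set_integrable_Un[OF l u]) (auto intro!: sets.Int strip_sets B)
  then show "h absolutely_integrable_on (collar \<inter> B)"
    by (subst absolutely_integrable_spike_set_eq[of _ ?V]) (use n in \<open>auto intro: negligible_subset\<close>)
  have "integral (collar \<inter> B) h = integral ?V h"
    by (rule integral_spike_set) (use n in \<open>auto intro: negligible_subset\<close>)
  also have "\<dots> = integral (lower \<inter> B) h + integral (upper \<inter> B) h"
  proof (rule integral_Un)
    have "(lower \<inter> B) \<inter> (upper \<inter> B) = {}" by (auto simp: strip_def)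
    then show "negligible ((lower \<inter> B) \<inter> (upper \<inter> B))" by simp
  qed (use l u set_lebesgue_integral_eq_integral(1) in auto)
  finally show "integral (collar \<inter> B) h = integral (lower \<inter> B) h + integral (upper \<inter> B) h" .
qed

definition glue :: "(pt \<Rightarrow> real) \<Rightarrow> (pt \<Rightarrow> real) \<Rightarrow> pt \<Rightarrow> real" where
  "glue A B w = (if w$2 < 0 then A w else if 0 < w$2 then B (refl2 w) else 0)"

lemma glue_integral:
  fixes A B :: "pt \<Rightarrow> real"
  assumes "A absolutely_integrable_on (lower \<inter> C)" "B absolutely_integrable_on (lower \<inter> C)" "C \<in> sets lebesgue" "refl2 ` C = C"
  shows "glue A B absolutely_integrable_on (collar \<inter> C)"
    "integral (collar \<inter> C) (glue A B) = integral (lower \<inter> C) A + integral (lower \<inter> C) B"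
proof -
  have img: "refl2 ` (upper \<inter> C) = lower \<inter> C"
    using assms(4) refl2_image_lower by (metis image_Int inj_onI refl2_refl2 injI)
  have m: "upper \<inter> C \<in> sets lebesgue" by (intro sets.Int strip_sets assms)
  have l: "glue A B absolutely_integrable_on (lower \<inter> C)"
    using assms(1) by (rule set_integrable_cong[THEN iffD1, rotated -1]) (auto simp: glue_def strip_def)
  have "(\<lambda>w. B (refl2 w)) absolutely_integrable_on (upper \<inter> C)"
    using refl2_integral(1)[OF m, of B] assms(2) img by simp
  then have u: "glue A B absolutely_integrable_on (upper \<inter> C)"
    by (rule set_integrable_cong[THEN iffD1, rotated -1]) (auto simp: glue_def strip_def)
  show "glue A B absolutely_integrable_on (collar \<inter> C)" by (rule collar_integral_split(1)[OF l u assms(3)])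
  have "integral (lower \<inter> C) (glue A B) = integral (lower \<inter> C) A" by (rule integral_cong) (auto simp: glue_def strip_def)
  moreover have "integral (upper \<inter> C) (glue A B) = integral (upper \<inter> C) (\<lambda>w. B (refl2 w))" by (rule integral_cong) (auto simp: glue_def strip_def)
  moreover have "\<dots> = integral (lower \<inter> C) B" using refl2_integral(2)[OF m, of B] assms(2) img by simp
  ultimately show "integral (collar \<inter> C) (glue A B) = integral (lower \<inter> C) A + integral (lower \<inter> C) B"
    using collar_integral_split(2)[OF l u assms(3)] by simp
qed

lemma loc_int_glue: "loc_int lower A \<Longrightarrow> loc_int lower B \<Longrightarrow> loc_int collar (glue A B)"
  unfolding loc_int_def
proof (intro allI glue_integral(1))
  fix r :: real
  show "refl2 ` cball 0 r = cball 0 r"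
  proof -
    have "x \<in> refl2 ` cball 0 r" if "x \<in> cball 0 r" for x
      by (rule image_eqI[of _ _ "refl2 x"]) (use that in auto)
    then show ?thesis by auto
  qed
qed auto

definition ramp :: "real \<Rightarrow> real" where "ramp s = (if s \<le> 0 then 0 else s\<^sup>2 / (1 + s\<^sup>2))"
definition ramp' :: "real \<Rightarrow> real" where "ramp' s = (if s \<le> 0 then 0 else 2 * s / (1 + s\<^sup>2)\<^sup>2)"

lemma DERIV_ramp: "DERIV ramp s :> ramp' s"
  unfolding ramp_def[abs_def] ramp'_def
proof (rule DERIV_piecewise_zero[where c = 1])
  fix s :: real assume s: "0 < s"
  have p: "0 < 1 + s\<^sup>2" by (simp add: add_pos_nonneg)
  show "\<bar>s\<^sup>2 / (1 + s\<^sup>2)\<bar> \<le> 1 * s\<^sup>2" using p by (simp add: divide_le_eq mult_le_cancel_left1)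
  have "(2 * s * (1 + s\<^sup>2) - s\<^sup>2 * (2 * s)) / ((1 + s\<^sup>2) * (1 + s\<^sup>2)) = 2 * s / (1 + s\<^sup>2)\<^sup>2"
    by (simp add: power2_eq_square algebra_simps)
  then show "DERIV (\<lambda>s. s\<^sup>2 / (1 + s\<^sup>2)) s :> 2 * s / (1 + s\<^sup>2)\<^sup>2"
    using p by (auto intro!: derivative_eq_intros)
qed simp

lemma continuous_on_ramp': "continuous_on S ramp'"
proof -
  have eq: "ramp' = (\<lambda>s. 2 * max s 0 / (1 + (max s 0)\<^sup>2)\<^sup>2)" by (auto simp: ramp'_def fun_eq_iff max_def)
  have "1 + (max s 0)\<^sup>2 \<noteq> 0" for s :: real by (smt (verit) zero_le_power2)
  then show ?thesis unfolding eq by (intro continuous_intros) auto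
qed

lemma ramp_bounds: "0 \<le> ramp s" "ramp s \<le> 1" "0 \<le> ramp' s" "ramp' s * (1 + s) \<le> 4"
proof -
  have p: "0 < 1 + s\<^sup>2" for s :: real by (simp add: add_pos_nonneg)
  show "0 \<le> ramp s" "ramp s \<le> 1" "0 \<le> ramp' s" using p[of s] by (auto simp: ramp_def ramp'_def divide_le_eq)
  show "ramp' s * (1 + s) \<le> 4"
  proof (cases "s \<le> 0")
    case False
    have a: "2 * s \<le> 1 + s\<^sup>2" using zero_le_power2[of "s - 1"] by (simp add: power2_eq_square algebra_simps)
    have b: "1 + s \<le> 2 * (1 + s\<^sup>2)" using zero_le_power2[of "s - 1/4"] by (simp add: power2_eq_square algebra_simps)
    have "2 * s * (1 + s) \<le> (1 + s\<^sup>2) * (2 * (1 + s\<^sup>2))" using a b False by (intro mult_mono) auto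
    then have "2 * s * (1 + s) \<le> 4 * (1 + s\<^sup>2)\<^sup>2" using zero_le_power2[of "1 + s\<^sup>2"] unfolding power2_eq_square[of "1 + s\<^sup>2"] by linarith
    then show ?thesis using False p[of s] by (simp add: ramp'_def divide_le_eq)
  qed (simp add: ramp'_def)
qed

lemma ramp_limits:
  assumes y: "y < 0"
  shows "(\<lambda>n. ramp (- real n * y - 1)) \<longlonglongrightarrow> 1" "(\<lambda>n. real n * ramp' (- real n * y - 1)) \<longlonglongrightarrow> 0"
proof -
  have top: "filterlim (\<lambda>n. - real n * y - 1) at_top sequentially"
  proof -
    have "filterlim (\<lambda>n. -1 + (- y) * real n) at_top sequentially"
      using y by (intro filterlim_tendsto_add_at_top[OF tendsto_const] filterlim_tendsto_pos_mult_at_top[OF tendsto_const] filterlim_real_sequentially) auto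
    moreover have "(\<lambda>n. -1 + (- y) * real n) = (\<lambda>n. - real n * y - 1)" by (simp add: fun_eq_iff)
    ultimately show ?thesis by simp
  qed
  have r: "(ramp \<longlongrightarrow> 1) at_top"
  proof -
    have "((\<lambda>s::real. s\<^sup>2 / (1 + s\<^sup>2)) \<longlongrightarrow> 1) at_top" by real_asymp
    then show ?thesis by (rule Lim_transform_eventually) (auto simp: ramp_def intro: eventually_mono[OF eventually_gt_at_top[of 0]])
  qed
  show "(\<lambda>n. ramp (- real n * y - 1)) \<longlonglongrightarrow> 1" by (rule filterlim_compose[OF r top])
  have r': "((\<lambda>s. (s + 1) * ramp' s) \<longlongrightarrow> 0) at_top"
  proof -
    have "((\<lambda>s::real. (s + 1) * (2 * s / (1 + s\<^sup>2)\<^sup>2)) \<longlongrightarrow> 0) at_top" by real_asymp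
    then show ?thesis by (rule Lim_transform_eventually) (auto simp: ramp'_def intro: eventually_mono[OF eventually_gt_at_top[of 0]])
  qed
  have "(\<lambda>n. (1 / (- y)) * (((- real n * y - 1) + 1) * ramp' (- real n * y - 1))) \<longlonglongrightarrow> (1 / (- y)) * 0"
    by (intro tendsto_mult tendsto_const filterlim_compose[OF r' top])
  then show "(\<lambda>n. real n * ramp' (- real n * y - 1)) \<longlonglongrightarrow> 0" using y by simp
qed

lemma reflection_identity:
  assumes w: "weak_grad lower F G" and F: "loc_int lower F" and G: "\<And>i. loc_int lower (G i)"
    and \<phi>: "C1c collar \<phi> H" and \<sigma>: "(i = 1 \<and> \<sigma> = 1) \<or> (i = 2 \<and> \<sigma> = - 1)"
  shows "integral lower (\<lambda>x. F x * (H x $ i + H (refl2 x) $ i)) = - integral lower (\<lambda>x. G i x * (\<phi> x + \<sigma> * \<phi> (refl2 x)))"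
proof -
  obtain K where K: "compact K" "K \<subseteq> collar" "\<And>x. x \<notin> K \<Longrightarrow> \<phi> x = 0" "\<And>x. x \<notin> K \<Longrightarrow> H x = 0"
    by (rule C1c_support[OF \<phi>], rule that)
  have Hc: "continuous_on UNIV H" using C1c_continuous[OF \<phi>] by blast
  have H0: "H x $ i = 0" if "x \<notin> K" for x i using K(4)[OF that] by simp
  obtain L1 where L1: "L1 \<ge> 0" "\<And>x. \<bar>H x $ 1\<bar> \<le> L1"
    using compact_support_bounded[OF continuous_on_component[OF Hc] K(1) H0, of 1] by blast
  obtain L2 where L2: "L2 \<ge> 0" "\<And>x. \<bar>H x $ 2\<bar> \<le> L2"
    using compact_support_bounded[OF continuous_on_component[OF Hc] K(1) H0, of 2] by blast
  define L where "L = L1 + L2"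
  have L: "0 \<le> L" "\<bar>H x $ j\<bar> \<le> L" for x j using L1(1) L2(1) L1(2)[of x] L2(2)[of x] exhaust_2[of j] by (auto simp: L_def)
  have HL: "norm (H x) \<le> L" for x using norm_le_l1_cart[of "H x"] L1(2)[of x] L2(2)[of x] by (simp add: UNIV_2 L_def)
  define h where "h x = \<phi> x + \<sigma> * \<phi> (refl2 x)" for x
  define Gh where "Gh x = H x + \<sigma> *\<^sub>R refl2 (H (refl2 x))" for x
  have hd: "(h has_derivative (\<lambda>v. Gh x \<bullet> v)) (at x)" for x
  proof -
    have "((\<lambda>x. \<phi> x + \<sigma> * \<phi> (refl2 x)) has_derivative (\<lambda>v. H x \<bullet> v + \<sigma> * (H (refl2 x) \<bullet> refl2 v))) (at x)"
      by (intro has_derivative_add has_derivative_mult_right C1cD[OF \<phi>] has_derivative_compose[OF refl2_has_derivative C1cD[OF \<phi>]])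
    then show ?thesis unfolding h_def[abs_def] by (rule has_derivative_eq_rhs) (auto simp: Gh_def inner_pt algebra_simps)
  qed
  have Ghc: "continuous_on A Gh" for A unfolding Gh_def
    by (intro continuous_intros continuous_on_subset[OF Hc] continuous_on_compose2[OF Hc] continuous_on_compose2[OF continuous_on_refl2[of UNIV]]) auto
  have hc: "continuous_on A h" for A by (rule has_derivative_continuous_on) (rule has_derivative_at_withinI[OF hd])
  define K2 where "K2 = K \<union> refl2 ` K"
  have K2: "compact K2" unfolding K2_def by (intro compact_Un K(1) compact_continuous_image continuous_on_refl2)
  have h0: "h x = 0" "Gh x = 0" if "x \<notin> K2" for x
  proof -
    have "x \<notin> K" "refl2 x \<notin> K" using that by (auto simp: K2_def) (metis imageI refl2_refl2)
    then show "h x = 0" "Gh x = 0" using K(3,4) by (auto simp: h_def Gh_def vec_eq_iff forall_2)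
  qed
  obtain M where M: "M \<ge> 0" "\<And>x. \<bar>h x\<bar> \<le> M"
    using compact_support_bounded[OF hc K2 h0(1)] by blast
  have Ghi: "Gh x $ i = H x $ i + H (refl2 x) $ i" for x using \<sigma> by (auto simp: Gh_def)
  have hlip: "\<bar>h x\<bar> \<le> 2 * L * \<bar>x$2\<bar>" if "i = 2" for x
  proof -
    have "norm (\<phi> x - \<phi> (refl2 x)) \<le> L * norm (x - refl2 x)"
    proof (rule differentiable_bound[of UNIV])
      show "(\<phi> has_derivative (\<lambda>v. H x \<bullet> v)) (at x within UNIV)" for x using C1cD[OF \<phi>] by simp
      show "onorm (\<lambda>v. H x \<bullet> v) \<le> L" for x
        by (rule onorm_bound[OF L(1)]) (metis HL Cauchy_Schwarz_ineq2 mult_right_mono norm_ge_zero order_trans real_norm_def)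
    qed auto
    also have "norm (x - refl2 x) = 2 * \<bar>x$2\<bar>" by (simp add: norm_pt power_mult_distrib real_sqrt_mult)
    finally show ?thesis using that \<sigma> by (auto simp: h_def)
  qed
  define \<eta> where "\<eta> n y = ramp (- real n * y - 1)" for n y
  define \<eta>' where "\<eta>' n y = - real n * ramp' (- real n * y - 1)" for n y
  have \<eta>d: "((\<lambda>x::pt. \<eta> n (x$2)) has_derivative (\<lambda>v. (\<eta>' n (x$2) *\<^sub>R axis 2 1) \<bullet> v)) (at x)" for n x
  proof -
    have "((\<lambda>x::pt. - real n * x$2 - 1) has_derivative (\<lambda>v. - real n * v$2)) (at x)"
      by (auto intro!: derivative_eq_intros vec_nth_has_derivative)
    from has_derivative_compose[OF this DERIV_ramp[unfolded has_field_derivative_def]]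
    show ?thesis unfolding \<eta>_def by (rule has_derivative_eq_rhs) (auto simp: \<eta>'_def inner_axis' fun_eq_iff)
  qed
  have \<eta>'c: "continuous_on A (\<lambda>x::pt. \<eta>' n (x$2))" for A n unfolding \<eta>'_def
    by (intro continuous_intros continuous_on_compose2[OF continuous_on_ramp'[of UNIV]]) auto
  have \<eta>c: "continuous_on A (\<lambda>x::pt. \<eta> n (x$2))" for A n
    by (rule has_derivative_continuous_on) (rule has_derivative_at_withinI[OF \<eta>d])
  have lm: "lower \<in> sets lebesgue" by (rule strip_sets)
  have test: "C1c lower (\<lambda>x. if x \<in> lower then h x * \<eta> n (x$2) else 0)
      (\<lambda>x. if x \<in> lower then h x *\<^sub>R (\<eta>' n (x$2) *\<^sub>R axis 2 1) + \<eta> n (x$2) *\<^sub>R Gh x else 0)" for n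
  proof (rule C1c_extend[OF open_strip])
    have cl: "closed {x::pt. x$2 \<le> - (1 / (real n + 1))}" by (intro closed_Collect_le continuous_intros)
    show "compact (K2 \<inter> {x. x$2 \<le> - (1 / (real n + 1))})" by (rule compact_Int_closed[OF K2 cl])
    have "0 < 1 / (real n + 1)" by simp
    moreover have "K2 \<subseteq> collar" using K(2) by (auto simp: K2_def strip_def)
    ultimately have "- (1/10) < x$2 \<and> x$2 < 0" if "x \<in> K2" "x$2 \<le> - (1 / (real n + 1))" for x
      using that unfolding strip_def by (smt (verit) mem_Collect_eq subsetD)
    then show "K2 \<inter> {x. x$2 \<le> - (1 / (real n + 1))} \<subseteq> lower" by (auto simp: strip_def)
    fix x assume x: "x \<in> lower"
    show "((\<lambda>x. h x * \<eta> n (x$2)) has_derivative (\<lambda>v. (h x *\<^sub>R (\<eta>' n (x$2) *\<^sub>R axis 2 1) + \<eta> n (x$2) *\<^sub>R Gh x) \<bullet> v)) (at x)"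
      by (rule has_derivative_eq_rhs[OF has_derivative_mult[OF hd \<eta>d]]) (auto simp: inner_add_left algebra_simps)
    show "h x * \<eta> n (x$2) = 0" if "x \<notin> K2 \<inter> {x. x$2 \<le> - (1 / (real n + 1))}"
    proof (cases "x \<in> K2")
      case True
      then have "- (1 / (real n + 1)) < x$2" using that by auto
      then have "- x$2 * (real n + 1) < 1" by (simp add: field_simps)
      moreover have "- x$2 > 0" using x by (auto simp: strip_def)
      ultimately have "- real n * x$2 - 1 \<le> 0" by (simp add: algebra_simps)
      then show ?thesis by (simp add: \<eta>_def ramp_def)
    qed (simp add: h0)
  next
    show "continuous_on lower (\<lambda>x. h x *\<^sub>R (\<eta>' n (x$2) *\<^sub>R axis 2 1) + \<eta> n (x$2) *\<^sub>R Gh x)"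
      by (intro continuous_intros hc Ghc \<eta>c \<eta>'c)
  qed
  define \<psi> where "\<psi> n x = h x * \<eta>' n (x$2) * (axis 2 1 :: pt) $ i + \<eta> n (x$2) * Gh x $ i" for n x
  have eq: "integral lower (\<lambda>x. F x * \<psi> n x) = - integral lower (\<lambda>x. G i x * (h x * \<eta> n (x$2)))" for n
  proof -
    have "integral lower (\<lambda>x. F x * (if x \<in> lower then h x *\<^sub>R (\<eta>' n (x$2) *\<^sub>R axis 2 1) + \<eta> n (x$2) *\<^sub>R Gh x else 0) $ i)
       = - integral lower (\<lambda>x. G i x * (if x \<in> lower then h x * \<eta> n (x$2) else 0))"
      using w test[of n] unfolding weak_grad_def by blast
    moreover have "integral lower (\<lambda>x. F x * (if x \<in> lower then h x *\<^sub>R (\<eta>' n (x$2) *\<^sub>R axis 2 1) + \<eta> n (x$2) *\<^sub>R Gh x else 0) $ i)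
       = integral lower (\<lambda>x. F x * \<psi> n x)" by (rule integral_cong) (simp add: \<psi>_def algebra_simps)
    moreover have "integral lower (\<lambda>x. G i x * (if x \<in> lower then h x * \<eta> n (x$2) else 0)) = integral lower (\<lambda>x. G i x * (h x * \<eta> n (x$2)))"
      by (rule integral_cong) simp
    ultimately show ?thesis by simp
  qed
  have bK: "bounded K2" using K2 compact_imp_bounded by auto
  have Ghb: "\<bar>Gh x $ i\<bar> \<le> 2 * L" for x using L(2)[of x i] L(2)[of "refl2 x" i] unfolding Ghi by linarith
  have bnd: "\<bar>\<psi> n x\<bar> \<le> 10 * L" if x: "x \<in> lower" for n x
  proof -
    have \<eta>1: "\<bar>\<eta> n (x$2)\<bar> \<le> 1" using ramp_bounds(1,2) by (simp add: \<eta>_def)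
    have a: "\<bar>\<eta> n (x$2) * Gh x $ i\<bar> \<le> 2 * L" using mult_mono[OF \<eta>1 Ghb[of x]] by (simp add: abs_mult)
    have b: "\<bar>h x * \<eta>' n (x$2)\<bar> \<le> 8 * L" if "i = 2"
    proof -
      define s where "s = - real n * x$2 - 1"
      have xn: "x$2 < 0" using x by (auto simp: strip_def)
      have "\<bar>h x * \<eta>' n (x$2)\<bar> = \<bar>h x\<bar> * (real n * ramp' s)" using ramp_bounds(3)[of s] by (simp add: \<eta>'_def abs_mult s_def)
      also have "\<dots> \<le> (2 * L * \<bar>x$2\<bar>) * (real n * ramp' s)" using hlip[OF that, of x] ramp_bounds(3)[of s] by (intro mult_right_mono) auto
      also have "\<dots> = 2 * L * (ramp' s * (1 + s))" using xn by (simp add: s_def algebra_simps)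
      also have "\<dots> \<le> 2 * L * 4" using ramp_bounds(4)[of s] L(1) by (intro mult_left_mono) auto
      finally show ?thesis by simp
    qed
    show ?thesis using a b \<sigma> L(1) by (auto simp: \<psi>_def axis_def) 
  qed
  have l1: "(\<lambda>n. integral lower (\<lambda>x. F x * \<psi> n x)) \<longlonglongrightarrow> integral lower (\<lambda>x. F x * Gh x $ i)"
  proof (rule dominated_test_limit[OF F lm _ bnd bK])
    show "continuous_on lower (\<psi> n)" for n unfolding \<psi>_def by (intro continuous_intros hc \<eta>c \<eta>'c continuous_on_component[OF Ghc])
    show "\<psi> n x = 0" if "x \<notin> K2" for n x using h0[OF that] by (simp add: \<psi>_def)
    show "(\<lambda>n. \<psi> n x) \<longlonglongrightarrow> Gh x $ i" if "x \<in> lower" for x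
    proof -
      have xn: "x$2 < 0" using that by (auto simp: strip_def)
      have "(\<lambda>n. h x * (- (real n * ramp' (- real n * x$2 - 1))) * (axis 2 1 :: pt) $ i + ramp (- real n * x$2 - 1) * Gh x $ i)
        \<longlonglongrightarrow> h x * (- 0) * (axis 2 1 :: pt) $ i + 1 * Gh x $ i"
        by (intro tendsto_intros ramp_limits[OF xn])
      then show ?thesis by (simp add: \<psi>_def \<eta>_def \<eta>'_def)
    qed
  qed
  have l2: "(\<lambda>n. integral lower (\<lambda>x. G i x * (h x * \<eta> n (x$2)))) \<longlonglongrightarrow> integral lower (\<lambda>x. G i x * h x)"
  proof (rule dominated_test_limit[OF G lm _ _ bK])
    show "continuous_on lower (\<lambda>x. h x * \<eta> n (x$2))" for n by (intro continuous_intros hc \<eta>c)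
    show "\<bar>h x * \<eta> n (x$2)\<bar> \<le> M" for n x
      using mult_mono[OF M(2)[of x], of "\<bar>\<eta> n (x$2)\<bar>" 1] ramp_bounds(1,2)[of "- real n * x$2 - 1"] M(1) by (simp add: abs_mult \<eta>_def)
    show "h x * \<eta> n (x$2) = 0" if "x \<notin> K2" for n x using h0[OF that] by simp
    show "(\<lambda>n. h x * \<eta> n (x$2)) \<longlonglongrightarrow> h x" if "x \<in> lower" for x
    proof -
      have xn: "x$2 < 0" using that by (auto simp: strip_def)
      have "(\<lambda>n. h x * \<eta> n (x$2)) \<longlonglongrightarrow> h x * 1" unfolding \<eta>_def by (intro tendsto_intros ramp_limits[OF xn])
      then show ?thesis by simp
    qed
  qed
  have "integral lower (\<lambda>x. F x * Gh x $ i) = - integral lower (\<lambda>x. G i x * h x)"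
    using LIMSEQ_unique[OF l1[unfolded eq] tendsto_minus[OF l2]] .
  then show ?thesis unfolding Ghi h_def .
qed

lemma reflect_weak_grad:
  assumes w: "weak_grad lower F G" and F: "loc_int lower F" and G: "\<And>i. loc_int lower (G i)"
  shows "weak_grad collar (glue F F) (\<lambda>i. if i = 1 then glue (G 1) (G 1) else glue (G 2) (\<lambda>w. - G 2 w))"
  unfolding weak_grad_def
proof (intro allI impI)
  fix \<phi> H and i :: 2 assume \<phi>: "C1c collar \<phi> H"
  define \<sigma> :: real where "\<sigma> = (if i = 1 then 1 else - 1)"
  have \<sigma>: "(i = 1 \<and> \<sigma> = 1) \<or> (i = 2 \<and> \<sigma> = - 1)" using exhaust_2[of i] by (auto simp: \<sigma>_def)
  have lm: "lower \<in> sets lebesgue" by (rule strip_sets)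
  have \<phi>col_nbhd: "C1c UNIV \<phi> H" using \<phi> by (auto simp: C1c_def)
  define \<phi>r where "\<phi>r x = \<phi> (refl2 x)" for x
  define Hr where "Hr x = refl2 (H (refl2 x))" for x
  have \<phi>r: "C1c UNIV \<phi>r Hr"
  proof -
    obtain K where K: "compact K" "\<And>x. x \<notin> K \<Longrightarrow> \<phi> x = 0"
      by (rule C1c_support[OF \<phi>], rule that)
    have "(\<phi>r has_derivative (\<lambda>v. Hr x \<bullet> v)) (at x)" for x unfolding \<phi>r_def
      by (rule has_derivative_eq_rhs[OF has_derivative_compose[OF refl2_has_derivative C1cD[OF \<phi>]]]) (auto simp: Hr_def inner_pt)
    moreover have "continuous_on UNIV Hr" unfolding Hr_def
      by (intro continuous_on_compose2[OF continuous_on_refl2[of UNIV]] continuous_on_compose2[OF C1c_continuous(2)[OF \<phi>, of UNIV]] continuous_on_refl2) auto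
    moreover have "compact (refl2 ` K)" by (intro compact_continuous_image continuous_on_refl2 K)
    moreover have "\<phi>r x = 0" if "x \<notin> refl2 ` K" for x unfolding \<phi>r_def by (rule K(2)) (use that in \<open>metis imageI refl2_refl2\<close>)
    ultimately show ?thesis unfolding C1c_def by blast
  qed
  have Hri: "Hr x $ i = \<sigma> * H (refl2 x) $ i" for x using \<sigma> by (auto simp: Hr_def)
  have s2: "\<sigma> * \<sigma> = 1" using \<sigma> by auto
  have Hri': "H (refl2 x) $ i = \<sigma> * Hr x $ i" for x unfolding Hri using s2 by (simp add: mult.assoc[symmetric])
  have hk: "f integrable_on lower" if "f absolutely_integrable_on lower" for f :: "pt \<Rightarrow> real" using set_lebesgue_integral_eq_integral(1)[OF that] .
  have a1: "(\<lambda>x. F x * H x $ i) absolutely_integrable_on lower" by (rule C1c_integrable(2)[OF \<phi>col_nbhd F lm])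
  have "(\<lambda>x. \<sigma> * (F x * Hr x $ i)) absolutely_integrable_on lower" by (intro set_integrable_mult_right C1c_integrable(2)[OF \<phi>r F lm])
  then have a2: "(\<lambda>x. F x * H (refl2 x) $ i) absolutely_integrable_on lower" unfolding Hri' by (simp add: mult.left_commute)
  have b1: "(\<lambda>x. G i x * \<phi> x) absolutely_integrable_on lower" by (rule C1c_integrable(1)[OF \<phi>col_nbhd G lm])
  have "(\<lambda>x. \<sigma> * (G i x * \<phi>r x)) absolutely_integrable_on lower" by (intro set_integrable_mult_right C1c_integrable(1)[OF \<phi>r G lm])
  then have b2: "(\<lambda>x. \<sigma> * G i x * \<phi> (refl2 x)) absolutely_integrable_on lower" by (simp add: \<phi>r_def mult.assoc)
  note gi = glue_integral[where C = UNIV, simplified]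
  have col_nbhd: "refl2 ` UNIV = UNIV" by (metis refl2_refl2 surj_def)
  have L: "integral collar (\<lambda>x. glue F F x * H x $ i) = integral lower (\<lambda>x. F x * (H x $ i + H (refl2 x) $ i))"
  proof -
    have "(\<lambda>x. glue F F x * H x $ i) = glue (\<lambda>x. F x * H x $ i) (\<lambda>x. F x * H (refl2 x) $ i)" by (auto simp: glue_def fun_eq_iff)
    then have "integral collar (\<lambda>x. glue F F x * H x $ i) = integral lower (\<lambda>x. F x * H x $ i) + integral lower (\<lambda>x. F x * H (refl2 x) $ i)"
      using gi(2)[OF a1 a2 col_nbhd] by simp
    also have "\<dots> = integral lower (\<lambda>x. F x * H x $ i + F x * H (refl2 x) $ i)"
      using integral_add[OF hk[OF a1] hk[OF a2]] by simp
    finally show ?thesis by (simp add: distrib_left)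
  qed
  have R: "integral collar (\<lambda>x. (if i = 1 then glue (G 1) (G 1) else glue (G 2) (\<lambda>w. - G 2 w)) x * \<phi> x) = integral lower (\<lambda>x. G i x * (\<phi> x + \<sigma> * \<phi> (refl2 x)))"
  proof -
    have "(\<lambda>x. (if i = 1 then glue (G 1) (G 1) else glue (G 2) (\<lambda>w. - G 2 w)) x * \<phi> x) = glue (\<lambda>x. G i x * \<phi> x) (\<lambda>x. \<sigma> * G i x * \<phi> (refl2 x))"
      using \<sigma> by (auto simp: glue_def fun_eq_iff)
    then have "integral collar (\<lambda>x. (if i = 1 then glue (G 1) (G 1) else glue (G 2) (\<lambda>w. - G 2 w)) x * \<phi> x)
       = integral lower (\<lambda>x. G i x * \<phi> x) + integral lower (\<lambda>x. \<sigma> * G i x * \<phi> (refl2 x))"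
      using gi(2)[OF b1 b2 col_nbhd] by simp
    also have "\<dots> = integral lower (\<lambda>x. G i x * \<phi> x + \<sigma> * G i x * \<phi> (refl2 x))"
      using integral_add[OF hk[OF b1] hk[OF b2]] by simp
    finally show ?thesis by (simp add: distrib_left mult.assoc mult.left_commute)
  qed
  show "integral collar (\<lambda>x. glue F F x * H x $ i) = - integral collar (\<lambda>x. (if i = 1 then glue (G 1) (G 1) else glue (G 2) (\<lambda>w. - G 2 w)) x * \<phi> x)"
    unfolding L R by (rule reflection_identity[OF w F G \<phi> \<sigma>])
qed

section \<open>Lebesgue spaces under extension and reflection\<close>

lemma absolutely_integrable_iff_integrable_lebesgue_on:
  fixes h :: "pt \<Rightarrow> real"
  shows "S \<in> sets lebesgue \<Longrightarrow> h absolutely_integrable_on S \<longleftrightarrow> integrable (lebesgue_on S) h"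
  unfolding set_integrable_def by (simp add: integrable_restrict_space)

lemma enn2real_ge1: "1 \<le> p \<Longrightarrow> p \<noteq> \<infinity> \<Longrightarrow> 1 \<le> enn2real p"
  by (metis enn2real_1 enn2real_mono infinity_ennreal_def top.not_eq_extremum)

lemma Lp_finite:
  assumes "p \<noteq> \<infinity>" "S \<in> sets lebesgue"
  shows "Lp_mem S p f \<longleftrightarrow> f \<in> borel_measurable (lebesgue_on S) \<and> (\<lambda>x. \<bar>f x\<bar> powr enn2real p) absolutely_integrable_on S"
    and "Lp_mem S p f \<Longrightarrow> Lp_norm S p f = (integral S (\<lambda>x. \<bar>f x\<bar> powr enn2real p)) powr (1 / enn2real p)"
proof -
  show *: "Lp_mem S p f \<longleftrightarrow> f \<in> borel_measurable (lebesgue_on S) \<and> (\<lambda>x. \<bar>f x\<bar> powr enn2real p) absolutely_integrable_on S"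
    using assms by (simp add: Lp_mem_def absolutely_integrable_iff_integrable_lebesgue_on)
  assume "Lp_mem S p f"
  then have "integrable (lebesgue_on S) (\<lambda>x. \<bar>f x\<bar> powr enn2real p)" using assms by (simp add: Lp_mem_def)
  then show "Lp_norm S p f = (integral S (\<lambda>x. \<bar>f x\<bar> powr enn2real p)) powr (1 / enn2real p)"
    using assms lebesgue_integral_eq_integral[of S "\<lambda>x. \<bar>f x\<bar> powr enn2real p"] by (simp add: Lp_norm_def)
qed

lemma Linf_bound:
  assumes f: "Lp_mem S \<infinity> f" and S: "S \<in> sets lebesgue" "\<not> negligible S"
  shows "AE x in lebesgue. x \<in> S \<longrightarrow> \<bar>f x\<bar> \<le> Lp_norm S \<infinity> f" "0 \<le> Lp_norm S \<infinity> f"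
proof -
  define e where "e = esssup (lebesgue_on S) (\<lambda>x. ereal \<bar>f x\<bar>)"
  have "AE x in lebesgue_on S. ereal \<bar>f x\<bar> \<le> e" unfolding e_def by (rule esssup_AE)
  then have ae: "AE x in lebesgue. x \<in> S \<longrightarrow> ereal \<bar>f x\<bar> \<le> e" using S by (subst (asm) AE_restrict_space_iff) auto
  have "0 \<le> e"
  proof (rule ccontr)
    assume "\<not> 0 \<le> e"
    have "AE x in lebesgue. x \<notin> S"
      using ae by eventually_elim (use \<open>\<not> 0 \<le> e\<close> order_trans[of "0::ereal" "ereal \<bar>f _\<bar>" e] in \<open>auto simp: zero_ereal_def\<close>)
    then have "S \<in> null_sets lebesgue" using S(1) by (simp add: AE_iff_null_sets)
    then show False using S(2) by (simp add: negligible_iff_null_sets)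
  qed
  moreover have "e < \<infinity>" using f by (simp add: Lp_mem_def e_def)
  ultimately obtain N where N: "e = ereal N" "0 \<le> N" by (cases e) auto
  have "Lp_norm S \<infinity> f = N" using N by (simp add: Lp_norm_def e_def)
  then show "AE x in lebesgue. x \<in> S \<longrightarrow> \<bar>f x\<bar> \<le> Lp_norm S \<infinity> f" "0 \<le> Lp_norm S \<infinity> f" using ae N by auto
qed

lemma Linf_intro:
  assumes h: "h \<in> borel_measurable (lebesgue_on UNIV)" and b: "AE x in lebesgue. \<bar>h x\<bar> \<le> B"
  shows "Lp_mem UNIV \<infinity> h" "Lp_norm UNIV \<infinity> h \<le> B"
proof -
  have m: "(\<lambda>x. ereal \<bar>h x\<bar>) \<in> borel_measurable (lebesgue_on UNIV)" using h by measurable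
  have le: "esssup (lebesgue_on UNIV) (\<lambda>x. ereal \<bar>h x\<bar>) \<le> ereal B"
    by (rule esssup_I[OF m], subst AE_restrict_space_iff) (use b in auto)
  then show L: "Lp_mem UNIV \<infinity> h" using h by (auto simp: Lp_mem_def intro: le_less_trans)
  have "\<not> negligible (UNIV :: pt set)" by (rule open_not_negligible) auto
  have "0 \<le> B"
  proof (rule ccontr)
    assume "\<not> 0 \<le> B"
    have "AE x in lebesgue. x \<notin> (UNIV :: pt set)" using b by eventually_elim (use \<open>\<not> 0 \<le> B\<close> in linarith)
    then have "(UNIV :: pt set) \<in> null_sets lebesgue" by (subst AE_iff_null_sets) auto
    then show False using \<open>\<not> negligible (UNIV :: pt set)\<close> by (simp add: negligible_iff_null_sets)
  qed
  then show "Lp_norm UNIV \<infinity> h \<le> B"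
    using le L by (cases "esssup (lebesgue_on UNIV) (\<lambda>x. ereal \<bar>h x\<bar>)") (auto simp: Lp_norm_def Lp_mem_def)
qed

lemma Lp_norm_nonneg: "Lp_mem S p f \<Longrightarrow> S \<in> sets lebesgue \<Longrightarrow> \<not> negligible S \<Longrightarrow> 0 \<le> Lp_norm S p f"
  using Linf_bound(2)[of S f] by (cases "p = \<infinity>") (auto simp: Lp_norm_def)

lemma UNIV_not_negligible: "\<not> negligible (UNIV :: pt set)" by (rule open_not_negligible) auto

lemma Lp_dominated:
  assumes p: "1 \<le> p" and h: "h \<in> borel_measurable (lebesgue_on UNIV)" and k: "Lp_mem UNIV p k"
    and c: "0 \<le> c" and le: "\<And>x. \<bar>h x\<bar> \<le> c * \<bar>k x\<bar>"
  shows "Lp_mem UNIV p h \<and> Lp_norm UNIV p h \<le> c * Lp_norm UNIV p k"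
proof (cases "p = \<infinity>")
  case True
  have "AE x in lebesgue. \<bar>k x\<bar> \<le> Lp_norm UNIV \<infinity> k" using Linf_bound(1)[of UNIV k] k True UNIV_not_negligible by simp
  then have "AE x in lebesgue. \<bar>h x\<bar> \<le> c * Lp_norm UNIV \<infinity> k"
    by eventually_elim (meson c le mult_left_mono order_trans)
  from Linf_intro[OF h this] show ?thesis using True by simp
next
  case False
  define q where "q = enn2real p"
  have q: "1 \<le> q" unfolding q_def by (rule enn2real_ge1[OF p False])
  have ki: "(\<lambda>x. \<bar>k x\<bar> powr q) absolutely_integrable_on UNIV" using k Lp_finite(1)[OF False, of UNIV] by (simp add: q_def)
  have pw: "\<bar>h x\<bar> powr q \<le> c powr q * \<bar>k x\<bar> powr q" for x
    using powr_mono2[OF _ _ le[of x], of q] q c by (simp add: powr_mult)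
  have ki': "(\<lambda>x. c powr q * \<bar>k x\<bar> powr q) integrable_on UNIV"
    using ki by (intro integrable_on_mult_right set_lebesgue_integral_eq_integral(1))
  have hi: "(\<lambda>x. \<bar>h x\<bar> powr q) absolutely_integrable_on UNIV"
    by (rule measurable_bounded_by_integrable_imp_absolutely_integrable[OF _ _ ki']) (use h pw in auto)
  then have L: "Lp_mem UNIV p h" using Lp_finite(1)[OF False, of UNIV] h by (simp add: q_def)
  have "integral UNIV (\<lambda>x. \<bar>h x\<bar> powr q) \<le> integral UNIV (\<lambda>x. c powr q * \<bar>k x\<bar> powr q)"
    by (rule integral_le[OF set_lebesgue_integral_eq_integral(1)[OF hi] ki' pw])
  also have "\<dots> = c powr q * integral UNIV (\<lambda>x. \<bar>k x\<bar> powr q)" by simp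
  finally have "(integral UNIV (\<lambda>x. \<bar>h x\<bar> powr q)) powr (1/q) \<le> (c powr q * integral UNIV (\<lambda>x. \<bar>k x\<bar> powr q)) powr (1/q)"
    using q by (intro powr_mono2 integral_nonneg set_lebesgue_integral_eq_integral(1)[OF hi]) auto
  also have "\<dots> = c * (integral UNIV (\<lambda>x. \<bar>k x\<bar> powr q)) powr (1/q)"
    using q c integral_nonneg[OF set_lebesgue_integral_eq_integral(1)[OF ki]] by (simp add: powr_mult powr_powr)
  finally show ?thesis using L Lp_finite(2)[OF False _ L] Lp_finite(2)[OF False _ k] by (simp add: q_def)
qed

lemma Lp_add:
  assumes p: "1 \<le> p" and h: "Lp_mem UNIV p h" and k: "Lp_mem UNIV p k"
  shows "Lp_mem UNIV p (\<lambda>x. h x + k x) \<and> Lp_norm UNIV p (\<lambda>x. h x + k x) \<le> 2 * (Lp_norm UNIV p h + Lp_norm UNIV p k)"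
proof -
  have mh: "h \<in> borel_measurable (lebesgue_on UNIV)" and mk: "k \<in> borel_measurable (lebesgue_on UNIV)" using h k by (auto simp: Lp_mem_def)
  then have m: "(\<lambda>x. h x + k x) \<in> borel_measurable (lebesgue_on UNIV)" by measurable
  show ?thesis
  proof (cases "p = \<infinity>")
    case True
    have "AE x in lebesgue. \<bar>k x\<bar> \<le> Lp_norm UNIV \<infinity> k" "AE x in lebesgue. \<bar>h x\<bar> \<le> Lp_norm UNIV \<infinity> h"
      using Linf_bound(1)[of UNIV k] Linf_bound(1)[of UNIV h] k h True UNIV_not_negligible by simp_all
    then have "AE x in lebesgue. \<bar>h x + k x\<bar> \<le> Lp_norm UNIV \<infinity> h + Lp_norm UNIV \<infinity> k"
      by eventually_elim linarith
    from Linf_intro[OF m this] show ?thesis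
      using True Lp_norm_nonneg[OF h] Lp_norm_nonneg[OF k] UNIV_not_negligible by auto
  next
    case False
    define q where "q = enn2real p"
    have q: "1 \<le> q" unfolding q_def by (rule enn2real_ge1[OF p False])
    have ki: "(\<lambda>x. \<bar>k x\<bar> powr q) absolutely_integrable_on UNIV" and hi: "(\<lambda>x. \<bar>h x\<bar> powr q) absolutely_integrable_on UNIV"
      using k h Lp_finite(1)[OF False, of UNIV] by (simp_all add: q_def)
    note ki' = set_lebesgue_integral_eq_integral(1)[OF ki] and hi' = set_lebesgue_integral_eq_integral(1)[OF hi]
    have pw: "\<bar>h x + k x\<bar> powr q \<le> 2 powr q * (\<bar>h x\<bar> powr q + \<bar>k x\<bar> powr q)" for x
    proof -
      have "\<bar>h x + k x\<bar> powr q \<le> (2 * max \<bar>h x\<bar> \<bar>k x\<bar>) powr q" using q by (intro powr_mono2) auto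
      also have "\<dots> = 2 powr q * (max \<bar>h x\<bar> \<bar>k x\<bar>) powr q" by (rule powr_mult)
      also have "(max \<bar>h x\<bar> \<bar>k x\<bar>) powr q \<le> \<bar>h x\<bar> powr q + \<bar>k x\<bar> powr q" by (auto simp: max_def)
      finally show ?thesis by simp
    qed
    have si: "(\<lambda>x. 2 powr q * (\<bar>h x\<bar> powr q + \<bar>k x\<bar> powr q)) integrable_on UNIV"
      by (intro integrable_on_mult_right integrable_add ki' hi')
    have ai: "(\<lambda>x. \<bar>h x + k x\<bar> powr q) absolutely_integrable_on UNIV"
      by (rule measurable_bounded_by_integrable_imp_absolutely_integrable[OF _ _ si]) (use m pw in auto)
    then have L: "Lp_mem UNIV p (\<lambda>x. h x + k x)" using Lp_finite(1)[OF False, of UNIV] m by (simp add: q_def)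
    define A where "A = integral UNIV (\<lambda>x. \<bar>h x\<bar> powr q)"
    define B where "B = integral UNIV (\<lambda>x. \<bar>k x\<bar> powr q)"
    have AB: "0 \<le> A" "0 \<le> B" unfolding A_def B_def by (auto intro!: integral_nonneg ki' hi')
    have "integral UNIV (\<lambda>x. \<bar>h x + k x\<bar> powr q) \<le> 2 powr q * (A + B)"
      using integral_le[OF set_lebesgue_integral_eq_integral(1)[OF ai] si pw] integral_add[OF hi' ki'] by (simp add: A_def B_def)
    then have "(integral UNIV (\<lambda>x. \<bar>h x + k x\<bar> powr q)) powr (1/q) \<le> (2 powr q * (A + B)) powr (1/q)"
      using q by (intro powr_mono2 integral_nonneg set_lebesgue_integral_eq_integral(1)[OF ai]) auto
    also have "\<dots> = 2 * (A + B) powr (1/q)" using q AB by (simp add: powr_mult powr_powr)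
    also have "(A + B) powr (1/q) \<le> A powr (1/q) + B powr (1/q)"
    proof -
      have "A + B \<le> (A powr (1/q) + B powr (1/q)) powr q"
      proof -
        have "A + B = (A powr (1/q)) powr q + (B powr (1/q)) powr q" using q AB by (simp add: powr_powr)
        also have "\<dots> \<le> (A powr (1/q) + B powr (1/q)) powr q"
        proof -
          define a where "a = A powr (1/q)"
          define b where "b = B powr (1/q)"
          have ab: "0 \<le> a" "0 \<le> b" by (auto simp: a_def b_def)
          have split: "x powr q = x * x powr (q - 1)" if "0 \<le> x" for x :: real
            using that powr_mult_base[OF that, of "q - 1"] by simp
          have "a powr q + b powr q \<le> a * (a + b) powr (q - 1) + b * (a + b) powr (q - 1)"
            unfolding split[OF ab(1)] split[OF ab(2)] using ab q by (intro add_mono mult_left_mono powr_mono2) auto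
          also have "\<dots> = (a + b) powr q" using ab by (subst split[of "a + b"]) (auto simp: distrib_right)
          finally show ?thesis unfolding a_def b_def .
        qed
        finally show ?thesis .
      qed
      then have "(A + B) powr (1/q) \<le> ((A powr (1/q) + B powr (1/q)) powr q) powr (1/q)" using q AB by (intro powr_mono2) auto
      also have "\<dots> = A powr (1/q) + B powr (1/q)" using q by (simp add: powr_powr)
      finally show ?thesis .
    qed
    finally show ?thesis using L Lp_finite(2)[OF False _ L] Lp_finite(2)[OF False _ k] Lp_finite(2)[OF False _ h]
      by (simp add: q_def A_def B_def)
  qed
qed

lemma spiral_sets: "spiral \<in> sets lebesgue" and spiral_not_negligible: "\<not> negligible spiral"
  using open_spiral spiral_nonempty open_not_negligible by auto

definition zero_ext :: "(pt \<Rightarrow> real) \<Rightarrow> pt \<Rightarrow> real" where "zero_ext f z = (if z \<in> spiral then f z else 0)"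

lemma borel_measurable_if_zero:
  fixes f :: "pt \<Rightarrow> real"
  assumes "f \<in> borel_measurable (lebesgue_on S)" "S \<in> sets lebesgue"
  shows "(\<lambda>x. if x \<in> S then f x else 0) \<in> borel_measurable (lebesgue_on UNIV)"
  using assms by (simp add: borel_measurable_if lebesgue_on_UNIV_eq)

lemma Lp_zero_ext:
  assumes p: "1 \<le> p" and f: "Lp_mem spiral p f"
  shows "Lp_mem UNIV p (zero_ext f) \<and> Lp_norm UNIV p (zero_ext f) \<le> Lp_norm spiral p f"
proof -
  have "f \<in> borel_measurable (lebesgue_on spiral)" using f by (simp add: Lp_mem_def)
  from borel_measurable_if_zero[OF this spiral_sets]
  have m: "zero_ext f \<in> borel_measurable (lebesgue_on UNIV)" by (simp add: zero_ext_def[abs_def])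
  show ?thesis
  proof (cases "p = \<infinity>")
    case True
    have nn: "0 \<le> Lp_norm spiral \<infinity> f" using Linf_bound(2) f True spiral_sets spiral_not_negligible by auto
    have "AE x in lebesgue. x \<in> spiral \<longrightarrow> \<bar>f x\<bar> \<le> Lp_norm spiral \<infinity> f" using Linf_bound(1) f True spiral_sets spiral_not_negligible by auto
    then have "AE x in lebesgue. \<bar>zero_ext f x\<bar> \<le> Lp_norm spiral \<infinity> f"
      by eventually_elim (use nn in \<open>auto simp: zero_ext_def\<close>)
    from Linf_intro[OF m this] show ?thesis using True by simp
  next
    case False
    define q where "q = enn2real p"
    have fi: "(\<lambda>x. \<bar>f x\<bar> powr q) absolutely_integrable_on spiral" using f Lp_finite(1)[OF False spiral_sets] by (simp add: q_def)
    have eq: "(\<lambda>x. \<bar>zero_ext f x\<bar> powr q) = (\<lambda>x. if x \<in> spiral then \<bar>f x\<bar> powr q else 0)" by (auto simp: zero_ext_def fun_eq_iff)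
    have "(\<lambda>x. \<bar>zero_ext f x\<bar> powr q) absolutely_integrable_on UNIV" unfolding eq absolutely_integrable_restrict_UNIV by (rule fi)
    then have L: "Lp_mem UNIV p (zero_ext f)" using Lp_finite(1)[OF False, of UNIV] m by (simp add: q_def)
    have "integral UNIV (\<lambda>x. \<bar>zero_ext f x\<bar> powr q) = integral spiral (\<lambda>x. \<bar>f x\<bar> powr q)" unfolding eq by (rule integral_restrict_UNIV)
    then show ?thesis using L Lp_finite(2)[OF False _ L] Lp_finite(2)[OF False spiral_sets f] by (simp add: q_def)
  qed
qed

abbreviation "col_inner \<equiv> col_map ` lower"
abbreviation "col_outer \<equiv> col_map ` upper"

lemma lower_upper_collar: "lower \<subseteq> collar" "upper \<subseteq> collar" by (auto simp: strip_def)

lemma spiral_fun_col_inner: "z \<in> col_inner \<Longrightarrow> spiral_fun z < 0" and spiral_fun_col_outer: "z \<in> col_outer \<Longrightarrow> 0 < spiral_fun z"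
proof -
  have "w$2 * spiral_fun (col_map w) > 0" if "w \<in> lower \<union> upper" for w
    by (rule spiral_fun_col_map_sign) (use that in \<open>auto simp: strip_def\<close>)
  then have k: "w \<in> lower \<Longrightarrow> w$2 * spiral_fun (col_map w) > 0" "w \<in> upper \<Longrightarrow> w$2 * spiral_fun (col_map w) > 0" for w by auto
  show "z \<in> col_inner \<Longrightarrow> spiral_fun z < 0" using k(1) by (force simp: strip_def zero_less_mult_iff)
  show "z \<in> col_outer \<Longrightarrow> 0 < spiral_fun z" using k(2) by (force simp: strip_def zero_less_mult_iff)
qed

lemma col_inner_eq: "col_inner = col_nbhd \<inter> spiral" and col_outer_disjoint: "col_outer \<inter> spiral = {}"
proof -
  show "col_outer \<inter> spiral = {}" using spiral_fun_col_outer by (force simp: spiral_def)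
  show "col_inner = col_nbhd \<inter> spiral"
  proof
    show "col_inner \<subseteq> col_nbhd \<inter> spiral" using spiral_fun_col_inner lower_upper_collar by (auto simp: spiral_def)
    show "col_nbhd \<inter> spiral \<subseteq> col_inner"
    proof
      fix z assume "z \<in> col_nbhd \<inter> spiral"
      then obtain w where w: "w \<in> collar" "z = col_map w" "spiral_fun z < 0" by (auto simp: spiral_def)
      have "w$2 < 0"
      proof (rule ccontr)
        assume "\<not> w$2 < 0"
        then consider "w$2 = 0" | "w \<in> upper" using w(1) by (force simp: strip_def)
        then show False using spiral_fun_col_map_zero[of w] spiral_fun_col_outer[of z] w by cases auto
      qed
      then show "z \<in> col_inner" using w by (auto simp: strip_def)
    qed
  qed
qed

lemma col_inner_sets: "col_inner \<in> sets lebesgue" and col_outer_sets: "col_outer \<in> sets lebesgue" and col_nbhd_sets: "col_nbhd \<in> sets lebesgue"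
  using open_col_map_image[OF open_strip lower_upper_collar(1)] open_col_map_image[OF open_strip lower_upper_collar(2)] open_col_nbhd by auto

definition col_refl :: "pt \<Rightarrow> pt" where "col_refl z = col_map (refl2 (col_inv z))"

lemma refl2_collar: "w \<in> collar \<Longrightarrow> refl2 w \<in> collar" by (auto simp: strip_def)

lemma col_refl_col_map: "w \<in> collar \<Longrightarrow> col_refl (col_map w) = col_map (refl2 w)"
  by (simp add: col_refl_def col_inv_col_map)

lemma col_refl_col_refl: "z \<in> col_nbhd \<Longrightarrow> col_refl (col_refl z) = z"
  using col_refl_col_map refl2_collar by auto

lemma col_refl_image: "col_refl ` col_outer = col_inner" "col_refl ` col_inner = col_outer"
proof -
  have "col_refl ` col_map ` S = col_map ` refl2 ` S" if "S \<subseteq> collar" for S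
    unfolding image_image using col_refl_col_map that by (intro image_cong) auto
  then show "col_refl ` col_outer = col_inner" "col_refl ` col_inner = col_outer" using lower_upper_collar refl2_image_lower by auto
qed

lemma inj_col_refl: "S \<subseteq> col_nbhd \<Longrightarrow> inj_on col_refl S"
  by (metis col_refl_col_refl inj_onI subsetD)

definition col_refl_deriv :: "pt \<Rightarrow> pt \<Rightarrow> pt" where
  "col_refl_deriv w v = (let w' = refl2 w; a = (TY2 w * v$1 - TY1 w * v$2) / col_jac w; b = (TX1 w * v$2 - TX2 w * v$1) / col_jac w in
     vector [TX1 w' * a - TY1 w' * b, TX2 w' * a - TY2 w' * b])"

lemma col_refl_has_derivative:
  assumes w: "w \<in> collar" shows "(col_refl has_derivative col_refl_deriv w) (at (col_map w) within S)"
proof -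
  have "((\<lambda>z. col_map (refl2 (col_inv z))) has_derivative col_refl_deriv w) (at (col_map w))"
    using has_derivative_compose[OF has_derivative_compose[OF col_inv_has_derivative[OF w] refl2_has_derivative] col_map_has_derivative]
    by (rule has_derivative_eq_rhs) (auto simp: col_refl_deriv_def Let_def fun_eq_iff col_inv_col_map[OF w])
  then show ?thesis unfolding col_refl_def[abs_def] by (rule has_derivative_at_withinI)
qed

lemma det_col_refl_deriv:
  assumes w: "w \<in> collar" shows "\<bar>det (matrix (col_refl_deriv w))\<bar> = col_jac (refl2 w) / col_jac w"
proof -
  define J where "J = col_jac w"
  have J: "J > 0" "col_jac (refl2 w) > 0" using col_jac_pos[OF w] col_jac_pos[OF refl2_collar[OF w]] by (auto simp: J_def)
  define m where "m = matrix (col_refl_deriv w)"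
  define x1 x2 y1 y2 X1 X2 Y1 Y2 where d: "x1 = TX1 w" "x2 = TX2 w" "y1 = TY1 w" "y2 = TY2 w"
    "X1 = TX1 (refl2 w)" "X2 = TX2 (refl2 w)" "Y1 = TY1 (refl2 w)" "Y2 = TY2 (refl2 w)"
  have m: "J * m$1$1 = X1 * y2 + Y1 * x2" "J * m$1$2 = - X1 * y1 - Y1 * x1" "J * m$2$1 = X2 * y2 + Y2 * x2" "J * m$2$2 = - X2 * y1 - Y2 * x1"
    using J by (simp_all add: m_def matrix_def col_refl_deriv_def Let_def axis_def J_def[symmetric] d[symmetric] field_simps)
  have "J * J * det m = (J * m$1$1) * (J * m$2$2) - (J * m$1$2) * (J * m$2$1)" unfolding det_2 by algebra
  also have "\<dots> = - (x1 * y2 - x2 * y1) * (X1 * Y2 - X2 * Y1)" unfolding m by algebra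
  also have "\<dots> = - J * col_jac (refl2 w)" using col_jac_eq[of w] col_jac_eq[of "refl2 w"] by (simp add: d J_def)
  finally have "J * (J * det m) = J * (- col_jac (refl2 w))" by (simp add: mult.assoc)
  then have "J * det m = - col_jac (refl2 w)" using J by (simp only: mult_cancel_left) auto
  then have "det m = - (col_jac (refl2 w) / J)" using J by (simp add: field_simps)
  then show ?thesis using J by (simp add: m_def J_def)
qed

definition refl_ext :: "(pt \<Rightarrow> real) \<Rightarrow> pt \<Rightarrow> real" where "refl_ext f z = (if z \<in> col_outer then f (col_refl z) else 0)"

lemma jac_bounds: "w \<in> collar \<Longrightarrow> 1/6 \<le> col_jac (refl2 w) / col_jac w"
proof -
  assume w: "w \<in> collar"
  have a: "\<bar>w$2\<bar> \<le> 1/10" "\<bar>refl2 w$2\<bar> \<le> 1/10" using collar_abs[OF w] by auto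
  have "col_jac w \<le> 6 * col_jac (refl2 w)" using col_jac_bounds[OF a(1)] col_jac_bounds[OF a(2)] by simp
  then show ?thesis using col_jac_pos[OF w] by (simp add: field_simps)
qed

lemma col_refl_differentiable: "S \<subseteq> col_nbhd \<Longrightarrow> col_refl differentiable_on S"
  unfolding differentiable_on_def differentiable_def
proof
  fix z assume "S \<subseteq> col_nbhd" "z \<in> S"
  then obtain w where "w \<in> collar" "z = col_map w" by auto
  then show "\<exists>D. (col_refl has_derivative D) (at z within S)" using col_refl_has_derivative[of w S] by auto
qed

lemma refl_ext_measurable:
  assumes "f \<in> borel_measurable (lebesgue_on spiral)"
  shows "refl_ext f \<in> borel_measurable (lebesgue_on UNIV)"
proof -
  have fl: "f \<in> borel_measurable (lebesgue_on col_inner)"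
    by (rule measurable_restrict_mono[OF assms]) (use col_inner_eq in auto)
  have "(\<lambda>z. f (col_refl z)) \<in> borel_measurable (lebesgue_on col_outer)"
  proof (rule measurableI)
    fix B :: "real set" assume B: "B \<in> sets borel"
    have "f -` B \<inter> space (lebesgue_on col_inner) \<in> sets (lebesgue_on col_inner)" using fl B by (rule measurable_sets)
    then have "f -` B \<inter> col_inner \<in> sets lebesgue" using col_inner_sets by (auto simp: sets_restrict_space_iff)
    then have "col_refl ` (f -` B \<inter> col_inner) \<in> sets lebesgue"
      by (rule differentiable_image_in_sets_lebesgue[OF _ order_refl]) (rule col_refl_differentiable, use col_inner_eq in blast)
    moreover have "col_refl ` (f -` B \<inter> col_inner) = (\<lambda>z. f (col_refl z)) -` B \<inter> col_outer"
    proof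
      have UU: "col_inner \<subseteq> col_nbhd" "col_outer \<subseteq> col_nbhd" using lower_upper_collar by auto
      show "col_refl ` (f -` B \<inter> col_inner) \<subseteq> (\<lambda>z. f (col_refl z)) -` B \<inter> col_outer"
        using col_refl_col_refl UU col_refl_image(2) by auto
      show "(\<lambda>z. f (col_refl z)) -` B \<inter> col_outer \<subseteq> col_refl ` (f -` B \<inter> col_inner)"
      proof
        fix z assume z: "z \<in> (\<lambda>z. f (col_refl z)) -` B \<inter> col_outer"
        then have "col_refl z \<in> f -` B \<inter> col_inner" using col_refl_image(1) by blast
        moreover have "z = col_refl (col_refl z)" using col_refl_col_refl[of z] z UU by auto
        ultimately show "z \<in> col_refl ` (f -` B \<inter> col_inner)" by (rule rev_image_eqI)
      qed
    qed
    ultimately show "(\<lambda>z. f (col_refl z)) -` B \<inter> space (lebesgue_on col_outer) \<in> sets (lebesgue_on col_outer)"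
      using col_outer_sets by (simp add: sets_restrict_space_iff)
  qed auto
  from borel_measurable_if_zero[OF this col_outer_sets] show ?thesis by (simp add: refl_ext_def[abs_def])
qed

lemma Lp_refl_ext:
  assumes p: "1 \<le> p" and f: "Lp_mem spiral p f"
  shows "Lp_mem UNIV p (refl_ext f) \<and> Lp_norm UNIV p (refl_ext f) \<le> 6 * Lp_norm spiral p f"
proof -
  have m: "refl_ext f \<in> borel_measurable (lebesgue_on UNIV)" by (rule refl_ext_measurable) (use f in \<open>simp add: Lp_mem_def\<close>)
  have UU: "col_inner \<subseteq> col_nbhd" "col_outer \<subseteq> col_nbhd" using lower_upper_collar by auto
  show ?thesis
  proof (cases "p = \<infinity>")
    case True
    define N where "N = Lp_norm spiral \<infinity> f"
    have nn: "0 \<le> N" unfolding N_def using Linf_bound(2) f True spiral_sets spiral_not_negligible by auto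
    have "AE x in lebesgue. x \<in> spiral \<longrightarrow> \<bar>f x\<bar> \<le> N" unfolding N_def using Linf_bound(1) f True spiral_sets spiral_not_negligible by auto
    then obtain Z where Z: "{x. \<not> (x \<in> spiral \<longrightarrow> \<bar>f x\<bar> \<le> N)} \<subseteq> Z" "Z \<in> null_sets lebesgue" by (auto simp: eventually_ae_filter)
    have "negligible (Z \<inter> col_inner)" using Z(2) by (meson negligible_iff_null_sets negligible_Int)
    then have "negligible (col_refl ` (Z \<inter> col_inner))"
      by (rule negligible_differentiable_image_negligible[OF order_refl]) (rule col_refl_differentiable, use UU in auto)
    then have "col_refl ` (Z \<inter> col_inner) \<in> null_sets lebesgue" by (simp add: negligible_iff_null_sets)
    moreover have "{x. \<not> \<bar>refl_ext f x\<bar> \<le> N} \<subseteq> col_refl ` (Z \<inter> col_inner)"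
    proof
      fix z assume "z \<in> {x. \<not> \<bar>refl_ext f x\<bar> \<le> N}"
      then have z: "z \<in> col_outer" "\<not> \<bar>f (col_refl z)\<bar> \<le> N" using nn by (auto simp: refl_ext_def split: if_splits)
      then have "col_refl z \<in> col_inner" using col_refl_image(1) by blast
      then have "col_refl z \<in> Z \<inter> col_inner" using Z(1) z(2) col_inner_eq by auto
      moreover have "z = col_refl (col_refl z)" using col_refl_col_refl[of z] z UU by auto
      ultimately show "z \<in> col_refl ` (Z \<inter> col_inner)" by (rule rev_image_eqI)
    qed
    ultimately have "AE x in lebesgue. \<bar>refl_ext f x\<bar> \<le> N" by (intro AE_I'[of "col_refl ` (Z \<inter> col_inner)"]) auto
    from Linf_intro[OF m this] show ?thesis using True nn by (auto simp: N_def)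
  next
    case False
    define q where "q = enn2real p"
    have q: "1 \<le> q" unfolding q_def by (rule enn2real_ge1[OF p False])
    define F where "F x = \<bar>f x\<bar> powr q" for x
    have Fs: "F absolutely_integrable_on spiral" using f Lp_finite(1)[OF False spiral_sets] by (simp add: q_def F_def[abs_def])
    have Fl: "F absolutely_integrable_on col_inner" by (rule set_integrable_subset[OF Fs col_inner_sets]) (use col_inner_eq in auto)
    define jr where "jr z = col_jac (refl2 (col_inv z)) / col_jac (col_inv z)" for z
    have dz: "(col_refl has_derivative col_refl_deriv (col_inv z)) (at z within col_outer)" if "z \<in> col_outer" for z
      using col_refl_has_derivative[OF col_inv_mem[of z], of col_outer] col_map_col_inv[of z] that UU by auto
    have cv: "(\<lambda>z. \<bar>det (matrix (col_refl_deriv (col_inv z)))\<bar> * F (col_refl z)) absolutely_integrable_on col_outer \<and>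
       integral col_outer (\<lambda>z. \<bar>det (matrix (col_refl_deriv (col_inv z)))\<bar> * F (col_refl z)) = integral col_inner F"
      using change_of_variables_real[OF col_outer_sets dz inj_col_refl[OF UU(2)], of F "integral col_inner F"] Fl col_refl_image(1) by simp
    have dj: "\<bar>det (matrix (col_refl_deriv (col_inv z)))\<bar> = jr z" "1/6 \<le> jr z" if "z \<in> col_outer" for z
      using det_col_refl_deriv[OF col_inv_mem[of z]] jac_bounds[OF col_inv_mem[of z]] that UU by (auto simp: jr_def)
    have ji: "(\<lambda>z. jr z * F (col_refl z)) absolutely_integrable_on col_outer"
      using cv by (intro set_integrable_cong[THEN iffD1, OF refl refl _ conjunct1[OF cv]]) (simp add: dj)
    have jint: "integral col_outer (\<lambda>z. jr z * F (col_refl z)) = integral col_inner F"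
      unfolding conjunct2[OF cv, symmetric] by (rule integral_cong) (simp add: dj)
    have nz: "col_jac (col_inv z) \<noteq> 0" if "z \<in> col_outer" for z using col_jac_pos[OF col_inv_mem[of z]] that UU by auto
    have cI: "continuous_on col_outer col_inv" by (rule continuous_on_subset[OF continuous_on_col_inv UU(2)])
    have jc: "continuous_on col_outer jr" unfolding jr_def
      by (intro continuous_on_divide continuous_on_compose2[OF continuous_on_T(5)[of UNIV]] continuous_on_compose2[OF continuous_on_refl2[of UNIV]] cI)
         (use nz in auto)
    have "(\<lambda>z. (jr z * F (col_refl z)) * (1 / jr z)) absolutely_integrable_on col_outer"
    proof (rule absolutely_integrable_mult_bounded[OF ji col_outer_sets])
      show "continuous_on col_outer (\<lambda>z. 1 / jr z)" by (intro continuous_intros jc) (use dj(2) in force)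
      have "\<bar>1 / jr z\<bar> \<le> 6" if "z \<in> col_outer" for z using dj(2)[OF that] by (simp add: field_simps)
      then show "bounded ((\<lambda>z. 1 / jr z) ` col_outer)" by (auto simp: bounded_iff intro!: exI[of _ 6])
    qed
    then have Ri: "(\<lambda>z. F (col_refl z)) absolutely_integrable_on col_outer"
      by (rule set_integrable_cong[THEN iffD1, OF refl refl, rotated]) (use dj(2) in force)
    have eq: "(\<lambda>x. \<bar>refl_ext f x\<bar> powr q) = (\<lambda>x. if x \<in> col_outer then F (col_refl x) else 0)" by (auto simp: refl_ext_def F_def fun_eq_iff)
    have "(\<lambda>x. \<bar>refl_ext f x\<bar> powr q) absolutely_integrable_on UNIV" unfolding eq absolutely_integrable_restrict_UNIV by (rule Ri)
    then have L: "Lp_mem UNIV p (refl_ext f)" using Lp_finite(1)[OF False, of UNIV] m by (simp add: q_def)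
    have "integral UNIV (\<lambda>x. \<bar>refl_ext f x\<bar> powr q) = integral col_outer (\<lambda>z. F (col_refl z))" unfolding eq by (rule integral_restrict_UNIV)
    also have "\<dots> \<le> integral col_outer (\<lambda>z. 6 * (jr z * F (col_refl z)))"
    proof (rule integral_le)
      show "F (col_refl z) \<le> 6 * (jr z * F (col_refl z))" if "z \<in> col_outer" for z
        using mult_right_mono[OF dj(2)[OF that], of "F (col_refl z)"] by (simp add: F_def)
    qed (use set_lebesgue_integral_eq_integral(1) Ri ji in \<open>auto intro!: integrable_on_mult_right\<close>)
    also have "\<dots> = 6 * integral col_inner F" using jint by simp
    also have "\<dots> \<le> 6 * integral spiral F"
    proof -
      have "integral col_inner F \<le> integral spiral F"
        by (rule integral_subset_le) (use col_inner_eq set_lebesgue_integral_eq_integral(1) Fl Fs in \<open>auto simp: F_def\<close>)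
      then show ?thesis by simp
    qed
    finally have le: "integral UNIV (\<lambda>x. \<bar>refl_ext f x\<bar> powr q) \<le> 6 * integral spiral F" .
    have I0: "0 \<le> integral spiral F" using set_lebesgue_integral_eq_integral(1)[OF Fs] by (intro integral_nonneg) (auto simp: F_def)
    have "(integral UNIV (\<lambda>x. \<bar>refl_ext f x\<bar> powr q)) powr (1/q) \<le> (6 * integral spiral F) powr (1/q)"
      using q le \<open>(\<lambda>x. \<bar>refl_ext f x\<bar> powr q) absolutely_integrable_on UNIV\<close>
      by (intro powr_mono2 integral_nonneg set_lebesgue_integral_eq_integral(1)) auto
    also have "\<dots> = 6 powr (1/q) * (integral spiral F) powr (1/q)" using I0 by (simp add: powr_mult)
    also have "\<dots> \<le> 6 * (integral spiral F) powr (1/q)"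
      using powr_mono[of "1/q" 1 6] q by (intro mult_right_mono) auto
    finally show ?thesis using L Lp_finite(2)[OF False _ L] Lp_finite(2)[OF False spiral_sets f] by (simp add: q_def F_def[abs_def])
  qed
qed

section \<open>The extension operator\<close>

definition sq_pos :: "real \<Rightarrow> real" where "sq_pos s = (if s \<le> 0 then 0 else s\<^sup>2)"
definition sq_pos' :: "real \<Rightarrow> real" where "sq_pos' s = (if s \<le> 0 then 0 else 2 * s)"

lemma DERIV_sq_pos: "DERIV sq_pos s :> sq_pos' s"
  unfolding sq_pos_def[abs_def] sq_pos'_def
  by (rule DERIV_piecewise_zero[where c = 1]) (auto intro!: derivative_eq_intros)

lemma continuous_on_sq_pos [continuous_intros]: "continuous_on S f \<Longrightarrow> continuous_on S (\<lambda>x. sq_pos (f x))"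
  and continuous_on_sq_pos' [continuous_intros]: "continuous_on S f \<Longrightarrow> continuous_on S (\<lambda>x. sq_pos' (f x))"
proof -
  have eq: "sq_pos = (\<lambda>s. (max s 0)\<^sup>2)" "sq_pos' = (\<lambda>s. 2 * max s 0)" by (auto simp: sq_pos_def sq_pos'_def max_def fun_eq_iff)
  show "continuous_on S (\<lambda>x. sq_pos (f x))" "continuous_on S (\<lambda>x. sq_pos' (f x))" if "continuous_on S f"
    unfolding eq by (intro continuous_intros that)+
qed

definition cutA :: "real \<Rightarrow> real" where "cutA y = sq_pos (1/400 - y\<^sup>2)"
definition cutB :: "real \<Rightarrow> real" where "cutB y = sq_pos (y\<^sup>2 - 1/1600)"
definition cutX :: "real \<Rightarrow> real" where "cutX y = cutA y / (cutA y + cutB y)"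
definition cutX' :: "real \<Rightarrow> real" where
  "cutX' y = ((- (2 * y) * sq_pos' (1/400 - y\<^sup>2)) * (cutA y + cutB y) - cutA y * (- (2 * y) * sq_pos' (1/400 - y\<^sup>2) + 2 * y * sq_pos' (y\<^sup>2 - 1/1600)))
      / ((cutA y + cutB y) * (cutA y + cutB y))"

lemma cut_pos: "0 < cutA y + cutB y"
proof -
  have "0 < 1/400 - y\<^sup>2 \<or> 0 < y\<^sup>2 - 1/1600" by linarith
  then show ?thesis by (auto simp: cutA_def cutB_def sq_pos_def add_pos_nonneg add_nonneg_pos)
qed

lemma cutX_bounds: "0 \<le> cutX y" "cutX y \<le> 1"
  using cut_pos[of y] by (auto simp: cutX_def divide_le_eq) (auto simp: cutA_def cutB_def sq_pos_def)

lemma DERIV_cutX: "DERIV cutX y :> cutX' y"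
proof -
  have a: "DERIV cutA y :> - (2 * y) * sq_pos' (1/400 - y\<^sup>2)"
  proof -
    have "DERIV (\<lambda>y. 1/400 - y\<^sup>2) y :> - (2 * y)" by (auto intro!: derivative_eq_intros)
    from DERIV_chain2[OF DERIV_sq_pos this] show ?thesis by (simp add: cutA_def[abs_def] mult.commute)
  qed
  have b: "DERIV cutB y :> 2 * y * sq_pos' (y\<^sup>2 - 1/1600)"
  proof -
    have "DERIV (\<lambda>y. y\<^sup>2 - 1/1600) y :> 2 * y" by (auto intro!: derivative_eq_intros)
    from DERIV_chain2[OF DERIV_sq_pos this] show ?thesis by (simp add: cutB_def[abs_def] mult.commute)
  qed
  show ?thesis unfolding cutX_def[abs_def] cutX'_def
    by (rule DERIV_divide[OF a DERIV_add[OF a b]]) (use cut_pos[of y] in simp)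
qed

lemma continuous_on_cutX': "continuous_on S cutX'"
  unfolding cutX'_def[abs_def] cutA_def cutB_def
  by (intro continuous_intros ballI) (use cut_pos[unfolded cutA_def cutB_def] in \<open>auto simp: less_imp_neq[symmetric]\<close>)

lemma cutX_zero: "1/20 \<le> \<bar>y\<bar> \<Longrightarrow> cutX y = 0"
proof -
  assume "1/20 \<le> \<bar>y\<bar>"
  then have "(1/20)\<^sup>2 \<le> \<bar>y\<bar>\<^sup>2" by (intro power_mono) auto
  then show ?thesis by (simp add: cutX_def cutA_def sq_pos_def power2_eq_square)
qed

lemma cutX_one: "\<bar>y\<bar> \<le> 1/40 \<Longrightarrow> cutX y = 1"
proof -
  assume "\<bar>y\<bar> \<le> 1/40"
  then have "\<bar>y\<bar>\<^sup>2 \<le> (1/40)\<^sup>2" by (intro power_mono) auto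
  then have "cutB y = 0" by (simp add: cutB_def sq_pos_def power2_eq_square)
  then show ?thesis using cut_pos[of y] by (simp add: cutX_def)
qed

lemma cutX'_bounded: obtains C where "C \<ge> 0" "\<And>y. \<bar>y\<bar> \<le> 1/10 \<Longrightarrow> \<bar>cutX' y\<bar> \<le> C"
proof -
  have "bounded (cutX' ` {-1/10..1/10})" by (intro compact_imp_bounded compact_continuous_image continuous_on_cutX') auto
  then obtain C where C: "C > 0" "\<And>y. y \<in> {-1/10..1/10} \<Longrightarrow> \<bar>cutX' y\<bar> \<le> C" unfolding bounded_pos by auto
  have "y \<in> {-1/10..1/10}" if "\<bar>y\<bar> \<le> 1/10" for y :: real using that unfolding atLeastAtMost_iff by linarith
  then show ?thesis using C by (intro that[of C]) (simp, blast)
qed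

definition cutoff :: "pt \<Rightarrow> real" where "cutoff z = (if z \<in> col_nbhd then cutX (col_inv z $ 2) else 0)"
definition cutoff_grad :: "pt \<Rightarrow> pt" where
  "cutoff_grad z = (if z \<in> col_nbhd then cutX' (col_inv z $ 2) *\<^sub>R vector [- TX2 (col_inv z) / col_jac (col_inv z), TX1 (col_inv z) / col_jac (col_inv z)] else 0)"
abbreviation "cutoff_supp \<equiv> col_map ` {w. \<bar>w$2\<bar> \<le> 1/20}"

lemma cutoff_supp_col_nbhd: "cutoff_supp \<subseteq> col_nbhd" by (auto simp: strip_def abs_le_iff)

lemma cutoff_bounds: "0 \<le> cutoff z" "cutoff z \<le> 1" using cutX_bounds by (auto simp: cutoff_def)

lemma cutoff_zero: "z \<notin> cutoff_supp \<Longrightarrow> cutoff z = 0"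
proof (cases "z \<in> col_nbhd")
  case True
  assume "z \<notin> cutoff_supp"
  then have "\<not> \<bar>col_inv z $ 2\<bar> \<le> 1/20" using col_map_col_inv[OF True] by (metis (mono_tags, lifting) imageI mem_Collect_eq)
  then show ?thesis using cutX_zero[of "col_inv z $ 2"] by (simp add: cutoff_def)
qed (simp add: cutoff_def)

lemma closed_cutoff_supp: "closed cutoff_supp" by (rule closed_col_map_strip) simp

lemma cutoff_has_derivative: "(cutoff has_derivative (\<lambda>v. cutoff_grad z \<bullet> v)) (at z)"
  and continuous_on_cutoff_grad: "continuous_on A cutoff_grad"
proof -
  have dU: "(cutoff has_derivative (\<lambda>v. cutoff_grad z \<bullet> v)) (at z)" if zU: "z \<in> col_nbhd" for z
  proof -
    obtain w where w: "w \<in> collar" "z = col_map w" using zU by auto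
    have Iz: "col_inv z = w" using w col_inv_col_map by simp
    have "((\<lambda>z. col_inv z $ 2) has_derivative (\<lambda>v. (TX1 w * v$2 - TX2 w * v$1) / col_jac w)) (at z)"
      using bounded_linear.has_derivative[OF bounded_linear_vec_nth[of 2] col_inv_has_derivative[OF w(1)]] w(2) by simp
    from has_derivative_compose[OF this DERIV_cutX[unfolded has_field_derivative_def]]
    have "((\<lambda>z. cutX (col_inv z $ 2)) has_derivative (\<lambda>v. cutoff_grad z \<bullet> v)) (at z)"
      by (rule has_derivative_eq_rhs) (use zU in \<open>auto simp: cutoff_grad_def Iz inner_pt fun_eq_iff diff_divide_distrib algebra_simps\<close>)
    then show ?thesis by (rule has_derivative_transform_within_open[OF _ open_col_nbhd zU]) (simp add: cutoff_def)
  qed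
  have op: "open (- cutoff_supp)" using closed_cutoff_supp by auto
  have d0: "(cutoff has_derivative (\<lambda>v. 0)) (at z)" if "z \<notin> cutoff_supp" for z
    by (rule has_derivative_transform_within_open[OF has_derivative_const[of 0] op]) (use that cutoff_zero in auto)
  have G0: "cutoff_grad z = 0" if "z \<notin> cutoff_supp" for z
  proof (cases "z \<in> col_nbhd")
    case True
    show ?thesis by (rule gradient_zero_off_closed_support[OF closed_cutoff_supp cutoff_zero dU[OF True] that])
  qed (simp add: cutoff_grad_def)
  show "(cutoff has_derivative (\<lambda>v. cutoff_grad z \<bullet> v)) (at z)"
  proof (cases "z \<in> col_nbhd")
    case False
    then have "z \<notin> cutoff_supp" using cutoff_supp_col_nbhd by auto
    then show ?thesis using d0[of z] G0[of z] by simp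
  qed (rule dU)
  have nz: "col_jac (col_inv z) \<noteq> 0" if "z \<in> col_nbhd" for z using col_jac_pos[OF col_inv_mem[OF that]] by simp
  have cI: "continuous_on col_nbhd (\<lambda>z. f (col_inv z))" if "continuous_on UNIV f" for f :: "pt \<Rightarrow> real"
    by (rule continuous_on_compose2[OF that continuous_on_col_inv]) auto
  have "continuous_on (col_nbhd \<union> - cutoff_supp) cutoff_grad"
  proof (rule continuous_on_open_Un[OF open_col_nbhd op])
    have "continuous_on col_nbhd (\<lambda>z. cutX' (col_inv z $ 2) *\<^sub>R (vector [- TX2 (col_inv z) / col_jac (col_inv z), TX1 (col_inv z) / col_jac (col_inv z)] :: pt))"
      by (intro continuous_on_scaleR continuous_on_vector2 continuous_on_divide continuous_on_minus
          cI[OF continuous_on_T(1)] cI[OF continuous_on_T(2)] cI[OF continuous_on_T(5)] ballI nz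
          continuous_on_compose2[OF continuous_on_cutX'[of UNIV]] continuous_on_component continuous_on_col_inv) auto
    then show "continuous_on col_nbhd cutoff_grad" by (rule continuous_on_eq) (simp add: cutoff_grad_def)
    have "continuous_on (- cutoff_supp) (\<lambda>z. 0 :: pt)" by (rule continuous_on_const)
    then show "continuous_on (- cutoff_supp) cutoff_grad" by (rule continuous_on_eq) (use G0 in auto)
  qed
  moreover have "col_nbhd \<union> - cutoff_supp = UNIV" using cutoff_supp_col_nbhd by auto
  ultimately show "continuous_on A cutoff_grad" by (metis continuous_on_subset subset_UNIV)
qed

lemma cutoff_grad_bounded: obtains C where "C \<ge> 0" "\<And>z i. \<bar>cutoff_grad z $ i\<bar> \<le> C"
proof -
  obtain C where C: "C \<ge> 0" "\<And>y. \<bar>y\<bar> \<le> 1/10 \<Longrightarrow> \<bar>cutX' y\<bar> \<le> C" using cutX'_bounded by blast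
  have "\<bar>cutoff_grad z $ i\<bar> \<le> C * 8" for z i
  proof (cases "z \<in> col_nbhd")
    case True
    define w where "w = col_inv z"
    have w: "w \<in> collar" "\<bar>w$2\<bar> \<le> 1/10" using col_inv_mem[OF True] collar_abs by (auto simp: w_def)
    have J: "0 < col_jac w" "col_phase (w$1) \<le> 2 * col_jac w" using col_jac_pos[OF w(1)] col_jac_bounds(1)[OF w(2)] by auto
    have t: "\<bar>TX1 w\<bar> / col_jac w \<le> 8" "\<bar>TX2 w\<bar> / col_jac w \<le> 8" using TX_bounds(1,2)[OF w(2)] J by (auto simp: divide_le_eq)
    have v: "\<bar>(vector [- TX2 w / col_jac w, TX1 w / col_jac w] :: pt) $ i\<bar> \<le> 8"
      using t J exhaust_2[of i] by auto
    have "\<bar>cutoff_grad z $ i\<bar> = \<bar>cutX' (w$2)\<bar> * \<bar>(vector [- TX2 w / col_jac w, TX1 w / col_jac w] :: pt) $ i\<bar>"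
      using True by (simp add: cutoff_grad_def w_def abs_mult)
    also have "\<dots> \<le> C * 8" using C(1) C(2)[OF w(2)] v by (intro mult_mono) auto
    finally show ?thesis .
  qed (use C(1) in \<open>simp add: cutoff_grad_def\<close>)
  then show ?thesis using C(1) by (intro that[of "C * 8"]) auto
qed

text \<open>The derivative of the reflection at col_map w, namely D col_map (refl2 w) diag(1, -1) (D col_map w)^(-1).\<close>
definition col_matrix :: "2 \<Rightarrow> 2 \<Rightarrow> pt \<Rightarrow> real" where
  "col_matrix k i w = (if k = 1 then TX1 else TX2) (refl2 w) * ((if i = 1 then TY2 w else - TY1 w) / col_jac w)
     - (if k = 1 then TY1 else TY2) (refl2 w) * ((if i = 1 then - TX2 w else TX1 w) / col_jac w)"
definition refl_matrix :: "2 \<Rightarrow> 2 \<Rightarrow> pt \<Rightarrow> real" where "refl_matrix k i z = (if z \<in> col_nbhd then col_matrix k i (col_inv z) else 0)"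

lemma refl_matrix_bounded: "\<bar>refl_matrix k i z\<bar> \<le> 32"
proof (cases "z \<in> col_nbhd")
  case True
  define w where "w = col_inv z"
  have w: "w \<in> collar" "\<bar>w$2\<bar> \<le> 1/10" "\<bar>refl2 w$2\<bar> \<le> 1/10" using col_inv_mem[OF True] collar_abs by (auto simp: w_def)
  define c where "c = col_phase (w$1)"
  have c: "0 < c" by (simp add: c_def col_phase_pos)
  have J: "0 < col_jac w" "c \<le> 2 * col_jac w" using col_jac_pos[OF w(1)] col_jac_bounds(1)[OF w(2)] by (auto simp: c_def)
  have ij: "1 / col_jac w \<le> 2 / c" using J c by (simp add: field_simps)
  have a: "\<bar>(if k = 1 then TX1 else TX2) (refl2 w)\<bar> \<le> 4 * c" "\<bar>(if k = 1 then TY1 else TY2) (refl2 w)\<bar> \<le> 2"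
    using TX_bounds[OF w(3)] by (auto simp: c_def)
  have "\<bar>(if i = 1 then TY2 w else - TY1 w) / col_jac w\<bar> = \<bar>if i = 1 then TY2 w else - TY1 w\<bar> * (1 / col_jac w)" using J by simp
  also have "\<dots> \<le> 2 * (2 / c)" using TX_bounds(3,4)[OF w(2)] ij J by (intro mult_mono) auto
  finally have b1: "\<bar>(if i = 1 then TY2 w else - TY1 w) / col_jac w\<bar> \<le> 4 / c" by simp
  have "\<bar>(if i = 1 then - TX2 w else TX1 w) / col_jac w\<bar> = \<bar>if i = 1 then - TX2 w else TX1 w\<bar> * (1 / col_jac w)" using J by simp
  also have "\<dots> \<le> (4 * c) * (2 / c)" using TX_bounds(1,2)[OF w(2)] ij J c by (intro mult_mono) (auto simp: c_def)
  finally have b2: "\<bar>(if i = 1 then - TX2 w else TX1 w) / col_jac w\<bar> \<le> 8" using c by simp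
  have "\<bar>(if k = 1 then TX1 else TX2) (refl2 w) * ((if i = 1 then TY2 w else - TY1 w) / col_jac w)\<bar> \<le> (4 * c) * (4 / c)"
    unfolding abs_mult by (intro mult_mono a b1) (use c in auto)
  also have "(4 * c) * (4 / c) = 16" using c by simp
  finally have "\<bar>(if k = 1 then TX1 else TX2) (refl2 w) * ((if i = 1 then TY2 w else - TY1 w) / col_jac w)\<bar> \<le> 16" .
  moreover have "\<bar>(if k = 1 then TY1 else TY2) (refl2 w) * ((if i = 1 then - TX2 w else TX1 w) / col_jac w)\<bar> \<le> 2 * 8"
    unfolding abs_mult by (intro mult_mono a b2) auto
  ultimately have "\<bar>col_matrix k i w\<bar> \<le> 32" unfolding col_matrix_def by linarith
  then show ?thesis using True by (simp add: refl_matrix_def w_def)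
qed (simp add: refl_matrix_def)

lemma col_matrix_identities:
  assumes w: "w \<in> collar"
  shows "col_matrix 1 1 w * TX1 w + col_matrix 1 2 w * TX2 w = TX1 (refl2 w)" "col_matrix 2 1 w * TX1 w + col_matrix 2 2 w * TX2 w = TX2 (refl2 w)"
    "col_matrix 1 1 w * TY1 w + col_matrix 1 2 w * TY2 w = - TY1 (refl2 w)" "col_matrix 2 1 w * TY1 w + col_matrix 2 2 w * TY2 w = - TY2 (refl2 w)"
proof -
  define R11 where "R11 = TY2 w / col_jac w"
  define R12 where "R12 = - TY1 w / col_jac w"
  define R21 where "R21 = - TX2 w / col_jac w"
  define R22 where "R22 = TX1 w / col_jac w"
  have J: "col_jac w \<noteq> 0" using col_jac_pos[OF w] by simp
  have r: "R11 * TX1 w + R12 * TX2 w = 1" "R21 * TX1 w + R22 * TX2 w = 0" "R11 * TY1 w + R12 * TY2 w = 0" "R21 * TY1 w + R22 * TY2 w = 1"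
    using J col_jac_eq[of w] by (simp_all add: R11_def R12_def R21_def R22_def add_divide_distrib[symmetric] diff_divide_distrib[symmetric] algebra_simps)
  have m: "col_matrix 1 1 w = TX1 (refl2 w) * R11 - TY1 (refl2 w) * R21" "col_matrix 1 2 w = TX1 (refl2 w) * R12 - TY1 (refl2 w) * R22"
    "col_matrix 2 1 w = TX2 (refl2 w) * R11 - TY2 (refl2 w) * R21" "col_matrix 2 2 w = TX2 (refl2 w) * R12 - TY2 (refl2 w) * R22"
    by (simp_all add: col_matrix_def R11_def R12_def R21_def R22_def)
  show "col_matrix 1 1 w * TX1 w + col_matrix 1 2 w * TX2 w = TX1 (refl2 w)" using r unfolding m by algebra
  show "col_matrix 2 1 w * TX1 w + col_matrix 2 2 w * TX2 w = TX2 (refl2 w)" using r unfolding m by algebra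
  show "col_matrix 1 1 w * TY1 w + col_matrix 1 2 w * TY2 w = - TY1 (refl2 w)" using r unfolding m by algebra
  show "col_matrix 2 1 w * TY1 w + col_matrix 2 2 w * TY2 w = - TY2 (refl2 w)" using r unfolding m by algebra
qed

lemma refl_matrix_measurable: "refl_matrix k i \<in> borel_measurable (lebesgue_on UNIV)"
proof -
  have nz: "col_jac (col_inv z) \<noteq> 0" if "z \<in> col_nbhd" for z using col_jac_pos[OF col_inv_mem[OF that]] by simp
  have cI: "continuous_on col_nbhd (\<lambda>z. f (col_inv z))" if "continuous_on UNIV f" for f :: "pt \<Rightarrow> real"
    by (rule continuous_on_compose2[OF that continuous_on_col_inv]) auto
  have cR: "continuous_on col_nbhd (\<lambda>z. f (refl2 (col_inv z)))" if "continuous_on UNIV f" for f :: "pt \<Rightarrow> real"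
    by (rule cI) (rule continuous_on_compose2[OF that continuous_on_refl2], auto)
  have c: "continuous_on UNIV (if k = 1 then TX1 else TX2)" "continuous_on UNIV (if k = 1 then TY1 else TY2)"
    "continuous_on UNIV (\<lambda>w. if i = 1 then TY2 w else - TY1 w)" "continuous_on UNIV (\<lambda>w. if i = 1 then - TX2 w else TX1 w)"
    by (cases "k = 1"; cases "i = 1"; auto intro!: continuous_on_T continuous_on_minus)+
  have "continuous_on col_nbhd (\<lambda>z. col_matrix k i (col_inv z))" unfolding col_matrix_def
    by (intro continuous_on_diff continuous_on_mult continuous_on_divide cR[OF c(1)] cR[OF c(2)] cI[OF c(3)] cI[OF c(4)] cI[OF continuous_on_T(5)] ballI nz)
  then have "(\<lambda>z. col_matrix k i (col_inv z)) \<in> borel_measurable (lebesgue_on col_nbhd)"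
    by (rule continuous_imp_measurable_on_sets_lebesgue[OF _ col_nbhd_sets])
  from borel_measurable_if_zero[OF this col_nbhd_sets] show ?thesis by (simp add: refl_matrix_def[abs_def])
qed

lemma integral_zero_outside:
  fixes h :: "pt \<Rightarrow> real"
  assumes "T \<subseteq> S" "\<And>x. x \<in> S \<Longrightarrow> x \<notin> T \<Longrightarrow> h x = 0" shows "integral S h = integral T h"
proof -
  have "(\<lambda>x. if x \<in> S then h x else 0) = (\<lambda>x. if x \<in> T then h x else 0)" using assms by (auto simp: fun_eq_iff)
  then show ?thesis using integral_restrict_UNIV[of S h] integral_restrict_UNIV[of T h] by simp
qed

lemma weak_grad_subset:
  assumes w: "weak_grad S f g" and T: "T \<subseteq> S" shows "weak_grad T f g"
  unfolding weak_grad_def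
proof (intro allI impI)
  fix \<phi> G i assume \<phi>: "C1c T \<phi> G"
  obtain K where K: "compact K" "K \<subseteq> T" "\<And>x. x \<notin> K \<Longrightarrow> \<phi> x = 0" "\<And>x. x \<notin> K \<Longrightarrow> G x = 0"
    by (rule C1c_support[OF \<phi>], rule that)
  have "C1c S \<phi> G" using \<phi> T unfolding C1c_def by blast
  then have "integral S (\<lambda>x. f x * G x $ i) = - integral S (\<lambda>x. g i x * \<phi> x)" using w unfolding weak_grad_def by blast
  moreover have "integral S (\<lambda>x. f x * G x $ i) = integral T (\<lambda>x. f x * G x $ i)"
  proof (rule integral_zero_outside[OF T])
    fix x assume "x \<notin> T"
    then have "G x = 0" using K(2,4) by blast
    then show "f x * G x $ i = 0" by simp
  qed
  moreover have "integral S (\<lambda>x. g i x * \<phi> x) = integral T (\<lambda>x. g i x * \<phi> x)"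
    by (rule integral_zero_outside[OF T]) (use K in auto)
  ultimately show "integral T (\<lambda>x. f x * G x $ i) = - integral T (\<lambda>x. g i x * \<phi> x)" by simp
qed

lemma weak_grad_cong:
  assumes "\<And>x. x \<in> S \<Longrightarrow> f x = f' x" "weak_grad S f g" shows "weak_grad S f' g"
  unfolding weak_grad_def
proof (intro allI impI)
  fix \<phi> G i assume "C1c S \<phi> G"
  then have "integral S (\<lambda>x. f x * G x $ i) = - integral S (\<lambda>x. g i x * \<phi> x)" using assms(2) unfolding weak_grad_def by blast
  moreover have "integral S (\<lambda>x. f x * G x $ i) = integral S (\<lambda>x. f' x * G x $ i)" by (rule integral_cong) (simp add: assms(1))
  ultimately show "integral S (\<lambda>x. f' x * G x $ i) = - integral S (\<lambda>x. g i x * \<phi> x)" by simp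
qed

definition ext_op :: "(pt \<Rightarrow> real) \<Rightarrow> pt \<Rightarrow> real" where "ext_op f z = zero_ext f z + cutoff z * refl_ext f z"
definition ext_grad :: "(pt \<Rightarrow> real) \<Rightarrow> (2 \<Rightarrow> pt \<Rightarrow> real) \<Rightarrow> 2 \<Rightarrow> pt \<Rightarrow> real" where
  "ext_grad f g i z = zero_ext (g i) z + (cutoff z * (refl_matrix 1 i z * refl_ext (g 1) z) + (cutoff z * (refl_matrix 2 i z * refl_ext (g 2) z) + cutoff_grad z $ i * refl_ext f z))"
definition refl_grad :: "(2 \<Rightarrow> pt \<Rightarrow> real) \<Rightarrow> 2 \<Rightarrow> pt \<Rightarrow> real" where
  "refl_grad g i z = refl_matrix 1 i z * refl_ext (g 1) z + refl_matrix 2 i z * refl_ext (g 2) z"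

lemma collar_weak_grad:
  assumes f: "loc_int spiral f" "\<And>i. loc_int spiral (g i)" and w: "weak_grad spiral f g"
    and l: "loc_int UNIV (\<lambda>z. zero_ext f z + refl_ext f z)" "\<And>i. loc_int UNIV (\<lambda>z. zero_ext (g i) z + refl_grad g i z)"
  shows "weak_grad col_nbhd (\<lambda>z. zero_ext f z + refl_ext f z) (\<lambda>i z. zero_ext (g i) z + refl_grad g i z)"
proof -
  have sub: "col_inner \<subseteq> spiral" using col_inner_eq by auto
  note op = open_strip[of "- (1/10)" 0]
  have fl: "loc_int col_inner f" "\<And>i. loc_int col_inner (g i)" using f loc_int_subset[OF _ sub col_inner_sets] by auto
  define F where "F w = f (col_map w)" for w
  define G where "G m w = (if m = 1 then g 1 (col_map w) * TX1 w + g 2 (col_map w) * TX2 w else g 1 (col_map w) * TY1 w + g 2 (col_map w) * TY2 w)" for m :: 2 and w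
  have wl: "weak_grad lower F G"
    using chain_rule_down[OF op lower_upper_collar(1) weak_grad_subset[OF w sub] fl] by (simp add: F_def[abs_def] G_def[abs_def])
  have Fl: "loc_int lower F" unfolding F_def[abs_def] by (rule loc_int_col_map[OF op lower_upper_collar(1) fl(1)])
  have bT: "bounded (h ` (lower \<inter> cball 0 r))" if "continuous_on UNIV h" for h :: "pt \<Rightarrow> real" and r
  proof -
    have "bounded (h ` cball 0 r)" using that by (intro compact_imp_bounded compact_continuous_image) (auto elim: continuous_on_subset)
    then show ?thesis by (rule bounded_subset) auto
  qed
  have pr: "loc_int lower (\<lambda>w. g k (col_map w) * h w)" if "\<And>A. continuous_on A h" for k h
    by (rule loc_int_mult[OF loc_int_col_map[OF op lower_upper_collar(1) fl(2)] strip_sets that bT[OF that]])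
  have Gl: "loc_int lower (G i)" for i
    using loc_int_add[OF pr[OF continuous_on_T(1), of 1] pr[OF continuous_on_T(2), of 2]]
      loc_int_add[OF pr[OF continuous_on_T(3), of 1] pr[OF continuous_on_T(4), of 2]]
    unfolding G_def[abs_def] by (cases "i = 1") auto
  define H where "H i = (if i = 1 then glue (G 1) (G 1) else glue (G 2) (\<lambda>w. - G 2 w))" for i :: 2
  have wc: "weak_grad collar (glue F F) H"
    using reflect_weak_grad[OF wl Fl Gl] by (simp add: H_def[abs_def])
  have Gm: "loc_int lower (\<lambda>w. - G 2 w)"
    using loc_int_mult[OF Gl[of 2] strip_sets continuous_on_const[of _ "-1"] bT[OF continuous_on_const]] by simp
  have Hl: "loc_int collar (H i)" for i unfolding H_def using loc_int_glue Gl Gm by auto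
  have low: "col_map w \<in> spiral" "col_map w \<notin> col_outer" if "w \<in> collar" "w$2 < 0" for w
  proof -
    have "w \<in> lower" using that by (auto simp: strip_def)
    then show "col_map w \<in> spiral" "col_map w \<notin> col_outer" using sub col_outer_disjoint by auto
  qed
  have upp: "col_map w \<in> col_outer" "col_map w \<notin> spiral" if "w \<in> collar" "0 < w$2" for w
  proof -
    have "w \<in> upper" using that by (auto simp: strip_def)
    then show "col_map w \<in> col_outer" "col_map w \<notin> spiral" using col_outer_disjoint by auto
  qed
  have mid: "col_map w \<notin> col_outer" "col_map w \<notin> spiral" if "w$2 = 0" for w
    using spiral_fun_col_map_zero[OF that] spiral_fun_col_outer[of "col_map w"] by (auto simp: spiral_def)
  have Feq: "glue F F w = zero_ext f (col_map w) + refl_ext f (col_map w)" if w: "w \<in> collar" for w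
  proof -
    consider "w$2 < 0" | "0 < w$2" | "w$2 = 0" by linarith
    then show ?thesis
      using low[OF w] upp[OF w] mid[of w] col_refl_col_map[OF w] by cases (auto simp: glue_def F_def zero_ext_def refl_ext_def)
  qed
  have Fc: "loc_int collar (\<lambda>w. zero_ext f (col_map w) + refl_ext f (col_map w))"
    using loc_int_cong[of collar "glue F F" "\<lambda>w. zero_ext f (col_map w) + refl_ext f (col_map w)"] Feq loc_int_glue[OF Fl Fl] by auto
  have wc': "weak_grad collar (\<lambda>w. zero_ext f (col_map w) + refl_ext f (col_map w)) H" by (rule weak_grad_cong[OF Feq wc])
  have geq: "zero_ext (g i) (col_map w) + refl_grad g i (col_map w) = (if w$2 < 0 then g i (col_map w) else col_matrix 1 i w * g 1 (col_map (refl2 w)) + col_matrix 2 i w * g 2 (col_map (refl2 w)))"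
    if w: "w \<in> collar" "w$2 \<noteq> 0" for w i
  proof -
    have wU: "col_map w \<in> col_nbhd" using w by auto
    consider "w$2 < 0" | "0 < w$2" using w(2) by linarith
    then show ?thesis
      using low[OF w(1)] upp[OF w(1)] col_refl_col_map[OF w(1)] col_inv_col_map[OF w(1)] wU by cases (auto simp: zero_ext_def refl_ext_def refl_grad_def refl_matrix_def)
  qed
  have lU: "loc_int col_nbhd (\<lambda>z. zero_ext f z + refl_ext f z)" "\<And>i. loc_int col_nbhd (\<lambda>z. zero_ext (g i) z + refl_grad g i z)"
    using loc_int_subset[OF l(1) subset_UNIV col_nbhd_sets] loc_int_subset[OF l(2) subset_UNIV col_nbhd_sets] by auto
  show ?thesis
  proof (rule chain_rule_up[OF wc' lU Fc Hl])
    fix w assume w: "w \<in> collar" "w$2 \<noteq> 0"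
    note id = col_matrix_identities[OF w(1)]
    show "H 1 w = (zero_ext (g 1) (col_map w) + refl_grad g 1 (col_map w)) * TX1 w + (zero_ext (g 2) (col_map w) + refl_grad g 2 (col_map w)) * TX2 w"
    proof (cases "w$2 < 0")
      case True then show ?thesis unfolding geq[OF w] by (simp add: H_def glue_def G_def)
    next
      case False
      have "H 1 w = g 1 (col_map (refl2 w)) * TX1 (refl2 w) + g 2 (col_map (refl2 w)) * TX2 (refl2 w)" using False w by (simp add: H_def glue_def G_def)
      also have "\<dots> = (col_matrix 1 1 w * g 1 (col_map (refl2 w)) + col_matrix 2 1 w * g 2 (col_map (refl2 w))) * TX1 w + (col_matrix 1 2 w * g 1 (col_map (refl2 w)) + col_matrix 2 2 w * g 2 (col_map (refl2 w))) * TX2 w"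
        unfolding id(1,2)[symmetric] by algebra
      finally show ?thesis unfolding geq[OF w] using False by simp
    qed
    show "H 2 w = (zero_ext (g 1) (col_map w) + refl_grad g 1 (col_map w)) * TY1 w + (zero_ext (g 2) (col_map w) + refl_grad g 2 (col_map w)) * TY2 w"
    proof (cases "w$2 < 0")
      case True then show ?thesis unfolding geq[OF w] by (simp add: H_def glue_def G_def)
    next
      case False
      have "H 2 w = g 1 (col_map (refl2 w)) * (- TY1 (refl2 w)) + g 2 (col_map (refl2 w)) * (- TY2 (refl2 w))" using False w by (simp add: H_def glue_def G_def)
      also have "\<dots> = (col_matrix 1 1 w * g 1 (col_map (refl2 w)) + col_matrix 2 1 w * g 2 (col_map (refl2 w))) * TY1 w + (col_matrix 1 2 w * g 1 (col_map (refl2 w)) + col_matrix 2 2 w * g 2 (col_map (refl2 w))) * TY2 w"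
        unfolding id(3,4)[symmetric] by algebra
      finally show ?thesis unfolding geq[OF w] using False by simp
    qed
  qed
qed

lemma Lp_mult_bounded:
  assumes p: "1 \<le> p" and k: "Lp_mem UNIV p k" and m: "m \<in> borel_measurable (lebesgue_on UNIV)"
    and c: "0 \<le> c" "\<And>x. \<bar>m x\<bar> \<le> c"
  shows "Lp_mem UNIV p (\<lambda>x. m x * k x) \<and> Lp_norm UNIV p (\<lambda>x. m x * k x) \<le> c * Lp_norm UNIV p k"
proof (rule Lp_dominated[OF p _ k c(1)])
  have "k \<in> borel_measurable (lebesgue_on UNIV)" using k by (simp add: Lp_mem_def)
  then show "(\<lambda>x. m x * k x) \<in> borel_measurable (lebesgue_on UNIV)" using m by measurable
  show "\<bar>m x * k x\<bar> \<le> c * \<bar>k x\<bar>" for x unfolding abs_mult by (intro mult_right_mono c) auto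
qed

lemma measurable_cutoff: "cutoff \<in> borel_measurable (lebesgue_on UNIV)" and measurable_cutoff_grad: "(\<lambda>z. cutoff_grad z $ i) \<in> borel_measurable (lebesgue_on UNIV)"
proof -
  have "continuous_on UNIV cutoff" using cutoff_has_derivative by (meson continuous_at_imp_continuous_on has_derivative_continuous)
  then show "cutoff \<in> borel_measurable (lebesgue_on UNIV)" by (rule continuous_imp_measurable_on_sets_lebesgue) simp
  show "(\<lambda>z. cutoff_grad z $ i) \<in> borel_measurable (lebesgue_on UNIV)"
    by (intro continuous_imp_measurable_on_sets_lebesgue continuous_on_component continuous_on_cutoff_grad) simp
qed

lemma cutoff_near_boundary: "spiral_fun z = 0 \<Longrightarrow> z \<in> col_map ` strip (- (1/40)) (1/40)"
  using boundary_col_map[of z] by (auto simp: strip_def intro!: image_eqI)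

lemma cutoff_one: "z \<in> col_map ` strip (- (1/40)) (1/40) \<Longrightarrow> cutoff z = 1"
proof -
  assume "z \<in> col_map ` strip (- (1/40)) (1/40)"
  then obtain w where w: "w \<in> strip (- (1/40)) (1/40)" "z = col_map w" by auto
  then have wc: "w \<in> collar" "\<bar>w$2\<bar> \<le> 1/40" by (auto simp: strip_def)
  then show ?thesis using w col_inv_col_map[OF wc(1)] cutX_one[OF wc(2)] by (auto simp: cutoff_def)
qed

lemma ext_op_weak_grad:
  assumes w: "weak_grad spiral f g"
    and l: "loc_int spiral f" "\<And>i. loc_int spiral (g i)" "loc_int UNIV (zero_ext f)" "\<And>i. loc_int UNIV (zero_ext (g i))"
      "loc_int UNIV (refl_ext f)" "\<And>i. loc_int UNIV (refl_grad g i)"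
  shows "weak_grad UNIV (ext_op f) (ext_grad f g)"
  unfolding weak_grad_def
proof (intro allI impI)
  fix \<phi> H and i :: 2 assume \<phi>: "C1c UNIV \<phi> H"
  obtain K where K: "compact K" "\<And>x. x \<notin> K \<Longrightarrow> \<phi> x = 0" "\<And>x. x \<notin> K \<Longrightarrow> H x = 0"
    by (rule C1c_support[OF \<phi>], rule that)
  have wU: "weak_grad col_nbhd (\<lambda>z. zero_ext f z + refl_ext f z) (\<lambda>i z. zero_ext (g i) z + refl_grad g i z)"
    by (rule collar_weak_grad[OF l(1,2) w]) (intro loc_int_add l)+
  have chic: "continuous_on A cutoff" for A using cutoff_has_derivative by (meson continuous_at_imp_continuous_on has_derivative_continuous)
  define D where "D z = \<phi> z *\<^sub>R cutoff_grad z + cutoff z *\<^sub>R H z" for z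
  have dD: "((\<lambda>z. \<phi> z * cutoff z) has_derivative (\<lambda>v. D z \<bullet> v)) (at z)" for z
    by (rule has_derivative_eq_rhs[OF has_derivative_mult[OF C1cD[OF \<phi>] cutoff_has_derivative]]) (auto simp: D_def inner_add_left algebra_simps)
  have Dc: "continuous_on A D" for A unfolding D_def by (intro continuous_intros C1c_continuous[OF \<phi>] continuous_on_cutoff_grad chic)
  have CU: "C1c col_nbhd (\<lambda>z. \<phi> z * cutoff z) D"
    unfolding C1c_def
  proof (intro conjI allI exI[of _ "K \<inter> cutoff_supp"] dD Dc impI)
    show "compact (K \<inter> cutoff_supp)" by (rule compact_Int_closed[OF K(1) closed_cutoff_supp])
    show "K \<inter> cutoff_supp \<subseteq> col_nbhd" using cutoff_supp_col_nbhd by auto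
    show "\<phi> x * cutoff x = 0" if "x \<notin> K \<inter> cutoff_supp" for x using that K(2) cutoff_zero by auto
  qed
  then have CUN: "C1c UNIV (\<lambda>z. \<phi> z * cutoff z) D" unfolding C1c_def by blast
  have Csp: "C1c spiral (\<lambda>z. if z \<in> spiral then \<phi> z - \<phi> z * cutoff z else 0) (\<lambda>z. if z \<in> spiral then H z - D z else 0)"
  proof (rule C1c_extend[OF open_spiral])
    let ?K = "K \<inter> ({z. spiral_fun z \<le> 0} \<inter> - col_map ` strip (- (1/40)) (1/40))"
    have "strip (- (1/40)) (1/40) \<subseteq> collar" by (auto simp: strip_def)
    from open_col_map_image[OF open_strip this]
    have "closed ({z. spiral_fun z \<le> 0} \<inter> - col_map ` strip (- (1/40)) (1/40))"
      by (intro closed_Int closed_Collect_le continuous_on_spiral_fun continuous_on_const) (simp add: closed_Compl)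
    then show "compact ?K" by (rule compact_Int_closed[OF K(1)])
    show "?K \<subseteq> spiral" using cutoff_near_boundary by (force simp: spiral_def)
    show "((\<lambda>z. \<phi> z - \<phi> z * cutoff z) has_derivative (\<lambda>v. (H x - D x) \<bullet> v)) (at x)" for x
      unfolding inner_diff_left by (intro has_derivative_diff C1cD[OF \<phi>] dD)
    show "continuous_on spiral (\<lambda>x. H x - D x)" by (intro continuous_intros C1c_continuous[OF \<phi>] Dc)
    show "\<phi> x - \<phi> x * cutoff x = 0" if "x \<in> spiral" "x \<notin> ?K" for x
      using that K(2)[of x] cutoff_one[of x] by (auto simp: spiral_def)
  qed
  have e1: "integral spiral (\<lambda>x. f x * (if x \<in> spiral then H x - D x else 0) $ i) = - integral spiral (\<lambda>x. g i x * (if x \<in> spiral then \<phi> x - \<phi> x * cutoff x else 0))"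
    using w Csp unfolding weak_grad_def by blast
  have e2: "integral col_nbhd (\<lambda>x. (zero_ext f x + refl_ext f x) * D x $ i) = - integral col_nbhd (\<lambda>x. (zero_ext (g i) x + refl_grad g i x) * (\<phi> x * cutoff x))"
    using wU CU unfolding weak_grad_def by blast
  have sp: "integral spiral h = integral UNIV (\<lambda>x. if x \<in> spiral then h x else 0)" for h :: "pt \<Rightarrow> real" by (rule integral_restrict_UNIV[symmetric])
  have E1: "integral UNIV (\<lambda>x. zero_ext f x * H x $ i - zero_ext f x * D x $ i) = - integral UNIV (\<lambda>x. zero_ext (g i) x * \<phi> x - zero_ext (g i) x * (\<phi> x * cutoff x))"
  proof -
    have "integral spiral (\<lambda>x. f x * (if x \<in> spiral then H x - D x else 0) $ i) = integral UNIV (\<lambda>x. zero_ext f x * H x $ i - zero_ext f x * D x $ i)"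
      unfolding sp by (rule integral_cong) (simp add: zero_ext_def algebra_simps)
    moreover have "integral spiral (\<lambda>x. g i x * (if x \<in> spiral then \<phi> x - \<phi> x * cutoff x else 0)) = integral UNIV (\<lambda>x. zero_ext (g i) x * \<phi> x - zero_ext (g i) x * (\<phi> x * cutoff x))"
      unfolding sp by (rule integral_cong) (simp add: zero_ext_def algebra_simps)
    ultimately show ?thesis using e1 by simp
  qed
  obtain K' where K': "K' \<subseteq> col_nbhd" "\<And>x. x \<notin> K' \<Longrightarrow> \<phi> x * cutoff x = 0" "\<And>x. x \<notin> K' \<Longrightarrow> D x = 0"
    by (rule C1c_support[OF CU], rule that)
  have E2: "integral UNIV (\<lambda>x. zero_ext f x * D x $ i + refl_ext f x * D x $ i) = - integral UNIV (\<lambda>x. zero_ext (g i) x * (\<phi> x * cutoff x) + refl_grad g i x * (\<phi> x * cutoff x))"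
  proof -
    have "integral UNIV (\<lambda>x. zero_ext f x * D x $ i + refl_ext f x * D x $ i) = integral col_nbhd (\<lambda>x. zero_ext f x * D x $ i + refl_ext f x * D x $ i)"
    proof (rule integral_zero_outside)
      fix x assume "x \<notin> col_nbhd"
      then have "D x = 0" using K' by blast
      then show "zero_ext f x * D x $ i + refl_ext f x * D x $ i = 0" by simp
    qed auto
    moreover have "integral UNIV (\<lambda>x. zero_ext (g i) x * (\<phi> x * cutoff x) + refl_grad g i x * (\<phi> x * cutoff x)) = integral col_nbhd (\<lambda>x. zero_ext (g i) x * (\<phi> x * cutoff x) + refl_grad g i x * (\<phi> x * cutoff x))"
    proof (rule integral_zero_outside)
      fix x assume "x \<notin> col_nbhd"
      then have "\<phi> x * cutoff x = 0" using K' by blast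
      then show "zero_ext (g i) x * (\<phi> x * cutoff x) + refl_grad g i x * (\<phi> x * cutoff x) = 0" by (simp only: mult_zero_right add_0)
    qed auto
    ultimately show ?thesis using e2 by (simp add: distrib_right)
  qed
  have um: "(UNIV :: pt set) \<in> sets lebesgue" by simp
  have hk: "h integrable_on UNIV" if "h absolutely_integrable_on UNIV" for h :: "pt \<Rightarrow> real" using set_lebesgue_integral_eq_integral(1)[OF that] .
  have i1: "(\<lambda>x. zero_ext f x * H x $ i) integrable_on UNIV" "(\<lambda>x. zero_ext f x * D x $ i) integrable_on UNIV" "(\<lambda>x. refl_ext f x * D x $ i) integrable_on UNIV"
    "(\<lambda>x. zero_ext (g i) x * \<phi> x) integrable_on UNIV" "(\<lambda>x. zero_ext (g i) x * (\<phi> x * cutoff x)) integrable_on UNIV" "(\<lambda>x. refl_grad g i x * (\<phi> x * cutoff x)) integrable_on UNIV"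
    by (intro hk C1c_integrable[OF \<phi> _ um] C1c_integrable[OF CUN _ um] l)+
  have i2: "(\<lambda>x. refl_ext f x * (\<phi> x * cutoff_grad x $ i)) integrable_on UNIV"
  proof (rule hk, rule loc_int_mult_test[OF l(5) um _ _ compact_imp_bounded[OF K(1)]])
    show c: "continuous_on UNIV (\<lambda>x. \<phi> x * cutoff_grad x $ i)" by (intro continuous_intros C1c_continuous[OF \<phi>] continuous_on_cutoff_grad)
    show z: "\<phi> x * cutoff_grad x $ i = 0" if "x \<notin> K" for x using K(2)[OF that] by simp
    obtain C where "\<And>x. \<bar>\<phi> x * cutoff_grad x $ i\<bar> \<le> C" using compact_support_bounded[OF c K(1) z] by blast
    then show "bounded ((\<lambda>x. \<phi> x * cutoff_grad x $ i) ` UNIV)" by (auto simp: bounded_iff)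
  qed
  have L: "integral UNIV (\<lambda>x. ext_op f x * H x $ i) = integral UNIV (\<lambda>x. zero_ext f x * H x $ i) + integral UNIV (\<lambda>x. refl_ext f x * D x $ i) - integral UNIV (\<lambda>x. refl_ext f x * (\<phi> x * cutoff_grad x $ i))"
    unfolding integral_add[OF i1(1,3), symmetric] integral_diff[OF integrable_add[OF i1(1,3)] i2, symmetric]
    by (rule integral_cong) (simp add: ext_op_def D_def algebra_simps)
  have R: "integral UNIV (\<lambda>x. ext_grad f g i x * \<phi> x) = integral UNIV (\<lambda>x. zero_ext (g i) x * \<phi> x) + integral UNIV (\<lambda>x. refl_grad g i x * (\<phi> x * cutoff x)) + integral UNIV (\<lambda>x. refl_ext f x * (\<phi> x * cutoff_grad x $ i))"
    unfolding integral_add[OF i1(4,6), symmetric] integral_add[OF integrable_add[OF i1(4,6)] i2, symmetric]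
    by (rule integral_cong) (simp add: ext_grad_def refl_grad_def algebra_simps)
  show "integral UNIV (\<lambda>x. ext_op f x * H x $ i) = - integral UNIV (\<lambda>x. ext_grad f g i x * \<phi> x)"
    using E1 E2 unfolding L R integral_diff[OF i1(1,2)] integral_diff[OF i1(4,5)] integral_add[OF i1(2,3)] integral_add[OF i1(5,6)] by linarith
qed

lemma ext_op_bound:
  assumes p: "1 \<le> p"
  obtains C where "\<And>f g. W1p_grad spiral p f g \<Longrightarrow> W1p_grad UNIV p (ext_op f) (ext_grad f g) \<and>
     W1p_norm_with UNIV p (ext_op f) (ext_grad f g) \<le> C * W1p_norm_with spiral p f g"
proof -
  obtain c where c: "c \<ge> 0" "\<And>z i. \<bar>cutoff_grad z $ i\<bar> \<le> c" using cutoff_grad_bounded by blast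
  have um: "(UNIV :: pt set) \<in> sets lebesgue" by simp
  show ?thesis
  proof (rule that[of "4000 + 100 * c"])
    fix f g assume W: "W1p_grad spiral p f g"
    have f: "Lp_mem spiral p f" and g: "\<And>i. Lp_mem spiral p (g i)" and wp: "\<And>i. weak_partial spiral f i (g i)"
      using W by (auto simp: W1p_grad_def)
    define nf where "nf = Lp_norm spiral p f"
    define ng where "ng i = Lp_norm spiral p (g i)" for i
    have nn: "0 \<le> nf" "0 \<le> ng i" for i
      using Lp_norm_nonneg[OF f spiral_sets spiral_not_negligible] Lp_norm_nonneg[OF g spiral_sets spiral_not_negligible] by (auto simp: nf_def ng_def)
    note lf = Lp_mem_loc_int[OF p spiral_sets f] and lg = Lp_mem_loc_int[OF p spiral_sets g]
    note wg = weak_partial_imp_weak_grad[OF open_spiral lf lg wp]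
    have xf: "Lp_mem UNIV p (zero_ext f)" "Lp_norm UNIV p (zero_ext f) \<le> nf" using Lp_zero_ext[OF p f] by (auto simp: nf_def)
    have xg: "Lp_mem UNIV p (zero_ext (g i))" "Lp_norm UNIV p (zero_ext (g i)) \<le> ng i" for i using Lp_zero_ext[OF p g[of i]] by (auto simp: ng_def)
    have rf: "Lp_mem UNIV p (refl_ext f)" "Lp_norm UNIV p (refl_ext f) \<le> 6 * nf" using Lp_refl_ext[OF p f] by (auto simp: nf_def)
    have rg: "Lp_mem UNIV p (refl_ext (g i))" "Lp_norm UNIV p (refl_ext (g i)) \<le> 6 * ng i" for i using Lp_refl_ext[OF p g[of i]] by (auto simp: ng_def)
    have mg: "Lp_mem UNIV p (\<lambda>x. refl_matrix k i x * refl_ext (g k) x)" "Lp_norm UNIV p (\<lambda>x. refl_matrix k i x * refl_ext (g k) x) \<le> 192 * ng k" for k i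
      using Lp_mult_bounded[OF p rg(1)[of k] refl_matrix_measurable[of k i] _ refl_matrix_bounded] rg(2)[of k] by auto
    have ch: "Lp_mem UNIV p (\<lambda>x. cutoff x * h x) \<and> Lp_norm UNIV p (\<lambda>x. cutoff x * h x) \<le> 1 * Lp_norm UNIV p h" if "Lp_mem UNIV p h" for h
      by (rule Lp_mult_bounded[OF p that measurable_cutoff]) (use cutoff_bounds in auto)
    have col_phase: "Lp_mem UNIV p (\<lambda>x. cutoff x * refl_ext f x)" "Lp_norm UNIV p (\<lambda>x. cutoff x * refl_ext f x) \<le> 6 * nf" using ch[OF rf(1)] rf(2) by auto
    have cm: "Lp_mem UNIV p (\<lambda>x. cutoff x * (refl_matrix k i x * refl_ext (g k) x))" "Lp_norm UNIV p (\<lambda>x. cutoff x * (refl_matrix k i x * refl_ext (g k) x)) \<le> 192 * ng k" for k i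
      using ch[OF mg(1)[of k i]] mg(2)[of k i] by auto
    have gf: "Lp_mem UNIV p (\<lambda>x. cutoff_grad x $ i * refl_ext f x)" "Lp_norm UNIV p (\<lambda>x. cutoff_grad x $ i * refl_ext f x) \<le> c * (6 * nf)" for i
      using Lp_mult_bounded[OF p rf(1) measurable_cutoff_grad c(1) c(2), of i] mult_left_mono[OF rf(2) c(1)] by auto
    have E: "Lp_mem UNIV p (ext_op f)" "Lp_norm UNIV p (ext_op f) \<le> 14 * nf"
      using Lp_add[OF p xf(1) col_phase(1)] xf(2) col_phase(2) by (auto simp: ext_op_def[abs_def])
    have G: "Lp_mem UNIV p (ext_grad f g i) \<and> Lp_norm UNIV p (ext_grad f g i) \<le> 2 * ng i + 768 * ng 1 + 1536 * ng 2 + 48 * c * nf" for i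
    proof -
      have a: "Lp_mem UNIV p (\<lambda>x. cutoff x * (refl_matrix 2 i x * refl_ext (g 2) x) + cutoff_grad x $ i * refl_ext f x)"
        "Lp_norm UNIV p (\<lambda>x. cutoff x * (refl_matrix 2 i x * refl_ext (g 2) x) + cutoff_grad x $ i * refl_ext f x) \<le> 384 * ng 2 + 12 * c * nf"
        using Lp_add[OF p cm(1)[of 2 i] gf(1)[of i]] cm(2)[of 2 i] gf(2)[of i] by auto
      have b: "Lp_mem UNIV p (\<lambda>x. cutoff x * (refl_matrix 1 i x * refl_ext (g 1) x) + (cutoff x * (refl_matrix 2 i x * refl_ext (g 2) x) + cutoff_grad x $ i * refl_ext f x))"
        "Lp_norm UNIV p (\<lambda>x. cutoff x * (refl_matrix 1 i x * refl_ext (g 1) x) + (cutoff x * (refl_matrix 2 i x * refl_ext (g 2) x) + cutoff_grad x $ i * refl_ext f x)) \<le> 384 * ng 1 + 768 * ng 2 + 24 * c * nf"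
        using Lp_add[OF p cm(1)[of 1 i] a(1)] cm(2)[of 1 i] a(2) by auto
      show ?thesis using Lp_add[OF p xg(1)[of i] b(1)] xg(2)[of i] b(2) by (auto simp: ext_grad_def[abs_def])
    qed
    have Mt: "Lp_mem UNIV p (refl_grad g i)" for i
      using Lp_add[OF p mg(1)[of 1 i] mg(1)[of 2 i]] by (simp add: refl_grad_def[abs_def])
    note li = Lp_mem_loc_int[OF p um]
    have wE: "weak_grad UNIV (ext_op f) (ext_grad f g)"
      by (rule ext_op_weak_grad[OF wg lf lg]) (intro li xf xg rf Mt)+
    have "weak_partial UNIV (ext_op f) i (ext_grad f g i)" for i
      by (rule weak_grad_imp_weak_partial_UNIV[OF wE li[OF E(1)] li]) (use G in blast)
    then have W': "W1p_grad UNIV p (ext_op f) (ext_grad f g)" using E G by (auto simp: W1p_grad_def)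
    have "W1p_norm_with UNIV p (ext_op f) (ext_grad f g) = Lp_norm UNIV p (ext_op f) + (Lp_norm UNIV p (ext_grad f g 1) + Lp_norm UNIV p (ext_grad f g 2))"
      by (simp add: W1p_norm_with_def UNIV_2)
    also have "\<dots> \<le> 14 * nf + ((2 * ng 1 + 768 * ng 1 + 1536 * ng 2 + 48 * c * nf) + (2 * ng 2 + 768 * ng 1 + 1536 * ng 2 + 48 * c * nf))"
      using E(2) G[of 1] G[of 2] by (intro add_mono) auto
    also have "\<dots> \<le> (4000 + 100 * c) * (nf + (ng 1 + ng 2))"
    proof -
      have "0 \<le> c * nf" "0 \<le> c * ng 1" "0 \<le> c * ng 2" using c(1) nn by auto
      then show ?thesis using nn(1) nn(2)[of 1] nn(2)[of 2] by (simp add: algebra_simps)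
    qed
    also have "nf + (ng 1 + ng 2) = W1p_norm_with spiral p f g" by (simp add: W1p_norm_with_def UNIV_2 nf_def ng_def)
    finally show "W1p_grad UNIV p (ext_op f) (ext_grad f g) \<and> W1p_norm_with UNIV p (ext_op f) (ext_grad f g) \<le> (4000 + 100 * c) * W1p_norm_with spiral p f g"
      using W' by simp
  qed
qed

lemma spiral_extension_property: "extension_property spiral"
  unfolding extension_property_def
proof (intro allI impI)
  fix p :: ennreal assume p: "1 \<le> p"
  obtain C where C: "\<And>f g. W1p_grad spiral p f g \<Longrightarrow> W1p_grad UNIV p (ext_op f) (ext_grad f g) \<and>
     W1p_norm_with UNIV p (ext_op f) (ext_grad f g) \<le> C * W1p_norm_with spiral p f g"
    by (rule ext_op_bound[OF p], rule that)
  have "extension_operator spiral p ext_op"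
    unfolding extension_operator_def
  proof (intro conjI allI impI exI[of _ C])
    show "W1p UNIV p (ext_op f)" if "W1p spiral p f" for f using that C unfolding W1p_def by blast
    show "AE x in lebesgue. ext_op (\<lambda>y. a * f y + b * h y) x = a * ext_op f x + b * ext_op h x" for f h a b
      by (intro always_eventually allI) (simp add: ext_op_def zero_ext_def refl_ext_def algebra_simps)
    show "\<exists>g'. W1p_grad UNIV p (ext_op f) g' \<and> W1p_norm_with UNIV p (ext_op f) g' \<le> C * W1p_norm_with spiral p f g" if "W1p_grad spiral p f g" for f g
      using C[OF that] by blast
    show "AE x in lebesgue_on spiral. ext_op f x = f x" for f
    proof (rule AE_I2)
      fix x assume "x \<in> space (lebesgue_on spiral)"
      then have x: "x \<in> spiral" by simp
      then have "x \<notin> col_outer" using col_outer_disjoint by auto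
      then show "ext_op f x = f x" using x by (simp add: ext_op_def zero_ext_def refl_ext_def)
    qed
  qed
  then show "\<exists>E. extension_operator spiral p E" by (rule exI[of _ ext_op])
qed

theorem theorem00:
  fixes d1 d2 r1 r2 a1 a2 :: real
  assumes "0 < d1" "0 < d2" "0 < r1" "0 < r2" "0 < a1" "a1 < 1" "1 < a2"
  shows "\<exists>\<Omega>::(real^2) set. locally_C2_domain \<Omega> \<and> extension_property \<Omega> \<and>
           (\<forall>e::real^2. norm e = 1 \<longrightarrow> strongly_unbounded \<Omega> e) \<and>
           (d1 = d2 \<and> a1 * a2 \<le> 1 \<longrightarrow>
              (\<forall>e z u0 v0 u v. norm e = 1 \<longrightarrow> (u0, v0) \<in> Theta \<Omega> \<longrightarrow>
                 LV_solution \<Omega> d1 d2 r1 r2 a1 a2 u0 v0 u v \<longrightarrow>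
                 w_star_z \<Omega> u v e z = 0 \<and> w_star \<Omega> u v e = 0))"
proof (intro exI[of _ spiral] conjI allI impI)
  have "0 < a2" using assms by simp
  note speeds = spiral_speeds_zero[OF assms(1-5) this]
  fix e z u0 v0 u v
  assume "norm (e::real^2) = 1" "(u0, v0) \<in> Theta spiral" "LV_solution spiral d1 d2 r1 r2 a1 a2 u0 v0 u v"
  then show "w_star_z spiral u v e z = 0" "w_star spiral u v e = 0" using speeds by blast+
qed (use spiral_locally_C2 spiral_extension_property spiral_strongly_unbounded in auto)

end
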